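(* Let $(\lambda_N)_{N}$ be a sequence of non-trivial conjugacy classes $\lambda_N\subset\mathfrak{S}(N)$ which converges, and for each $N$ let $(S^N_t)_{t\ge 0}$ be a $\lambda_N$-random walk on $\mathfrak{S}(N)$. Let $t>0$. The eigenvalue distribution $\mu_t^{\lambda_N}$ of $S^N_t$ converges in law, as $N\to\infty$, to a random measure $\mu^\lambda_t$ on the unit circle $\mathbb{U}$. Two behaviors are possible: 1. if $(\lambda_N)_N$ is evanescent, then the limiting measure is non-random, $\mu^\lambda_t=\overline{\mu}^\lambda_t$, and the convergence holds in probability. The family $(S^N_t)_{N}$ satisfies the asymptotic $\mathcal{P}$-factorization and thus it converges in probability in $\mathcal{P}$-distribution; 2. if $(\lambda_N)_N$ is macroscopic, then the limiting measure $\mu^\lambda_t$ is not a non-random measure on $\mathbb{U}$, and the family $(S^N_t)_N$ does not satisfy the asymptotic $\mathcal{P}$-factorization.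
   Context: Random walks. $\mathfrak{S}(N)$ is the symmetric group; permutations $S$ are identified with $N\times N$ permutation matrices ($S e_j=e_{S(j)}$). For a permutation $\sigma$, the period of $j$ in $\sigma$ is the smallest $n\ge1$ with $\sigma^n(j)=j$. For a conjugacy class $\lambda_N$ of $\mathfrak{S}(N)$, $\lambda_N(i)$ is the number of $j\in\{1,\dots,N\}$ whose period in $\sigma$ equals $i$ (any $\sigma\in\lambda_N$), and $\lambda_N(1^c)=N-\lambda_N(1)$. Classes are assumed non-trivial: $\lambda_N\neq\{id_N\}$ ($N\ge2$). The $\lambda_N$-random walk $(S^N_t)_{t\ge0}$ is the Markov process on $\mathfrak{S}(N)$ with $S^N_0=id_N$ and generator $$H_Nf(\sigma_0)=\frac{N}{\lambda_N(1^c)}\frac{1}{\#\lambda_N}\sum_{\sigma\in\lambda_N}[f(\sigma\sigma_0)-f(\sigma_0)].$$ The sequence $(\lambda_N)_N$ converges if there are $\lambda(i)\ge0$ ($i\ge2$) with $\sum_{i\ge2}\lambda(i)\le1$ and $\lambda_N(i)/\lambda_N(1^c)\to\lambda(i)$ for every $i\ge2$, and there is $\alpha\in[0,1]$ with $\lambda_N(1)/N\to1-\alpha$. It is evanescent if $\alpha=0$ and macroscopic if $\alpha>0$. The eigenvalue distribution of an $N\times N$ matrix is $\frac1N\sum\delta_{\text{eigenvalue}}$; the spaces of probability measures on $\mathbb{U}$ are given the weak topology. $\overline{\mu}^\lambda_t$ is the limit as $N\to\infty$ of the mean (expected) eigenvalue distribution of $S^N_t$ (this limit exists). $\mathcal{P}$-moments.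 $\mathcal{P}_k$ is the set of partitions of $\{1,\dots,k,1',\dots,k'\}$, $id=id_k=\{\{i,i'\}:1\le i\le k\}$, $p\vee p'$ is the supremum (finest common coarsening), ${\sf nc}(p)$ is the number of blocks. For $p_1\in\mathcal{P}_k,p_2\in\mathcal{P}_{l}$, $p_1\otimes p_2\in\mathcal{P}_{k+l}$ is the juxtaposition ($p_2$ placed to the right of $p_1$). For $I=(i_1,\dots,i_k,i_{1'},\dots,i_{k'})\in\{1,\dots,N\}^{2k}$, ${\sf Ker}(I)$ is the partition in which $a,b$ are in the same block iff $i_a=i_b$. For an $N\times N$ matrix $M$, $$m_p(M)=\frac{1}{N^{{\sf nc}(p\vee id)}}\sum_{I:\ p\text{ finer than or equal to }{\sf Ker}(I)}\ \prod_{l=1}^kM_{i_{l'}i_l}.$$ A sequence of random matrices $M=(M_N)_N$ converges in $\mathcal{P}$-distribution if $\mathbb{E}[m_p(M_N)]$ converges for all $k$ and $p\in\mathcal{P}_k$; the limit is denoted $\mathbb{E}m_p(M)$. It satisfies the asymptotic $\mathcal{P}$-factorization if moreover $\mathbb{E}m_{p_1\otimes p_2}(M)=\mathbb{E}m_{p_1}(M)\,\mathbb{E}m_{p_2}(M)$ for all $p_1\in\mathcal{P}_k$, $p_2\in\mathcal{P}_{l}$, $k,l\ge1$. It converges in probability in $\mathcal{P}$-distribution if for all $k$ and $p\in\mathcal{P}_k$, $m_p(M_N)$ converges in probability to $\mathbb{E}m_p(M)$. *)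

theory Defs
  imports
    "HOL-Probability.Probability"
    "HOL-Combinatorics.Cycles"
    "HOL-Computational_Algebra.Computational_Algebra"
    "Jordan_Normal_Form.Char_Poly"
begin

text \<open>The set on which permutations act, and which indexes matrices, is \<open>{..<N}\<close>
  instead of \<open>{1, \<dots>, N}\<close>; this is the convention of the matrix library.\<close>

definition Sym :: "nat \<Rightarrow> (nat \<Rightarrow> nat) set" where
  "Sym N = {\<sigma>. \<sigma> permutes {..<N}}"

definition conjugacy_class :: "nat \<Rightarrow> (nat \<Rightarrow> nat) set \<Rightarrow> bool" where
  "conjugacy_class N C \<longleftrightarrow>
     (\<exists>\<sigma>\<in>Sym N. C = {\<tau> \<circ> \<sigma> \<circ> inv_into UNIV \<tau> |\<tau>. \<tau> \<in> Sym N})"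

text \<open>The number of points of period \<open>i\<close>, written \<open>\<lambda>\<^sub>N(i)\<close> in the literature. The choice of
  the representative is irrelevant; \<^const>\<open>least_power\<close> is the period.\<close>

definition period_count :: "nat \<Rightarrow> (nat \<Rightarrow> nat) set \<Rightarrow> nat \<Rightarrow> nat" where
  "period_count N C i = card {j\<in>{..<N}. least_power (SOME \<sigma>. \<sigma> \<in> C) j = i}"

definition nonfixed_count :: "nat \<Rightarrow> (nat \<Rightarrow> nat) set \<Rightarrow> nat" where
  "nonfixed_count N C = N - period_count N C 1"

definition classes_converge_to ::
    "(nat \<Rightarrow> (nat \<Rightarrow> nat) set) \<Rightarrow> (nat \<Rightarrow> real) \<Rightarrow> real \<Rightarrow> bool" where
  "classes_converge_to C l \<alpha> \<longleftrightarrow>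
     (\<forall>i\<ge>2. l i \<ge> 0) \<and> l summable_on {2..} \<and> infsum l {2..} \<le> 1 \<and>
     (\<forall>i\<ge>2. (\<lambda>N. real (period_count N (C N) i) / real (nonfixed_count N (C N))) \<longlonglongrightarrow> l i) \<and>
     \<alpha> \<in> {0..1} \<and> (\<lambda>N. real (period_count N (C N) 1) / real N) \<longlonglongrightarrow> 1 - \<alpha>"

definition classes_converge :: "(nat \<Rightarrow> (nat \<Rightarrow> nat) set) \<Rightarrow> bool" where
  "classes_converge C \<longleftrightarrow> (\<exists>l \<alpha>. classes_converge_to C l \<alpha>)"

definition evanescent :: "(nat \<Rightarrow> (nat \<Rightarrow> nat) set) \<Rightarrow> bool" where
  "evanescent C \<longleftrightarrow> (\<exists>l. classes_converge_to C l 0)"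

definition macroscopic :: "(nat \<Rightarrow> (nat \<Rightarrow> nat) set) \<Rightarrow> bool" where
  "macroscopic C \<longleftrightarrow> (\<exists>l \<alpha>. classes_converge_to C l \<alpha> \<and> \<alpha> > 0)"

definition transition_semigroup :: "'s set \<Rightarrow> (real \<Rightarrow> 's \<Rightarrow> 's pmf) \<Rightarrow> bool" where
  "transition_semigroup E P \<longleftrightarrow>
     (\<forall>x\<in>E. P 0 x = return_pmf x) \<and>
     (\<forall>t\<ge>0. \<forall>x\<in>E. set_pmf (P t x) \<subseteq> E) \<and>
     (\<forall>s\<ge>0. \<forall>t\<ge>0. \<forall>x\<in>E. P (s + t) x = bind_pmf (P s x) (P t))"

definition has_generator ::
    "'s set \<Rightarrow> (real \<Rightarrow> 's \<Rightarrow> 's pmf) \<Rightarrow> (('s \<Rightarrow> real) \<Rightarrow> 's \<Rightarrow> real) \<Rightarrow> bool" where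
  "has_generator E P H \<longleftrightarrow>
     (\<forall>f. \<forall>x\<in>E. ((\<lambda>h. (measure_pmf.expectation (P h x) f - f x) / h) \<longlongrightarrow> H f x) (at_right 0))"

definition natural_filtration :: "'a measure \<Rightarrow> 's set \<Rightarrow> (real \<Rightarrow> 'a \<Rightarrow> 's) \<Rightarrow> real \<Rightarrow> 'a measure" where
  "natural_filtration M E X s = sigma (space M) {X r -` A \<inter> space M |r A. 0 \<le> r \<and> r \<le> s \<and> A \<subseteq> E}"

definition markov_process ::
    "'a measure \<Rightarrow> 's set \<Rightarrow> (real \<Rightarrow> 's \<Rightarrow> 's pmf) \<Rightarrow> (real \<Rightarrow> 'a \<Rightarrow> 's) \<Rightarrow> bool" where
  "markov_process M E P X \<longleftrightarrow>
     prob_space M \<and> (\<forall>t\<ge>0. X t \<in> M \<rightarrow>\<^sub>M count_space E) \<and>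
     (\<forall>s\<ge>0. \<forall>u\<ge>0. \<forall>f :: 's \<Rightarrow> real.
        AE \<omega> in M. real_cond_exp M (natural_filtration M E X s) (\<lambda>\<omega>. f (X (s + u) \<omega>)) \<omega>
                 = measure_pmf.expectation (P u (X s \<omega>)) f)"

definition walk_generator ::
    "nat \<Rightarrow> (nat \<Rightarrow> nat) set \<Rightarrow> ((nat \<Rightarrow> nat) \<Rightarrow> real) \<Rightarrow> (nat \<Rightarrow> nat) \<Rightarrow> real" where
  "walk_generator N C f \<sigma>\<^sub>0 =
     real N / real (nonfixed_count N C) * (1 / real (card C)) * (\<Sum>\<sigma>\<in>C. f (\<sigma> \<circ> \<sigma>\<^sub>0) - f \<sigma>\<^sub>0)"

definition random_walk ::
    "nat \<Rightarrow> (nat \<Rightarrow> nat) set \<Rightarrow> 'a measure \<Rightarrow> (real \<Rightarrow> 'a \<Rightarrow> (nat \<Rightarrow> nat)) \<Rightarrow> bool" where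
  "random_walk N C M S \<longleftrightarrow>
     (AE \<omega> in M. S 0 \<omega> = id) \<and>
     (\<exists>P. transition_semigroup (Sym N) P \<and> has_generator (Sym N) P (walk_generator N C) \<and>
          markov_process M (Sym N) P S)"

text \<open>Column \<open>j\<close> is the basis vector with index \<open>S j\<close>.\<close>

definition permutation_matrix :: "nat \<Rightarrow> (nat \<Rightarrow> nat) \<Rightarrow> complex mat" where
  "permutation_matrix N S = mat N N (\<lambda>(i, j). if i = S j then 1 else 0)"

text \<open>The uniform distribution on the multiset of roots of the characteristic polynomial
  is \<open>1/N\<close> times the sum of the Dirac masses at the eigenvalues, counted with
  algebraic multiplicity.\<close>

definition eigenvalue_distribution :: "complex mat \<Rightarrow> complex measure" where
  "eigenvalue_distribution A =
     distr (measure_pmf (pmf_of_multiset (proots (char_poly A)))) borel (\<lambda>z. z)"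

abbreviation unit_circle :: "complex set" where
  "unit_circle \<equiv> sphere 0 1"

text \<open>For a matrix with all its eigenvalues on the unit circle, such as a permutation
  matrix, the eigenvalue distribution as a probability measure on the circle.\<close>

definition circle_eigenvalue_distribution :: "complex mat \<Rightarrow> complex measure" where
  "circle_eigenvalue_distribution A = restrict_space (eigenvalue_distribution A) unit_circle"

definition prob_measures_on :: "'b::topological_space set \<Rightarrow> 'b measure set" where
  "prob_measures_on K = space (prob_algebra (restrict_space borel K))"

text \<open>The coarsest topology on probability measures on \<open>K\<close> making integration against every
  bounded continuous function on \<open>K\<close> continuous.\<close>

definition weak_topology :: "'b::topological_space set \<Rightarrow> 'b measure topology" where
  "weak_topology K = topology_generated_by
     {{\<mu> \<in> prob_measures_on K. (\<integral>z. f z \<partial>\<mu>) \<in> V} |(f :: 'b \<Rightarrow> real) V.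
        continuous_on K f \<and> bounded (f ` K) \<and> open V}"

definition borel_of :: "'c topology \<Rightarrow> 'c measure" where
  "borel_of T = sigma (topspace T) {V. openin T V}"

definition random_measure ::
    "'b::topological_space set \<Rightarrow> 'a measure \<Rightarrow> ('a \<Rightarrow> 'b measure) \<Rightarrow> bool" where
  "random_measure K M X \<longleftrightarrow> prob_space M \<and> X \<in> M \<rightarrow>\<^sub>M borel_of (weak_topology K)"

definition nonrandom :: "'a measure \<Rightarrow> ('a \<Rightarrow> 'c) \<Rightarrow> bool" where
  "nonrandom M X \<longleftrightarrow> (\<exists>c. AE \<omega> in M. X \<omega> = c)"

definition converges_in_law ::
    "'c topology \<Rightarrow> (nat \<Rightarrow> 'a measure) \<Rightarrow> (nat \<Rightarrow> 'a \<Rightarrow> 'c) \<Rightarrow> 'b measure \<Rightarrow> ('b \<Rightarrow> 'c) \<Rightarrow> bool" where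
  "converges_in_law T M X M' X' \<longleftrightarrow>
     (\<forall>F. continuous_map T euclideanreal F \<and> bounded (F ` topspace T) \<longrightarrow>
        (\<lambda>N. \<integral>\<omega>. F (X N \<omega>) \<partial>M N) \<longlonglongrightarrow> (\<integral>\<omega>. F (X' \<omega>) \<partial>M'))"

text \<open>Convergence in probability to a deterministic point \<open>c\<close>.\<close>

definition converges_in_prob ::
    "'c topology \<Rightarrow> (nat \<Rightarrow> 'a measure) \<Rightarrow> (nat \<Rightarrow> 'a \<Rightarrow> 'c) \<Rightarrow> 'c \<Rightarrow> bool" where
  "converges_in_prob T M X c \<longleftrightarrow>
     c \<in> topspace T \<and>
     (\<forall>V. openin T V \<and> c \<in> V \<longrightarrow>
        (\<lambda>N. measure (M N) {\<omega> \<in> space (M N). X N \<omega> \<notin> V}) \<longlonglongrightarrow> 0)"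

text \<open>In \<open>{1, \<dots>, k, 1', \<dots>, k'}\<close> the element \<open>i\<close> is \<open>Inl i\<close> and \<open>i'\<close> is \<open>Inr i\<close>.\<close>

definition vertices :: "nat \<Rightarrow> (nat + nat) set" where
  "vertices k = {1..k} <+> {1..k}"

type_synonym diagram = "(nat + nat) set set"

definition diagrams :: "nat \<Rightarrow> diagram set" where
  "diagrams k = {p. partition_on (vertices k) p}"

definition id_diagram :: "nat \<Rightarrow> diagram" where
  "id_diagram k = {{Inl i, Inr i} |i. i \<in> {1..k}}"

definition sup_diagram :: "nat \<Rightarrow> diagram \<Rightarrow> diagram \<Rightarrow> diagram" where
  "sup_diagram k p p' = (THE q. refines (vertices k) p q \<and> refines (vertices k) p' q \<and>
     (\<forall>r. refines (vertices k) p r \<and> refines (vertices k) p' r \<longrightarrow> refines (vertices k) q r))"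

definition juxtapose :: "nat \<Rightarrow> diagram \<Rightarrow> diagram \<Rightarrow> diagram" where
  "juxtapose k p1 p2 = p1 \<union> (\<lambda>b. map_sum (\<lambda>i. k + i) (\<lambda>i. k + i) ` b) ` p2"

definition Ker :: "nat \<Rightarrow> (nat + nat \<Rightarrow> nat) \<Rightarrow> diagram" where
  "Ker k I = {{b \<in> vertices k. I b = I a} |a. a \<in> vertices k}"

definition moment :: "nat \<Rightarrow> diagram \<Rightarrow> complex mat \<Rightarrow> complex" where
  "moment k p A =
     (\<Sum>I | I \<in> vertices k \<rightarrow>\<^sub>E {..<dim_row A} \<and> refines (vertices k) p (Ker k I).
        \<Prod>l\<in>{1..k}. A $$ (I (Inr l), I (Inl l)))
     / of_nat (dim_row A) ^ card (sup_diagram k p (id_diagram k))"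

definition mean_moment ::
    "(nat \<Rightarrow> 'a measure) \<Rightarrow> (nat \<Rightarrow> 'a \<Rightarrow> complex mat) \<Rightarrow> nat \<Rightarrow> diagram \<Rightarrow> nat \<Rightarrow> complex" where
  "mean_moment M A k p N = (\<integral>\<omega>. moment k p (A N \<omega>) \<partial>M N)"

definition converges_in_P_distribution ::
    "(nat \<Rightarrow> 'a measure) \<Rightarrow> (nat \<Rightarrow> 'a \<Rightarrow> complex mat) \<Rightarrow> bool" where
  "converges_in_P_distribution M A \<longleftrightarrow> (\<forall>k. \<forall>p\<in>diagrams k. convergent (mean_moment M A k p))"

definition limit_moment ::
    "(nat \<Rightarrow> 'a measure) \<Rightarrow> (nat \<Rightarrow> 'a \<Rightarrow> complex mat) \<Rightarrow> nat \<Rightarrow> diagram \<Rightarrow> complex" where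
  "limit_moment M A k p = lim (mean_moment M A k p)"

definition asymptotic_P_factorization ::
    "(nat \<Rightarrow> 'a measure) \<Rightarrow> (nat \<Rightarrow> 'a \<Rightarrow> complex mat) \<Rightarrow> bool" where
  "asymptotic_P_factorization M A \<longleftrightarrow>
     converges_in_P_distribution M A \<and>
     (\<forall>k\<ge>1. \<forall>l\<ge>1. \<forall>p1\<in>diagrams k. \<forall>p2\<in>diagrams l.
        limit_moment M A (k + l) (juxtapose k p1 p2) = limit_moment M A k p1 * limit_moment M A l p2)"

definition converges_in_prob_in_P_distribution ::
    "(nat \<Rightarrow> 'a measure) \<Rightarrow> (nat \<Rightarrow> 'a \<Rightarrow> complex mat) \<Rightarrow> bool" where
  "converges_in_prob_in_P_distribution M A \<longleftrightarrow>
     converges_in_P_distribution M A \<and>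
     (\<forall>k. \<forall>p\<in>diagrams k.
        converges_in_prob euclidean M (\<lambda>N \<omega>. moment k p (A N \<omega>)) (limit_moment M A k p))"

end

theory Submission
  imports Defs "HOL-Real_Asymp.Real_Asymp" "Jordan_Normal_Form.Schur_Decomposition"
begin

text \<open>The \<open>\<P>\<close>-moments and the moments of the eigenvalue distribution of a permutation \<open>S\<close> are
  (products of) the fractions \<open>T\<^sub>m = |Fix (S ^ m)| / N\<close>.  The mean of \<open>T\<^sub>m\<close> converges because
  the generator maps functions of the coincidence pattern of \<open>m\<close> pairs \<open>(x, S x)\<close> to such functions,
  its matrix in the suitably normalised basis converges, and so does the exponential series.

  Altering one factor of a product of permutations by a permutation that moves \<open>c\<close> points changes
  \<open>T\<^sub>m\<close> by at most \<open>m c / N\<close>.  Hence one step of a walk whose class moves \<open>d\<close> points adds at most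
  \<open>(m d / N)\<^sup>2\<close> to the variance, and, as uniform random permutations concentrate, also at most
  \<open>16 m\<^sup>2 / N\<close>.  The number of steps up to time \<open>t\<close> is a Poisson variable with parameter \<open>t N / d\<close>.
  If \<open>d / N \<rightarrow> 0\<close>, the first bound shows that \<open>T\<^sub>m\<close> concentrates at its mean.  If
  \<open>d / N \<rightarrow> \<alpha> > 0\<close>, the second one gives concentration after each fixed number of steps, and the
  limit is a mixture, with weights given by the Poisson distribution of parameter \<open>t / \<alpha>\<close>, of
  measures whose first moments differ already for \<open>0\<close> and \<open>1\<close> steps.\<close>

subsection \<open>Counting solutions of systems \<open>S\<^sup>i z\<^sub>a = S\<^sup>j z\<^sub>b\<close>\<close>

text \<open>The obstacle is that the rate \<open>N / d\<close> may diverge. Convergence of the jump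
  law is then not enough for convergence of the generator: the differences from the identity must
  themselves be of order \<open>d / N\<close>. This is where exact counting enters. The solutions of
  a system of equations between powers of S number a product of fixed-point counts, with the same
  list of exponents for all N and S. For an element of the class each factor, divided by N, is 1
  plus a term that still converges after multiplication by the rate, and a telescoping product keeps
  this property. Such counts allow additional coincidences; exact patterns are recovered by Moebius
  inversion, which loses no power of N because coarser patterns have no more components. That the
  entries of the normalised matrix stay bounded needs more, namely the submodularity of numbers of
  components. For \<alpha> = 0 the fluctuation of the Poisson number of steps adds its own
  contribution to the variance, again of order \<open>d / N\<close>; for \<alpha> > 0 it is the
  randomness that survives.\<close>

definition fixed_count :: "nat \<Rightarrow> (nat \<Rightarrow> nat) \<Rightarrow> nat \<Rightarrow> nat" where
  "fixed_count N S m = card {x\<in>{..<N}. (S ^^ m) x = x}"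

text \<open>A power on either side of an equation avoids inverse powers of S; extensional
  assignments make the solution set finite for finite V, so that it can be counted.\<close>

definition sols :: "nat \<Rightarrow> (nat \<Rightarrow> nat) \<Rightarrow> 'v set \<Rightarrow> ('v \<times> nat \<times> 'v \<times> nat) set \<Rightarrow> ('v \<Rightarrow> nat) set" where
  "sols N S V E = {z \<in> V \<rightarrow>\<^sub>E {..<N}. \<forall>(a, i, b, j)\<in>E. (S ^^ i) (z a) = (S ^^ j) (z b)}"

lemma
  assumes "z \<in> sols N S V E"
  shows sols_PiE: "z \<in> V \<rightarrow>\<^sub>E {..<N}"
    and sols_Pi: "z \<in> V \<rightarrow> {..<N}"
    and sols_extensional: "z \<in> extensional V"
    and sols_ball: "\<forall>(a, i, b, j)\<in>E. (S ^^ i) (z a) = (S ^^ j) (z b)"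
    and sols_eq: "(a, i, b, j) \<in> E \<Longrightarrow> (S ^^ i) (z a) = (S ^^ j) (z b)"
  using assms unfolding sols_def PiE_def by blast+

lemma solsI:
  assumes "z \<in> V \<rightarrow>\<^sub>E {..<N}" "\<And>a i b j. (a, i, b, j) \<in> E \<Longrightarrow> (S ^^ i) (z a) = (S ^^ j) (z b)"
  shows "z \<in> sols N S V E"
  using assms unfolding sols_def by blast

lemma funpow_permutes: "S permutes A \<Longrightarrow> (S ^^ n) permutes A"
proof (induction n)
  case 0
  show ?case unfolding funpow.simps by (rule permutes_id)
next
  case (Suc n)
  then have "(S ^^ n) permutes A" by blast
  then show ?case unfolding funpow.simps by (rule permutes_compose[OF _ Suc.prems])
qed

lemma funpow_in: "S permutes {..<N} \<Longrightarrow> x < N \<Longrightarrow> (S ^^ n) x < (N::nat)"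
  using permutes_in_image[OF funpow_permutes[of S "{..<N}" n]] by auto

lemma funpow_eq_iff:
  assumes S: "S permutes A" and "i \<le> j"
  shows "(S ^^ i) x = (S ^^ j) y \<longleftrightarrow> x = (S ^^ (j - i)) y"
proof -
  have "(S ^^ j) y = (S ^^ i) ((S ^^ (j - i)) y)"
    using funpow_add[of i "j - i" S] \<open>i \<le> j\<close> by (simp add: comp_def fun_eq_iff)
  moreover have "inj (S ^^ i)"
    using funpow_permutes[OF S] permutes_inj by blast
  ultimately show ?thesis by (simp only: inj_eq)
qed

lemma funpow_fixed_gcd:
  assumes S: "S permutes {..<(N::nat)}"
  shows "(S ^^ a) x = x \<and> (S ^^ b) x = x \<longleftrightarrow> (S ^^ gcd a b) x = x"
proof -
  have "permutation S" using S finite_lessThan permutation_permutes by blast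
  then show ?thesis by (simp only: least_power_dvd[symmetric] gcd_greatest_iff)
qed

text \<open>Equations in a single variable collapse to one. Each says that the period of x divides
  the difference of its two exponents, so together they say that it divides the gcd g of these
  differences, and g depends neither on N nor on S.\<close>

lemma diagonal_system:
  assumes "finite D"
  shows "\<exists>g. \<forall>(N :: nat) S. S permutes {..<N} \<longrightarrow>
    (\<forall>x. (\<forall>(i, j)\<in>D. (S ^^ i) x = (S ^^ j) x) \<longleftrightarrow> (S ^^ g) x = x)"
  using assms
proof (induction D)
  case empty
  \<comment> \<open>0 is the neutral element of gcd, and the power 0 fixes every point.\<close>
  show ?case by (rule exI[of _ 0]) simp
next
  case (insert d D)
  obtain g where g: "\<forall>(N :: nat) S. S permutes {..<N} \<longrightarrow>
    (\<forall>x. (\<forall>(i, j)\<in>D. (S ^^ i) x = (S ^^ j) x) \<longleftrightarrow> (S ^^ g) x = x)"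
    using insert.IH ..
  obtain i j where d: "d = (i, j)" by (cases d)
  have *: "(S ^^ i) x = (S ^^ j) x \<longleftrightarrow> (S ^^ (max i j - min i j)) x = x"
    if S: "S permutes {..<N}" for N :: nat and S x
  proof (cases "i \<le> j")
    case True
    then have m: "max i j = j" "min i j = i" by simp_all
    show ?thesis unfolding m by (rule trans[OF funpow_eq_iff[OF S True] eq_commute])
  next
    case False
    then have ji: "j \<le> i" by simp
    then have m: "max i j = i" "min i j = j" by simp_all
    show ?thesis unfolding m by (rule trans[OF eq_commute trans[OF funpow_eq_iff[OF S ji] eq_commute]])
  qed
  show ?case
  proof (rule exI[of _ "gcd (max i j - min i j) g"], intro allI impI)
    fix N :: nat and S x assume S: "S permutes {..<N}"
    have "(\<forall>(i, j)\<in>insert d D. (S ^^ i) x = (S ^^ j) x) \<longleftrightarrow>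
        (S ^^ i) x = (S ^^ j) x \<and> (\<forall>(i, j)\<in>D. (S ^^ i) x = (S ^^ j) x)"
      unfolding d by blast
    also have "\<dots> \<longleftrightarrow> (S ^^ (max i j - min i j)) x = x \<and> (S ^^ g) x = x"
      using *[OF S, of x] g S by blast
    also have "\<dots> \<longleftrightarrow> (S ^^ gcd (max i j - min i j) g) x = x"
      by (rule funpow_fixed_gcd[OF S])
    finally show "(\<forall>(i, j)\<in>insert d D. (S ^^ i) x = (S ^^ j) x) \<longleftrightarrow>
      (S ^^ gcd (max i j - min i j) g) x = x" .
  qed
qed

definition subst :: "'v \<Rightarrow> 'v \<Rightarrow> nat \<Rightarrow> 'v \<times> nat \<times> 'v \<times> nat \<Rightarrow> 'v \<times> nat \<times> 'v \<times> nat" where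
  "subst v w k = (\<lambda>(a, i, b, j). (if a = v then w else a, if a = v then i + k else i,
                               if b = v then w else b, if b = v then j + k else j))"

lemma card_sols_subst:
  assumes S: "S permutes {..<N}" and v: "v \<in> V" "w \<in> V" "v \<noteq> w"
    and E: "\<forall>(a, i, b, j)\<in>E. a \<in> V \<and> b \<in> V"
    and det: "\<And>z. z \<in> sols N S V E \<Longrightarrow> z v = (S ^^ k) (z w)"
  shows "card (sols N S V E) = card (sols N S (V - {v}) (subst v w k ` E))"
proof -
  define ext where "ext z = z(v := (S ^^ k) (z w))" for z :: "'a \<Rightarrow> nat"
  have sat: "(\<forall>(a, i, b, j)\<in>subst v w k ` E. (S ^^ i) (z a) = (S ^^ j) (z b)) \<longleftrightarrow>
      (\<forall>(a, i, b, j)\<in>E. (S ^^ i) (z' a) = (S ^^ j) (z' b))"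
    if zz: "z' v = (S ^^ k) (z w)" "\<And>a. a \<noteq> v \<Longrightarrow> a \<in> V \<Longrightarrow> z' a = z a"
 for z z'
  proof -
    have "(case subst v w k e of (a, i, b, j) \<Rightarrow> (S ^^ i) (z a) = (S ^^ j) (z b)) \<longleftrightarrow>
       (case e of (a, i, b, j) \<Rightarrow> (S ^^ i) (z' a) = (S ^^ j) (z' b))" if e: "e \<in> E" for e
    proof -
      obtain a i b j where eq: "e = (a, i, b, j)" by (cases e)
      have ab: "a \<in> V" "b \<in> V" using E e eq by auto
      have h: "(S ^^ (if c = v then n + k else n)) (z (if c = v then w else c)) = (S ^^ n) (z' c)"
        if "c \<in> V" for c n
      proof (cases "c = v")
        case True
        have "(S ^^ (n + k)) (z w) = (S ^^ n) ((S ^^ k) (z w))" by (simp add: funpow_add)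
        then show ?thesis using True zz(1) by (simp only: if_True simp_thms refl)
      next
        case False
        then show ?thesis using zz(2)[OF False that] by (simp only: if_False)
      qed
      show ?thesis unfolding eq subst_def prod.case h[OF ab(1)] h[OF ab(2)] ..
    qed
    note sat1 = this
    show ?thesis unfolding Set.ball_simps(9) using sat1 by (intro ball_cong refl) 
  qed
  have "bij_betw (\<lambda>z. restrict z (V - {v})) (sols N S V E) (sols N S (V - {v}) (subst v w k ` E))"
    proof (rule bij_betw_byWitness[where f' = ext])
      show "\<forall>z\<in>sols N S V E. ext (restrict z (V - {v})) = z"
      proof
        fix z assume z: "z \<in> sols N S V E"
        have zE: "z \<in> extensional V" using z by (rule sols_extensional)
        have "ext (restrict z (V - {v})) c = z c" for c
          using det[OF z] v zE by (cases "c = v"; cases "c \<in> V") (simp_all add: ext_def extensional_def)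
        then show "ext (restrict z (V - {v})) = z" ..
      qed
      show "\<forall>z\<in>sols N S (V - {v}) (subst v w k ` E). restrict (ext z) (V - {v}) = z"
      proof
        fix z assume z: "z \<in> sols N S (V - {v}) (subst v w k ` E)"
        have zE: "z \<in> extensional (V - {v})" using z by (rule sols_extensional)
        have "restrict (ext z) (V - {v}) c = z c" for c
          using zE by (cases "c = v"; cases "c \<in> V") (simp_all add: ext_def extensional_def)
        then show "restrict (ext z) (V - {v}) = z" ..
      qed
      show "(\<lambda>z. restrict z (V - {v})) ` sols N S V E \<subseteq> sols N S (V - {v}) (subst v w k ` E)"
      proof (rule image_subsetI)
        fix z assume z: "z \<in> sols N S V E"
        have zP: "z \<in> V \<rightarrow> {..<N}" using z by (rule sols_Pi)
        have "restrict z (V - {v}) \<in> (V - {v}) \<rightarrow>\<^sub>E {..<N}" using zP by auto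
        moreover have "\<forall>(a, i, b, j)\<in>subst v w k ` E.
            (S ^^ i) (restrict z (V - {v}) a) = (S ^^ j) (restrict z (V - {v}) b)"
        proof (rule iffD2[OF sat[where z = "restrict z (V - {v})" and z' = z]])
          show "z v = (S ^^ k) (restrict z (V - {v}) w)" using det[OF z] v by simp
          show "\<forall>(a, i, b, j)\<in>E. (S ^^ i) (z a) = (S ^^ j) (z b)" using z by (rule sols_ball)
        qed simp
        ultimately show "restrict z (V - {v}) \<in> sols N S (V - {v}) (subst v w k ` E)"
          unfolding sols_def by (intro CollectI conjI)
      qed
      show "ext ` sols N S (V - {v}) (subst v w k ` E) \<subseteq> sols N S V E"
      proof (rule image_subsetI)
        fix z assume z: "z \<in> sols N S (V - {v}) (subst v w k ` E)"
        have zP: "z \<in> (V - {v}) \<rightarrow>\<^sub>E {..<N}" using z by (rule sols_PiE)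
        have zw: "z w < N" using zP v by auto
        have "ext z \<in> V \<rightarrow>\<^sub>E {..<N}"
          unfolding PiE_iff
        proof (intro conjI ballI)
          fix c assume "c \<in> V"
          then show "ext z c \<in> {..<N}"
            using zP funpow_in[OF S zw, of k] by (cases "c = v") (auto simp: ext_def PiE_iff)
        next
          show "ext z \<in> extensional V" using zP v by (auto simp: ext_def PiE_iff extensional_def)
        qed
        moreover have "\<forall>(a, i, b, j)\<in>E. (S ^^ i) (ext z a) = (S ^^ j) (ext z b)"
        proof (rule iffD1[OF sat[where z = z and z' = "ext z"]])
          show "\<forall>(a, i, b, j)\<in>subst v w k ` E. (S ^^ i) (z a) = (S ^^ j) (z b)"
            using z by (rule sols_ball)
        qed (simp_all add: ext_def)
        ultimately show "ext z \<in> sols N S V E" unfolding sols_def by (intro CollectI conjI)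
      qed
    qed
  then show ?thesis by (rule bij_betw_same_card)
qed


lemma subst_wf:
  assumes "\<forall>(a, i, b, j)\<in>E. a \<in> V \<and> b \<in> V" "w \<in> V" "v \<noteq> w"
  shows "\<forall>(a, i, b, j)\<in>subst v w k ` E. a \<in> V - {v} \<and> b \<in> V - {v}"
proof
  fix e assume "e \<in> subst v w k ` E"
  then obtain a i b j where e: "(a, i, b, j) \<in> E" "e = subst v w k (a, i, b, j)"
    by (metis imageE prod_cases4)
  then have "a \<in> V" "b \<in> V" using assms(1) by auto
  then show "case e of (a, i, b, j) \<Rightarrow> a \<in> V - {v} \<and> b \<in> V - {v}"
    using e(2) assms(2,3) by (auto simp: subst_def)
qed

text \<open>Gaussian elimination for permutations, by induction on the number of variables. An
  equation between distinct variables, after cancelling the smaller power, expresses one through the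
  other and eliminates it. Once all equations are diagonal, any variable splits off with its
  equations and contributes the factor \<open>fixed_count N S g\<close>. The choices depend only on
  the system, hence the order of quantifiers: one multiset for all N and S.\<close>

theorem card_sols:
  fixes V :: "'v set"
  assumes "finite V" "finite E" "\<forall>(a, i, b, j)\<in>E. a \<in> V \<and> b \<in> V"
  shows "\<exists>ms. \<forall>N S. S permutes {..<N} \<longrightarrow> card (sols N S V E) = (\<Prod>m\<in>#ms. fixed_count N S m)"
  using assms
proof (induction "card V" arbitrary: V E)
  case 0
  then have "V = {}" by simp
  then have "E = {}" using 0 by fastforce
  have "sols N S V E = {\<lambda>_. undefined}" for N S
    unfolding sols_def \<open>V = {}\<close> \<open>E = {}\<close> by simp
  then show ?case by (intro exI[of _ "{#}"]) simp
next
  case (Suc n)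
  have step: ?case
    if vw: "v \<in> V" "w \<in> V" "v \<noteq> w"
      and det: "\<And>N S z. S permutes {..<N} \<Longrightarrow> z \<in> sols N S V E \<Longrightarrow> z v = (S ^^ k) (z w)" for v w k
  proof -
    have "\<exists>ms. \<forall>N S. S permutes {..<N} \<longrightarrow>
      card (sols N S (V - {v}) (subst v w k ` E)) = (\<Prod>m\<in>#ms. fixed_count N S m)"
    proof (rule Suc.hyps(1))
      show "n = card (V - {v})" using Suc.hyps(2) vw Suc.prems(1) by simp
      show "\<forall>(a, i, b, j)\<in>subst v w k ` E. a \<in> V - {v} \<and> b \<in> V - {v}"
        by (rule subst_wf[OF Suc.prems(3) vw(2,3)])
    qed (use Suc.prems in simp_all)
    then obtain ms where ms: "\<forall>N S. S permutes {..<N} \<longrightarrow>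
      card (sols N S (V - {v}) (subst v w k ` E)) = (\<Prod>m\<in>#ms. fixed_count N S m)" ..
    show ?case
    proof (rule exI[of _ ms], intro allI impI)
      fix N :: nat and S assume S: "S permutes {..<N}"
      show "card (sols N S V E) = (\<Prod>m\<in>#ms. fixed_count N S m)"
        using ms S card_sols_subst[of S N v V w E k, OF S vw Suc.prems(3)] det[OF S] by presburger
    qed
  qed
  show ?case
  proof (cases "\<exists>v i w j. (v, i, w, j) \<in> E \<and> v \<noteq> w")
    case True
    then obtain v i w j where e: "(v, i, w, j) \<in> E" "v \<noteq> w" by blast
    have vw: "v \<in> V" "w \<in> V" using Suc.prems(3) e by auto
    have eq: "(S ^^ i) (z v) = (S ^^ j) (z w)" if "z \<in> sols N S V E" for N S z
      by (rule sols_eq[OF that e(1)])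
    show ?thesis
    \<comment> \<open>Exponents are naturals, so the variable with the smaller exponent is the one
      that is solved for.\<close>
    proof (cases "i \<le> j")
      case True
      show ?thesis
      proof (rule step[OF vw e(2)])
        fix N :: nat and S z assume S: "S permutes {..<N}" and z: "z \<in> sols N S V E"
        show "z v = (S ^^ (j - i)) (z w)" by (rule iffD1[OF funpow_eq_iff[OF S True] eq[OF z]])
      qed
    next
      case False
      then have ji: "j \<le> i" by simp
      show ?thesis
      proof (rule step[OF vw(2,1) e(2)[symmetric]])
        fix N :: nat and S z assume S: "S permutes {..<N}" and z: "z \<in> sols N S V E"
        show "z w = (S ^^ (i - j)) (z v)" by (rule iffD1[OF funpow_eq_iff[OF S ji] eq[OF z, symmetric]])
      qed
    qed
  next
    case False
    \<comment> \<open>No equation links two variables any more: those with left variable v constrain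
      \<open>z v\<close> alone, and the others do not mention v.\<close>
    obtain v where v: "v \<in> V" using Suc.hyps(2) by fastforce
    define D where "D = (\<lambda>(a, i, b, j). (i, j)) ` {e\<in>E. fst e = v}"
    define E' where "E' = {e\<in>E. fst e \<noteq> v}"
    have "finite D" using Suc.prems unfolding D_def by simp
    then obtain g where g: "\<forall>(N :: nat) S. S permutes {..<N} \<longrightarrow>
        (\<forall>x. (\<forall>(i, j)\<in>D. (S ^^ i) x = (S ^^ j) x) \<longleftrightarrow> (S ^^ g) x = x)"
      using diagonal_system by blast
    have gR: "(\<forall>(i, j)\<in>D. (S ^^ i) x = (S ^^ j) x) \<longleftrightarrow> (S ^^ g) x = x"
      if "S permutes {..<N}" for N :: nat and S x using g that by blast
    have diag: "\<And>a i b j. (a, i, b, j) \<in> E \<Longrightarrow> a = b" using False by blast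
    have "\<exists>ms. \<forall>N S. S permutes {..<N} \<longrightarrow>
      card (sols N S (V - {v}) E') = (\<Prod>m\<in>#ms. fixed_count N S m)"
    proof (rule Suc.hyps(1))
      show "n = card (V - {v})" using Suc.hyps(2) v Suc.prems(1) by simp
      show "\<forall>(a, i, b, j)\<in>E'. a \<in> V - {v} \<and> b \<in> V - {v}"
        using Suc.prems(3) diag by (fastforce simp: E'_def)
    qed (use Suc.prems in \<open>simp_all add: E'_def\<close>)
    then obtain ms where ms: "\<forall>N S. S permutes {..<N} \<longrightarrow>
      card (sols N S (V - {v}) E') = (\<Prod>m\<in>#ms. fixed_count N S m)" ..
    show ?thesis
    proof (rule exI[of _ "add_mset g ms"], intro allI impI)
      fix N :: nat and S assume S: "S permutes {..<N}"
      define X where "X = {x\<in>{..<N}. (S ^^ g) x = x}"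
      have "bij_betw (\<lambda>z. (z v, restrict z (V - {v}))) (sols N S V E) (X \<times> sols N S (V - {v}) E')"
      proof (rule bij_betw_byWitness[where f' = "\<lambda>(x, z). z(v := x)"])
        show "\<forall>z\<in>sols N S V E. (case (z v, restrict z (V - {v})) of (x, z) \<Rightarrow> z(v := x)) = z"
        proof
          fix z assume "z \<in> sols N S V E"
          then have zE: "z \<in> extensional V" by (rule sols_extensional)
          have "((restrict z (V - {v}))(v := z v)) c = z c" for c
            using v zE by (cases "c = v"; cases "c \<in> V") (simp_all add: extensional_def)
          then show "(case (z v, restrict z (V - {v})) of (x, z) \<Rightarrow> z(v := x)) = z" by auto
        qed
        show "\<forall>p\<in>X \<times> sols N S (V - {v}) E'. (((case p of (x, z) \<Rightarrow> z(v := x)) v,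
            restrict (case p of (x, z) \<Rightarrow> z(v := x)) (V - {v}))) = p"
        proof
          fix p assume "p \<in> X \<times> sols N S (V - {v}) E'"
          then obtain x z where p: "p = (x, z)" and z: "z \<in> sols N S (V - {v}) E'" by blast
          have zE: "z \<in> extensional (V - {v})" using z by (rule sols_extensional)
          have "restrict (z(v := x)) (V - {v}) c = z c" for c
            using zE by (cases "c = v"; cases "c \<in> V") (simp_all add: extensional_def)
          then have "restrict (z(v := x)) (V - {v}) = z" ..
          then show "(((case p of (x, z) \<Rightarrow> z(v := x)) v,
            restrict (case p of (x, z) \<Rightarrow> z(v := x)) (V - {v}))) = p" unfolding p by simp
        qed
        show "(\<lambda>z. (z v, restrict z (V - {v}))) ` sols N S V E \<subseteq> X \<times> sols N S (V - {v}) E'"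
        proof (rule image_subsetI)
          fix z assume z: "z \<in> sols N S V E"
          have zP: "z \<in> V \<rightarrow> {..<N}" using z by (rule sols_Pi)
          have sat: "\<And>a i b j. (a, i, b, j) \<in> E \<Longrightarrow> (S ^^ i) (z a) = (S ^^ j) (z b)"
            by (rule sols_eq[OF z])
          have "\<forall>(i, j)\<in>D. (S ^^ i) (z v) = (S ^^ j) (z v)"
          proof clarify
            fix i j assume "(i, j) \<in> D"
            then obtain b where "(v, i, b, j) \<in> E" unfolding D_def by auto
            with diag sat show "(S ^^ i) (z v) = (S ^^ j) (z v)" by blast
          qed
          then have "(S ^^ g) (z v) = z v" by (rule iffD1[OF gR[OF S]])
          then have "z v \<in> X" unfolding X_def using zP v by blast
          moreover have "restrict z (V - {v}) \<in> sols N S (V - {v}) E'"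
          proof -
            have "restrict z (V - {v}) \<in> (V - {v}) \<rightarrow>\<^sub>E {..<N}" using zP by auto
            moreover have "(S ^^ i) (restrict z (V - {v}) a) = (S ^^ j) (restrict z (V - {v}) b)"
              if "(a, i, b, j) \<in> E'" for a i b j
            proof -
              have e: "(a, i, b, j) \<in> E" "a \<noteq> v" using that unfolding E'_def by auto
              then have "b \<noteq> v" "a \<in> V" "b \<in> V" using diag Suc.prems(3) by blast+
              then show ?thesis using e sat[OF e(1)] by (simp del: funpow.simps)
            qed
            ultimately show ?thesis by (rule solsI)
          qed
          ultimately show "(z v, restrict z (V - {v})) \<in> X \<times> sols N S (V - {v}) E'" by blast
        qed
        show "(\<lambda>(x, z). z(v := x)) ` (X \<times> sols N S (V - {v}) E') \<subseteq> sols N S V E"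
        proof (rule image_subsetI, clarify)
          fix x z assume x: "x \<in> X" and z: "z \<in> sols N S (V - {v}) E'"
          have zP: "z \<in> (V - {v}) \<rightarrow>\<^sub>E {..<N}" using z by (rule sols_PiE)
          have xN: "x < N" "(S ^^ g) x = x" using x unfolding X_def by blast+
          have "z(v := x) \<in> insert v (V - {v}) \<rightarrow>\<^sub>E {..<N}"
            by (rule PiE_fun_upd[OF _ zP]) (use xN(1) in blast)
          then have "z(v := x) \<in> V \<rightarrow>\<^sub>E {..<N}" using v by (simp add: insert_absorb)
          moreover have "(S ^^ i) ((z(v := x)) a) = (S ^^ j) ((z(v := x)) b)"
            if e: "(a, i, b, j) \<in> E" for a i b j
          proof (cases "a = v")
            case True
            have "(i, j) \<in> D" unfolding D_def using e True by force
            then have "(S ^^ i) x = (S ^^ j) x" using iffD2[OF gR[OF S] xN(2)] by blast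
            moreover have "b = v" using diag[OF e] True by simp
            ultimately show ?thesis using True by (simp only: fun_upd_same)
          next
            case False
            then have "(a, i, b, j) \<in> E'" unfolding E'_def using e by simp
            then have "(S ^^ i) (z a) = (S ^^ j) (z b)" by (rule sols_eq[OF z])
            moreover have "b \<noteq> v" using diag[OF e] False by simp
            ultimately show ?thesis using False by (simp only: fun_upd_other not_False_eq_True)
          qed
          ultimately show "z(v := x) \<in> sols N S V E" by (rule solsI)
        qed
      qed
      then have "card (sols N S V E) = card X * card (sols N S (V - {v}) E')"
        by (simp add: bij_betw_same_card card_cartesian_product)
      also have "\<dots> = (\<Prod>m\<in>#add_mset g ms. fixed_count N S m)"
        using ms S unfolding X_def fixed_count_def by simp
      finally show "card (sols N S V E) = (\<Prod>m\<in>#add_mset g ms. fixed_count N S m)" .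
    qed
  qed
qed

subsection \<open>Patterns and their numbers of components\<close>

definition cons :: "nat \<Rightarrow> 'v set \<Rightarrow> 'v rel \<Rightarrow> ('v \<Rightarrow> nat) set" where
  "cons N V R = {c \<in> V \<rightarrow>\<^sub>E {..<N}. \<forall>(a, b)\<in>R. c a = c b}"

text \<open>The number of classes of \<open>V\<close> under the equivalence generated by \<open>R\<close>, read off from the
  number of colourings; meaningful for finite \<open>V\<close> only.\<close>

definition comps :: "'v set \<Rightarrow> 'v rel \<Rightarrow> nat" where
  "comps V R = (SOME k. \<forall>N. card (cons N V R) = N ^ k)"

lemma finite_cons: "finite V \<Longrightarrow> finite (cons N V R)"
  unfolding cons_def by (simp add: finite_PiE)

lemma fixed_count_id: "fixed_count N id m = N"
proof -
  have "(id ^^ m) x = (x :: nat)" for x by (induction m) auto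
  then show ?thesis unfolding fixed_count_def by simp
qed

lemma sols_id: "sols N id V E = cons N V {(a, b). \<exists>i j. (a, i, b, j) \<in> E}"
proof -
  have "(id ^^ m) x = (x :: nat)" for x m by (induction m) auto
  then show ?thesis unfolding sols_def cons_def by fastforce
qed

text \<open>Constancy along R is a system with all exponents 0, and every power of the identity has
  N fixed points, so the product in \<open>card_sols\<close> is a pure power of N. This also
  provides the witness for the choice in \<open>comps\<close>.\<close>

lemma card_cons:
  assumes "finite V" "R \<subseteq> V \<times> V"
  shows "card (cons N V R) = N ^ comps V R"
proof -
  define E where "E = (\<lambda>(a, b). (a, 0 :: nat, b, 0 :: nat)) ` R"
  have "finite R" using assms finite_subset by blast
  then have "finite E" unfolding E_def by simp
  moreover have "\<forall>(a, i, b, j)\<in>E. a \<in> V \<and> b \<in> V" using assms unfolding E_def by auto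
  ultimately obtain ms where ms: "\<forall>N S. S permutes {..<N} \<longrightarrow>
      card (sols N S V E) = (\<Prod>m\<in>#ms. fixed_count N S m)"
    using card_sols[OF assms(1)] by blast
  have R: "{(a, b). \<exists>i j. (a, i, b, j) \<in> E} = R" unfolding E_def by force
  have "card (cons N V R) = N ^ size ms" for N
  proof -
    have "card (sols N id V E) = (\<Prod>m\<in>#ms. fixed_count N id m)" using ms permutes_id by blast
    then show ?thesis by (simp add: sols_id R fixed_count_id)
  qed
  then have "\<forall>N. card (cons N V R) = N ^ comps V R"
    unfolding comps_def by (intro someI[of "\<lambda>k. \<forall>N. card (cons N V R) = N ^ k"]) blast
  then show ?thesis by blast
qed

text \<open>The number of factors is found by evaluating the count at S = id and N = 2: there only
  the pairs of variables matter, and 2 to the power k determines k.\<close>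

lemma card_sols_comps:
  assumes "finite V" "finite E" "\<forall>(a, i, b, j)\<in>E. a \<in> V \<and> b \<in> V"
  obtains ms where "size ms = comps V {(a, b). \<exists>i j. (a, i, b, j) \<in> E}"
    "\<And>N S. S permutes {..<N} \<Longrightarrow> card (sols N S V E) = (\<Prod>m\<in>#ms. fixed_count N S m)"
proof -
  let ?R = "{(a, b). \<exists>i j. (a, i, b, j) \<in> E}"
  obtain ms where ms: "\<forall>N S. S permutes {..<N} \<longrightarrow>
      card (sols N S V E) = (\<Prod>m\<in>#ms. fixed_count N S m)"
    using card_sols[OF assms] by blast
  have "card (sols 2 id V E) = (\<Prod>m\<in>#ms. fixed_count 2 id m)" using ms permutes_id by blast
  then have "card (cons 2 V ?R) = 2 ^ size ms" by (simp add: sols_id fixed_count_id)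
  moreover have "?R \<subseteq> V \<times> V" using assms(3) by fastforce
  ultimately have "2 ^ size ms = (2 :: nat) ^ comps V ?R" using card_cons[OF assms(1), of ?R 2] by simp
  then have "size ms = comps V ?R" by simp
  then show ?thesis using that ms by blast
qed

lemma comps_le_of_card:
  assumes "finite V" "R \<subseteq> V \<times> V" "R' \<subseteq> V \<times> V" "N \<ge> 2" "cons N V R \<subseteq> cons N V R'"
  shows "comps V R \<le> comps V R'"
proof -
  have "card (cons N V R) \<le> card (cons N V R')" by (rule card_mono[OF finite_cons assms(5)]) fact
  then have "N ^ comps V R \<le> N ^ comps V R'" by (simp add: card_cons assms)
  then show ?thesis by (rule power_le_imp_le_exp[rotated]) (use assms in simp)
qed

lemma comps_antimono:
  assumes "finite V" "R' \<subseteq> R" "R \<subseteq> V \<times> V"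
  shows "comps V R \<le> comps V R'"
  by (rule comps_le_of_card[where N = 2]) (use assms in \<open>auto simp: cons_def\<close>)

text \<open>Colourings of \<open>V\<close> by two colours that are constant along a relation form a vector space
  over the field with two elements, of dimension \<^const>\<open>comps\<close>; this is the dimension formula
  for the sum of two subspaces.\<close>

lemma comps_submodular:
  assumes fin: "finite V" and A: "A \<subseteq> V \<times> V" and B: "B \<subseteq> V \<times> V" and Q: "Q \<subseteq> A" "Q \<subseteq> B"
  shows "comps V A + comps V B \<le> comps V Q + comps V (A \<union> B)"
proof -
  define add where "add c d = restrict (\<lambda>v. (c v + d v) mod 2) V" for c d :: "'a \<Rightarrow> nat"
  define X where "X = cons 2 V A \<times> cons 2 V B"
  define f where "f = (\<lambda>(c, d). add c d)"
  \<comment> \<open>\<open>ch e\<close> fixes one decomposition of e as a sum of a colouring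
    constant along A and one constant along B. Two decompositions of the same sum differ, in
    characteristic 2, by a colouring constant along both. So \<open>g\<close> sends (c, d) to its
    sum and to the difference from the chosen decomposition, and its injectivity replaces the
    dimension count.\<close>
  define ch where "ch e = (SOME p. p \<in> X \<and> f p = e)" for e
  define g where "g = (\<lambda>(c, d). (add c d, add c (fst (ch (add c d)))))"
  have val: "c v < 2" if "c \<in> cons 2 V R" "v \<in> V" for c v R
    using that unfolding cons_def by (auto simp: PiE_iff)
  have addcons: "add c d \<in> cons 2 V R"
    if "\<forall>(a, b)\<in>R. (c a + d a) mod 2 = (c b + d b) mod 2" "R \<subseteq> V \<times> V" for c d R
    using that unfolding add_def cons_def by fastforce
  have ch: "ch (add c d) \<in> X \<and> f (ch (add c d)) = add c d" if "(c, d) \<in> X" for c d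
    unfolding ch_def by (rule someI[of _ "(c, d)"]) (use that in \<open>auto simp: f_def\<close>)
  have cancel: "c = c'" if "add c e = add c' e" "c \<in> cons 2 V R" "c' \<in> cons 2 V R" for c c' e R
  proof
    fix v
    show "c v = c' v"
    proof (cases "v \<in> V")
      case True
      have "(c v + e v) mod 2 = (c' v + e v) mod 2"
        using fun_cong[OF that(1), of v] True by (simp add: add_def)
      moreover have "c v < 2" "c' v < 2" using val that True by blast+
      ultimately show ?thesis by presburger
    next
      case False
      then show ?thesis using that unfolding cons_def by (auto simp: PiE_iff extensional_def)
    qed
  qed
  have add_comm: "add c d = add d c" for c d unfolding add_def by (simp add: add.commute)
  have "inj_on g X"
  proof (rule inj_onI)
    fix p p' assume p: "p \<in> X" and p': "p' \<in> X" and gg: "g p = g p'"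
    obtain c d c' d' where pp: "p = (c, d)" "p' = (c', d')" by fastforce
    have e: "add c d = add c' d'" "add c (fst (ch (add c d))) = add c' (fst (ch (add c d)))"
      using gg unfolding pp g_def by auto
    have mem: "c \<in> cons 2 V A" "c' \<in> cons 2 V A" "d \<in> cons 2 V B" "d' \<in> cons 2 V B"
      using p p' unfolding pp X_def by auto
    have c: "c = c'" by (rule cancel[OF e(2) mem(1,2)])
    have "add d c = add d' c" using e(1) c add_comm by metis
    then have "d = d'" by (rule cancel[OF _ mem(3,4)])
    with c show "p = p'" unfolding pp by simp
  qed
  moreover have "g ` X \<subseteq> cons 2 V Q \<times> cons 2 V (A \<union> B)"
  proof (rule image_subsetI)
    fix p assume p: "p \<in> X"
    obtain c d where pp: "p = (c, d)" by fastforce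
    obtain c' d' where pp': "ch (add c d) = (c', d')" by fastforce
    have c': "c' \<in> cons 2 V A" "d' \<in> cons 2 V B" "add c' d' = add c d"
      using ch[of c d] p unfolding pp pp' X_def f_def by auto
    have mem: "c \<in> cons 2 V A" "d \<in> cons 2 V B" using p unfolding pp X_def by auto
    have eqA: "c a = c b" "c' a = c' b" if "(a, b) \<in> A" for a b using mem c' that unfolding cons_def by auto
    have eqB: "d a = d b" "d' a = d' b" if "(a, b) \<in> B" for a b using mem c' that unfolding cons_def by auto
    have "add c d \<in> cons 2 V Q"
    proof (rule addcons)
      show "\<forall>(a, b)\<in>Q. (c a + d a) mod 2 = (c b + d b) mod 2"
      proof clarify
        fix a b assume "(a, b) \<in> Q"
        then have "(a, b) \<in> A" "(a, b) \<in> B" using Q by auto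
        then show "(c a + d a) mod 2 = (c b + d b) mod 2" using eqA(1) eqB(1) by metis
      qed
    qed (use Q A in blast)
    moreover have "add c c' \<in> cons 2 V (A \<union> B)"
    proof (rule addcons)
      show "\<forall>(a, b)\<in>A \<union> B. (c a + c' a) mod 2 = (c b + c' b) mod 2"
      proof clarify
        fix a b assume ab: "(a, b) \<in> A \<union> B"
        show "(c a + c' a) mod 2 = (c b + c' b) mod 2"
        proof (cases "(a, b) \<in> A")
          case True
          show ?thesis unfolding eqA[OF True] ..
        next
          case False
          then have bB: "(a, b) \<in> B" using ab by blast
          then have V: "a \<in> V" "b \<in> V" using B by auto
          \<comment> \<open>Equality of the two sums, read modulo 2, moves summands across: c + c'
            agrees with d + d', which is constant along B.\<close>
          have s: "(c v + c' v) mod 2 = (d v + d' v) mod 2" if "v \<in> V" for v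
            using fun_cong[OF c'(3), of v] that by (auto simp: add_def mod2_eq_if split: if_splits)
          show ?thesis unfolding s[OF V(1)] s[OF V(2)] eqB[OF bB] ..
        qed
      qed
    qed (use A B in blast)
    ultimately show "g p \<in> cons 2 V Q \<times> cons 2 V (A \<union> B)" unfolding pp g_def pp' by (simp add: pp')
  qed
  moreover have "finite (cons 2 V Q \<times> cons 2 V (A \<union> B))" by (simp add: finite_cons fin)
  ultimately have "card X \<le> card (cons 2 V Q \<times> cons 2 V (A \<union> B))" by (rule card_inj_on_le)
  moreover have "Q \<subseteq> V \<times> V" using Q A by blast
  ultimately have "(2 :: nat) ^ (comps V A + comps V B) \<le> 2 ^ (comps V Q + comps V (A \<union> B))"
    using fin A B unfolding X_def by (simp add: card_cartesian_product card_cons power_add)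
  then show ?thesis by (rule power_le_imp_le_exp[rotated]) simp
qed

section \<open>Exact coincidence patterns of labellings and their numbers\<close>

definition rel :: "'v set \<Rightarrow> ('v \<Rightarrow> nat) \<Rightarrow> 'v rel" where
  "rel V y = {(a, b). a \<in> V \<and> b \<in> V \<and> y a = y b}"

definition patterns :: "'v set \<Rightarrow> 'v rel set" where
  "patterns V = {q. \<exists>N. \<exists>y \<in> V \<rightarrow>\<^sub>E {..<N}. rel V y = q}"

definition labels :: "nat \<Rightarrow> 'v set \<Rightarrow> 'v rel \<Rightarrow> ('v \<Rightarrow> nat) set" where
  "labels N V q = {y \<in> V \<rightarrow>\<^sub>E {..<N}. rel V y = q}"

lemma rel_subset: "rel V y \<subseteq> V \<times> V"
  unfolding rel_def by auto

lemma patterns_subset: "q \<in> patterns V \<Longrightarrow> q \<subseteq> V \<times> V"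
  unfolding patterns_def using rel_subset by blast

lemma finite_patterns: "finite V \<Longrightarrow> finite (patterns V)"
  by (rule finite_subset[of _ "Pow (V \<times> V)"]) (use patterns_subset in auto)

lemma rel_patterns: "y \<in> V \<rightarrow>\<^sub>E {..<N} \<Longrightarrow> rel V y \<in> patterns V"
  unfolding patterns_def by blast

lemma finite_labels: "finite V \<Longrightarrow> finite (labels N V q)"
  unfolding labels_def by (simp add: finite_PiE)

lemma cons_eq_rel: "R \<subseteq> V \<times> V \<Longrightarrow> cons N V R = {y \<in> V \<rightarrow>\<^sub>E {..<N}. R \<subseteq> rel V y}"
  unfolding cons_def rel_def by auto

text \<open>A labelling whose pattern is exactly q is constant along q but not along q', so the two
  numbers of colourings, both powers of N, differ as soon as N admits such a labelling. Taking N at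
  least 2 allows the exponents to be compared.\<close>

lemma comps_strict:
  assumes fin: "finite V" and q: "q \<in> patterns V" "q' \<in> patterns V" "q \<subset> q'"
  shows "comps V q' < comps V q"
proof -
  obtain M y where y: "y \<in> V \<rightarrow>\<^sub>E {..<M}" "rel V y = q" using q(1) unfolding patterns_def by blast
  define N where "N = max 2 M"
  have sub: "q \<subseteq> V \<times> V" "q' \<subseteq> V \<times> V" using patterns_subset q by blast+
  have yN: "y \<in> V \<rightarrow>\<^sub>E {..<N}" using y(1) unfolding N_def PiE_iff by fastforce
  have "cons N V q' \<subset> cons N V q"
    unfolding cons_eq_rel[OF sub(1)] cons_eq_rel[OF sub(2)] using yN y(2) q(3) by blast
  then have "card (cons N V q') < card (cons N V q)" by (rule psubset_card_mono[OF finite_cons[OF fin]])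
  then have "N ^ comps V q' < N ^ comps V q" by (simp add: card_cons fin sub)
  then show ?thesis by (rule power_less_imp_less_exp[rotated]) (simp add: N_def)
qed

lemma card_cons_labels:
  assumes fin: "finite V" and R: "R \<subseteq> V \<times> V"
  shows "card (cons N V R) = (\<Sum>q\<in>{q\<in>patterns V. R \<subseteq> q}. card (labels N V q))"
proof -
  have "cons N V R = (\<Union>q\<in>{q\<in>patterns V. R \<subseteq> q}. labels N V q)"
    unfolding cons_eq_rel[OF R] labels_def using rel_patterns by fastforce
  then show ?thesis
    by (simp only:, subst card_UN_disjoint) (auto simp: finite_patterns fin finite_labels, auto simp: labels_def)
qed

lemma labels_le: "finite V \<Longrightarrow> q \<subseteq> V \<times> V \<Longrightarrow> card (labels N V q) \<le> N ^ comps V q"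
  unfolding card_cons[symmetric]
  by (rule card_mono[OF finite_cons]) (auto simp: labels_def cons_eq_rel)

text \<open>Among the \<open>N ^ comps V q\<close> labellings constant along q, those with further
  coincidences have a strictly coarser pattern, thus at least one component less, and are
  negligible.\<close>

lemma labels_asymp:
  assumes fin: "finite V" and q: "q \<in> patterns V"
  shows "(\<lambda>N. real (card (labels N V q)) / real N ^ comps V q) \<longlonglongrightarrow> 1"
proof -
  have sub: "q \<subseteq> V \<times> V" by (rule patterns_subset[OF q])
  let ?P = "{q'\<in>patterns V. q \<subset> q'}"
  have P: "{q'\<in>patterns V. q \<subseteq> q'} = insert q ?P" using q by blast
  have dec: "N ^ comps V q = card (labels N V q) + (\<Sum>q'\<in>?P. card (labels N V q'))" for N
    unfolding card_cons[OF fin sub, symmetric] card_cons_labels[OF fin sub] P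
    by (subst sum.insert) (simp_all add: finite_patterns fin)
  have lim: "(\<lambda>N. real (card (labels N V q')) / real N ^ comps V q) \<longlonglongrightarrow> 0" if q': "q' \<in> ?P" for q'
  proof (rule tendsto_sandwich[where f = "\<lambda>_. 0" and h = "\<lambda>N. 1 / real N"])
    have lt: "comps V q' < comps V q" using comps_strict[OF fin q] q' by blast
    show "\<forall>\<^sub>F N in sequentially. real (card (labels N V q')) / real N ^ comps V q \<le> 1 / real N"
    proof (rule eventually_sequentiallyI[of 1])
      fix N :: nat assume N: "1 \<le> N"
      have "real (card (labels N V q')) \<le> real N ^ comps V q'"
        using labels_le[OF fin patterns_subset, of q' N] q' by (simp flip: of_nat_power)
      also have "\<dots> \<le> real N ^ (comps V q - 1)" using lt N by (intro power_increasing) auto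
      finally show "real (card (labels N V q')) / real N ^ comps V q \<le> 1 / real N"
        using lt N by (cases "comps V q") (auto simp: field_simps)
    qed
    show "(\<lambda>N. 1 / real N) \<longlonglongrightarrow> 0" by (rule lim_1_over_n)
  qed auto
  have "(\<lambda>N. 1 - (\<Sum>q'\<in>?P. real (card (labels N V q')) / real N ^ comps V q)) \<longlonglongrightarrow> 1 - (\<Sum>q'\<in>?P. 0)"
    by (intro tendsto_diff tendsto_const tendsto_sum lim)
  moreover have "\<forall>\<^sub>F N in sequentially. 1 - (\<Sum>q'\<in>?P. real (card (labels N V q')) / real N ^ comps V q)
      = real (card (labels N V q)) / real N ^ comps V q"
  proof (rule eventually_sequentiallyI[of 1])
    fix N :: nat assume N: "1 \<le> N"
    have X: "real N ^ comps V q = real (card (labels N V q)) + (\<Sum>q'\<in>?P. real (card (labels N V q')))"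
      using arg_cong[OF dec[of N], of real] by simp
    have "1 = real N ^ comps V q / real N ^ comps V q" using N by simp
    also have "\<dots> = real (card (labels N V q)) / real N ^ comps V q
        + (\<Sum>q'\<in>?P. real (card (labels N V q')) / real N ^ comps V q)"
      by (subst (1) X) (simp only: add_divide_distrib sum_divide_distrib)
    finally show "1 - (\<Sum>q'\<in>?P. real (card (labels N V q')) / real N ^ comps V q)
      = real (card (labels N V q)) / real N ^ comps V q"
      by linarith
  qed
  ultimately show ?thesis by (simp add: tendsto_cong)
qed

subsection \<open>Conjugacy classes and transitions between patterns\<close>

definition fixed_fraction :: "nat \<Rightarrow> (nat \<Rightarrow> nat) \<Rightarrow> nat \<Rightarrow> real" where
  "fixed_fraction N S m = real (fixed_count N S m) / real N"

definition avg :: "'b set \<Rightarrow> ('b \<Rightarrow> real) \<Rightarrow> real" where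
  "avg A f = (\<Sum>a\<in>A. f a) / real (card A)"

lemma avg_const: "finite A \<Longrightarrow> A \<noteq> {} \<Longrightarrow> avg A (\<lambda>_. c) = c"
  by (simp add: avg_def)

lemma avg_cong: "(\<And>a. a \<in> A \<Longrightarrow> f a = g a) \<Longrightarrow> avg A f = avg A g"
  by (simp add: avg_def)

lemma avg_eqI: "finite A \<Longrightarrow> A \<noteq> {} \<Longrightarrow> (\<And>a. a \<in> A \<Longrightarrow> f a = c) \<Longrightarrow> avg A f = c"
  by (simp add: avg_def)

lemma avg_sum: "avg A (\<lambda>a. \<Sum>i\<in>I. f a i) = (\<Sum>i\<in>I. avg A (\<lambda>a. f a i))"
  unfolding avg_def by (subst sum.swap) (simp add: sum_divide_distrib)

lemma avg_cmult: "avg A (\<lambda>a. c * f a) = c * avg A f"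
  by (simp add: avg_def sum_distrib_left)

lemma avg_add: "avg A (\<lambda>a. f a + g a) = avg A f + avg A g"
  by (simp add: avg_def sum.distrib add_divide_distrib)

lemma avg_mono: "(\<And>a. a \<in> A \<Longrightarrow> f a \<le> g a) \<Longrightarrow> avg A f \<le> avg A g"
  unfolding avg_def by (intro divide_right_mono sum_mono) auto

lemma inv_permutes_apply:
  assumes "t permutes A"
  shows "inv_into UNIV t (t x) = x" "t (inv_into UNIV t x) = x"
  using permutes_inverses[OF assms] by blast+

lemma funpow_conj:
  assumes "t permutes A"
  shows "((t \<circ> s \<circ> inv_into UNIV t) ^^ m) x = t ((s ^^ m) (inv_into UNIV t x))"
  by (induction m arbitrary: x) (simp_all add: inv_permutes_apply[OF assms])

lemma fixed_count_conj:
  assumes t: "t permutes {..<N}"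
  shows "fixed_count N (t \<circ> s \<circ> inv_into UNIV t) m = fixed_count N s m"
proof -
  have in_N: "t x < N \<longleftrightarrow> x < N" "inv_into UNIV t x < N \<longleftrightarrow> x < N" for x
    using permutes_in_image[OF t, of x] permutes_in_image[OF permutes_inv[OF t], of x] by auto
  have "bij_betw t {x\<in>{..<N}. (s ^^ m) x = x} {x\<in>{..<N}. ((t \<circ> s \<circ> inv_into UNIV t) ^^ m) x = x}"
    unfolding funpow_conj[OF t]
    by (rule bij_betw_byWitness[where f' = "inv_into UNIV t"])
      (auto simp: inv_permutes_apply[OF t] in_N, metis inv_permutes_apply(1)[OF t])
  then show ?thesis unfolding fixed_count_def by (simp add: bij_betw_same_card)
qed

text \<open>With W the set of right ends of pairs (x, S x), this produces the pairs (x, s (S x)): it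
  is left multiplication of S by s, seen on labellings.\<close>

definition twist :: "'v set \<Rightarrow> 'v set \<Rightarrow> (nat \<Rightarrow> nat) \<Rightarrow> ('v \<Rightarrow> nat) \<Rightarrow> 'v \<Rightarrow> nat" where
  "twist V W s y = restrict (\<lambda>v. if v \<in> W then s (y v) else y v) V"

definition trans_count :: "nat \<Rightarrow> 'v set \<Rightarrow> 'v set \<Rightarrow> (nat \<Rightarrow> nat) \<Rightarrow> 'v rel \<Rightarrow> 'v rel \<Rightarrow> nat" where
  "trans_count N V W s q p = card {y \<in> V \<rightarrow>\<^sub>E {..<N}. rel V y = q \<and> rel V (twist V W s y) = p}"

text \<open>Merges two conditions into one system to which \<open>card_sols\<close> applies: y is
  constant along q, and its twist by s is constant along p. The exponent records whether s acts at
  that vertex.\<close>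

definition pair_system :: "'v set \<Rightarrow> 'v rel \<Rightarrow> 'v rel \<Rightarrow> ('v \<times> nat \<times> 'v \<times> nat) set" where
  "pair_system W q p = {(a, i, b, j). (a, b) \<in> q \<and> i = 0 \<and> j = 0 \<or>
     (a, b) \<in> p \<and> i = of_bool (a \<in> W) \<and> j = of_bool (b \<in> W)}"

lemma pair_system_ball:
  "(\<forall>(a, i, b, j)\<in>pair_system W q p. P a i b j) \<longleftrightarrow>
    (\<forall>(a, b)\<in>q. P a 0 b 0) \<and> (\<forall>(a, b)\<in>p. P a (of_bool (a \<in> W)) b (of_bool (b \<in> W)))"
  unfolding pair_system_def by blast

lemma finite_pair_system:
  assumes "finite q" "finite p"
  shows "finite (pair_system W q p)"
proof (rule finite_subset)
  show "pair_system W q p \<subseteq> (\<lambda>((a, b), i, j). (a, i, b, j)) ` ((q \<union> p) \<times> {0, 1} \<times> {0, 1})"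
  proof
    fix e assume "e \<in> pair_system W q p"
    then obtain a i b j where e: "e = (a, i, b, j)" "(a, b) \<in> q \<union> p" "i \<in> {0, 1}" "j \<in> {0, 1}"
      unfolding pair_system_def by fastforce
    then show "e \<in> (\<lambda>((a, b), i, j). (a, i, b, j)) ` ((q \<union> p) \<times> {0, 1} \<times> {0, 1})"
      by (intro image_eqI[of _ _ "((a, b), i, j)"]) auto
  qed
qed (use assms in simp)

lemma twist_PiE:
  assumes "s permutes {..<N}" "y \<in> V \<rightarrow>\<^sub>E {..<N}"
  shows "twist V W s y \<in> V \<rightarrow>\<^sub>E {..<N}"
  using assms funpow_in[OF assms(1), of _ 1] unfolding twist_def by (auto simp: PiE_iff)

lemma twist_id: "y \<in> V \<rightarrow>\<^sub>E A \<Longrightarrow> twist V W id y = y"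
  unfolding twist_def by (auto simp: PiE_iff extensional_def restrict_def)

lemma sols_pair_system:
  assumes "q \<subseteq> V \<times> V" "p \<subseteq> V \<times> V"
  shows "sols N s V (pair_system W q p) =
    {y \<in> V \<rightarrow>\<^sub>E {..<N}. q \<subseteq> rel V y \<and> p \<subseteq> rel V (twist V W s y)}"
proof -
  have pw: "(s ^^ of_bool (a \<in> W)) x = (if a \<in> W then s x else x)" for a x by simp
  have "(\<forall>(a, i, b, j)\<in>pair_system W q p. (s ^^ i) (y a) = (s ^^ j) (y b)) \<longleftrightarrow>
      (\<forall>(a, b)\<in>q. y a = y b) \<and>
      (\<forall>(a, b)\<in>p. (if a \<in> W then s (y a) else y a) = (if b \<in> W then s (y b) else y b))" for y
    unfolding pair_system_ball by (simp only: pw funpow_0)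
  moreover have "q \<subseteq> rel V y \<longleftrightarrow> (\<forall>(a, b)\<in>q. y a = y b)" for y
    using assms unfolding rel_def by auto
  moreover have "p \<subseteq> rel V (twist V W s y) \<longleftrightarrow>
      (\<forall>(a, b)\<in>p. (if a \<in> W then s (y a) else y a) = (if b \<in> W then s (y b) else y b))" for y
  proof -
    have "twist V W s y a = (if a \<in> W then s (y a) else y a)" if "a \<in> V" for a
      using that by (simp add: twist_def)
    then have "(a, b) \<in> rel V (twist V W s y) \<longleftrightarrow>
       (if a \<in> W then s (y a) else y a) = (if b \<in> W then s (y b) else y b)" if "(a, b) \<in> p" for a b
      using assms(2) that unfolding rel_def by auto
    then show ?thesis by fast
  qed
  ultimately show ?thesis unfolding sols_def by presburger
qed

lemma pair_system_wf:
  assumes "q \<subseteq> V \<times> V" "p \<subseteq> V \<times> V"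
  shows "\<forall>(a, i, b, j)\<in>pair_system W q p. a \<in> V \<and> b \<in> V"
    and "{(a, b). \<exists>i j. (a, i, b, j) \<in> pair_system W q p} = q \<union> p"
proof -
  show "\<forall>(a, i, b, j)\<in>pair_system W q p. a \<in> V \<and> b \<in> V"
    unfolding pair_system_ball using assms by auto
  show "{(a, b). \<exists>i j. (a, i, b, j) \<in> pair_system W q p} = q \<union> p"
    unfolding pair_system_def by blast
qed

lemma card_sols_pair_system:
  assumes fin: "finite V" and sub: "q \<subseteq> V \<times> V" "p \<subseteq> V \<times> V" and s: "s permutes {..<N}"
  shows "card (sols N s V (pair_system W q p)) =
    (\<Sum>(q', p')\<in>{q'\<in>patterns V. q \<subseteq> q'} \<times> {p'\<in>patterns V. p \<subseteq> p'}. trans_count N V W s q' p')"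
proof -
  let ?I = "{q'\<in>patterns V. q \<subseteq> q'} \<times> {p'\<in>patterns V. p \<subseteq> p'}"
  let ?A = "\<lambda>(q', p'). {y \<in> V \<rightarrow>\<^sub>E {..<N}. rel V y = q' \<and> rel V (twist V W s y) = p'}"
  have "sols N s V (pair_system W q p) = (\<Union>i\<in>?I. ?A i)"
  proof (intro Set.set_eqI iffI)
    fix y assume "y \<in> sols N s V (pair_system W q p)"
    then have y: "y \<in> V \<rightarrow>\<^sub>E {..<N}" "q \<subseteq> rel V y" "p \<subseteq> rel V (twist V W s y)"
      unfolding sols_pair_system[OF sub] by blast+
    then have "(rel V y, rel V (twist V W s y)) \<in> ?I"
      using rel_patterns[OF y(1)] rel_patterns[OF twist_PiE[OF s y(1)]] by blast
    moreover have "y \<in> ?A (rel V y, rel V (twist V W s y))" using y(1) by simp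
    ultimately show "y \<in> (\<Union>i\<in>?I. ?A i)" by (rule UN_I)
  next
    fix y assume "y \<in> (\<Union>i\<in>?I. ?A i)"
    then show "y \<in> sols N s V (pair_system W q p)" unfolding sols_pair_system[OF sub] by auto
  qed
  also have "card \<dots> = (\<Sum>i\<in>?I. card (?A i))"
  proof (rule card_UN_disjoint)
    show "\<forall>i\<in>?I. finite (?A i)" using fin by (auto simp: finite_PiE)
  qed (auto simp: finite_patterns fin)
  finally show ?thesis unfolding trans_count_def by (simp add: case_prod_beta)
qed

section \<open>Transitivity of permutations on labellings with the same pattern\<close>

lemma ex_permutes_extending:
  assumes "f ` A \<subseteq> {..<N}" "inj_on f A" "A \<subseteq> {..<N :: nat}"
  shows "\<exists>t. t permutes {..<N} \<and> (\<forall>x\<in>A. t x = f x)"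
proof -
  have fin: "finite A" using assms(3) finite_subset by blast
  have "card ({..<N} - A) = card ({..<N} - f ` A)"
    using assms fin by (simp add: card_Diff_subset card_image)
  then obtain h where h: "bij_betw h ({..<N} - A) ({..<N} - f ` A)"
    using finite_same_card_bij[of "{..<N} - A" "{..<N} - f ` A"] by auto
  define t where "t x = (if x \<in> A then f x else if x < N then h x else x)" for x
  have "bij_betw t A (f ` A)"
    using assms(2) by (subst bij_betw_cong[of _ _ f]) (auto simp: t_def bij_betw_def)
  moreover have "bij_betw t ({..<N} - A) ({..<N} - f ` A)"
    using h by (subst bij_betw_cong[of _ _ h]) (auto simp: t_def)
  ultimately have "bij_betw t (A \<union> ({..<N} - A)) (f ` A \<union> ({..<N} - f ` A))"
    by (rule bij_betw_combine) auto
  moreover have "A \<union> ({..<N} - A) = {..<N}" "f ` A \<union> ({..<N} - f ` A) = {..<N}"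
    using assms by auto
  ultimately have "t permutes {..<N}"
    using assms(3) by (intro bij_imp_permutes) (auto simp: t_def)
  then show ?thesis by (auto simp: t_def)
qed

text \<open>Equality of patterns is what makes the assignment of \<open>y' v\<close> to
  \<open>y v\<close> well defined and injective on the labels in use; it then extends to a
  permutation.\<close>

lemma labels_permuted:
  assumes y: "y \<in> labels N V q" and y': "y' \<in> labels N V q"
  obtains t where "t permutes {..<N}" "\<And>v. v \<in> V \<Longrightarrow> y' v = t (y v)"
proof -
  have eq: "y a = y b \<longleftrightarrow> y' a = y' b" if "a \<in> V" "b \<in> V" for a b
  proof -
    have "(a, b) \<in> rel V y \<longleftrightarrow> (a, b) \<in> rel V y'" using y y' unfolding labels_def by simp
    then show ?thesis using that by (simp add: rel_def)
  qed
  define f where "f x = y' (SOME v. v \<in> V \<and> y v = x)" for x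
  have f: "f (y v) = y' v" if "v \<in> V" for v
  proof -
    have "(SOME w. w \<in> V \<and> y w = y v) \<in> V \<and> y (SOME w. w \<in> V \<and> y w = y v) = y v"
      by (rule someI[of _ v]) (use that in simp)
    then show ?thesis unfolding f_def using eq that by blast
  qed
  have yP: "y \<in> V \<rightarrow> {..<N}" "y' \<in> V \<rightarrow> {..<N}" using y y' unfolding labels_def PiE_def by auto
  have "f ` y ` V = y' ` V" using f by force
  moreover have "inj_on f (y ` V)" using f eq by (auto simp: inj_on_def)
  ultimately have "\<exists>t. t permutes {..<N} \<and> (\<forall>x\<in>y ` V. t x = f x)"
    using yP by (intro ex_permutes_extending) auto
  then show ?thesis using f that by auto
qed

text \<open>Collects what the asymptotic analysis takes from the classes. The expression in
  \<open>fixed_rate\<close> is minus the number of points moved by \<open>s ^^ m\<close>, relative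
  to the number \<open>d N\<close> of points moved by s; its convergence is the form in which the
  convergence of the period counts is used. Conditions on single classes start at N = 2, the
  smallest N with a non-trivial permutation.\<close>

locale class_sequence =
  fixes C :: "nat \<Rightarrow> (nat \<Rightarrow> nat) set" and d :: "nat \<Rightarrow> nat" and \<alpha> :: real
  assumes C_nonempty: "N \<ge> 2 \<Longrightarrow> C N \<noteq> {}"
    and C_permutes: "N \<ge> 2 \<Longrightarrow> s \<in> C N \<Longrightarrow> s permutes {..<N}"
    and C_conj: "N \<ge> 2 \<Longrightarrow> s \<in> C N \<Longrightarrow> t permutes {..<N} \<Longrightarrow> t \<circ> s \<circ> inv_into UNIV t \<in> C N"
    and C_conjugate: "N \<ge> 2 \<Longrightarrow> s \<in> C N \<Longrightarrow> s' \<in> C N \<Longrightarrow> \<exists>t. t permutes {..<N} \<and> s' = t \<circ> s \<circ> inv_into UNIV t"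
    and d_support: "N \<ge> 2 \<Longrightarrow> s \<in> C N \<Longrightarrow> card {x\<in>{..<N}. s x \<noteq> x} = d N"
    and d_pos: "N \<ge> 2 \<Longrightarrow> d N > 0"
    and d_asymp: "(\<lambda>N. real (d N) / real N) \<longlonglongrightarrow> \<alpha>"
    and fixed_rate: "convergent (\<lambda>N. real N / real (d N) * (avg (C N) (\<lambda>s. fixed_fraction N s m) - 1))"
begin

lemma C_finite: "N \<ge> 2 \<Longrightarrow> finite (C N)"
  by (rule finite_subset[of _ "{s. s permutes {..<N}}"]) (use C_permutes in \<open>auto simp: finite_permutations\<close>)

definition rate :: "nat \<Rightarrow> real" where
  "rate N = real N / real (d N)"

definition tau :: "nat \<Rightarrow> nat \<Rightarrow> real" where
  "tau N m = avg (C N) (\<lambda>s. fixed_fraction N s m)"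

lemma rate_pos: "N \<ge> 2 \<Longrightarrow> rate N > 0"
  unfolding rate_def using d_pos[of N] by simp

lemma fixed_fraction_tau:
  assumes N: "N \<ge> 2" and s: "s \<in> C N"
  shows "fixed_fraction N s m = tau N m"
proof -
  have "fixed_fraction N s' m = fixed_fraction N s m" if s': "s' \<in> C N" for s'
    using C_conjugate[OF N s s'] fixed_count_conj unfolding fixed_fraction_def by auto
  then show ?thesis unfolding tau_def using avg_eqI[OF C_finite[OF N] C_nonempty[OF N]] by metis
qed

lemma tau_rate: "convergent (\<lambda>N. rate N * (tau N m - 1))"
  using fixed_rate unfolding rate_def tau_def .

lemma inverse_rate: "(\<lambda>N. 1 / rate N) \<longlonglongrightarrow> \<alpha>"
  unfolding rate_def using d_asymp by simp

lemma tau_convergent: "convergent (\<lambda>N. tau N m)"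
proof -
  have "convergent (\<lambda>N. 1 + rate N * (tau N m - 1) * (1 / rate N))"
    by (intro convergent_add convergent_mult convergent_const tau_rate convergentI[OF inverse_rate])
  moreover have "\<forall>\<^sub>F N in sequentially. 1 + rate N * (tau N m - 1) * (1 / rate N) = tau N m"
    by (rule eventually_sequentiallyI[of 2]) (use rate_pos in \<open>force simp: field_simps\<close>)
  ultimately show ?thesis by (simp add: convergent_cong)
qed

text \<open>A discrete product rule: ab - 1 = (a - 1) b + (b - 1). Convergence of the plain product
  is carried along in the induction because it is the factor b.\<close>

lemma prod_tau_rate:
  "convergent (\<lambda>N. \<Prod>m\<in>#ms. tau N m) \<and> convergent (\<lambda>N. rate N * ((\<Prod>m\<in>#ms. tau N m) - 1))"
proof (induction ms)
  case empty
  then show ?case by (simp add: convergent_const)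
next
  case (add m ms)
  have "convergent (\<lambda>N. rate N * (tau N m - 1) * (\<Prod>m\<in>#ms. tau N m) + rate N * ((\<Prod>m\<in>#ms. tau N m) - 1))"
    by (rule convergent_add[OF convergent_mult[OF tau_rate conjunct1[OF add]] conjunct2[OF add]])
  moreover have "convergent (\<lambda>N. tau N m * (\<Prod>m\<in>#ms. tau N m))"
    by (rule convergent_mult[OF tau_convergent conjunct1[OF add]])
  ultimately show ?case by (simp add: algebra_simps)
qed

definition drift_count :: "nat \<Rightarrow> 'v set \<Rightarrow> 'v set \<Rightarrow> 'v rel \<Rightarrow> 'v rel \<Rightarrow> real" where
  "drift_count N V W q p =
     rate N * (avg (C N) (\<lambda>s. real (trans_count N V W s q p)) - real (trans_count N V W id q p))"

text \<open>Summing over all coarser pairs of patterns turns exact counts into solution counts of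
  \<open>pair_system\<close>. These are \<open>N ^ comps V (q \<union> p)\<close> times a product of
  fixed fractions, and just this power of N for the identity, so the normalised sum is
  \<open>rate N * ((\<Prod>m\<in>#ms. tau N m) - 1)\<close>.\<close>

lemma sum_drift_count_convergent:
  assumes fin: "finite V" and q: "q \<subseteq> V \<times> V" "p \<subseteq> V \<times> V"
  shows "convergent (\<lambda>N. (\<Sum>(q', p')\<in>{q'\<in>patterns V. q \<subseteq> q'} \<times> {p'\<in>patterns V. p \<subseteq> p'}.
      drift_count N V W q' p') / real N ^ comps V (q \<union> p))"
proof -
  let ?I = "{q'\<in>patterns V. q \<subseteq> q'} \<times> {p'\<in>patterns V. p \<subseteq> p'}"
  let ?E = "pair_system W q p"
  have "finite q" "finite p" using q fin finite_subset by blast+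
  then have finE: "finite ?E" by (rule finite_pair_system)
  obtain ms where ms: "size ms = comps V (q \<union> p)"
    "\<And>N s. s permutes {..<N} \<Longrightarrow> card (sols N s V ?E) = (\<Prod>m\<in>#ms. fixed_count N s m)"
    using card_sols_comps[OF fin finE pair_system_wf(1)[OF q]] pair_system_wf(2)[OF q] by metis
  have "(\<Sum>(q', p')\<in>?I. drift_count N V W q' p') / real N ^ comps V (q \<union> p)
      = rate N * ((\<Prod>m\<in>#ms. tau N m) - 1)" if N: "N \<ge> 2" for N
  proof -
    have count: "real (card (sols N s V ?E)) = real N ^ comps V (q \<union> p) * (\<Prod>m\<in>#ms. fixed_fraction N s m)"
      if "s permutes {..<N}" for s
    proof -
      have "real (\<Prod>m\<in>#M. fixed_count N s m) = real N ^ size M * (\<Prod>m\<in>#M. fixed_fraction N s m)" for M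
        by (induction M) (use N in \<open>simp_all add: fixed_fraction_def field_simps\<close>)
      then show ?thesis unfolding ms(2)[OF that] ms(1)[symmetric] .
    qed
    have id: "real (card (sols N id V ?E)) = real N ^ comps V (q \<union> p)"
    proof -
      have "(\<Prod>m\<in>#M. fixed_fraction N id m) = 1" for M
        by (induction M) (use N in \<open>simp_all add: fixed_fraction_def fixed_count_id[unfolded id_def] id_def\<close>)
      then show ?thesis using count[OF permutes_id] by simp
    qed
    have "(\<Sum>(q', p')\<in>?I. drift_count N V W q' p') =
      rate N * (avg (C N) (\<lambda>s. real (\<Sum>(q', p')\<in>?I. trans_count N V W s q' p'))
        - real (\<Sum>(q', p')\<in>?I. trans_count N V W id q' p'))"
      unfolding drift_count_def of_nat_sum case_prod_beta avg_sum
      by (simp add: sum_distrib_left[symmetric] sum_subtractf)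
    also have "avg (C N) (\<lambda>s. real (\<Sum>(q', p')\<in>?I. trans_count N V W s q' p')) =
        real N ^ comps V (q \<union> p) * (\<Prod>m\<in>#ms. tau N m)"
    proof (rule avg_eqI[OF C_finite[OF N] C_nonempty[OF N]])
      fix s assume s: "s \<in> C N"
      note perm = C_permutes[OF N s]
      have "(\<Prod>m\<in>#ms. fixed_fraction N s m) = (\<Prod>m\<in>#ms. tau N m)"
        by (simp add: fixed_fraction_tau[OF N s])
      then show "real (\<Sum>(q', p')\<in>?I. trans_count N V W s q' p') =
          real N ^ comps V (q \<union> p) * (\<Prod>m\<in>#ms. tau N m)"
        using count[OF perm] card_sols_pair_system[OF fin q perm] by simp
    qed
    also have "real (\<Sum>(q', p')\<in>?I. trans_count N V W id q' p') = real N ^ comps V (q \<union> p)"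
      using id card_sols_pair_system[OF fin q permutes_id] by simp
    finally show ?thesis using N by (simp add: field_simps)
  qed
  then have "\<forall>\<^sub>F N in sequentially. rate N * ((\<Prod>m\<in>#ms. tau N m) - 1) =
      (\<Sum>(q', p')\<in>?I. drift_count N V W q' p') / real N ^ comps V (q \<union> p)"
    by (intro eventually_sequentiallyI[of 2]) simp
  then show ?thesis using prod_tau_rate[of ms] by (simp add: convergent_cong)
qed

lemma convergent_inverse_power:
  "convergent (\<lambda>N. 1 / real N ^ k)"
proof (cases "k = 0")
  case False
  then have "(\<lambda>N. 1 / real N ^ k) \<longlonglongrightarrow> 0" by real_asymp
  then show ?thesis by (rule convergentI)
qed (simp add: convergent_const)

text \<open>Moebius inversion from the coarse end: the drift of (q, p) is the sum over coarser pairs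
  minus the strictly coarser terms. The latter are known by induction, and since a coarser pair has
  no more components, dividing by the power of N that belongs to (q, p) keeps them
  convergent.\<close>

lemma drift_count_convergent:
  assumes fin: "finite V" and q: "q \<in> patterns V" "p \<in> patterns V"
  shows "convergent (\<lambda>N. drift_count N V W q p / real N ^ comps V (q \<union> p))"
  using q
proof (induction "2 * card (V \<times> V) - card q - card p" arbitrary: q p rule: less_induct)
  case less
  let ?I = "{q'\<in>patterns V. q \<subseteq> q'} \<times> {p'\<in>patterns V. p \<subseteq> p'}"
  have finI: "finite ?I" using finite_patterns[OF fin] by simp
  have mem: "(q, p) \<in> ?I" using less.prems by simp
  have sub: "q \<subseteq> V \<times> V" "p \<subseteq> V \<times> V" using less.prems patterns_subset by blast+
  have cv: "convergent (\<lambda>N. drift_count N V W q' p' / real N ^ comps V (q \<union> p))"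
    if i: "(q', p') \<in> ?I - {(q, p)}" for q' p'
  proof -
    have sub': "q' \<subseteq> V \<times> V" "p' \<subseteq> V \<times> V" using i patterns_subset by auto
    have finV: "finite (V \<times> V)" using fin by simp
    have fin': "finite q'" "finite p'" using sub' finV finite_subset by blast+
    have "card q \<le> card q'" "card p \<le> card p'" using i fin' by (auto intro: card_mono)
    moreover have "card q < card q' \<or> card p < card p'"
      using i fin' by (auto intro: psubset_card_mono)
    moreover have "card q' \<le> card (V \<times> V)" "card p' \<le> card (V \<times> V)"
      using sub' finV by (auto intro: card_mono)
    ultimately have "2 * card (V \<times> V) - card q' - card p' < 2 * card (V \<times> V) - card q - card p"
      by linarith
    then have c: "convergent (\<lambda>N. drift_count N V W q' p' / real N ^ comps V (q' \<union> p'))"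
      by (rule less.hyps) (use i in auto)
    have le: "comps V (q' \<union> p') \<le> comps V (q \<union> p)"
      by (rule comps_antimono[OF fin]) (use i sub' in auto)
    have "convergent (\<lambda>N. drift_count N V W q' p' / real N ^ comps V (q' \<union> p')
        * (1 / real N ^ (comps V (q \<union> p) - comps V (q' \<union> p'))))"
      by (rule convergent_mult[OF c convergent_inverse_power])
    then show ?thesis using le by (simp add: power_add[symmetric])
  qed
  have "convergent (\<lambda>N. \<Sum>i\<in>?I - {(q, p)}. drift_count N V W (fst i) (snd i) / real N ^ comps V (q \<union> p))"
  proof (rule convergent_sum)
    fix i assume "i \<in> ?I - {(q, p)}"
    then have "(fst i, snd i) \<in> ?I - {(q, p)}" by simp
    then show "convergent (\<lambda>N. drift_count N V W (fst i) (snd i) / real N ^ comps V (q \<union> p))"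
      by (rule cv)
  qed
  then have "convergent (\<lambda>N. (\<Sum>(q', p')\<in>?I. drift_count N V W q' p') / real N ^ comps V (q \<union> p)
      - (\<Sum>i\<in>?I - {(q, p)}. drift_count N V W (fst i) (snd i) / real N ^ comps V (q \<union> p)))"
    by (intro convergent_diff sum_drift_count_convergent[OF fin sub])
  then show ?case
    unfolding sum.remove[OF finI mem] by (simp add: case_prod_beta add_divide_distrib sum_divide_distrib)
qed

text \<open>This is why the generator preserves functions of patterns. Two labellings with the same
  pattern differ by a permutation t of the labels, conjugation by t permutes the class, and it
  carries twists of one labelling into twists of the other. So the probability of reaching p is the
  same for all labellings with pattern q.\<close>

lemma transition_probability:
  assumes N: "N \<ge> 2" and fin: "finite V" and z: "z \<in> labels N V q"
  shows "avg (C N) (\<lambda>s. of_bool (rel V (twist V W s z) = p)) * real (card (labels N V q)) =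
    avg (C N) (\<lambda>s. real (trans_count N V W s q p))"
proof -
  have exch: "avg (C N) (\<lambda>s. of_bool (rel V (twist V W s y) = p)) =
      avg (C N) (\<lambda>s. of_bool (rel V (twist V W s z) = p))" if y: "y \<in> labels N V q" for y
  proof -
    obtain t where t: "t permutes {..<N}" "\<And>v. v \<in> V \<Longrightarrow> y v = t (z v)"
      using labels_permuted[OF z y] by blast
    note tt = inv_permutes_apply[OF t(1)]
    have "bij_betw (\<lambda>s. t \<circ> s \<circ> inv_into UNIV t) (C N) (C N)"
    proof (rule bij_betw_byWitness[where f' = "\<lambda>s. inv_into UNIV t \<circ> s \<circ> t"])
      show "(\<lambda>s. inv_into UNIV t \<circ> s \<circ> t) ` C N \<subseteq> C N"
        using C_conj[OF N _ permutes_inv[OF t(1)]] permutes_inv_inv[OF t(1)] by auto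
    qed (auto simp: fun_eq_iff tt C_conj[OF N _ t(1)])
    then have "(\<Sum>s\<in>C N. of_bool (rel V (twist V W s y) = p)) =
        (\<Sum>s\<in>C N. of_bool (rel V (twist V W (t \<circ> s \<circ> inv_into UNIV t) y) = p) :: real)"
      by (rule sum.reindex_bij_betw[symmetric])
    moreover have "rel V (twist V W (t \<circ> s \<circ> inv_into UNIV t) y) = rel V (twist V W s z)" for s
    proof -
      have "twist V W (t \<circ> s \<circ> inv_into UNIV t) y v = t (twist V W s z v)" if "v \<in> V" for v
        using that by (simp add: twist_def t(2) tt)
      moreover have "t a = t b \<longleftrightarrow> a = b" for a b using tt by metis
      ultimately show ?thesis unfolding rel_def by auto
    qed
    ultimately show ?thesis unfolding avg_def by simp
  qed
  have "real (trans_count N V W s q p) = (\<Sum>y\<in>labels N V q. of_bool (rel V (twist V W s y) = p))" for s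
  proof -
    have "{y \<in> V \<rightarrow>\<^sub>E {..<N}. rel V y = q \<and> rel V (twist V W s y) = p}
        = labels N V q \<inter> {y. rel V (twist V W s y) = p}" unfolding labels_def by blast
    then show ?thesis
      unfolding trans_count_def by (subst sum_of_bool_eq) (simp_all add: finite_labels fin)
  qed
  then have "avg (C N) (\<lambda>s. real (trans_count N V W s q p)) =
      (\<Sum>y\<in>labels N V q. avg (C N) (\<lambda>s. of_bool (rel V (twist V W s y) = p)))"
    by (simp add: avg_sum)
  also have "\<dots> = (\<Sum>y\<in>labels N V q. avg (C N) (\<lambda>s. of_bool (rel V (twist V W s z) = p)))"
    by (rule sum.cong[OF refl exch])
  finally show ?thesis by (simp add: mult.commute)
qed

end

subsection \<open>The generator on functions of patterns\<close>

definition lin :: "'b set \<Rightarrow> ('b \<Rightarrow> 'b \<Rightarrow> real) \<Rightarrow> ('b \<Rightarrow> real) \<Rightarrow> 'b \<Rightarrow> real" where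
  "lin P M x q = (\<Sum>p\<in>P. M q p * x p)"

lemma convergent_eventually_eq:
  fixes f g :: "nat \<Rightarrow> 'b::topological_space"
  assumes "convergent f" "\<forall>\<^sub>F N in sequentially. f N = g N"
  shows "convergent g"
  using assms convergent_cong by blast

lemma lin_iter_convergent:
  assumes "\<And>q p. q \<in> P \<Longrightarrow> p \<in> P \<Longrightarrow> convergent (\<lambda>N. M N q p)" "\<And>p. p \<in> P \<Longrightarrow> convergent (\<lambda>N. x N p)"
    and "q \<in> P"
  shows "convergent (\<lambda>N. (lin P (M N) ^^ n) (x N) q)"
  using assms(3)
proof (induction n arbitrary: q)
  case 0
  then show ?case using assms(2) by simp
next
  case (Suc n)
  have "convergent (\<lambda>N. \<Sum>p\<in>P. M N q p * (lin P (M N) ^^ n) (x N) p)"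
    by (intro convergent_sum convergent_mult Suc assms(1))
  then show ?case unfolding funpow.simps comp_def by (simp add: lin_def)
qed

lemma lin_iter_bound:
  assumes "\<And>q p. q \<in> P \<Longrightarrow> p \<in> P \<Longrightarrow> \<bar>M q p\<bar> \<le> K" "\<And>p. p \<in> P \<Longrightarrow> \<bar>x p\<bar> \<le> B" "q \<in> P"
  shows "\<bar>(lin P M ^^ n) x q\<bar> \<le> B * (real (card P) * K) ^ n"
  using assms(3)
proof (induction n arbitrary: q)
  case 0
  then show ?case using assms(2) by simp
next
  case (Suc n)
  have K: "0 \<le> K" using assms(1)[OF Suc.prems Suc.prems] by linarith
  have "\<bar>\<Sum>p\<in>P. M q p * (lin P M ^^ n) x p\<bar> \<le> (\<Sum>p\<in>P. \<bar>M q p * (lin P M ^^ n) x p\<bar>)"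
    by (rule sum_abs)
  also have "\<dots> \<le> (\<Sum>p\<in>P. K * (B * (real (card P) * K) ^ n))"
    unfolding abs_mult using Suc K by (intro sum_mono mult_mono assms(1)) auto
  also have "\<dots> = B * (real (card P) * K) ^ Suc n" by simp
  finally show ?case unfolding funpow.simps comp_def by (simp add: lin_def)
qed

lemma convergent_family_bounded:
  fixes f :: "'b \<Rightarrow> nat \<Rightarrow> real"
  assumes "finite P" "\<And>p. p \<in> P \<Longrightarrow> convergent (f p)"
  obtains K where "K \<ge> 0" "\<And>p N. p \<in> P \<Longrightarrow> \<bar>f p N\<bar> \<le> K"
proof -
  have "\<exists>K. \<forall>N. \<bar>f p N\<bar> \<le> K" if "p \<in> P" for p
    using Bseq_iff[of "f p"] convergent_imp_Bseq[OF assms(2)[OF that]] unfolding Bseq_def real_norm_def by blast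
  then obtain k where k: "\<And>p N. p \<in> P \<Longrightarrow> \<bar>f p N\<bar> \<le> k p" by metis
  have "\<bar>f p N\<bar> \<le> (\<Sum>p\<in>P. \<bar>k p\<bar>)" if "p \<in> P" for p N
    using k[OF that, of N] member_le_sum[of p P "\<lambda>p. \<bar>k p\<bar>"] that assms(1) by fastforce
  then show ?thesis using that[of "\<Sum>p\<in>P. \<bar>k p\<bar>"] by (simp add: sum_nonneg)
qed

section \<open>Labellings by pairs (x, S x) and their coincidence patterns\<close>

definition diag :: "nat \<Rightarrow> (nat + nat) rel" where
  "diag k = {(Inl l, Inr l) |l. l \<in> {1..k}}"

definition compat :: "nat \<Rightarrow> nat \<Rightarrow> (nat \<Rightarrow> nat) \<Rightarrow> (nat + nat \<Rightarrow> nat) set" where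
  "compat N k S = {y \<in> vertices k \<rightarrow>\<^sub>E {..<N}. \<forall>l\<in>{1..k}. y (Inr l) = S (y (Inl l))}"

definition inj_count :: "nat \<Rightarrow> nat \<Rightarrow> (nat \<Rightarrow> nat) \<Rightarrow> (nat + nat) rel \<Rightarrow> nat" where
  "inj_count N k S p = card {y \<in> compat N k S. rel (vertices k) y = p}"

lemma finite_vertices: "finite (vertices k)"
  unfolding vertices_def by simp

lemma in_vertices [simp]: "Inl l \<in> vertices k \<longleftrightarrow> l \<in> {1..k}" "Inr l \<in> vertices k \<longleftrightarrow> l \<in> {1..k}"
  unfolding vertices_def by auto

lemma finite_compat: "finite (compat N k S)"
  unfolding compat_def by (simp add: finite_PiE finite_vertices)

lemma diag_subset: "diag k \<subseteq> vertices k \<times> vertices k"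
  unfolding diag_def by auto

abbreviation twist_right :: "nat \<Rightarrow> (nat \<Rightarrow> nat) \<Rightarrow> (nat + nat \<Rightarrow> nat) \<Rightarrow> nat + nat \<Rightarrow> nat" where
  "twist_right k \<equiv> twist (vertices k) (Inr ` {1..k})"

lemma twist_right_Inr: "l \<in> {1..k} \<Longrightarrow> twist_right k s y (Inr l) = s (y (Inr l))"
  unfolding twist_def by auto

lemma twist_right_Inl: "l \<in> {1..k} \<Longrightarrow> twist_right k s y (Inl l) = y (Inl l)"
  unfolding twist_def by auto

lemma twist_right_compat:
  assumes s: "s permutes {..<N}" and y: "y \<in> compat N k S"
  shows "twist_right k s y \<in> compat N k (s \<circ> S)"
proof -
  have y: "y \<in> vertices k \<rightarrow>\<^sub>E {..<N}" "\<And>l. l \<in> {1..k} \<Longrightarrow> y (Inr l) = S (y (Inl l))"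
    using y unfolding compat_def by auto
  show ?thesis
    unfolding compat_def mem_Collect_eq
  proof (intro conjI ballI)
    fix l assume l: "l \<in> {1..k}"
    show "twist_right k s y (Inr l) = (s \<circ> S) (twist_right k s y (Inl l))"
      unfolding twist_right_Inr[OF l] twist_right_Inl[OF l] y(2)[OF l] comp_def ..
  qed (rule twist_PiE[OF s y(1)])
qed

lemma twist_twist_inv:
  assumes "y \<in> V \<rightarrow>\<^sub>E A" "\<And>x. s' (s x) = x"
  shows "twist V W s' (twist V W s y) = y"
  using assms unfolding twist_def by (auto simp: fun_eq_iff PiE_iff extensional_def)

text \<open>Twisting the right ends by s is a bijection from the labellings compatible with S to
  those compatible with \<open>s \<circ> S\<close>; the twist by the inverse of s undoes it.\<close>

lemma inj_count_comp:
  assumes s: "s permutes {..<N}"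
  shows "inj_count N k (s \<circ> S) p = card {z \<in> compat N k S. rel (vertices k) (twist_right k s z) = p}"
proof -
  note ss = inv_permutes_apply[OF s]
  have eq: "inv_into UNIV s \<circ> (s \<circ> S) = S" by (simp add: fun_eq_iff ss)
  have PiE: "y \<in> vertices k \<rightarrow>\<^sub>E {..<N}" if "y \<in> compat N k S'" for y S'
    using that unfolding compat_def by blast
  have tw: "twist_right k (inv_into UNIV s) (twist_right k s y) = y" if "y \<in> compat N k S'" for y S'
    by (rule twist_twist_inv[OF PiE[OF that]], rule ss(1))
  have tw': "twist_right k s (twist_right k (inv_into UNIV s) y) = y" if "y \<in> compat N k S'" for y S'
    by (rule twist_twist_inv[OF PiE[OF that]], rule ss(2))
  have "bij_betw (twist_right k s) {z \<in> compat N k S. rel (vertices k) (twist_right k s z) = p}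
     {y \<in> compat N k (s \<circ> S). rel (vertices k) y = p}"
  proof (rule bij_betw_byWitness[where f' = "twist_right k (inv_into UNIV s)"])
    show "\<forall>a\<in>{z \<in> compat N k S. rel (vertices k) (twist_right k s z) = p}.
       twist_right k (inv_into UNIV s) (twist_right k s a) = a"
      using tw by blast
    show "\<forall>a'\<in>{y \<in> compat N k (s \<circ> S). rel (vertices k) y = p}.
       twist_right k s (twist_right k (inv_into UNIV s) a') = a'"
      using tw' by blast
    show "twist_right k s ` {z \<in> compat N k S. rel (vertices k) (twist_right k s z) = p}
       \<subseteq> {y \<in> compat N k (s \<circ> S). rel (vertices k) y = p}"
      using twist_right_compat[OF s] by blast
    show "twist_right k (inv_into UNIV s) ` {y \<in> compat N k (s \<circ> S). rel (vertices k) y = p}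
       \<subseteq> {z \<in> compat N k S. rel (vertices k) (twist_right k s z) = p}"
    proof (rule image_subsetI)
      fix y assume "y \<in> {y \<in> compat N k (s \<circ> S). rel (vertices k) y = p}"
      then have y: "y \<in> compat N k (s \<circ> S)" "rel (vertices k) y = p" by blast+
      have "twist_right k (inv_into UNIV s) y \<in> compat N k S"
        using twist_right_compat[OF permutes_inv[OF s] y(1)] unfolding eq .
      moreover have "twist_right k s (twist_right k (inv_into UNIV s) y) = y"
        by (rule tw'[OF y(1)])
      ultimately show "twist_right k (inv_into UNIV s) y
          \<in> {z \<in> compat N k S. rel (vertices k) (twist_right k s z) = p}"
        using y(2) by simp
    qed
  qed
  then show ?thesis unfolding inj_count_def by (simp add: bij_betw_same_card)
qed

text \<open>Glues k pairs (x, S x) into a closed chain, the right end of each to the left end of the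
  next and the last to the first. A compatible labelling that respects it spells out an orbit x, S
  x, ... that returns to x after k steps.\<close>

definition cycle :: "nat \<Rightarrow> (nat + nat) rel" where
  "cycle k = insert (Inr k, Inl 1) {(Inr i, Inl (Suc i)) |i. i \<in> {1..<k}}"

lemma fixed_count_compat:
  assumes S: "S permutes {..<N}" and k: "k \<ge> 1"
  shows "fixed_count N S k = card {y \<in> compat N k S. cycle k \<subseteq> rel (vertices k) y}"
proof -
  define f where "f x = restrict (\<lambda>v. case v of Inl i \<Rightarrow> (S ^^ (i - 1)) x | Inr i \<Rightarrow> (S ^^ i) x) (vertices k)"
    for x :: nat
  have cyc: "y (Inr k) = y (Inl 1)" "\<And>i. i \<in> {1..<k} \<Longrightarrow> y (Inl (Suc i)) = y (Inr i)"
    if "cycle k \<subseteq> rel (vertices k) y" for y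
    using that unfolding cycle_def rel_def by auto
  have y: "y (Inl i) = (S ^^ (i - 1)) (y (Inl 1)) \<and> y (Inr i) = (S ^^ i) (y (Inl 1))"
    if y: "y \<in> compat N k S" "cycle k \<subseteq> rel (vertices k) y" and i: "1 \<le> i" "i \<le> k" for y i
    using i
  proof (induction i rule: dec_induct)
    case base
    then show ?case using y(1) k unfolding compat_def by simp
  next
    case (step n)
    have "y (Inl (Suc n)) = y (Inr n)" using cyc(2)[OF y(2)] step by simp
    moreover have "y (Inr (Suc n)) = S (y (Inl (Suc n)))" using y(1) step unfolding compat_def by simp
    ultimately show ?case using step by simp
  qed
  have fI: "f x (Inl i) = (S ^^ (i - 1)) x" "f x (Inr i) = (S ^^ i) x" if "i \<in> {1..k}" for x i
    using that by (simp_all add: f_def)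
  have "bij_betw f {x\<in>{..<N}. (S ^^ k) x = x} {y \<in> compat N k S. cycle k \<subseteq> rel (vertices k) y}"
  proof (rule bij_betw_byWitness[where f' = "\<lambda>y. y (Inl 1)"])
    show "\<forall>a\<in>{x\<in>{..<N}. (S ^^ k) x = x}. f a (Inl 1) = a" using fI k by simp
    show "\<forall>a'\<in>{y \<in> compat N k S. cycle k \<subseteq> rel (vertices k) y}. f (a' (Inl 1)) = a'"
    proof
      fix a assume a: "a \<in> {y \<in> compat N k S. cycle k \<subseteq> rel (vertices k) y}"
      have e: "a \<in> extensional (vertices k)" using a unfolding compat_def PiE_def by blast
      show "f (a (Inl 1)) = a"
      proof
        fix v
        show "f (a (Inl 1)) v = a v"
        proof (cases "v \<in> vertices k")
          case True
          then show ?thesis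
          proof (cases v)
            case (Inl i)
            have i: "i \<in> {1..k}" using True Inl by simp
            show ?thesis using y[of a i] a i unfolding Inl fI(1)[OF i] by auto
          next
            case (Inr i)
            have i: "i \<in> {1..k}" using True Inr by simp
            show ?thesis using y[of a i] a i unfolding Inr fI(2)[OF i] by auto
          qed
        next
          case False
          then show ?thesis using e by (simp add: f_def extensional_def)
        qed
      qed
    qed
    show "f ` {x\<in>{..<N}. (S ^^ k) x = x} \<subseteq> {y \<in> compat N k S. cycle k \<subseteq> rel (vertices k) y}"
    proof (rule image_subsetI)
      fix x assume "x \<in> {x\<in>{..<N}. (S ^^ k) x = x}"
      then have x: "x < N" "(S ^^ k) x = x" by blast+
      have "f x \<in> vertices k \<rightarrow>\<^sub>E {..<N}"
        unfolding f_def using funpow_in[OF S x(1)] by (auto split: sum.split)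
      moreover have "f x (Inr l) = S (f x (Inl l))" if "l \<in> {1..k}" for l
      proof -
        have "(S ^^ l) x = S ((S ^^ (l - 1)) x)"
          using that by (cases l) simp_all
        then show ?thesis unfolding fI[OF that] .
      qed
      moreover have "f x (Inr k) = f x (Inl 1)"
      proof -
        have "f x (Inr k) = (S ^^ k) x" "f x (Inl 1) = x" using fI[of k] fI[of 1] k by simp_all
        then show ?thesis using x(2) by metis
      qed
      moreover have "f x (Inr i) = f x (Inl (Suc i))" if "i \<in> {1..<k}" for i
        using that fI by simp
      ultimately show "f x \<in> {y \<in> compat N k S. cycle k \<subseteq> rel (vertices k) y}"
        using k unfolding compat_def cycle_def rel_def by auto
    qed
    show "(\<lambda>y. y (Inl 1)) ` {y \<in> compat N k S. cycle k \<subseteq> rel (vertices k) y} \<subseteq> {x\<in>{..<N}. (S ^^ k) x = x}"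
    proof (rule image_subsetI)
      fix a assume a: "a \<in> {y \<in> compat N k S. cycle k \<subseteq> rel (vertices k) y}"
      then have "a \<in> vertices k \<rightarrow>\<^sub>E {..<N}" unfolding compat_def by blast
      then have "a (Inl 1) < N" using k by (auto simp: PiE_iff)
      moreover have "(S ^^ k) (a (Inl 1)) = a (Inl 1)" using y[of a k] cyc(1)[of a] a k by auto
      ultimately show "a (Inl 1) \<in> {x\<in>{..<N}. (S ^^ k) x = x}" by simp
    qed
  qed
  then show ?thesis unfolding fixed_count_def by (rule bij_betw_same_card)
qed

text \<open>Together with the edges in \<open>diag\<close>, the chain connects all vertices, so a
  two-colouring is determined by its value at \<open>Inl 1\<close>. Hence the weights of the
  patterns that make up a number of fixed points are at most of order N.\<close>

lemma comps_cycle: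
  assumes k: "k \<ge> 1" and p: "cycle k \<subseteq> p" "p \<subseteq> vertices k \<times> vertices k"
  shows "comps (vertices k) (p \<union> diag k) \<le> 1"
proof -
  have sub: "p \<union> diag k \<subseteq> vertices k \<times> vertices k" using p diag_subset by blast
  have "inj_on (\<lambda>c. c (Inl 1)) (cons 2 (vertices k) (p \<union> diag k))"
  proof (rule inj_onI)
    fix c c' assume c: "c \<in> cons 2 (vertices k) (p \<union> diag k)" "c' \<in> cons 2 (vertices k) (p \<union> diag k)"
      and eq: "c (Inl 1) = c' (Inl 1)"
    have const: "b (Inl i) = b (Inl 1) \<and> b (Inr i) = b (Inl 1)"
      if b: "b \<in> cons 2 (vertices k) (p \<union> diag k)" and i: "1 \<le> i" "i \<le> k" for b i
      using i
    proof (induction i rule: dec_induct)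
      case base
      have "(Inl 1, Inr 1) \<in> p \<union> diag k" using k by (simp add: diag_def)
      then have "b (Inl 1) = b (Inr 1)" using b unfolding cons_def by blast
      then show ?case by simp
    next
      case (step n)
      have "(Inl (Suc n), Inr (Suc n)) \<in> p \<union> diag k" "(Inr n, Inl (Suc n)) \<in> p \<union> diag k"
        using step p(1) by (auto simp: diag_def cycle_def)
      then have "b (Inl (Suc n)) = b (Inr (Suc n))" "b (Inr n) = b (Inl (Suc n))"
        using b unfolding cons_def by fast+
      moreover have "b (Inr n) = b (Inl 1)" using step.IH[OF Suc_leD[OF step.prems]] by (rule conjunct2)
      ultimately show ?case by metis
    qed
    show "c = c'"
    proof
      fix v
      show "c v = c' v"
      proof (cases "v \<in> vertices k")
        case True
        then obtain i where i: "1 \<le> i" "i \<le> k" and v: "v = Inl i \<or> v = Inr i" by (cases v) auto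
        have "c v = c (Inl 1)" using const[OF c(1) i] v by metis
        moreover have "c' v = c' (Inl 1)" using const[OF c(2) i] v by metis
        ultimately show ?thesis using eq by metis
      next
        case False
        then show ?thesis using c unfolding cons_def by (auto simp: PiE_iff extensional_def)
      qed
    qed
  qed
  moreover have "(\<lambda>c. c (Inl 1)) ` cons 2 (vertices k) (p \<union> diag k) \<subseteq> {..<2}"
    using k unfolding cons_def by (auto simp: PiE_iff)
  ultimately have "card (cons 2 (vertices k) (p \<union> diag k)) \<le> card {..<2 :: nat}"
    by (intro card_inj_on_le) auto
  then have "(2 :: nat) ^ comps (vertices k) (p \<union> diag k) \<le> 2 ^ 1"
    by (simp add: card_cons[OF finite_vertices sub])
  then show ?thesis by (rule power_le_imp_le_exp[rotated]) simp
qed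

lemma fixed_count_patterns:
  assumes S: "S permutes {..<N}" and k: "k \<ge> 1"
  shows "fixed_count N S k = (\<Sum>p\<in>{p\<in>patterns (vertices k). cycle k \<subseteq> p}. inj_count N k S p)"
proof -
  have "{y \<in> compat N k S. cycle k \<subseteq> rel (vertices k) y} =
     (\<Union>p\<in>{p\<in>patterns (vertices k). cycle k \<subseteq> p}. {y \<in> compat N k S. rel (vertices k) y = p})"
    using rel_patterns unfolding compat_def by blast
  then show ?thesis unfolding fixed_count_compat[OF assms] inj_count_def
    by (simp only:, subst card_UN_disjoint) (auto simp: finite_patterns finite_vertices finite_compat)
qed

lemma inj_count_id:
  "inj_count N k id p = (if diag k \<subseteq> p then card (labels N (vertices k) p) else 0)"
proof -
  have d: "diag k \<subseteq> rel (vertices k) y \<longleftrightarrow> (\<forall>l\<in>{1..k}. y (Inl l) = y (Inr l))" for y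
    unfolding diag_def rel_def by fastforce
  have c: "y \<in> compat N k id \<longleftrightarrow> y \<in> vertices k \<rightarrow>\<^sub>E {..<N} \<and> diag k \<subseteq> rel (vertices k) y" for y
    unfolding compat_def d by auto
  have "{y \<in> compat N k id. rel (vertices k) y = p} = (if diag k \<subseteq> p then labels N (vertices k) p else {})"
    unfolding c labels_def by auto
  then show ?thesis unfolding inj_count_def by simp
qed

section \<open>The generator in the basis of normalised pattern counts\<close>

context class_sequence
begin

text \<open>The transition operator of the discrete walk that multiplies from the left by a uniform
  element of the class.\<close>

definition Qop :: "nat \<Rightarrow> ((nat \<Rightarrow> nat) \<Rightarrow> real) \<Rightarrow> (nat \<Rightarrow> nat) \<Rightarrow> real" where
  "Qop N f S = avg (C N) (\<lambda>s. f (s \<circ> S))"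

definition gen :: "nat \<Rightarrow> ((nat \<Rightarrow> nat) \<Rightarrow> real) \<Rightarrow> (nat \<Rightarrow> nat) \<Rightarrow> real" where
  "gen N f S = rate N * (Qop N f S - f S)"

abbreviation drift :: "nat \<Rightarrow> nat \<Rightarrow> (nat + nat) rel \<Rightarrow> (nat + nat) rel \<Rightarrow> real" where
  "drift N k \<equiv> drift_count N (vertices k) (Inr ` {1..k})"

text \<open>The number of labellings that are constant along p and compatible with S = id, since
  \<open>diag k\<close> expresses S = id. Measured against it, both the values of the counts at the
  identity and the matrix of the generator have limits.\<close>

definition weight :: "nat \<Rightarrow> nat \<Rightarrow> (nat + nat) rel \<Rightarrow> real" where
  "weight N k p = real N ^ comps (vertices k) (p \<union> diag k)"

text \<open>The matrix of the generator on the functions \<open>inj_count / weight\<close>, acting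
  on coefficient vectors. Dividing by the number of labellings with pattern q turns counts of
  transitions into probabilities, by \<open>transition_probability\<close>.\<close>

definition drift_matrix :: "nat \<Rightarrow> nat \<Rightarrow> (nat + nat) rel \<Rightarrow> (nat + nat) rel \<Rightarrow> real" where
  "drift_matrix N k q p = drift N k q p / real (card (labels N (vertices k) q)) * weight N k q / weight N k p"

definition pattern_function :: "nat \<Rightarrow> nat \<Rightarrow> ((nat + nat) rel \<Rightarrow> real) \<Rightarrow> (nat \<Rightarrow> nat) \<Rightarrow> real" where
  "pattern_function N k x S = (\<Sum>p\<in>patterns (vertices k). x p * real (inj_count N k S p) / weight N k p)"

text \<open>Counting powers of N, the entry has order
  \<open>e q + comps (q \<union> p) - comps q - e p\<close>, where \<open>e p\<close> stands for the
  number of components of \<open>p \<union> diag k\<close>. This exponent is at most 0: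
  submodularity for \<open>q \<union> diag k\<close> and \<open>q \<union> p\<close>, which share q,
  bounds the first two terms by \<open>comps q\<close> plus the components of the union, and the
  union contains \<open>p \<union> diag k\<close>.\<close>

lemma drift_matrix_convergent:
  assumes q: "q \<in> patterns (vertices k)" "p \<in> patterns (vertices k)"
  shows "convergent (\<lambda>N. drift_matrix N k q p)"
proof -
  let ?V = "vertices k"
  let ?e = "\<lambda>p. comps ?V (p \<union> diag k)"
  have sub: "q \<subseteq> ?V \<times> ?V" "p \<subseteq> ?V \<times> ?V" using q patterns_subset by blast+
  have "comps ?V (q \<union> diag k) + comps ?V (q \<union> p) \<le> comps ?V q + comps ?V (q \<union> diag k \<union> (q \<union> p))"
    by (rule comps_submodular[OF finite_vertices]) (use sub diag_subset in auto)
  also have "comps ?V (q \<union> diag k \<union> (q \<union> p)) \<le> ?e p"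
    by (rule comps_antimono[OF finite_vertices]) (use sub diag_subset in auto)
  finally have le: "?e q + comps ?V (q \<union> p) \<le> comps ?V q + ?e p" by simp
  have lim: "convergent (\<lambda>N. real N ^ comps ?V q / real (card (labels N ?V q)))"
    using tendsto_inverse[OF labels_asymp[OF finite_vertices q(1)]] by (intro convergentI) (simp add: field_simps)
  have "convergent (\<lambda>N. drift N k q p / real N ^ comps ?V (q \<union> p)
      * (real N ^ comps ?V q / real (card (labels N ?V q)))
      * (1 / real N ^ (comps ?V q + ?e p - (?e q + comps ?V (q \<union> p)))))"
    by (intro convergent_mult drift_count_convergent[OF finite_vertices q] lim convergent_inverse_power)
  moreover have "\<forall>\<^sub>F N in sequentially. drift N k q p / real N ^ comps ?V (q \<union> p)
      * (real N ^ comps ?V q / real (card (labels N ?V q)))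
      * (1 / real N ^ (comps ?V q + ?e p - (?e q + comps ?V (q \<union> p)))) = drift_matrix N k q p"
  proof (rule eventually_sequentiallyI[of 1])
    fix N :: nat assume N: "1 \<le> N"
    have pw: "real N ^ (comps ?V q + ?e p - (?e q + comps ?V (q \<union> p))) =
        real N ^ comps ?V q * real N ^ ?e p / (real N ^ ?e q * real N ^ comps ?V (q \<union> p))"
      using N le by (simp add: power_diff power_add)
    show "drift N k q p / real N ^ comps ?V (q \<union> p)
      * (real N ^ comps ?V q / real (card (labels N ?V q)))
      * (1 / real N ^ (comps ?V q + ?e p - (?e q + comps ?V (q \<union> p)))) = drift_matrix N k q p"
      using N unfolding pw drift_matrix_def weight_def by (simp add: field_simps)
  qed
  ultimately show ?thesis by (rule convergent_eventually_eq)
qed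

lemma Qop_inj_count:
  assumes N: "N \<ge> 2"
  shows "Qop N (\<lambda>S. real (inj_count N k S p)) S =
    (\<Sum>q\<in>patterns (vertices k). real (inj_count N k S q) *
      (avg (C N) (\<lambda>s. real (trans_count N (vertices k) (Inr ` {1..k}) s q p)) / real (card (labels N (vertices k) q))))"
proof -
  let ?V = "vertices k" and ?W = "Inr ` {1..k} :: (nat + nat) set"
  have split: "real (inj_count N k (s \<circ> S) p) = (\<Sum>q\<in>patterns ?V. \<Sum>z\<in>{z \<in> compat N k S. rel ?V z = q}.
      of_bool (rel ?V (twist_right k s z) = p))" if s: "s \<in> C N" for s
  proof -
    have "real (inj_count N k (s \<circ> S) p) = (\<Sum>z\<in>compat N k S. of_bool (rel ?V (twist_right k s z) = p))"
      unfolding inj_count_comp[OF C_permutes[OF N s]]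
      by (subst sum_of_bool_eq) (simp_all add: finite_compat Int_def)
    also have "\<dots> = (\<Sum>q\<in>patterns ?V. \<Sum>z\<in>{z \<in> compat N k S. rel ?V z = q}.
      of_bool (rel ?V (twist_right k s z) = p))"
    proof (rule sum.group[symmetric])
      show "rel ?V ` compat N k S \<subseteq> patterns ?V" using rel_patterns unfolding compat_def by blast
    qed (simp_all add: finite_compat finite_patterns finite_vertices)
    finally show ?thesis .
  qed
  have "Qop N (\<lambda>S. real (inj_count N k S p)) S = avg (C N) (\<lambda>s. \<Sum>q\<in>patterns ?V.
     \<Sum>z\<in>{z \<in> compat N k S. rel ?V z = q}. of_bool (rel ?V (twist_right k s z) = p))"
    unfolding Qop_def by (rule avg_cong[OF split])
  also have "\<dots> = (\<Sum>q\<in>patterns ?V. \<Sum>z\<in>{z \<in> compat N k S. rel ?V z = q}.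
     avg (C N) (\<lambda>s. of_bool (rel ?V (twist_right k s z) = p)))"
    by (simp only: avg_sum)
  also have "\<dots> = (\<Sum>q\<in>patterns ?V. \<Sum>z\<in>{z \<in> compat N k S. rel ?V z = q}.
     avg (C N) (\<lambda>s. real (trans_count N ?V ?W s q p)) / real (card (labels N ?V q)))"
  proof (intro sum.cong refl)
    fix q z assume "z \<in> {z \<in> compat N k S. rel ?V z = q}"
    then have z: "z \<in> labels N ?V q" unfolding compat_def labels_def by blast
    then have "card (labels N ?V q) \<noteq> 0" by (auto simp: finite_labels finite_vertices)
    then show "avg (C N) (\<lambda>s. of_bool (rel ?V (twist_right k s z) = p)) =
        avg (C N) (\<lambda>s. real (trans_count N ?V ?W s q p)) / real (card (labels N ?V q))"
      using transition_probability[OF N finite_vertices z, of ?W p] by (simp add: field_simps)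
  qed
  finally show ?thesis unfolding inj_count_def by simp
qed

lemma gen_inj_count:
  assumes N: "N \<ge> 2" and p: "p \<in> patterns (vertices k)"
  shows "gen N (\<lambda>S. real (inj_count N k S p)) S =
    (\<Sum>q\<in>patterns (vertices k). real (inj_count N k S q) * (drift N k q p / real (card (labels N (vertices k) q))))"
proof -
  let ?V = "vertices k" and ?W = "Inr ` {1..k} :: (nat + nat) set"
  \<comment> \<open>Without a jump patterns do not change, so subtracting the count for
    \<open>id\<close> in the drift subtracts the identity operator.\<close>
  have tid: "trans_count N ?V ?W id q p = (if q = p then card (labels N ?V q) else 0)" for q
  proof -
    have "{y \<in> ?V \<rightarrow>\<^sub>E {..<N}. rel ?V y = q \<and> rel ?V (twist ?V ?W id y) = p} =
        {y \<in> ?V \<rightarrow>\<^sub>E {..<N}. rel ?V y = q \<and> rel ?V y = p}"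
      by (intro Collect_cong conj_cong refl) (simp add: twist_id[unfolded id_def] id_def)
    moreover have "card {y \<in> ?V \<rightarrow>\<^sub>E {..<N}. rel ?V y = q \<and> rel ?V y = p} =
        (if q = p then card (labels N ?V q) else 0)"
    proof (cases "q = p")
      case False
      then have "{y \<in> ?V \<rightarrow>\<^sub>E {..<N}. rel ?V y = q \<and> rel ?V y = p} = {}" by blast
      then show ?thesis using False by (simp only: card.empty if_False)
    qed (simp add: labels_def)
    ultimately show ?thesis unfolding trans_count_def by (simp only:)
  qed
  have "real (inj_count N k S p) = (\<Sum>q\<in>patterns ?V. real (inj_count N k S q) *
      (real (trans_count N ?V ?W id q p) / real (card (labels N ?V q))))"
  proof -
    \<comment> \<open>If no labelling has pattern q for this N, the quotient is 0 by the convention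
      for division by 0; the identity survives because \<open>inj_count\<close> vanishes as
      well.\<close>
    have "inj_count N k S q = 0" if "card (labels N ?V q) = 0" for q
    proof -
      have "labels N ?V q = {}" using that by (simp add: finite_labels finite_vertices)
      then have "{y \<in> compat N k S. rel ?V y = q} = {}" unfolding labels_def compat_def by blast
      then show ?thesis unfolding inj_count_def by (simp only: card.empty)
    qed
    then have "real (inj_count N k S q) * (real (trans_count N ?V ?W id q p) / real (card (labels N ?V q)))
      = (if q = p then real (inj_count N k S q) else 0)" for q
      unfolding tid by auto
    then show ?thesis using p by (simp add: finite_patterns finite_vertices)
  qed
  then show ?thesis
    unfolding gen_def Qop_inj_count[OF N] drift_count_def
    by (simp add: sum_subtractf[symmetric] sum_distrib_left diff_divide_distrib algebra_simps)
qed

lemma gen_sum: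
  "gen N (\<lambda>S. \<Sum>i\<in>I. c i * f i S) S = (\<Sum>i\<in>I. c i * gen N (f i) S)"
  unfolding gen_def Qop_def avg_sum avg_cmult
  by (simp add: sum_subtractf[symmetric] sum_distrib_left algebra_simps)

lemma Qop_gen: "N \<ge> 2 \<Longrightarrow> Qop N f S = f S + gen N f S / rate N"
  unfolding gen_def using rate_pos[of N] by simp

lemma gen_pattern_function:
  assumes N: "N \<ge> 2"
  shows "gen N (pattern_function N k x) S =
    pattern_function N k (lin (patterns (vertices k)) (drift_matrix N k) x) S"
proof -
  let ?P = "patterns (vertices k)"
  have w: "weight N k p > 0" for p using N unfolding weight_def by simp
  have "gen N (pattern_function N k x) S = gen N (\<lambda>S. \<Sum>p\<in>?P. (x p / weight N k p) * real (inj_count N k S p)) S"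
    unfolding pattern_function_def[abs_def] by simp
  also have "\<dots> = (\<Sum>p\<in>?P. x p / weight N k p * gen N (\<lambda>S. real (inj_count N k S p)) S)"
    by (rule gen_sum)
  also have "\<dots> = (\<Sum>p\<in>?P. \<Sum>q\<in>?P. drift_matrix N k q p * x p * real (inj_count N k S q) / weight N k q)"
  proof (rule sum.cong[OF refl])
    fix p assume p: "p \<in> ?P"
    show "x p / weight N k p * gen N (\<lambda>S. real (inj_count N k S p)) S =
        (\<Sum>q\<in>?P. drift_matrix N k q p * x p * real (inj_count N k S q) / weight N k q)"
      unfolding gen_inj_count[OF N p] sum_distrib_left drift_matrix_def
      by (rule sum.cong[OF refl]) (use w in \<open>simp add: less_imp_neq[OF w, symmetric] ac_simps\<close>)
  qed
  also have "\<dots> = pattern_function N k (lin ?P (drift_matrix N k) x) S"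
    unfolding pattern_function_def lin_def
    by (subst sum.swap) (simp add: sum_distrib_right sum_divide_distrib)
  finally show ?thesis .
qed

text \<open>\<open>Qop\<close> is the identity plus the generator divided by the rate, and 1 / rate
  tends to \<alpha>. So its matrix converges too, to the identity when \<alpha> = 0.\<close>

lemma Qop_pattern_function:
  assumes N: "N \<ge> 2"
  shows "Qop N (pattern_function N k x) S =
    pattern_function N k (lin (patterns (vertices k)) (\<lambda>q p. of_bool (q = p) + drift_matrix N k q p * (1 / rate N)) x) S"
proof -
  let ?P = "patterns (vertices k)"
  have "lin ?P (\<lambda>q p. of_bool (q = p) + drift_matrix N k q p * (1 / rate N)) x q =
     x q + lin ?P (drift_matrix N k) x q / rate N" if "q \<in> ?P" for q
  proof -
    have "(\<Sum>p\<in>?P. of_bool (q = p) * x p) = x q"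
      using that by (simp add: finite_patterns finite_vertices of_bool_def if_distrib[of "\<lambda>c. c * _"] cong: if_cong)
    then show ?thesis
      unfolding lin_def by (simp add: distrib_right sum.distrib sum_divide_distrib)
  qed
  then have "pattern_function N k (lin ?P (\<lambda>q p. of_bool (q = p) + drift_matrix N k q p * (1 / rate N)) x) S =
     pattern_function N k x S + pattern_function N k (lin ?P (drift_matrix N k) x) S / rate N"
    unfolding pattern_function_def
    by (simp add: distrib_right sum.distrib add_divide_distrib sum_divide_distrib mult.commute[of "rate N"])
  then show ?thesis unfolding Qop_gen[OF N] gen_pattern_function[OF N] by simp
qed

lemma Qop_cong:
  assumes "N \<ge> 2" "S permutes {..<N}" "\<And>S. S permutes {..<N} \<Longrightarrow> f S = g S"
  shows "Qop N f S = Qop N g S"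
  unfolding Qop_def by (rule avg_cong) (use assms C_permutes permutes_compose in blast)

lemma gen_cong:
  assumes "N \<ge> 2" "S permutes {..<N}" "\<And>S. S permutes {..<N} \<Longrightarrow> f S = g S"
  shows "gen N f S = gen N g S"
  unfolding gen_def using Qop_cong[OF assms] assms(3)[OF assms(2)] by simp

text \<open>The coordinates of the fixed fraction of \<open>S ^^ k\<close> in the basis
  \<open>inj_count / weight\<close>: the patterns that contain the cycle, with the factor 1 / N.
  They converge because such a pattern has weight of order at most N.\<close>

definition cycle_vector :: "nat \<Rightarrow> nat \<Rightarrow> (nat + nat) rel \<Rightarrow> real" where
  "cycle_vector N k p = (if cycle k \<subseteq> p then weight N k p / real N else 0)"

lemma fixed_fraction_pattern_function:
  assumes "N \<ge> 2" "S permutes {..<N}" "k \<ge> 1"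
  shows "fixed_fraction N S k = pattern_function N k (cycle_vector N k) S"
proof -
  have w: "weight N k p \<noteq> 0" for p using assms(1) unfolding weight_def by simp
  have "pattern_function N k (cycle_vector N k) S =
     (\<Sum>p\<in>patterns (vertices k). if cycle k \<subseteq> p then real (inj_count N k S p) / real N else 0)"
    unfolding pattern_function_def cycle_vector_def by (rule sum.cong[OF refl]) (simp add: w)
  also have "\<dots> = (\<Sum>p\<in>{p\<in>patterns (vertices k). cycle k \<subseteq> p}. real (inj_count N k S p) / real N)"
    by (rule sum.inter_filter[symmetric]) (simp add: finite_patterns finite_vertices)
  finally show ?thesis
    unfolding fixed_fraction_def fixed_count_patterns[OF assms(2,3)] by (simp add: sum_divide_distrib)
qed

lemma cycle_vector_convergent:
  assumes k: "k \<ge> 1" and p: "p \<in> patterns (vertices k)"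
  shows "convergent (\<lambda>N. cycle_vector N k p)"
proof (cases "cycle k \<subseteq> p")
  case True
  let ?e = "comps (vertices k) (p \<union> diag k)"
  have "?e \<le> 1" by (rule comps_cycle[OF k True patterns_subset[OF p]])
  then consider "?e = 0" | "?e = 1" by linarith
  then show ?thesis
  proof cases
    case 1
    then show ?thesis using True convergentI[OF lim_1_over_n] by (simp add: cycle_vector_def weight_def)
  next
    case 2
    have "convergent (\<lambda>N. real N / real N)"
      by (rule convergentI[where L = 1]) real_asymp
    then show ?thesis using True 2 by (simp add: cycle_vector_def weight_def)
  qed
qed (simp add: cycle_vector_def convergent_const)

lemma inj_count_id_convergent:
  assumes p: "p \<in> patterns (vertices k)"
  shows "convergent (\<lambda>N. real (inj_count N k id p) / weight N k p)"
proof (cases "diag k \<subseteq> p")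
  case True
  then have "p \<union> diag k = p" by blast
  then show ?thesis
    using True convergentI[OF labels_asymp[OF finite_vertices p]] unfolding inj_count_id weight_def by simp
qed (simp add: inj_count_id convergent_const)

lemma pattern_function_id_convergent:
  assumes "\<And>p. p \<in> patterns (vertices k) \<Longrightarrow> convergent (\<lambda>N. x N p)"
  shows "convergent (\<lambda>N. pattern_function N k (x N) id)"
proof -
  have "convergent (\<lambda>N. \<Sum>p\<in>patterns (vertices k). x N p * (real (inj_count N k id p) / weight N k p))"
    by (intro convergent_sum convergent_mult assms inj_count_id_convergent)
  then show ?thesis unfolding pattern_function_def by simp
qed

lemma gen_iter_pattern_function:
  assumes N: "N \<ge> 2" and S: "S permutes {..<N}" and k: "k \<ge> 1"
  shows "(gen N ^^ n) (\<lambda>S. fixed_fraction N S k) S =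
    pattern_function N k ((lin (patterns (vertices k)) (drift_matrix N k) ^^ n) (cycle_vector N k)) S"
  using S
proof (induction n arbitrary: S)
  case 0
  then show ?case using fixed_fraction_pattern_function[OF N _ k] by simp
next
  case (Suc n)
  show ?case unfolding funpow.simps comp_def
    by (rule trans[OF gen_cong[OF N Suc.prems] gen_pattern_function[OF N]]) (rule Suc.IH)
qed

lemma Qop_iter_pattern_function:
  assumes N: "N \<ge> 2" and S: "S permutes {..<N}" and k: "k \<ge> 1"
  shows "(Qop N ^^ n) (\<lambda>S. fixed_fraction N S k) S =
    pattern_function N k ((lin (patterns (vertices k))
      (\<lambda>q p. of_bool (q = p) + drift_matrix N k q p * (1 / rate N)) ^^ n) (cycle_vector N k)) S"
  using S
proof (induction n arbitrary: S)
  case 0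
  then show ?case using fixed_fraction_pattern_function[OF N _ k] by simp
next
  case (Suc n)
  show ?case unfolding funpow.simps comp_def
    by (rule trans[OF Qop_cong[OF N Suc.prems] Qop_pattern_function[OF N]]) (rule Suc.IH)
qed

lemma gen_iter_convergent:
  assumes k: "k \<ge> 1"
  shows "convergent (\<lambda>N. (gen N ^^ n) (\<lambda>S. fixed_fraction N S k) id)"
proof -
  have "convergent (\<lambda>N. pattern_function N k
      ((lin (patterns (vertices k)) (drift_matrix N k) ^^ n) (cycle_vector N k)) id)"
    by (intro pattern_function_id_convergent lin_iter_convergent drift_matrix_convergent
        cycle_vector_convergent[OF k])
  moreover have "\<forall>\<^sub>F N in sequentially. pattern_function N k
      ((lin (patterns (vertices k)) (drift_matrix N k) ^^ n) (cycle_vector N k)) id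
      = (gen N ^^ n) (\<lambda>S. fixed_fraction N S k) id"
    by (rule eventually_sequentiallyI[of 2]) (rule gen_iter_pattern_function[OF _ permutes_id k, symmetric])
  ultimately show ?thesis by (rule convergent_eventually_eq)
qed

lemma Qop_iter_convergent:
  assumes k: "k \<ge> 1"
  shows "convergent (\<lambda>N. (Qop N ^^ n) (\<lambda>S. fixed_fraction N S k) id)"
proof -
  have "convergent (\<lambda>N. pattern_function N k ((lin (patterns (vertices k))
      (\<lambda>q p. of_bool (q = p) + drift_matrix N k q p * (1 / rate N)) ^^ n) (cycle_vector N k)) id)"
    by (intro pattern_function_id_convergent lin_iter_convergent convergent_add convergent_mult
        convergent_const convergentI[OF inverse_rate] drift_matrix_convergent cycle_vector_convergent[OF k])
  moreover have "\<forall>\<^sub>F N in sequentially. pattern_function N k ((lin (patterns (vertices k))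
      (\<lambda>q p. of_bool (q = p) + drift_matrix N k q p * (1 / rate N)) ^^ n) (cycle_vector N k)) id
      = (Qop N ^^ n) (\<lambda>S. fixed_fraction N S k) id"
    by (rule eventually_sequentiallyI[of 2]) (rule Qop_iter_pattern_function[OF _ permutes_id k, symmetric])
  ultimately show ?thesis by (rule convergent_eventually_eq)
qed

text \<open>Uniformity in N is the point: the obvious bound for the n-th iterate is a power of the
  rate, which may diverge. The converging matrix entries give a geometric bound with a fixed ratio
  instead, as needed to exchange the limit with the exponential series.\<close>

lemma gen_iter_bound:
  assumes k: "k \<ge> 1"
  obtains B K where "\<And>N n. N \<ge> 2 \<Longrightarrow> \<bar>(gen N ^^ n) (\<lambda>S. fixed_fraction N S k) id\<bar> \<le> B * K ^ n"
proof -
  let ?P = "patterns (vertices k)"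
  have fin: "finite ?P" by (simp add: finite_patterns finite_vertices)
  obtain K where K: "K \<ge> 0" "\<And>i N. i \<in> ?P \<times> ?P \<Longrightarrow> \<bar>drift_matrix N k (fst i) (snd i)\<bar> \<le> K"
    by (rule convergent_family_bounded[of "?P \<times> ?P" "\<lambda>i N. drift_matrix N k (fst i) (snd i)"])
      (use fin drift_matrix_convergent in auto)
  have KK: "\<bar>drift_matrix N k q p\<bar> \<le> K" if "q \<in> ?P" "p \<in> ?P" for q p N
    using K(2)[of "(q, p)" N] that by simp
  obtain X where X: "X \<ge> 0" "\<And>p N. p \<in> ?P \<Longrightarrow> \<bar>cycle_vector N k p\<bar> \<le> X"
    by (rule convergent_family_bounded[of ?P "\<lambda>p N. cycle_vector N k p"])
      (use fin cycle_vector_convergent[OF k] in auto)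
  obtain J where J: "J \<ge> 0" "\<And>p N. p \<in> ?P \<Longrightarrow> \<bar>real (inj_count N k id p) / weight N k p\<bar> \<le> J"
    by (rule convergent_family_bounded[of ?P "\<lambda>p N. real (inj_count N k id p) / weight N k p"])
      (use fin inj_count_id_convergent in auto)
  have "\<bar>(gen N ^^ n) (\<lambda>S. fixed_fraction N S k) id\<bar> \<le> (real (card ?P) * X * J) * (real (card ?P) * K) ^ n"
    if N: "N \<ge> 2" for N n
  proof -
    let ?x = "(lin ?P (drift_matrix N k) ^^ n) (cycle_vector N k)"
    have "\<bar>pattern_function N k ?x id\<bar> \<le> (\<Sum>p\<in>?P. \<bar>?x p * (real (inj_count N k id p) / weight N k p)\<bar>)"
      unfolding pattern_function_def times_divide_eq_right[symmetric] by (rule sum_abs)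
    also have "\<dots> \<le> (\<Sum>p\<in>?P. (X * (real (card ?P) * K) ^ n) * J)"
    proof (rule sum_mono)
      fix p assume p: "p \<in> ?P"
      have "\<bar>?x p\<bar> \<le> X * (real (card ?P) * K) ^ n"
        by (rule lin_iter_bound[OF KK X(2) p])
      then show "\<bar>?x p * (real (inj_count N k id p) / weight N k p)\<bar> \<le> (X * (real (card ?P) * K) ^ n) * J"
        unfolding abs_mult[of "?x p"] by (rule mult_mono[OF _ J(2)[OF p]]) (use K(1) X(1) in simp_all)
    qed
    finally show ?thesis unfolding gen_iter_pattern_function[OF N permutes_id k] by (simp add: ac_simps)
  qed
  then show ?thesis by (rule that)
qed

end

subsection \<open>Concentration of the number of fixed points\<close>

text \<open>If \<open>S ^^ m\<close> fixes x and \<open>S' ^^ m\<close> does not, the orbit of x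
  under S meets, during its first m steps, a point where the two maps differ. Each time i
  contributes at most the number of such points, as \<open>S ^^ i\<close> is injective.\<close>

lemma fixed_set_diff:
  fixes N :: nat
  assumes S: "S permutes {..<N}"
  shows "card ({x\<in>{..<N}. (S ^^ m) x = x} - {x\<in>{..<N}. (S' ^^ m) x = x})
    \<le> m * card {x\<in>{..<N}. S x \<noteq> S' x}"
proof -
  let ?D = "{x\<in>{..<N}. S x \<noteq> S' x}"
  have "{x\<in>{..<N}. (S ^^ m) x = x} - {x\<in>{..<N}. (S' ^^ m) x = x}
      \<subseteq> (\<Union>i<m. {x\<in>{..<N}. (S ^^ i) x \<in> ?D})" (is "_ \<subseteq> ?U")
  proof
    fix x assume x: "x \<in> {x\<in>{..<N}. (S ^^ m) x = x} - {x\<in>{..<N}. (S' ^^ m) x = x}"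
    show "x \<in> ?U"
    proof (rule ccontr)
      assume not: "x \<notin> ?U"
      have "(S' ^^ j) x = (S ^^ j) x" if "j \<le> m" for j
        using that
      proof (induction j)
        case (Suc j)
        have "(S ^^ j) x \<notin> ?D" using not x Suc.prems by auto
        then have "S ((S ^^ j) x) = S' ((S ^^ j) x)" using funpow_in[OF S] x by auto
        moreover have "(S' ^^ j) x = (S ^^ j) x" using Suc by simp
        ultimately show ?case by simp
      qed simp
      from this[OF le_refl] show False using x by auto
    qed
  qed
  then have "card ({x\<in>{..<N}. (S ^^ m) x = x} - {x\<in>{..<N}. (S' ^^ m) x = x}) \<le> card ?U"
    by (intro card_mono) auto
  also have "\<dots> \<le> (\<Sum>i<m. card {x\<in>{..<N}. (S ^^ i) x \<in> ?D})" by (rule card_UN_le) simp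
  also have "\<dots> \<le> (\<Sum>i<m. card ?D)"
  proof (rule sum_mono)
    fix i
    have "inj_on (S ^^ i) {x\<in>{..<N}. (S ^^ i) x \<in> ?D}"
      using permutes_inj[OF funpow_permutes[OF S]] by (rule inj_on_subset) simp
    then show "card {x\<in>{..<N}. (S ^^ i) x \<in> ?D} \<le> card ?D" by (rule card_inj_on_le) auto
  qed
  finally show ?thesis by simp
qed

lemma fixed_count_lipschitz:
  assumes S: "S permutes {..<N}" and S': "S' permutes {..<N}"
  shows "\<bar>real (fixed_count N S m) - real (fixed_count N S' m)\<bar> \<le> real m * real (card {x\<in>{..<N}. S x \<noteq> S' x})"
proof -
  let ?F = "\<lambda>S. {x\<in>{..<N}. (S ^^ m) x = x}"
  have le: "card (?F S) \<le> card (?F S') + card (?F S - ?F S')" for S S'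
  proof -
    have "card (?F S) \<le> card (?F S' \<union> (?F S - ?F S'))" by (intro card_mono) auto
    also have "\<dots> \<le> card (?F S') + card (?F S - ?F S')" by (rule card_Un_le)
    finally show ?thesis .
  qed
  have sym: "{x\<in>{..<N}. S' x \<noteq> S x} = {x\<in>{..<N}. S x \<noteq> S' x}" by auto
  have "card (?F S) \<le> card (?F S') + m * card {x\<in>{..<N}. S x \<noteq> S' x}"
    using le[of S S'] fixed_set_diff[OF S, of m S'] by linarith
  moreover have "card (?F S') \<le> card (?F S) + m * card {x\<in>{..<N}. S x \<noteq> S' x}"
    using le[of S' S] fixed_set_diff[OF S', of m S] unfolding sym by linarith
  ultimately show ?thesis
    unfolding fixed_count_def of_nat_mult[symmetric] abs_le_iff by linarith
qed

text \<open>The factor u is inserted at an arbitrary place of a product, not only at its end. This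
  makes the property stable under \<open>Qop\<close>, whose additional left factor is absorbed in
  a.\<close>

definition insertion_lipschitz :: "nat \<Rightarrow> (nat \<Rightarrow> nat) set \<Rightarrow> real \<Rightarrow> ((nat \<Rightarrow> nat) \<Rightarrow> real) \<Rightarrow> bool" where
  "insertion_lipschitz N U \<delta> f \<longleftrightarrow> (\<forall>a b u. a permutes {..<N} \<longrightarrow> b permutes {..<N} \<longrightarrow> u \<in> U \<longrightarrow>
     \<bar>f (a \<circ> u \<circ> b) - f (a \<circ> b)\<bar> \<le> \<delta>)"

lemma insertion_lipschitz_fixed_fraction:
  assumes "\<And>u. u \<in> U \<Longrightarrow> u permutes {..<N}" "\<And>u. u \<in> U \<Longrightarrow> card {x\<in>{..<N}. u x \<noteq> x} \<le> c"
  shows "insertion_lipschitz N U (real m * real c / real N) (\<lambda>S. fixed_fraction N S m)"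
  unfolding insertion_lipschitz_def
proof (intro allI impI)
  fix a b u assume a: "a permutes {..<N}" and b: "b permutes {..<N}" and u: "u \<in> U"
  have perm: "a \<circ> u \<circ> b permutes {..<N}" "a \<circ> b permutes {..<N}"
    using a b assms(1)[OF u] by (auto intro!: permutes_compose)
  have "inj_on b {x\<in>{..<N}. (a \<circ> u \<circ> b) x \<noteq> (a \<circ> b) x}"
    using permutes_inj[OF b] by (rule inj_on_subset) simp
  moreover have "b ` {x\<in>{..<N}. (a \<circ> u \<circ> b) x \<noteq> (a \<circ> b) x} \<subseteq> {x\<in>{..<N}. u x \<noteq> x}"
  proof (rule image_subsetI)
    fix x assume "x \<in> {x\<in>{..<N}. (a \<circ> u \<circ> b) x \<noteq> (a \<circ> b) x}"
    then have "x \<in> {..<N}" "u (b x) \<noteq> b x" by (simp_all only: mem_Collect_eq comp_def) metis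
    then show "b x \<in> {x\<in>{..<N}. u x \<noteq> x}" using permutes_in_image[OF b, of x] by blast
  qed
  moreover have "finite {x\<in>{..<N}. u x \<noteq> x}" by simp
  ultimately have "card {x\<in>{..<N}. (a \<circ> u \<circ> b) x \<noteq> (a \<circ> b) x} \<le> card {x\<in>{..<N}. u x \<noteq> x}"
    by (rule card_inj_on_le)
  with assms(2)[OF u] have "card {x\<in>{..<N}. (a \<circ> u \<circ> b) x \<noteq> (a \<circ> b) x} \<le> c"
    by (rule le_trans[rotated])
  then have "real m * real (card {x\<in>{..<N}. (a \<circ> u \<circ> b) x \<noteq> (a \<circ> b) x}) \<le> real m * real c"
    by (intro mult_left_mono) auto
  then have "\<bar>real (fixed_count N (a \<circ> u \<circ> b) m) - real (fixed_count N (a \<circ> b) m)\<bar> \<le> real m * real c"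
    using fixed_count_lipschitz[OF perm, of m] by linarith
  then show "\<bar>fixed_fraction N (a \<circ> u \<circ> b) m - fixed_fraction N (a \<circ> b) m\<bar> \<le> real m * real c / real N"
    unfolding fixed_fraction_def diff_divide_distrib[symmetric] abs_divide
    by (simp add: divide_right_mono)
qed

lemma avg_abs_le:
  assumes "finite A" "A \<noteq> {}" "\<And>a. a \<in> A \<Longrightarrow> \<bar>f a\<bar> \<le> c"
  shows "\<bar>avg A f\<bar> \<le> c"
proof -
  have "avg A f \<le> avg A (\<lambda>_. c)" "avg A (\<lambda>_. - c) \<le> avg A f"
    by (intro avg_mono; use assms(3) in fastforce)+
  then show ?thesis using avg_const[OF assms(1,2)] by (simp add: abs_le_iff)
qed

lemma avg_diff: "avg A (\<lambda>a. f a - g a) = avg A f - avg A g"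
  by (simp add: avg_def sum_subtractf diff_divide_distrib)

lemma avg_variance_le:
  assumes "finite A" "A \<noteq> {}" "\<And>a. a \<in> A \<Longrightarrow> \<bar>f a - c\<bar> \<le> \<delta>"
  shows "avg A (\<lambda>a. (f a)\<^sup>2) - (avg A f)\<^sup>2 \<le> \<delta>\<^sup>2"
proof -
  have "avg A (\<lambda>a. (f a - c)\<^sup>2) = avg A (\<lambda>a. (f a)\<^sup>2 + (- 2 * c) * f a + c\<^sup>2)"
    by (simp add: power2_diff algebra_simps)
  also have "\<dots> = avg A (\<lambda>a. (f a)\<^sup>2) + (- 2 * c) * avg A f + c\<^sup>2"
    by (simp only: avg_add avg_cmult avg_const[OF assms(1,2)])
  finally have eq: "avg A (\<lambda>a. (f a)\<^sup>2) - (avg A f)\<^sup>2 = avg A (\<lambda>a. (f a - c)\<^sup>2) - (avg A f - c)\<^sup>2"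
    by (simp add: power2_diff)
  have "(f a - c)\<^sup>2 \<le> \<delta>\<^sup>2" if "a \<in> A" for a
  proof -
    have "\<bar>f a - c\<bar>\<^sup>2 \<le> \<delta>\<^sup>2" using assms(3)[OF that] by (intro power_mono) auto
    then show ?thesis by simp
  qed
  then have "avg A (\<lambda>a. (f a - c)\<^sup>2) \<le> avg A (\<lambda>_. \<delta>\<^sup>2)" by (rule avg_mono)
  moreover have "0 \<le> (avg A f - c)\<^sup>2" by simp
  ultimately show ?thesis unfolding eq avg_const[OF assms(1,2)] by linarith
qed

section \<open>Variance of functions of a uniform random permutation\<close>

lemma transpose_conj:
  "Transposition.transpose a b \<circ> Transposition.transpose c d = Transposition.transpose (Transposition.transpose a b c) (Transposition.transpose a b d) \<circ> Transposition.transpose a b"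
  by (auto simp: fun_eq_iff Transposition.transpose_def)

lemma avg_permutes_insert:
  assumes "finite A" "a \<notin> A"
  shows "avg {p. p permutes insert a A} F =
    avg {p. p permutes A} (\<lambda>q. avg (insert a A) (\<lambda>b. F (Transposition.transpose a b \<circ> q)))"
proof -
  have "card {p. p permutes insert a A} = card (insert a A) * card {p. p permutes A}"
    using assms by (simp add: card_permutations[OF refl])
  moreover have "(\<Sum>p\<in>{p. p permutes insert a A}. F p) =
      (\<Sum>q\<in>{p. p permutes A}. \<Sum>b\<in>insert a A. F (Transposition.transpose a b \<circ> q))"
    by (subst sum_over_permutations_insert[OF assms]) (rule sum.swap)
  ultimately show ?thesis
    unfolding avg_def by (simp add: sum_divide_distrib[symmetric] divide_divide_eq_left)
qed

text \<open>A martingale argument that exposes one point at a time. A permutation of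
  \<open>insert a A\<close> is a transposition of a with a uniform b, composed with a permutation q
  of A. Given q, all values over b lie within \<delta> of \<open>F q\<close>, so the conditional
  variance is at most \<delta> squared; the conditional mean G inherits the hypothesis, and the
  induction bounds its variance.\<close>

lemma permutations_variance_le:
  fixes F :: "('b \<Rightarrow> 'b) \<Rightarrow> real"
  assumes "finite A"
    and "\<And>p a b. p permutes A \<Longrightarrow> a \<in> A \<Longrightarrow> b \<in> A \<Longrightarrow> \<bar>F (Transposition.transpose a b \<circ> p) - F p\<bar> \<le> \<delta>"
  shows "avg {p. p permutes A} (\<lambda>p. (F p)\<^sup>2) - (avg {p. p permutes A} F)\<^sup>2 \<le> real (card A) * \<delta>\<^sup>2"
  using assms
proof (induction A arbitrary: F)
  case empty
  then show ?case by (simp add: avg_def)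
next
  case (insert a A)
  let ?I = "insert a A"
  define G where "G q = avg ?I (\<lambda>b. F (Transposition.transpose a b \<circ> q))" for q
  have fin: "finite ?I" "?I \<noteq> {}" using insert.hyps by auto
  have perm: "{p. p permutes A} \<noteq> {}" "finite {p. p permutes A}"
    using permutes_id[of A] finite_permutations[OF insert.hyps(1)] by blast+
  have lip: "\<bar>F (Transposition.transpose c b \<circ> q) - F q\<bar> \<le> \<delta>" if "q permutes A" "c \<in> ?I" "b \<in> ?I" for q b c
    by (rule insert.prems[OF permutes_subset[OF that(1) subset_insertI] that(2,3)])
  have var: "avg ?I (\<lambda>b. (F (Transposition.transpose a b \<circ> q))\<^sup>2) \<le> (G q)\<^sup>2 + \<delta>\<^sup>2" if "q permutes A" for q
    using avg_variance_le[OF fin, of "\<lambda>b. F (Transposition.transpose a b \<circ> q)" "F q" \<delta>] lip[OF that] G_def by force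
  have IH: "avg {p. p permutes A} (\<lambda>p. (G p)\<^sup>2) - (avg {p. p permutes A} G)\<^sup>2 \<le> real (card A) * \<delta>\<^sup>2"
  proof (rule insert.IH)
    fix p c e assume p: "p permutes A" and c: "c \<in> A" "e \<in> A"
    have Gd: "G (Transposition.transpose c e \<circ> p) - G p = avg ?I (\<lambda>b. F (Transposition.transpose a b \<circ> (Transposition.transpose c e \<circ> p)) - F (Transposition.transpose a b \<circ> p))"
      unfolding G_def avg_diff ..
    \<comment> \<open>Commuting the two transpositions turns the inner one into a transposition of
      possibly different points of \<open>insert a A\<close>, now at the left end where the
      hypothesis applies.\<close>
    have Fd: "\<bar>F (Transposition.transpose a b \<circ> (Transposition.transpose c e \<circ> p)) - F (Transposition.transpose a b \<circ> p)\<bar> \<le> \<delta>" if b: "b \<in> ?I" for b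
    proof -
      have "Transposition.transpose a b \<circ> (Transposition.transpose c e \<circ> p) =
          Transposition.transpose (Transposition.transpose a b c) (Transposition.transpose a b e) \<circ> (Transposition.transpose a b \<circ> p)"
        using transpose_conj[of a b c e] by (simp add: o_assoc)
      moreover have "Transposition.transpose a b \<circ> p permutes ?I"
        using p b permutes_subset[OF p, of ?I] permutes_swap_id[of a ?I b] by (auto intro!: permutes_compose)
      moreover have "Transposition.transpose a b c \<in> ?I" "Transposition.transpose a b e \<in> ?I"
        using b c by (auto simp: Transposition.transpose_def)
      ultimately show ?thesis by (simp only: insert.prems)
    qed
    show "\<bar>G (Transposition.transpose c e \<circ> p) - G p\<bar> \<le> \<delta>"
      unfolding Gd by (rule avg_abs_le[OF fin Fd])
  qed
  have "avg {p. p permutes ?I} (\<lambda>p. (F p)\<^sup>2) =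
      avg {p. p permutes A} (\<lambda>q. avg ?I (\<lambda>b. (F (Transposition.transpose a b \<circ> q))\<^sup>2))"
    by (rule avg_permutes_insert[OF insert.hyps])
  also have "\<dots> \<le> avg {p. p permutes A} (\<lambda>q. (G q)\<^sup>2 + \<delta>\<^sup>2)" by (rule avg_mono) (use var in blast)
  also have "\<dots> = avg {p. p permutes A} (\<lambda>q. (G q)\<^sup>2) + \<delta>\<^sup>2" by (simp only: avg_add avg_const[OF perm(2,1)])
  finally have "avg {p. p permutes ?I} (\<lambda>p. (F p)\<^sup>2) \<le> avg {p. p permutes A} (\<lambda>q. (G q)\<^sup>2) + \<delta>\<^sup>2" .
  moreover have "avg {p. p permutes ?I} F = avg {p. p permutes A} G"
    unfolding G_def by (rule avg_permutes_insert[OF insert.hyps])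
  moreover have "real (card ?I) * \<delta>\<^sup>2 = real (card A) * \<delta>\<^sup>2 + \<delta>\<^sup>2" using insert.hyps by (simp add: algebra_simps)
  ultimately show ?case using IH by simp
qed

definition transpositions :: "nat \<Rightarrow> (nat \<Rightarrow> nat) set" where
  "transpositions N = {Transposition.transpose a b |a b. a < N \<and> b < N}"

lemma transpositions_permute:
  assumes "u \<in> transpositions N"
  shows "u permutes {..<N}"
proof -
  obtain a b where "u = Transposition.transpose a b" "a < N" "b < N"
    using assms unfolding transpositions_def by blast
  then show ?thesis using permutes_swap_id[of a "{..<N}" b] by simp
qed

lemma transpositions_support:
  assumes "u \<in> transpositions N"
  shows "card {x\<in>{..<N}. u x \<noteq> x} \<le> 2"
proof -
  obtain a b where u: "u = Transposition.transpose a b" using assms unfolding transpositions_def by blast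
  have "card {x\<in>{..<N}. u x \<noteq> x} \<le> card {a, b}"
    unfolding u by (intro card_mono) (auto simp: Transposition.transpose_def split: if_splits)
  also have "\<dots> \<le> 2" by (simp add: card_insert_if)
  finally show ?thesis .
qed

section \<open>Variance along iterates of the transition operator\<close>

context class_sequence
begin

lemma avg_class_conj:
  assumes N: "N \<ge> 2" and t: "t permutes {..<N}"
  shows "avg (C N) (\<lambda>s. h (t \<circ> s \<circ> inv_into UNIV t)) = avg (C N) h"
proof -
  note tt = inv_permutes_apply[OF t]
  have "bij_betw (\<lambda>s. t \<circ> s \<circ> inv_into UNIV t) (C N) (C N)"
  proof (rule bij_betw_byWitness[where f' = "\<lambda>s. inv_into UNIV t \<circ> s \<circ> t"])
    show "(\<lambda>s. inv_into UNIV t \<circ> s \<circ> t) ` C N \<subseteq> C N"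
      using C_conj[OF N _ permutes_inv[OF t]] permutes_inv_inv[OF t] by auto
  qed (auto simp: fun_eq_iff tt C_conj[OF N _ t])
  then have "(\<Sum>s\<in>C N. h (t \<circ> s \<circ> inv_into UNIV t)) = sum h (C N)" by (rule sum.reindex_bij_betw)
  then show ?thesis unfolding avg_def by (simp only:)
qed

text \<open>A uniform element of the class is the conjugate of a fixed one by a uniform permutation.
  Conjugation by t permutes the class, so averaging additionally over t changes nothing; after
  exchanging the averages the inner one does not depend on the representative.\<close>

lemma avg_class_uniform:
  assumes N: "N \<ge> 2" and s: "s \<in> C N"
  shows "avg (C N) h = avg {t. t permutes {..<N}} (\<lambda>t. h (t \<circ> s \<circ> inv_into UNIV t))"
proof -
  let ?P = "{t. t permutes {..<N}}"
  have P: "finite ?P" "?P \<noteq> {}" using finite_permutations[of "{..<N}"] permutes_id by blast+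
  have const: "avg ?P (\<lambda>t. h (t \<circ> s' \<circ> inv_into UNIV t)) = avg ?P (\<lambda>t. h (t \<circ> s \<circ> inv_into UNIV t))"
    if s': "s' \<in> C N" for s'
  proof -
    obtain r where r: "r permutes {..<N}" "s' = r \<circ> s \<circ> inv_into UNIV r" using C_conjugate[OF N s s'] by blast
    note rr = inv_permutes_apply[OF r(1)]
    have "bij_betw (\<lambda>t. t \<circ> r) ?P ?P"
      by (rule bij_betw_byWitness[where f' = "\<lambda>t. t \<circ> inv_into UNIV r"])
        (auto simp: fun_eq_iff rr intro!: permutes_compose r(1) permutes_inv)
    then have "(\<Sum>t\<in>?P. h (t \<circ> s \<circ> inv_into UNIV t)) =
        (\<Sum>t\<in>?P. h ((t \<circ> r) \<circ> s \<circ> inv_into UNIV (t \<circ> r)))"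
      by (rule sum.reindex_bij_betw[symmetric])
    also have "\<dots> = (\<Sum>t\<in>?P. h (t \<circ> s' \<circ> inv_into UNIV t))"
    proof (rule sum.cong[OF refl])
      fix t assume "t \<in> ?P"
      then have "inv_into UNIV (t \<circ> r) = inv_into UNIV r \<circ> inv_into UNIV t"
        using o_inv_distrib[OF permutes_bij permutes_bij[OF r(1)]] by blast
      then show "h ((t \<circ> r) \<circ> s \<circ> inv_into UNIV (t \<circ> r)) = h (t \<circ> s' \<circ> inv_into UNIV t)"
        unfolding r(2) by (simp add: o_assoc)
    qed
    finally show ?thesis unfolding avg_def by simp
  qed
  have "avg (C N) h = avg ?P (\<lambda>t. avg (C N) (\<lambda>s. h (t \<circ> s \<circ> inv_into UNIV t)))"
    by (rule avg_eqI[OF P, symmetric]) (use avg_class_conj[OF N] in auto)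
  also have "\<dots> = avg (C N) (\<lambda>s'. avg ?P (\<lambda>t. h (t \<circ> s' \<circ> inv_into UNIV t)))"
    unfolding avg_def by (subst sum_divide_distrib[symmetric], subst sum_divide_distrib[symmetric],
      subst sum.swap) simp
  also have "\<dots> = avg ?P (\<lambda>t. h (t \<circ> s \<circ> inv_into UNIV t))"
    by (rule avg_eqI[OF C_finite[OF N] C_nonempty[OF N] const])
  finally show ?thesis .
qed

lemma insertion_lipschitz_Qop:
  assumes N: "N \<ge> 2" and f: "insertion_lipschitz N U \<delta> f"
  shows "insertion_lipschitz N U \<delta> (Qop N f)"
  unfolding insertion_lipschitz_def
proof (intro allI impI)
  fix a b u assume ab: "a permutes {..<N}" "b permutes {..<N}" and u: "u \<in> U"
  have eq: "Qop N f (a \<circ> u \<circ> b) - Qop N f (a \<circ> b) = avg (C N) (\<lambda>s. f (s \<circ> a \<circ> u \<circ> b) - f (s \<circ> a \<circ> b))"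
    unfolding Qop_def avg_diff by (simp add: o_assoc)
  have le: "\<bar>f (s \<circ> a \<circ> u \<circ> b) - f (s \<circ> a \<circ> b)\<bar> \<le> \<delta>" if "s \<in> C N" for s
    using f permutes_compose[OF ab(1) C_permutes[OF N that]] ab u unfolding insertion_lipschitz_def by blast
  show "\<bar>Qop N f (a \<circ> u \<circ> b) - Qop N f (a \<circ> b)\<bar> \<le> \<delta>"
    unfolding eq by (rule avg_abs_le[OF C_finite[OF N] C_nonempty[OF N] le])
qed

lemma insertion_lipschitz_Qop_iter:
  "N \<ge> 2 \<Longrightarrow> insertion_lipschitz N U \<delta> f \<Longrightarrow> insertion_lipschitz N U \<delta> ((Qop N ^^ n) f)"
  by (induction n) (simp_all add: insertion_lipschitz_Qop)

lemma Qop_mono: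
  assumes "N \<ge> 2" "S permutes {..<N}" "\<And>S. S permutes {..<N} \<Longrightarrow> f S \<le> g S"
  shows "Qop N f S \<le> Qop N g S"
  unfolding Qop_def by (rule avg_mono) (use assms C_permutes permutes_compose in blast)

lemma Qop_add_const:
  assumes "N \<ge> 2"
  shows "Qop N (\<lambda>S. f S + c) S = Qop N f S + c"
  unfolding Qop_def using C_finite[OF assms] C_nonempty[OF assms] by (simp add: avg_add avg_const)

text \<open>The law of total variance: the variance after n + 1 steps is the mean variance of the
  last n steps plus the variance, over the first step, of the conditional mean.\<close>

lemma Qop_iter_variance:
  assumes N: "N \<ge> 2" and S: "S permutes {..<N}"
    and step: "\<And>n S. S permutes {..<N} \<Longrightarrow>
      Qop N (\<lambda>S. ((Qop N ^^ n) f S)\<^sup>2) S - (Qop N ((Qop N ^^ n) f) S)\<^sup>2 \<le> v"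
  shows "(Qop N ^^ n) (\<lambda>S. (f S)\<^sup>2) S - ((Qop N ^^ n) f S)\<^sup>2 \<le> real n * v"
  using S
proof (induction n arbitrary: S)
  case (Suc n)
  have "Qop N ((Qop N ^^ n) (\<lambda>S. (f S)\<^sup>2)) S \<le> Qop N (\<lambda>S. ((Qop N ^^ n) f S)\<^sup>2 + real n * v) S"
    by (rule Qop_mono[OF N Suc.prems]) (use Suc.IH in fastforce)
  also have "\<dots> = Qop N (\<lambda>S. ((Qop N ^^ n) f S)\<^sup>2) S + real n * v" by (rule Qop_add_const[OF N])
  also have "\<dots> \<le> (Qop N ((Qop N ^^ n) f) S)\<^sup>2 + v + real n * v" using step[OF Suc.prems, of n] by simp
  finally show ?case by (simp add: algebra_simps)
qed simp

lemma insertion_lipschitz_class: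
  assumes N: "N \<ge> 2"
  shows "insertion_lipschitz N (C N) (real m * real (d N) / real N) (\<lambda>S. fixed_fraction N S m)"
  by (rule insertion_lipschitz_fixed_fraction) (use C_permutes[OF N] d_support[OF N] in auto)

text \<open>Bounds how much the mean depends on the number of steps; needed because in continuous
  time that number is random.\<close>

lemma Qop_iter_step:
  assumes N: "N \<ge> 2" and S: "S permutes {..<N}"
  shows "\<bar>(Qop N ^^ Suc n) (\<lambda>S. fixed_fraction N S m) S - (Qop N ^^ n) (\<lambda>S. fixed_fraction N S m) S\<bar>
    \<le> real m * real (d N) / real N"
proof -
  let ?g = "(Qop N ^^ n) (\<lambda>S. fixed_fraction N S m)"
  have "insertion_lipschitz N (C N) (real m * real (d N) / real N) ?g"
    by (rule insertion_lipschitz_Qop_iter[OF N insertion_lipschitz_class[OF N]])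
  then have "\<bar>?g (id \<circ> s \<circ> S) - ?g (id \<circ> S)\<bar> \<le> real m * real (d N) / real N" if "s \<in> C N" for s
    unfolding insertion_lipschitz_def using permutes_id S that by blast
  then have "\<bar>avg (C N) (\<lambda>s. ?g (s \<circ> S) - ?g S)\<bar> \<le> real m * real (d N) / real N"
    by (intro avg_abs_le[OF C_finite[OF N] C_nonempty[OF N]]) simp
  moreover have "(Qop N ^^ Suc n) (\<lambda>S. fixed_fraction N S m) S = avg (C N) (\<lambda>s. ?g (s \<circ> S))"
    by (simp only: funpow.simps comp_apply Qop_def[of N ?g])
  ultimately show ?thesis
    unfolding avg_diff avg_const[OF C_finite[OF N] C_nonempty[OF N]] by (simp only:)
qed

lemma Qop_iter_variance_small_class:
  assumes N: "N \<ge> 2" and S: "S permutes {..<N}"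
  shows "(Qop N ^^ n) (\<lambda>S. (fixed_fraction N S m)\<^sup>2) S - ((Qop N ^^ n) (\<lambda>S. fixed_fraction N S m) S)\<^sup>2
    \<le> real n * (real m * real (d N) / real N)\<^sup>2"
proof (rule Qop_iter_variance[OF N S])
  fix n S assume S: "S permutes {..<N}"
  let ?g = "(Qop N ^^ n) (\<lambda>S. fixed_fraction N S m)"
  have "insertion_lipschitz N (C N) (real m * real (d N) / real N) ?g"
    by (rule insertion_lipschitz_Qop_iter[OF N insertion_lipschitz_class[OF N]])
  then have "\<bar>?g (id \<circ> s \<circ> S) - ?g (id \<circ> S)\<bar> \<le> real m * real (d N) / real N" if "s \<in> C N" for s
    unfolding insertion_lipschitz_def using permutes_id S that by blast
  then show "Qop N (\<lambda>S. (?g S)\<^sup>2) S - (Qop N ?g S)\<^sup>2 \<le> (real m * real (d N) / real N)\<^sup>2"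
    unfolding Qop_def[of N "\<lambda>S. (?g S)\<^sup>2"] Qop_def[of N ?g]
    by (intro avg_variance_le[OF C_finite[OF N] C_nonempty[OF N], where c = "?g S"]) simp
qed

text \<open>The class element is the conjugate of s by a uniform permutation p. Composing p with a
  transposition inserts this transposition at two places of the product, and each insertion changes
  the function by at most 2 m / N since at most two points are moved. With Lipschitz constant 4 m /
  N, \<open>permutations_variance_le\<close> on N points gives 16 m^2 / N per step, whatever the
  number of points that the class moves.\<close>

lemma Qop_iter_variance_uniform:
  assumes N: "N \<ge> 2" and S: "S permutes {..<N}"
  shows "(Qop N ^^ n) (\<lambda>S. (fixed_fraction N S m)\<^sup>2) S - ((Qop N ^^ n) (\<lambda>S. fixed_fraction N S m) S)\<^sup>2
    \<le> real n * (16 * (real m)\<^sup>2 / real N)"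
proof (rule Qop_iter_variance[OF N S])
  fix n S assume S: "S permutes {..<N}"
  let ?g = "(Qop N ^^ n) (\<lambda>S. fixed_fraction N S m)"
  let ?\<delta> = "real m * real 2 / real N"
  have "insertion_lipschitz N (transpositions N) ?\<delta> (\<lambda>S. fixed_fraction N S m)"
    by (rule insertion_lipschitz_fixed_fraction) (use transpositions_permute transpositions_support in auto)
  then have lip: "insertion_lipschitz N (transpositions N) ?\<delta> ?g"
    by (rule insertion_lipschitz_Qop_iter[OF N])
  obtain s where s: "s \<in> C N" using C_nonempty[OF N] by blast
  note sp = C_permutes[OF N s]
  have "avg {t. t permutes {..<N}} (\<lambda>t. (?g (t \<circ> s \<circ> inv_into UNIV t \<circ> S))\<^sup>2)
      - (avg {t. t permutes {..<N}} (\<lambda>t. ?g (t \<circ> s \<circ> inv_into UNIV t \<circ> S)))\<^sup>2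
    \<le> real (card {..<N}) * (2 * ?\<delta>)\<^sup>2"
  proof (rule permutations_variance_le)
    fix p a b assume p: "p permutes {..<N}" and ab: "a \<in> {..<N}" "b \<in> {..<N}"
    let ?t = "Transposition.transpose a b" and ?x = "p \<circ> s \<circ> inv_into UNIV p"
    have t: "?t \<in> transpositions N" using ab unfolding transpositions_def by blast
    have "inv_into UNIV (?t \<circ> p) = inv_into UNIV p \<circ> ?t"
      using o_inv_distrib[OF bij_transpose permutes_bij[OF p], of a b] by simp
    then have eq: "(?t \<circ> p) \<circ> s \<circ> inv_into UNIV (?t \<circ> p) \<circ> S = id \<circ> ?t \<circ> (?x \<circ> ?t \<circ> S)"
      by (simp add: o_assoc)
    have x: "?x permutes {..<N}"
      using p sp permutes_inv[OF p] by (auto intro!: permutes_compose)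
    have y: "?x \<circ> ?t \<circ> S permutes {..<N}"
      using x transpositions_permute[OF t] S by (auto intro!: permutes_compose)
    have "\<bar>?g (id \<circ> ?t \<circ> (?x \<circ> ?t \<circ> S)) - ?g (id \<circ> (?x \<circ> ?t \<circ> S))\<bar> \<le> ?\<delta>"
      using lip permutes_id y t unfolding insertion_lipschitz_def by blast
    moreover have "\<bar>?g (?x \<circ> ?t \<circ> S) - ?g (?x \<circ> S)\<bar> \<le> ?\<delta>"
      using lip x S t unfolding insertion_lipschitz_def by blast
    ultimately show "\<bar>?g ((?t \<circ> p) \<circ> s \<circ> inv_into UNIV (?t \<circ> p) \<circ> S) - ?g (?x \<circ> S)\<bar> \<le> 2 * ?\<delta>"
      unfolding eq id_comp by linarith
  qed simp
  then have "Qop N (\<lambda>S. (?g S)\<^sup>2) S - (Qop N ?g S)\<^sup>2 \<le> real (card {..<N}) * (2 * ?\<delta>)\<^sup>2"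
    unfolding Qop_def[of N "\<lambda>S. (?g S)\<^sup>2"] Qop_def[of N ?g]
      avg_class_uniform[OF N s, of "\<lambda>s. (?g (s \<circ> S))\<^sup>2"] avg_class_uniform[OF N s, of "\<lambda>s. ?g (s \<circ> S)"] .
  also have "\<dots> = 16 * (real m)\<^sup>2 / real N" using N by (simp add: power2_eq_square field_simps)
  finally show "Qop N (\<lambda>S. (?g S)\<^sup>2) S - (Qop N ?g S)\<^sup>2 \<le> 16 * (real m)\<^sup>2 / real N" .
qed

end

subsection \<open>The transition semigroup as a power series\<close>

text \<open>The derivatives grow at most geometrically, so the Taylor remainder, of size K^(n+1)
  t^(n+1) / n! up to a constant, tends to 0. Derivatives are taken relative to the closed interval,
  hence one-sided at its ends.\<close>

lemma taylor_sums:
  fixes g :: "nat \<Rightarrow> real \<Rightarrow> real"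
  assumes t: "t \<ge> 0"
    and deriv: "\<And>n s. 0 \<le> s \<Longrightarrow> s \<le> t \<Longrightarrow> (g n has_real_derivative g (Suc n) s) (at s within {0..t})"
    and bound: "\<And>n s. 0 \<le> s \<Longrightarrow> s \<le> t \<Longrightarrow> \<bar>g n s\<bar> \<le> B * K ^ n"
  shows "(\<lambda>n. g n 0 * t ^ n / fact n) sums g 0 t"
proof -
  have rem: "norm (g 0 t - (\<Sum>i\<le>n. g i 0 * (t - 0) ^ i / fact i)) \<le> B * K ^ Suc n * norm (t - 0) ^ Suc n / fact n" for n
    by (rule field_Taylor[where S = "{0..t}"]) (use t deriv bound[of _ "Suc n"] in auto)
  have "(\<lambda>n. (B * K * t) * (inverse (fact n) * (K * t) ^ n)) \<longlonglongrightarrow> (B * K * t) * 0"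
    using summable_LIMSEQ_zero[OF summable_exp[of "K * t"]] by (intro tendsto_intros)
  then have "(\<lambda>n. B * K ^ Suc n * norm (t - 0) ^ Suc n / fact n) \<longlonglongrightarrow> 0"
    using t by (simp add: field_simps power_mult_distrib)
  then have "(\<lambda>n. g 0 t - (\<Sum>i\<le>n. g i 0 * (t - 0) ^ i / fact i)) \<longlonglongrightarrow> 0"
    by (rule Lim_null_comparison[rotated]) (use rem in \<open>auto intro!: always_eventually\<close>)
  then have "(\<lambda>n. g 0 t - (g 0 t - (\<Sum>i\<le>n. g i 0 * (t - 0) ^ i / fact i))) \<longlonglongrightarrow> g 0 t - 0"
    by (intro tendsto_intros)
  then show ?thesis unfolding sums_def_le by simp
qed

locale finite_semigroup =
  fixes E :: "'s set" and P :: "real \<Rightarrow> 's \<Rightarrow> 's pmf" and H :: "('s \<Rightarrow> real) \<Rightarrow> 's \<Rightarrow> real"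
  assumes finite_E: "finite E" and semigroup: "transition_semigroup E P" and generator: "has_generator E P H"
begin

definition ev :: "real \<Rightarrow> ('s \<Rightarrow> real) \<Rightarrow> 's \<Rightarrow> real" where
  "ev t f x = measure_pmf.expectation (P t x) f"

lemma supp: "t \<ge> 0 \<Longrightarrow> x \<in> E \<Longrightarrow> set_pmf (P t x) \<subseteq> E"
  and P_zero: "x \<in> E \<Longrightarrow> P 0 x = return_pmf x"
  and P_add: "s \<ge> 0 \<Longrightarrow> t \<ge> 0 \<Longrightarrow> x \<in> E \<Longrightarrow> P (s + t) x = bind_pmf (P s x) (P t)"
  using semigroup unfolding transition_semigroup_def by blast+

lemma ev_sum: "t \<ge> 0 \<Longrightarrow> x \<in> E \<Longrightarrow> ev t f x = (\<Sum>y\<in>E. pmf (P t x) y * f y)"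
  unfolding ev_def using supp
  by (subst integral_measure_pmf_real[OF finite_E, of _ f]) (auto simp: mult.commute)

lemma ev_zero: "x \<in> E \<Longrightarrow> ev 0 f x = f x"
  unfolding ev_def by (simp add: P_zero)

lemma ev_add:
  assumes "s \<ge> 0" "t \<ge> 0" "x \<in> E"
  shows "ev (s + t) f x = ev s (ev t f) x"
proof -
  have "ev (s + t) f x = measure_pmf.expectation (bind_pmf (P s x) (P t)) f"
    unfolding ev_def P_add[OF assms] ..
  also have "\<dots> = (\<Sum>y\<in>E. pmf (P s x) y *\<^sub>R measure_pmf.expectation (P t y) f)"
    by (rule pmf_expectation_bind[OF finite_E])
      (use supp assms finite_subset[OF supp finite_E] in auto)
  finally show ?thesis unfolding ev_sum[OF assms(1,3)] by (simp add: ev_def)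
qed

lemma ev_bound:
  assumes "t \<ge> 0" "x \<in> E" "\<And>y. y \<in> E \<Longrightarrow> \<bar>f y\<bar> \<le> B"
  shows "\<bar>ev t f x\<bar> \<le> B"
proof -
  have one: "(\<Sum>y\<in>E. pmf (P t x) y) = 1"
    by (intro sum_pmf_eq_1 finite_E supp assms)
  have "\<bar>ev t f x\<bar> \<le> (\<Sum>y\<in>E. \<bar>pmf (P t x) y * f y\<bar>)"
    unfolding ev_sum[OF assms(1,2)] by (rule sum_abs)
  also have "\<dots> \<le> (\<Sum>y\<in>E. pmf (P t x) y * B)"
    unfolding abs_mult by (intro sum_mono mult_mono) (use assms(3) in auto)
  also have "\<dots> = B" using one by (simp add: sum_distrib_right[symmetric])
  finally show ?thesis .
qed

lemma generator_limit: "x \<in> E \<Longrightarrow> ((\<lambda>h. (ev h f x - f x) / h) \<longlongrightarrow> H f x) (at_right 0)"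
  using generator unfolding has_generator_def ev_def by blast

lemma ev_limit_zero:
  assumes "x \<in> E"
  shows "((\<lambda>h. ev h f x - f x) \<longlongrightarrow> 0) (at_right 0)"
proof -
  have "((\<lambda>h. (ev h f x - f x) / h * h) \<longlongrightarrow> H f x * 0) (at_right 0)"
    by (intro tendsto_intros generator_limit assms)
  moreover have "\<forall>\<^sub>F h in at_right 0. (ev h f x - f x) / h * h = ev h f x - f x"
    unfolding eventually_at_filter by (rule always_eventually) simp
  ultimately show ?thesis using tendsto_cong by fastforce
qed

text \<open>The generator controls times near 0 only, and only from the right. Left continuity at t
  follows from \<open>ev t f = ev (t - h) (ev h f)\<close>: averaging under \<open>P (t - h)\<close>
  is a contraction, and \<open>ev h f\<close> tends to f on the finite set E.\<close>

lemma ev_left_limit: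
  assumes t: "t > 0" and x: "x \<in> E"
  shows "((\<lambda>h. ev (t - h) f x) \<longlongrightarrow> ev t f x) (at_right 0)"
proof -
  have "((\<lambda>h. \<Sum>y\<in>E. \<bar>ev h f y - f y\<bar>) \<longlongrightarrow> (\<Sum>y\<in>E. \<bar>0\<bar>)) (at_right 0)"
    by (intro tendsto_sum tendsto_rabs ev_limit_zero)
  then have lim: "((\<lambda>h. \<Sum>y\<in>E. \<bar>ev h f y - f y\<bar>) \<longlongrightarrow> 0) (at_right 0)" by simp
  have "\<forall>\<^sub>F h in at_right 0. h \<in> {0<..<t}"
    by (rule eventually_at_right_real[OF t])
  then have "\<forall>\<^sub>F h in at_right 0. norm (ev (t - h) f x - ev t f x) \<le> (\<Sum>y\<in>E. \<bar>ev h f y - f y\<bar>)"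
  proof eventually_elim
    case (elim h)
    then have h: "t - h \<ge> 0" "h \<ge> 0" by auto
    have "ev t f x = ev (t - h) (ev h f) x" using ev_add[OF h x, of f] by simp
    then have "ev (t - h) f x - ev t f x = (\<Sum>y\<in>E. pmf (P (t - h) x) y * (f y - ev h f y))"
      unfolding ev_sum[OF h(1) x] by (simp add: right_diff_distrib sum_subtractf)
    then have "norm (ev (t - h) f x - ev t f x) \<le> (\<Sum>y\<in>E. \<bar>pmf (P (t - h) x) y * (f y - ev h f y)\<bar>)"
      by (simp only: real_norm_def sum_abs)
    also have "\<dots> \<le> (\<Sum>y\<in>E. 1 * \<bar>ev h f y - f y\<bar>)"
      unfolding abs_mult by (intro sum_mono mult_mono) (auto simp: pmf_le_1)
    finally show ?case by simp
  qed
  then have "((\<lambda>h. ev (t - h) f x - ev t f x) \<longlongrightarrow> 0) (at_right 0)"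
    by (rule Lim_null_comparison[OF _ lim])
  then show ?thesis by (rule LIM_zero_cancel)
qed

lemma ev_right_derivative:
  assumes t: "t \<ge> 0" and x: "x \<in> E"
  shows "((\<lambda>h. (ev (t + h) f x - ev t f x) / h) \<longlongrightarrow> ev t (H f) x) (at_right 0)"
proof -
  have "((\<lambda>h. \<Sum>y\<in>E. pmf (P t x) y * ((ev h f y - f y) / h)) \<longlongrightarrow> (\<Sum>y\<in>E. pmf (P t x) y * H f y)) (at_right 0)"
    by (intro tendsto_sum tendsto_mult tendsto_const generator_limit)
  moreover have "\<forall>\<^sub>F h in at_right 0. (\<Sum>y\<in>E. pmf (P t x) y * ((ev h f y - f y) / h)) = (ev (t + h) f x - ev t f x) / h"
    using eventually_at_right_less[of 0]
  proof eventually_elim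
    case (elim h)
    then have h: "h \<ge> 0" by simp
    show ?case unfolding ev_add[OF t h x] ev_sum[OF t x]
      by (simp add: right_diff_distrib diff_divide_distrib sum_subtractf sum_divide_distrib)
  qed
  ultimately show ?thesis unfolding ev_sum[OF t x] using tendsto_cong by fastforce
qed

text \<open>The increment from t - h to t is the average of \<open>ev h f - f\<close> under
  \<open>P (t - h) x\<close>; the weights converge by left continuity applied to indicators of
  points.\<close>

lemma ev_left_derivative:
  assumes t: "t > 0" and x: "x \<in> E"
  shows "((\<lambda>h. (ev t f x - ev (t - h) f x) / h) \<longlongrightarrow> ev t (H f) x) (at_right 0)"
proof -
  have p: "((\<lambda>h. pmf (P (t - h) x) y) \<longlongrightarrow> pmf (P t x) y) (at_right 0)" for y
  proof -
    have "ev s (indicator {y}) x = pmf (P s x) y" for s unfolding ev_def by (simp add: pmf.rep_eq)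
    then show ?thesis using ev_left_limit[OF t x, of "indicator {y}"] by simp
  qed
  have "((\<lambda>h. \<Sum>y\<in>E. pmf (P (t - h) x) y * ((ev h f y - f y) / h)) \<longlongrightarrow> (\<Sum>y\<in>E. pmf (P t x) y * H f y)) (at_right 0)"
    by (intro tendsto_sum tendsto_mult p generator_limit)
  moreover have "\<forall>\<^sub>F h in at_right 0. (\<Sum>y\<in>E. pmf (P (t - h) x) y * ((ev h f y - f y) / h)) = (ev t f x - ev (t - h) f x) / h"
    using eventually_at_right_real[OF t]
  proof eventually_elim
    case (elim h)
    then have h: "t - h \<ge> 0" "h \<ge> 0" by auto
    have "ev t f x = ev (t - h) (ev h f) x" using ev_add[OF h x, of f] by simp
    then show ?case unfolding ev_sum[OF h(1) x]
      by (simp add: right_diff_distrib diff_divide_distrib sum_subtractf sum_divide_distrib)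
  qed
  ultimately show ?thesis unfolding ev_sum[OF less_imp_le[OF t] x] using tendsto_cong by fastforce
qed

text \<open>Kolmogorov's forward equation, glued from the two one-sided derivatives; at s = 0 the
  interval leaves only the right one.\<close>

lemma ev_derivative:
  assumes s: "0 \<le> s" "s \<le> t" and t: "t > 0" and x: "x \<in> E"
  shows "((\<lambda>s. ev s f x) has_real_derivative ev s (H f) x) (at s within {0..t})"
proof -
  have right: "((\<lambda>y. (ev y f x - ev s f x) / (y - s)) \<longlongrightarrow> ev s (H f) x) (at_right s)"
    unfolding filterlim_at_right_to_0[of _ _ s] using ev_right_derivative[OF s(1) x, of f]
    by (simp add: add.commute)
  show ?thesis
  proof (cases "s = 0")
    case True
    then show ?thesis
      unfolding has_field_derivative_iff using right at_within_Icc_at_right[OF t] by simp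
  next
    case False
    then have s0: "s > 0" using s by simp
    have "((\<lambda>y. (ev y f x - ev s f x) / (y - s)) \<longlongrightarrow> ev s (H f) x) (at_left s)"
    proof -
      have "(ev (- (h + - s)) f x - ev s f x) / (- (h + - s) - s) = (ev s f x - ev (s - h) f x) / h" for h
      proof -
        have "- (h + - s) = s - h" "- (h + - s) - s = - h" by simp_all
        then show ?thesis
          by (simp only: minus_divide_right[symmetric] minus_divide_left minus_diff_eq)
      qed
      then show ?thesis
        unfolding filterlim_at_left_to_right filterlim_at_right_to_0[of _ _ "- s"]
        using ev_left_derivative[OF s0 x, of f] by (simp only:)
    qed
    then have "((\<lambda>y. (ev y f x - ev s f x) / (y - s)) \<longlongrightarrow> ev s (H f) x) (at s)"
      using right by (rule filterlim_split_at)
    then have "((\<lambda>s. ev s f x) has_real_derivative ev s (H f) x) (at s)"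
      unfolding has_field_derivative_iff .
    then show ?thesis by (rule has_field_derivative_at_within)
  qed
qed

lemma ev_series:
  assumes t: "t > 0" and x: "x \<in> E" and bound: "\<And>n y. y \<in> E \<Longrightarrow> \<bar>(H ^^ n) f y\<bar> \<le> B * K ^ n"
  shows "(\<lambda>n. (H ^^ n) f x * t ^ n / fact n) sums ev t f x"
proof -
  have "(\<lambda>n. ev 0 ((H ^^ n) f) x * t ^ n / fact n) sums ev t ((H ^^ 0) f) x"
  proof (rule taylor_sums)
    show "((\<lambda>s. ev s ((H ^^ n) f) x) has_real_derivative ev s ((H ^^ Suc n) f) x) (at s within {0..t})"
      if "0 \<le> s" "s \<le> t" for n s
      using ev_derivative[OF that t x, of "(H ^^ n) f"] by simp
    show "\<bar>ev s ((H ^^ n) f) x\<bar> \<le> B * K ^ n" if "0 \<le> s" "s \<le> t" for n s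
      by (rule ev_bound[OF that(1) x bound])
  qed (use t in simp)
  then show ?thesis by (simp add: ev_zero[OF x])
qed

text \<open>Uniformisation: the factor exp (r s) cancels the part - r of the generator, so
  differentiating \<open>exp (r * s) * ev s (F n) x\<close> in s merely raises n by one. The Taylor
  series at 0, divided by exp (r t), has Poisson weights.\<close>

lemma ev_poisson:
  assumes t: "t > 0" and x: "x \<in> E" and r: "r \<ge> 0"
    and H: "\<And>f y. y \<in> E \<Longrightarrow> H f y = r * (Q f y - f y)"
    and Q_mult: "\<And>c f. Q (\<lambda>y. c * f y) = (\<lambda>y. c * Q f y)"
    and bound: "\<And>n y. y \<in> E \<Longrightarrow> \<bar>(Q ^^ n) f y\<bar> \<le> B"
  shows "(\<lambda>n. exp (- (r * t)) * (r * t) ^ n / fact n * (Q ^^ n) f x) sums ev t f x"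
proof -
  define F where "F n = (\<lambda>y. r ^ n * (Q ^^ n) f y)" for n
  have B: "B \<ge> 0" using bound[OF x, of 0] by linarith
  have HF: "H (F n) y = F (Suc n) y - r * F n y" if "y \<in> E" for n y
    unfolding H[OF that] F_def Q_mult by (simp add: algebra_simps)
  have "(\<lambda>n. (exp (r * 0) * ev 0 (F n) x) * t ^ n / fact n) sums (exp (r * t) * ev t (F 0) x)"
  proof (rule taylor_sums)
    fix n s assume s: "0 \<le> s" "s \<le> t"
    have evH: "ev s (H (F n)) x = ev s (F (Suc n)) x - r * ev s (F n) x"
      unfolding ev_sum[OF s(1) x] using HF
      by (simp add: right_diff_distrib sum_subtractf sum_distrib_left mult.left_commute)
    have eq: "r * exp (r * s) * ev s (F n) x + ev s (H (F n)) x * exp (r * s) = exp (r * s) * ev s (F (Suc n)) x"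
      unfolding evH by (simp add: algebra_simps)
    have e: "((\<lambda>s. exp (r * s)) has_real_derivative r * exp (r * s)) (at s within {0..t})"
      by (auto intro!: derivative_eq_intros)
    show "((\<lambda>s. exp (r * s) * ev s (F n) x) has_real_derivative exp (r * s) * ev s (F (Suc n)) x) (at s within {0..t})"
      using DERIV_mult[OF e ev_derivative[OF s t x, of "F n"]] unfolding eq .
    have "\<bar>ev s (F n) x\<bar> \<le> r ^ n * B"
      by (rule ev_bound[OF s(1) x]) (use r bound in \<open>auto simp: F_def abs_mult intro!: mult_left_mono\<close>)
    moreover have "exp (r * s) \<le> exp (r * t)" using s r by (simp add: mult_left_mono)
    ultimately have "exp (r * s) * \<bar>ev s (F n) x\<bar> \<le> exp (r * t) * (r ^ n * B)"
      by (intro mult_mono) auto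
    then show "\<bar>exp (r * s) * ev s (F n) x\<bar> \<le> exp (r * t) * B * r ^ n"
      by (simp add: abs_mult ac_simps)
  qed (use t in simp)
  then have "(\<lambda>n. exp (- (r * t)) * ((exp (r * 0) * ev 0 (F n) x) * t ^ n / fact n)) sums
      (exp (- (r * t)) * (exp (r * t) * ev t (F 0) x))"
    by (rule sums_mult)
  moreover have "exp (- (r * t)) * (exp (r * t) * ev t (F 0) x) = ev t f x"
    by (simp add: mult.assoc[symmetric] exp_minus F_def)
  moreover have "exp (- (r * t)) * ((exp (r * 0) * ev 0 (F n) x) * t ^ n / fact n) =
      exp (- (r * t)) * (r * t) ^ n / fact n * (Q ^^ n) f x" for n
    unfolding ev_zero[OF x] by (simp add: F_def power_mult_distrib)
  ultimately show ?thesis by (simp only:)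
qed

end

section \<open>The law of the walk at a fixed time\<close>

lemma natural_filtration_subalgebra:
  assumes "\<And>r. r \<ge> 0 \<Longrightarrow> X r \<in> M \<rightarrow>\<^sub>M count_space E"
  shows "subalgebra M (natural_filtration M E X s)"
proof -
  let ?G = "{X r -` A \<inter> space M |r A. 0 \<le> r \<and> r \<le> s \<and> A \<subseteq> E}"
  have "?G \<subseteq> sets M"
  proof clarify
    fix r :: real and A assume "0 \<le> r" "A \<subseteq> E"
    then show "X r -` A \<inter> space M \<in> sets M" using measurable_sets[OF assms, of r A] by simp
  qed
  moreover have "?G \<subseteq> Pow (space M)" by blast
  ultimately show ?thesis
    unfolding subalgebra_def natural_filtration_def
    by (simp add: sets.sigma_sets_subset space_measure_of_conv sets_measure_of)
qed

text \<open>The Markov property at time 0: the conditional expectation given the initial filtration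
  preserves the mean, and almost surely it is the expectation under the semigroup started at
  id.\<close>

lemma random_walk_law:
  assumes walk: "random_walk N C M S"
  obtains P where "prob_space M" "transition_semigroup (Sym N) P" "has_generator (Sym N) P (walk_generator N C)"
    "\<And>t. t \<ge> 0 \<Longrightarrow> S t \<in> M \<rightarrow>\<^sub>M count_space (Sym N)"
    "\<And>t f :: (nat \<Rightarrow> nat) \<Rightarrow> real. t \<ge> 0 \<Longrightarrow> (\<integral>\<omega>. f (S t \<omega>) \<partial>M) = measure_pmf.expectation (P t id) f"
proof -
  obtain P where P: "transition_semigroup (Sym N) P" "has_generator (Sym N) P (walk_generator N C)"
    "markov_process M (Sym N) P S" and start: "AE \<omega> in M. S 0 \<omega> = id"
    using walk unfolding random_walk_def by blast
  have prob: "prob_space M" and meas: "\<And>t. t \<ge> 0 \<Longrightarrow> S t \<in> M \<rightarrow>\<^sub>M count_space (Sym N)"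
    using P(3) unfolding markov_process_def by blast+
  interpret prob_space M by (rule prob)
  interpret sub: finite_measure_subalgebra M "natural_filtration M (Sym N) S 0"
    by unfold_locales (rule natural_filtration_subalgebra[OF meas])
  have finite_Sym: "finite (Sym N)" unfolding Sym_def by (simp add: finite_permutations)
  have "(\<integral>\<omega>. f (S t \<omega>) \<partial>M) = measure_pmf.expectation (P t id) f" if t: "t \<ge> 0" for t and f :: "(nat \<Rightarrow> nat) \<Rightarrow> real"
  proof -
    let ?F = "natural_filtration M (Sym N) S 0"
    have fm: "(\<lambda>\<omega>. f (S (0 + t) \<omega>)) \<in> borel_measurable M"
      using measurable_compose[OF meas[OF t], of f borel] by simp
    have "\<bar>f (S (0 + t) \<omega>)\<bar> \<le> (\<Sum>x\<in>Sym N. \<bar>f x\<bar>)" if "\<omega> \<in> space M" for \<omega>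
    proof -
      have "S (0 + t) \<omega> \<in> Sym N" using measurable_space[OF meas[OF t] that] by simp
      then show ?thesis using member_le_sum[of _ "Sym N" "\<lambda>x. \<bar>f x\<bar>"] finite_Sym by simp
    qed
    then have int: "integrable M (\<lambda>\<omega>. f (S (0 + t) \<omega>))"
      using fm by (intro integrable_const_bound[of _ "\<Sum>x\<in>Sym N. \<bar>f x\<bar>"] AE_I2) auto
    have "AE \<omega> in M. real_cond_exp M ?F (\<lambda>\<omega>. f (S (0 + t) \<omega>)) \<omega> = measure_pmf.expectation (P t (S 0 \<omega>)) f"
      using P(3) t unfolding markov_process_def by blast
    then have "AE \<omega> in M. real_cond_exp M ?F (\<lambda>\<omega>. f (S (0 + t) \<omega>)) \<omega> = measure_pmf.expectation (P t id) f"
      using start by eventually_elim simp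
    then have "(\<integral>\<omega>. real_cond_exp M ?F (\<lambda>\<omega>. f (S (0 + t) \<omega>)) \<omega> \<partial>M) = (\<integral>\<omega>. measure_pmf.expectation (P t id) f \<partial>M)"
      by (intro integral_cong_AE) (auto intro: borel_measurable_cond_exp2)
    also have "\<dots> = measure_pmf.expectation (P t id) f" using prob_space by simp
    finally show ?thesis using sub.real_cond_exp_int(2)[OF int] by simp
  qed
  then show ?thesis using that prob P(1,2) meas by blast
qed

subsection \<open>Eigenvalues of permutation matrices\<close>

definition mat_trace :: "complex mat \<Rightarrow> complex" where
  "mat_trace A = (\<Sum>i<dim_row A. A $$ (i, i))"

lemma mult_mat_entry:
  assumes "X \<in> carrier_mat n n" "Y \<in> carrier_mat n n" "i < n" "j < n"
  shows "(X * Y) $$ (i, j) = (\<Sum>l<n. X $$ (i, l) * Y $$ (l, j))"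
  using assms by (simp add: scalar_prod_def atLeast0LessThan)

lemma mat_trace_comm:
  assumes "X \<in> carrier_mat n n" "Y \<in> carrier_mat n n"
  shows "mat_trace (X * Y) = mat_trace (Y * X)"
proof -
  have "mat_trace (X * Y) = (\<Sum>i<n. \<Sum>l<n. X $$ (i, l) * Y $$ (l, i))"
    unfolding mat_trace_def using assms mult_mat_entry[OF assms] by (intro sum.cong) auto
  also have "\<dots> = (\<Sum>l<n. \<Sum>i<n. Y $$ (l, i) * X $$ (i, l))"
    by (subst sum.swap) (simp add: mult.commute)
  also have "\<dots> = mat_trace (Y * X)"
    unfolding mat_trace_def using assms mult_mat_entry[OF assms(2,1)] by (intro sum.cong) auto
  finally show ?thesis .
qed

lemma upper_triangular_pow:
  assumes B: "B \<in> carrier_mat n n" and tri: "upper_triangular (B :: complex mat)"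
  shows "(\<forall>i<n. \<forall>j<i. (B ^\<^sub>m k) $$ (i, j) = 0) \<and> (\<forall>i<n. (B ^\<^sub>m k) $$ (i, i) = (B $$ (i, i)) ^ k)"
proof (induction k)
  case 0
  then show ?case using B by auto
next
  case (Suc k)
  have Bk: "B ^\<^sub>m k \<in> carrier_mat n n" using B by simp
  have low: "B $$ (i, j) = 0" if "i < n" "j < i" for i j
    using tri B that unfolding upper_triangular_def by auto
  have zero: "(B ^\<^sub>m k) $$ (i, l) * B $$ (l, j) = 0" if "i < n" "l < n" "l < i \<or> j < l" for i j l
    using Suc low that by auto
  have "(B ^\<^sub>m Suc k) $$ (i, j) = 0" if "i < n" "j < i" for i j
  proof -
    have "(B ^\<^sub>m Suc k) $$ (i, j) = (\<Sum>l<n. (B ^\<^sub>m k) $$ (i, l) * B $$ (l, j))"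
      unfolding pow_mat.simps by (rule mult_mat_entry[OF Bk B]) (use that in auto)
    also have "\<dots> = 0"
    proof (rule sum.neutral, rule ballI)
      fix l assume "l \<in> {..<n}"
      then have "l < n" "l < i \<or> j < l" using that by auto
      then show "(B ^\<^sub>m k) $$ (i, l) * B $$ (l, j) = 0" by (rule zero[OF that(1)])
    qed
    finally show ?thesis .
  qed
  moreover have "(B ^\<^sub>m Suc k) $$ (i, i) = (B $$ (i, i)) ^ Suc k" if "i < n" for i
  proof -
    have "(B ^\<^sub>m Suc k) $$ (i, i) = (\<Sum>l<n. (B ^\<^sub>m k) $$ (i, l) * B $$ (l, i))"
      unfolding pow_mat.simps by (rule mult_mat_entry[OF Bk B]) (use that in auto)
    also have "\<dots> = (\<Sum>l\<in>{i}. (B ^\<^sub>m k) $$ (i, l) * B $$ (l, i))"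
    proof (rule sum.mono_neutral_right)
      show "\<forall>l\<in>{..<n} - {i}. (B ^\<^sub>m k) $$ (i, l) * B $$ (l, i) = 0"
      proof
        fix l assume "l \<in> {..<n} - {i}"
        then have "l < n" "l < i \<or> i < l" by auto
        then show "(B ^\<^sub>m k) $$ (i, l) * B $$ (l, i) = 0" by (rule zero[OF that])
      qed
    qed (use that in auto)
    finally show ?thesis using Suc that by simp
  qed
  ultimately show ?case by blast
qed

lemma permutation_matrix_carrier: "permutation_matrix N S \<in> carrier_mat N N"
  unfolding permutation_matrix_def by simp

lemma permutation_matrix_pow:
  assumes S: "S permutes {..<N}"
  shows "permutation_matrix N S ^\<^sub>m k = permutation_matrix N (S ^^ k)"
proof (induction k)
  case 0
  show ?case by (rule eq_matI) (auto simp: permutation_matrix_def)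
next
  case (Suc k)
  show ?case
  proof (rule eq_matI)
    fix i j assume "i < dim_row (permutation_matrix N (S ^^ Suc k))" "j < dim_col (permutation_matrix N (S ^^ Suc k))"
    then have ij: "i < N" "j < N" by (auto simp: permutation_matrix_def)
    have Sj: "S j < N" using funpow_in[OF S ij(2), of 1] by simp
    have "(permutation_matrix N S ^\<^sub>m Suc k) $$ (i, j) =
        (\<Sum>l<N. permutation_matrix N (S ^^ k) $$ (i, l) * permutation_matrix N S $$ (l, j))"
      unfolding pow_mat.simps Suc by (rule mult_mat_entry[OF permutation_matrix_carrier permutation_matrix_carrier ij])
    also have "\<dots> = (\<Sum>l<N. if l = S j then permutation_matrix N (S ^^ k) $$ (i, l) else 0)"
      by (rule sum.cong[OF refl]) (use ij in \<open>simp add: permutation_matrix_def\<close>)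
    also have "\<dots> = permutation_matrix N (S ^^ k) $$ (i, S j)" using Sj by simp
    also have "\<dots> = permutation_matrix N (S ^^ Suc k) $$ (i, j)"
    proof -
      have "(S ^^ Suc k) j = (S ^^ k) (S j)" by (simp only: funpow_Suc_right comp_apply)
      then show ?thesis using ij Sj unfolding permutation_matrix_def by simp
    qed
    finally show "(permutation_matrix N S ^\<^sub>m Suc k) $$ (i, j) = permutation_matrix N (S ^^ Suc k) $$ (i, j)" .
  qed (simp_all add: permutation_matrix_def)
qed

lemma mat_trace_permutation_matrix:
  "mat_trace (permutation_matrix N S) = of_nat (card {x\<in>{..<N}. S x = x})"
proof -
  have "mat_trace (permutation_matrix N S) = (\<Sum>i<N. of_bool (i = S i))"
    unfolding mat_trace_def permutation_matrix_def by (intro sum.cong) auto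
  also have "\<dots> = of_nat (card ({..<N} \<inter> {i. i = S i}))" by (subst sum_of_bool_eq) simp_all
  also have "{..<N} \<inter> {i. i = S i} = {x\<in>{..<N}. S x = x}" by auto
  finally show ?thesis .
qed

text \<open>A Schur form has the eigenvalues on its diagonal, and their powers on the diagonal of
  its powers. So power sums of eigenvalues are traces of permutation matrices, that is, numbers of
  fixed points. The moduli are 1 because some power of S with positive exponent is the
  identity.\<close>

lemma permutation_matrix_eigenvalues:
  assumes S: "S permutes {..<N}"
  obtains as where "proots (char_poly (permutation_matrix N S)) = mset as" "length as = N"
    "\<And>k. (\<Sum>i<N. (as ! i) ^ k) = of_nat (fixed_count N S k)" "\<And>i. i < N \<Longrightarrow> norm (as ! i) = 1"
proof -
  let ?A = "permutation_matrix N S"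
  note A = permutation_matrix_carrier[of N S]
  obtain as where as: "char_poly ?A = (\<Prod>a\<leftarrow>as. [:- a, 1:])" "length as = N"
    using char_poly_factorized[OF A] by blast
  have roots: "proots (char_poly ?A) = mset as"
  proof -
    have "proots (\<Prod>a\<leftarrow>bs. [:- a, 1:]) = mset bs" for bs :: "complex list"
    proof (induction bs)
      case (Cons b bs)
      have "(\<Prod>a\<leftarrow>bs. [:- a, 1:]) \<noteq> 0" by (auto simp: prod_list_zero_iff)
      then show ?case using Cons by (simp add: proots_mult del: mult_pCons_left)
    qed simp
    then show ?thesis unfolding as(1) .
  qed
  obtain B P Q where "schur_decomposition ?A as = (B, P, Q)" by (cases "schur_decomposition ?A as") auto
  from schur_decomposition[OF A as(1) this]
  have wit: "similar_mat_wit ?A B P Q" and tri: "upper_triangular B" and dB: "diag_mat B = as" by auto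
  have B: "B \<in> carrier_mat N N" "P \<in> carrier_mat N N" "Q \<in> carrier_mat N N" "P * Q = 1\<^sub>m N" "Q * P = 1\<^sub>m N"
    using wit A unfolding similar_mat_wit_def Let_def by auto
  have Bk: "B ^\<^sub>m k \<in> carrier_mat N N" for k using B(1) by simp
  have Ak: "?A ^\<^sub>m k = P * B ^\<^sub>m k * Q" for k by (rule similar_mat_wit_pow_id[OF wit])
  have BQ: "B ^\<^sub>m k = Q * ?A ^\<^sub>m k * P" for k
  proof -
    have c: "P * B ^\<^sub>m k \<in> carrier_mat N N" "Q * P \<in> carrier_mat N N" using B Bk by auto
    have "Q * (P * B ^\<^sub>m k * Q) * P = Q * (P * B ^\<^sub>m k) * Q * P"
      using assoc_mult_mat[OF B(3) c(1) B(3)] by simp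
    also have "\<dots> = Q * P * B ^\<^sub>m k * Q * P" using assoc_mult_mat[OF B(3,2) Bk] by simp
    also have "\<dots> = B ^\<^sub>m k * Q * P" using B(5) left_mult_one_mat[OF Bk] by simp
    also have "\<dots> = B ^\<^sub>m k" using assoc_mult_mat[OF Bk B(3,2)] B(5) right_mult_one_mat[OF Bk] by simp
    finally show ?thesis unfolding Ak by simp
  qed
  have diag: "(B ^\<^sub>m k) $$ (i, i) = (as ! i) ^ k" if "i < N" for i k
    using upper_triangular_pow[OF B(1) tri, of k] that B(1) unfolding dB[symmetric] diag_mat_def by auto
  have "(\<Sum>i<N. (as ! i) ^ k) = of_nat (fixed_count N S k)" for k
  proof -
    have "(\<Sum>i<N. (as ! i) ^ k) = mat_trace (B ^\<^sub>m k)"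
      unfolding mat_trace_def using diag B(1) by (intro sum.cong) auto
    also have "\<dots> = mat_trace (B ^\<^sub>m k * (Q * P))" using B(5) right_mult_one_mat[OF Bk] by simp
    also have "B ^\<^sub>m k * (Q * P) = B ^\<^sub>m k * Q * P" using assoc_mult_mat[OF Bk B(3,2)] by simp
    also have "mat_trace (B ^\<^sub>m k * Q * P) = mat_trace (P * (B ^\<^sub>m k * Q))"
      by (rule mat_trace_comm[where n = N]) (use B Bk in auto)
    also have "P * (B ^\<^sub>m k * Q) = ?A ^\<^sub>m k" unfolding Ak using assoc_mult_mat[OF B(2) Bk B(3)] by simp
    finally show ?thesis
      unfolding permutation_matrix_pow[OF S] mat_trace_permutation_matrix fixed_count_def .
  qed
  moreover have "norm (as ! i) = 1" if i: "i < N" for i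
  proof -
    obtain L where L: "(S ^^ L) = id" "L > 0"
      using permutation_is_nilpotent S permutation_permutes finite_lessThan by metis
    have "?A ^\<^sub>m L = 1\<^sub>m N"
      unfolding permutation_matrix_pow[OF S] L(1) by (rule eq_matI) (auto simp: permutation_matrix_def)
    then have "B ^\<^sub>m L = 1\<^sub>m N" unfolding BQ using B by simp
    then have "(as ! i) ^ L = 1" using diag[OF i, of L] i by simp
    then show ?thesis using L(2) by (metis norm_power norm_one power_eq_1_iff norm_ge_zero power_eq_iff_eq_base power_one zero_le_one)
  qed
  ultimately show ?thesis using that roots as(2) by blast
qed

definition eig_pmf :: "nat \<Rightarrow> (nat \<Rightarrow> nat) \<Rightarrow> complex pmf" where
  "eig_pmf N S = pmf_of_multiset (proots (char_poly (permutation_matrix N S)))"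

lemma
  assumes N: "N \<ge> 1" and S: "S permutes {..<N}"
  shows set_eig_pmf: "set_pmf (eig_pmf N S) \<subseteq> unit_circle"
    and finite_eig_pmf: "finite (set_pmf (eig_pmf N S))"
    and eig_pmf_power: "measure_pmf.expectation (eig_pmf N S) (\<lambda>z. z ^ k) = of_real (fixed_fraction N S k)"
proof -
  obtain as where as: "proots (char_poly (permutation_matrix N S)) = mset as" "length as = N"
    "\<And>k. (\<Sum>i<N. (as ! i) ^ k) = of_nat (fixed_count N S k)" "\<And>i. i < N \<Longrightarrow> norm (as ! i) = 1"
    by (rule permutation_matrix_eigenvalues[OF S]) blast
  have ne: "{..<N} \<noteq> {}" using N by (auto simp: lessThan_empty_iff)
  have "mset as = image_mset ((!) as) (mset_set {..<N})"
    using as(2) by (metis atLeast0LessThan map_nth mset_map mset_upt)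
  then have eig: "eig_pmf N S = map_pmf ((!) as) (pmf_of_set {..<N})"
    unfolding eig_pmf_def as(1) using map_pmf_of_set[OF _ ne, of "(!) as"] by simp
  show "set_pmf (eig_pmf N S) \<subseteq> unit_circle" "finite (set_pmf (eig_pmf N S))"
    unfolding eig using as(4) ne by (auto simp: set_pmf_of_set)
  have "measure_pmf.expectation (eig_pmf N S) (\<lambda>z. z ^ k) = (\<Sum>i<N. (as ! i) ^ k) / of_nat N"
    unfolding eig integral_map_pmf
    by (subst integral_measure_pmf[of "{..<N}"])
      (use ne in \<open>auto simp: scaleR_conv_of_real sum_divide_distrib divide_inverse sum_distrib_left mult.commute\<close>)
  then show "measure_pmf.expectation (eig_pmf N S) (\<lambda>z. z ^ k) = of_real (fixed_fraction N S k)"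
    unfolding as(3) fixed_fraction_def by simp
qed

subsection \<open>Measures on the circle and their moments\<close>

text \<open>Trigonometric polynomials are the restrictions to the circle of real parts of
  complex polynomials.\<close>

lemma cnj_mult_poly:
  "\<exists>r. \<forall>z\<in>unit_circle. Re (poly p z * cnj (poly q z)) = Re (poly r z)"
proof (induction q arbitrary: p)
  case 0
  show ?case by (rule exI[of _ 0]) simp
next
  case (pCons a q)
  obtain b p' where p: "p = pCons b p'" by (cases p) auto
  obtain r where r: "\<forall>z\<in>unit_circle. Re (poly p' z * cnj (poly q z)) = Re (poly r z)"
    using pCons.IH by blast
  show ?case
  proof (intro exI ballI)
    fix z :: complex assume z: "z \<in> unit_circle"
    then have zz: "z * cnj z = 1" by (simp add: complex_norm_square[symmetric])
    \<comment> \<open>On the circle \<open>cnj z\<close> is the inverse of z. Multiplying p by it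
      leaves the shifted polynomial p' and a single term \<open>b * cnj z\<close>, whose product
      with \<open>cnj (poly q z)\<close> is again the conjugate of a polynomial.\<close>
    have "poly p z * cnj (poly (pCons a q) z) = poly p z * cnj a + poly p z * cnj z * cnj (poly q z)"
      by (simp add: algebra_simps)
    also have "poly p z * cnj z = b * cnj z + poly p' z"
      using zz unfolding p by (simp add: algebra_simps)
    finally have "poly p z * cnj (poly (pCons a q) z) =
        cnj a * poly p z + cnj (cnj b * z * poly q z) + poly p' z * cnj (poly q z)"
      by (simp add: algebra_simps)
    then have "Re (poly p z * cnj (poly (pCons a q) z)) =
        Re (cnj a * poly p z) + Re (cnj (cnj b * z * poly q z)) + Re (poly p' z * cnj (poly q z))"
      by (simp only: plus_complex.simps)
    also have "\<dots> = Re (cnj a * poly p z) + Re (cnj b * z * poly q z) + Re (poly r z)"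
      using r z by (simp only: cnj.simps)
    also have "\<dots> = Re (poly (Polynomial.smult (cnj a) p + Polynomial.smult (cnj b) (pCons 0 q) + r) z)"
      by (simp add: algebra_simps)
    finally show "Re (poly p z * cnj (poly (pCons a q) z)) =
      Re (poly (Polynomial.smult (cnj a) p + Polynomial.smult (cnj b) (pCons 0 q) + r) z)" .
  qed
qed

text \<open>On the circle, real parts of polynomials are closed under products:
  \<open>Re u * Re v\<close> is half of \<open>Re (u * v) + Re (u * cnj v)\<close>, and the second
  term is covered by \<open>cnj_mult_poly\<close>.\<close>

lemma real_polynomial_function_circle:
  assumes "real_polynomial_function (f :: complex \<Rightarrow> real)"
  shows "\<exists>p. \<forall>z\<in>unit_circle. f z = Re (poly p z)"
  using assms
proof (induction f)
  case (linear f)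
  interpret bounded_linear f by (rule linear)
  have "f z = Re (poly [:0, Complex (f 1) (- f \<i>):] z)" for z
  proof -
    have "z = Re z *\<^sub>R 1 + Im z *\<^sub>R \<i>" by (simp add: complex_eq_iff)
    then have "f z = Re z * f 1 + Im z * f \<i>" by (metis add scaleR real_scaleR_def)
    then show ?thesis by simp
  qed
  then show ?case by blast
next
  case (const c)
  show ?case by (rule exI[of _ "[:of_real c:]"]) simp
next
  case (add f g)
  then obtain p q where "\<forall>z\<in>unit_circle. f z = Re (poly p z)" "\<forall>z\<in>unit_circle. g z = Re (poly q z)" by blast
  then show ?case by (intro exI[of _ "p + q"]) simp
next
  case (mult f g)
  then obtain p q where pq: "\<forall>z\<in>unit_circle. f z = Re (poly p z)" "\<forall>z\<in>unit_circle. g z = Re (poly q z)" by blast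
  obtain r where r: "\<forall>z\<in>unit_circle. Re (poly p z * cnj (poly q z)) = Re (poly r z)"
    using cnj_mult_poly by blast
  have "f z * g z = Re (poly (Polynomial.smult (1/2) (p * q + r)) z)" if z: "z \<in> unit_circle" for z
  proof -
    have "Re u * Re v = (Re (u * v) + Re (u * cnj v)) / 2" for u v :: complex by simp
    then have "f z * g z = (Re (poly p z * poly q z) + Re (poly r z)) / 2" using pq r z by metis
    then show ?thesis by simp
  qed
  then show ?case by blast
qed

lemma circle_approximation:
  fixes f :: "complex \<Rightarrow> real"
  assumes "continuous_on unit_circle f" "e > 0"
  obtains p where "\<And>z. z \<in> unit_circle \<Longrightarrow> \<bar>f z - Re (poly p z)\<bar> < e"
proof -
  obtain g where "real_polynomial_function g" "\<And>z. z \<in> unit_circle \<Longrightarrow> \<bar>f z - g z\<bar> < e"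
    using Stone_Weierstrass_real_polynomial_function[OF compact_sphere assms] by blast
  then show ?thesis using real_polynomial_function_circle that by metis
qed

section \<open>Finitely many moments control weak neighbourhoods\<close>

abbreviation circle_space :: "complex measure" where
  "circle_space \<equiv> restrict_space borel unit_circle"

lemma prob_measures_on_circle:
  "\<mu> \<in> prob_measures_on unit_circle \<longleftrightarrow> sets \<mu> = sets circle_space \<and> prob_space \<mu>"
  unfolding prob_measures_on_def space_prob_algebra by simp

lemma space_circle: "sets \<mu> = sets circle_space \<Longrightarrow> space \<mu> = unit_circle"
  by (drule sets_eq_imp_space_eq) (simp add: space_restrict_space)

lemma integrable_circle:
  fixes f :: "complex \<Rightarrow> real"
  assumes \<mu>: "\<mu> \<in> prob_measures_on unit_circle" and f: "continuous_on unit_circle f"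
  shows "integrable \<mu> f"
proof -
  have sets: "sets \<mu> = sets circle_space" and "prob_space \<mu>" using \<mu> prob_measures_on_circle by auto
  interpret prob_space \<mu> by fact
  have "compact (f ` unit_circle)" by (rule compact_continuous_image[OF f compact_sphere])
  then obtain B where B: "\<forall>y\<in>f ` unit_circle. norm y \<le> B"
    using compact_imp_bounded bounded_iff by blast
  have "f \<in> borel_measurable \<mu>"
    using borel_measurable_continuous_on_restrict[OF f] by (simp add: measurable_cong_sets[OF sets refl])
  then show ?thesis
    by (rule integrable_const_bound[of _ B, rotated]) (use B space_circle[OF sets] in \<open>auto intro!: AE_I2\<close>)
qed

text \<open>Complex coefficients make the condition say that the i-th moment is the real number
  \<open>m i\<close>, imaginary part included. Real parts of polynomials are also the functions to
  which continuous test functions are reduced.\<close>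

definition has_moments :: "complex measure \<Rightarrow> (nat \<Rightarrow> real) \<Rightarrow> bool" where
  "has_moments \<mu> m \<longleftrightarrow> \<mu> \<in> prob_measures_on unit_circle \<and>
     (\<forall>p. (\<integral>z. Re (poly p z) \<partial>\<mu>) = (\<Sum>i\<le>degree p. Re (coeff p i) * m i))"

lemma topspace_weak_topology: "topspace (weak_topology K) = prob_measures_on K"
proof -
  have "{\<mu> \<in> prob_measures_on K. (\<integral>z. (0 :: real) \<partial>\<mu>) \<in> UNIV} \<in>
    {{\<mu> \<in> prob_measures_on K. (\<integral>z. f z \<partial>\<mu>) \<in> V} |(f :: 'a \<Rightarrow> real) V.
        continuous_on K f \<and> bounded (f ` K) \<and> open V}"
    by (intro CollectI exI[of _ "\<lambda>_. 0 :: real"] exI[of _ UNIV]) (auto intro: bounded_subset[of "{0}"])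
  then have "prob_measures_on K \<in> {{\<mu> \<in> prob_measures_on K. (\<integral>z. f z \<partial>\<mu>) \<in> V} |(f :: 'a \<Rightarrow> real) V.
        continuous_on K f \<and> bounded (f ` K) \<and> open V}" (is "_ \<in> ?S")
    by (simp only: UNIV_I simp_thms Collect_mem_eq)
  moreover have "\<Union>?S \<subseteq> prob_measures_on K" by blast
  ultimately have "\<Union>?S = prob_measures_on K" by blast
  then show ?thesis unfolding weak_topology_def topology_generated_by_topspace .
qed

text \<open>By Stone-Weierstrass a test function is, up to d / 3, the real part of a polynomial,
  whose integral depends on finitely many moments. The induction follows the generation of the
  topology; intersections take the larger number of moments and the smaller tolerance.\<close>

lemma weak_neighbourhood:
  assumes V: "openin (weak_topology unit_circle) V" and \<mu>: "\<mu> \<in> V" and m: "has_moments \<mu> m"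
  shows "\<exists>K. \<exists>e>0. \<forall>\<nu> m'. has_moments \<nu> m' \<and> (\<forall>i\<le>K. \<bar>m' i - m i\<bar> < e) \<longrightarrow> \<nu> \<in> V"
proof -
  have "generate_topology_on {{\<mu> \<in> prob_measures_on unit_circle. (\<integral>z. f z \<partial>\<mu>) \<in> V} |(f :: complex \<Rightarrow> real) V.
        continuous_on unit_circle f \<and> bounded (f ` unit_circle) \<and> open V} V"
    using V unfolding weak_topology_def openin_topology_generated_by_iff .
  then show ?thesis using \<mu>
  proof (induction V)
    case Empty
    then show ?case by simp
  next
    case (Int a b)
    then have ab: "\<mu> \<in> a" "\<mu> \<in> b" by auto
    from Int.IH(1)[OF ab(1)] obtain K e where a: "e > 0"
      "\<forall>\<nu> m'. has_moments \<nu> m' \<and> (\<forall>i\<le>K. \<bar>m' i - m i\<bar> < e) \<longrightarrow> \<nu> \<in> a" by blast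
    from Int.IH(2)[OF ab(2)] obtain K' e' where b: "e' > 0"
      "\<forall>\<nu> m'. has_moments \<nu> m' \<and> (\<forall>i\<le>K'. \<bar>m' i - m i\<bar> < e') \<longrightarrow> \<nu> \<in> b" by blast
    show ?case
    proof (intro exI[of _ "max K K'"] exI[of _ "min e e'"] conjI allI impI)
      show "min e e' > 0" using a(1) b(1) by simp
      fix \<nu> m' assume H: "has_moments \<nu> m' \<and> (\<forall>i\<le>max K K'. \<bar>m' i - m i\<bar> < min e e')"
      then have "\<forall>i\<le>K. \<bar>m' i - m i\<bar> < e" "\<forall>i\<le>K'. \<bar>m' i - m i\<bar> < e'" by simp_all
      then show "\<nu> \<in> a \<inter> b" using a(2) b(2) H by blast
    qed
  next
    case (UN \<U>)
    then obtain k where k: "k \<in> \<U>" "\<mu> \<in> k" by blast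
    from UN.IH[OF this] obtain K e where "e > 0"
      "\<forall>\<nu> m'. has_moments \<nu> m' \<and> (\<forall>i\<le>K. \<bar>m' i - m i\<bar> < e) \<longrightarrow> \<nu> \<in> k" by blast
    then show ?case using k(1) by blast
  next
    case (Basis s)
    then obtain f :: "complex \<Rightarrow> real" and U where s: "s = {\<mu> \<in> prob_measures_on unit_circle. (\<integral>z. f z \<partial>\<mu>) \<in> U}"
      and f: "continuous_on unit_circle f" and U: "open U" by blast
    obtain d where d: "d > 0" "\<And>y. dist y (\<integral>z. f z \<partial>\<mu>) < d \<Longrightarrow> y \<in> U"
      using U Basis.prems unfolding s open_dist by blast
    obtain p where p: "\<And>z. z \<in> unit_circle \<Longrightarrow> \<bar>f z - Re (poly p z)\<bar> < d / 3"
      using circle_approximation[OF f, of "d / 3"] d(1) by auto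
    \<comment> \<open>The summand 1 keeps c positive and yields a strict inequality even if all real
      parts of coefficients vanish.\<close>
    define c where "c = 1 + (\<Sum>i\<le>degree p. \<bar>Re (coeff p i)\<bar>)"
    have c: "c > 0" unfolding c_def by (simp add: add_pos_nonneg sum_nonneg)
    have approx: "\<bar>(\<integral>z. f z \<partial>\<nu>) - (\<integral>z. Re (poly p z) \<partial>\<nu>)\<bar> \<le> d / 3" if \<nu>: "\<nu> \<in> prob_measures_on unit_circle" for \<nu>
    proof -
      have sets: "sets \<nu> = sets circle_space" and "prob_space \<nu>" using \<nu> prob_measures_on_circle by auto
      interpret prob_space \<nu> by fact
      have cp: "continuous_on unit_circle (\<lambda>z. Re (poly p z))" by (intro continuous_intros)
      note ints = integrable_circle[OF \<nu> f] integrable_circle[OF \<nu> cp]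
      have "\<bar>(\<integral>z. f z \<partial>\<nu>) - (\<integral>z. Re (poly p z) \<partial>\<nu>)\<bar> = \<bar>\<integral>z. f z - Re (poly p z) \<partial>\<nu>\<bar>"
        by (simp only: Bochner_Integration.integral_diff[OF ints])
      also have "\<dots> \<le> (\<integral>z. \<bar>f z - Re (poly p z)\<bar> \<partial>\<nu>)" by (rule integral_abs_bound)
      also have "\<dots> \<le> (\<integral>z. d / 3 \<partial>\<nu>)"
        by (rule integral_mono) (use p space_circle[OF sets] ints in \<open>auto intro!: less_imp_le\<close>)
      also have "\<dots> = d / 3" using prob_space by simp
      finally show ?thesis .
    qed
    show ?case
    proof (intro exI[of _ "degree p"] exI[of _ "d / (3 * c)"] conjI allI impI)
      show "d / (3 * c) > 0" using d c by simp
      fix \<nu> m' assume H: "has_moments \<nu> m' \<and> (\<forall>i\<le>degree p. \<bar>m' i - m i\<bar> < d / (3 * c))"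
      have \<nu>: "\<nu> \<in> prob_measures_on unit_circle" using H unfolding has_moments_def by blast
      have \<mu>': "\<mu> \<in> prob_measures_on unit_circle" using m unfolding has_moments_def by blast
      have "(\<integral>z. Re (poly p z) \<partial>\<nu>) - (\<integral>z. Re (poly p z) \<partial>\<mu>) = (\<Sum>i\<le>degree p. Re (coeff p i) * (m' i - m i))"
        using H m unfolding has_moments_def by (simp add: right_diff_distrib sum_subtractf)
      also have "\<bar>\<dots>\<bar> \<le> (\<Sum>i\<le>degree p. \<bar>Re (coeff p i) * (m' i - m i)\<bar>)" by (rule sum_abs)
      also have "\<dots> \<le> (\<Sum>i\<le>degree p. \<bar>Re (coeff p i)\<bar> * (d / (3 * c)))"
        unfolding abs_mult using H by (intro sum_mono mult_left_mono) (auto intro: less_imp_le)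
      also have "\<dots> = (c - 1) * (d / (3 * c))" unfolding c_def by (simp add: sum_distrib_right sum_divide_distrib)
      also have "\<dots> < c * (d / (3 * c))" using c d by (intro mult_strict_right_mono) auto
      also have "\<dots> = d / 3" using c by simp
      finally have "\<bar>(\<integral>z. Re (poly p z) \<partial>\<nu>) - (\<integral>z. Re (poly p z) \<partial>\<mu>)\<bar> < d / 3" .
      then have "\<bar>(\<integral>z. f z \<partial>\<nu>) - (\<integral>z. f z \<partial>\<mu>)\<bar> < d" using approx[OF \<nu>] approx[OF \<mu>'] by linarith
      then have "(\<integral>z. f z \<partial>\<nu>) \<in> U" by (intro d(2)) (simp add: dist_real_def)
      then show "\<nu> \<in> s" unfolding s using \<nu> by blast
    qed
  qed
qed

section \<open>Pushforwards to the circle and existence of limit measures\<close>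

definition circle_measure :: "'b measure \<Rightarrow> ('b \<Rightarrow> complex) \<Rightarrow> complex measure" where
  "circle_measure M f = restrict_space (distr M borel f) unit_circle"

lemma
  assumes "prob_space M" and f: "f \<in> borel_measurable M" and AE: "AE x in M. f x \<in> unit_circle"
  shows circle_measure_prob: "circle_measure M f \<in> prob_measures_on unit_circle"
    and circle_measure_integral: "continuous_on unit_circle (g :: complex \<Rightarrow> real) \<Longrightarrow>
      (\<lambda>x. g (f x)) \<in> borel_measurable M \<Longrightarrow> (\<integral>z. g z \<partial>circle_measure M f) = (\<integral>x. g (f x) \<partial>M)"
proof -
  interpret prob_space M by fact
  have cb: "unit_circle \<in> sets borel" by (rule borel_closed) (simp add: closed_sphere)
  have "emeasure (distr M borel f) unit_circle = emeasure M (f -` unit_circle \<inter> space M)"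
    by (rule emeasure_distr[OF f cb])
  also have "\<dots> = 1"
  proof -
    have "f -` unit_circle \<inter> space M = {x \<in> space M. f x \<in> unit_circle}" by blast
    then show ?thesis using prob_Collect_eq_1[of "\<lambda>x. f x \<in> unit_circle"] AE measurable_sets[OF f cb]
      by (simp add: emeasure_eq_measure)
  qed
  finally have "prob_space (circle_measure M f)"
    unfolding circle_measure_def by (intro prob_space_restrict_space) (use cb in simp_all)
  moreover have "sets (circle_measure M f) = sets circle_space"
    unfolding circle_measure_def by (rule sets_restrict_space_cong) simp
  ultimately show "circle_measure M f \<in> prob_measures_on unit_circle"
    using prob_measures_on_circle by blast
  assume g: "continuous_on unit_circle g" and gm: "(\<lambda>x. g (f x)) \<in> borel_measurable M"
  have ind: "(\<lambda>z. indicator unit_circle z *\<^sub>R g z) \<in> borel_measurable borel"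
    by (rule borel_measurable_continuous_on_indicator[OF cb g])
  have "(\<integral>z. g z \<partial>circle_measure M f) = (\<integral>z. indicator unit_circle z *\<^sub>R g z \<partial>distr M borel f)"
    unfolding circle_measure_def by (rule integral_restrict_space) (use cb in simp)
  also have "\<dots> = (\<integral>x. indicator unit_circle (f x) *\<^sub>R g (f x) \<partial>M)"
    by (rule integral_distr[OF f ind])
  also have "\<dots> = (\<integral>x. g (f x) \<partial>M)"
  proof (rule integral_cong_AE)
    show "(\<lambda>x. indicator unit_circle (f x) *\<^sub>R g (f x)) \<in> borel_measurable M"
      using measurable_compose[OF f ind] .
    show "AE x in M. indicator unit_circle (f x) *\<^sub>R g (f x) = g (f x)"
      using AE by eventually_elim simp
  qed (rule gm)
  finally show "(\<integral>z. g z \<partial>circle_measure M f) = (\<integral>x. g (f x) \<partial>M)" .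
qed

lemma circle_measure_has_moments:
  assumes M: "prob_space M" and f: "f \<in> borel_measurable M" and AE: "AE x in M. f x \<in> unit_circle"
    and m: "\<And>k. (\<integral>x. (f x) ^ k \<partial>M) = of_real (m k)"
  shows "has_moments (circle_measure M f) m"
  unfolding has_moments_def
proof (intro conjI allI)
  show "circle_measure M f \<in> prob_measures_on unit_circle" by (rule circle_measure_prob[OF M f AE])
  fix p
  interpret prob_space M by fact
  have int: "integrable M (\<lambda>x. f x ^ k)" for k
  proof (rule integrable_const_bound[of _ 1])
    show "AE x in M. norm (f x ^ k) \<le> 1" using AE by eventually_elim (simp add: norm_power)
  qed (use f in measurable)
  have pm: "(\<lambda>x. Re (poly p (f x))) \<in> borel_measurable M"
    by (rule measurable_compose[OF f]) (intro borel_measurable_continuous_onI continuous_intros)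
  have int': "integrable M (\<lambda>x. poly p (f x))"
    unfolding poly_altdef by (intro Bochner_Integration.integrable_sum integrable_mult_right int)
  have "(\<integral>z. Re (poly p z) \<partial>circle_measure M f) = (\<integral>x. Re (poly p (f x)) \<partial>M)"
    by (rule circle_measure_integral[OF M f AE _ pm]) (intro continuous_intros)
  also have "\<dots> = Re (\<integral>x. poly p (f x) \<partial>M)"
    using integral_Re[OF int'] by simp
  also have "(\<integral>x. poly p (f x) \<partial>M) = (\<Sum>i\<le>degree p. coeff p i * of_real (m i))"
    unfolding poly_altdef by (subst Bochner_Integration.integral_sum) (simp_all add: int m)
  finally show "(\<integral>z. Re (poly p z) \<partial>circle_measure M f) = (\<Sum>i\<le>degree p. Re (coeff p i) * m i)"
    by simp
qed

lemma circle_eigenvalue_distribution_has_moments: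
  assumes "N \<ge> 1" "S permutes {..<N}"
  shows "has_moments (circle_eigenvalue_distribution (permutation_matrix N S)) (fixed_fraction N S)"
proof -
  have "has_moments (circle_measure (eig_pmf N S) (\<lambda>z. z)) (fixed_fraction N S)"
    using set_eig_pmf[OF assms] eig_pmf_power[OF assms]
    by (intro circle_measure_has_moments) (auto simp: measure_pmf.prob_space_axioms AE_measure_pmf_iff)
  then show ?thesis
    unfolding circle_measure_def circle_eigenvalue_distribution_def eigenvalue_distribution_def eig_pmf_def .
qed

text \<open>Existence of the limit measure: pull the measures back to the line by the argument and
  extract a weakly convergent subsequence by Helly's theorem.\<close>

lemma limit_measure:
  fixes p :: "nat \<Rightarrow> complex pmf"
  assumes supp: "\<And>N. set_pmf (p N) \<subseteq> unit_circle"
    and mom: "\<And>N k. measure_pmf.expectation (p N) (\<lambda>z. z ^ k) = of_real (a N k)"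
    and lim: "\<And>k. (\<lambda>N. a N k) \<longlonglongrightarrow> m k"
  shows "\<exists>\<mu>. has_moments \<mu> m"
proof -
  define \<nu> where "\<nu> N = distr (measure_pmf (p N)) borel Arg" for N
  have dist: "real_distribution (\<nu> N)" for N
    unfolding \<nu>_def by (rule prob_space.real_distribution_distr[OF measure_pmf.prob_space_axioms]) simp
  \<comment> \<open>Values of \<open>Arg\<close> lie between - \<pi> and \<pi>, and \<pi> < 4; all
    mass in one bounded interval gives tightness.\<close>
  have one: "measure (\<nu> N) {-4<..4} = 1" for N
  proof -
    have "Arg -` {-4<..4} = UNIV"
      using Arg_bounded pi_less_4 by (auto, smt (verit), smt (verit))
    then show ?thesis unfolding \<nu>_def by (subst measure_distr) auto
  qed
  have "tight \<nu>"
    unfolding tight_def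
  proof (intro conjI allI impI dist)
    fix e :: real assume "e > 0"
    then show "\<exists>a b. a < b \<and> (\<forall>n. 1 - e < measure (\<nu> n) {a<..b})"
      by (intro exI[of _ "-4"] exI[of _ 4]) (simp add: one)
  qed
  from tight_imp_convergent_subsubsequence[OF this strict_mono_id] obtain r M where
    r: "strict_mono r" and M: "real_distribution M" and conv: "weak_conv_m (\<nu> \<circ> id \<circ> r) M" by blast
  interpret M: real_distribution M by (rule M)
  have d: "real_distribution ((\<nu> \<circ> id \<circ> r) n)" for n using dist by simp
  have cont: "isCont cis x" for x
    using continuous_on_cis[OF continuous_on_id, of UNIV] by (simp add: continuous_on_eq_continuous_at)
  have "(\<integral>x. cis x ^ k \<partial>M) = of_real (m k)" for k
  proof -
    have "(\<lambda>n. \<integral>x. cis x ^ k \<partial>(\<nu> \<circ> id \<circ> r) n) \<longlonglongrightarrow> (\<integral>x. cis x ^ k \<partial>M)"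
      by (rule weak_conv_imp_integral_bdd_continuous_conv[OF d M conv, where B = 1])
        (auto simp: norm_power intro!: isCont_power cont)
    moreover have "(\<integral>x. cis x ^ k \<partial>(\<nu> \<circ> id \<circ> r) n) = of_real (a (r n) k)" for n
    proof -
      have "(\<integral>x. cis x ^ k \<partial>\<nu> (r n)) = (\<integral>z. cis (Arg z) ^ k \<partial>p (r n))"
        unfolding \<nu>_def
        by (rule integral_distr) (auto intro!: borel_measurable_continuous_onI continuous_intros)
      also have "\<dots> = (\<integral>z. z ^ k \<partial>p (r n))"
      proof (rule integral_cong_AE)
        have "cis (Arg z) = z" if "z \<in> unit_circle" for z
          using that rcis_cmod_Arg[of z] by (simp add: rcis_def)
        then show "AE z in p (r n). cis (Arg z) ^ k = z ^ k"
          using supp[of "r n"] unfolding AE_measure_pmf_iff by (metis subsetD)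
      qed auto
      finally show ?thesis using mom by simp
    qed
    moreover have "(\<lambda>n. of_real (a (r n) k) :: complex) \<longlonglongrightarrow> of_real (m k)"
      using LIMSEQ_subseq_LIMSEQ[OF lim r, of k] by (intro tendsto_of_real) (simp add: comp_def)
    ultimately show ?thesis using LIMSEQ_unique by (simp only:) blast
  qed
  moreover have "cis \<in> borel_measurable M"
    unfolding measurable_cong_sets[OF M.events_eq_borel refl]
    by (intro borel_measurable_continuous_onI continuous_intros)
  ultimately have "has_moments (circle_measure M cis) m"
    by (intro circle_measure_has_moments M.prob_space_axioms) auto
  then show ?thesis by blast
qed

subsection \<open>Moments indexed by partitions\<close>

text \<open>Partitions as equivalence relations: refinement becomes inclusion, and the counts of
  colourings constant along a relation apply.\<close>

definition block_rel :: "'v set set \<Rightarrow> 'v rel" where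
  "block_rel p = {(a, b). \<exists>X\<in>p. a \<in> X \<and> b \<in> X}"

lemma block_relI: "X \<in> p \<Longrightarrow> a \<in> X \<Longrightarrow> b \<in> X \<Longrightarrow> (a, b) \<in> block_rel p"
  unfolding block_rel_def by blast

lemma block_rel_subset: "partition_on V p \<Longrightarrow> block_rel p \<subseteq> V \<times> V"
  unfolding block_rel_def partition_on_def by blast

lemma equiv_block_rel: "partition_on V p \<Longrightarrow> equiv V (block_rel p)"
  unfolding block_rel_def by (rule equiv_partition_on)

lemma block_rel_quotient:
  assumes "equiv V r"
  shows "block_rel (V // r) = r"
proof (intro Set.set_eqI iffI; clarify)
  fix a b assume "(a, b) \<in> block_rel (V // r)"
  then obtain X where "X \<in> V // r" "a \<in> X" "b \<in> X" unfolding block_rel_def by blast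
  then show "(a, b) \<in> r" using quotient_eq_iff[OF assms, of X X a b] by blast
next
  fix a b assume ab: "(a, b) \<in> r"
  then have "a \<in> V" using assms unfolding equiv_def refl_on_def by blast
  then have "r `` {a} \<in> V // r" "a \<in> r `` {a}" using equiv_class_self[OF assms] by (auto intro: quotientI)
  then show "(a, b) \<in> block_rel (V // r)" using ab unfolding block_rel_def by blast
qed

lemma refines_iff_block_rel:
  assumes p: "partition_on V p" and q: "partition_on V q"
  shows "refines V p q \<longleftrightarrow> block_rel p \<subseteq> block_rel q"
proof
  assume "refines V p q"
  then have ref: "\<exists>Y\<in>q. X \<subseteq> Y" if "X \<in> p" for X using that unfolding refines_def by blast
  show "block_rel p \<subseteq> block_rel q"
  proof clarify
    fix a b assume "(a, b) \<in> block_rel p"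
    then obtain X where X: "X \<in> p" "a \<in> X" "b \<in> X" unfolding block_rel_def by blast
    from ref[OF X(1)] obtain Y where "Y \<in> q" "X \<subseteq> Y" ..
    then show "(a, b) \<in> block_rel q" using X unfolding block_rel_def by blast
  qed
next
  assume sub: "block_rel p \<subseteq> block_rel q"
  have "\<exists>Y\<in>q. X \<subseteq> Y" if X: "X \<in> p" for X
  proof -
    have "X \<noteq> {}" using p X unfolding partition_on_def by blast
    then obtain a where a: "a \<in> X" by blast
    then have "a \<in> V" using p X unfolding partition_on_def by blast
    then obtain Y where Y: "Y \<in> q" "a \<in> Y" using q unfolding partition_on_def by blast
    have "X \<subseteq> Y"
    proof
      fix b assume "b \<in> X"
      then have "(a, b) \<in> block_rel p" using a X unfolding block_rel_def by blast
      then have "(a, b) \<in> block_rel q" using sub by blast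
      then obtain Z where Z: "Z \<in> q" "a \<in> Z" "b \<in> Z" unfolding block_rel_def by blast
      have "Z = Y"
      proof (rule ccontr)
        assume "Z \<noteq> Y"
        then have "Z \<inter> Y = {}" using q Z(1) Y(1) unfolding partition_on_def disjoint_def by blast
        then show False using Z(2) Y(2) by blast
      qed
      then show "b \<in> Y" using Z by blast
    qed
    then show ?thesis using Y by blast
  qed
  then show "refines V p q" unfolding refines_def using p q by blast
qed

lemma card_block_functions:
  assumes fin: "finite V" and q: "partition_on V q"
  shows "card (cons N V (block_rel q)) = N ^ card q"
proof -
  have finq: "finite q" by (rule finite_elements[OF fin q])
  have ne: "X \<noteq> {}" "X \<subseteq> V" if "X \<in> q" for X using q that unfolding partition_on_def by blast+
  define pt where "pt X = (SOME a. a \<in> X)" for X :: "'a set"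
  have pt: "pt X \<in> X" if "X \<in> q" for X unfolding pt_def using ne[OF that] some_in_eq by blast
  define bl where "bl v = (THE X. X \<in> q \<and> v \<in> X)" for v
  have ex: "\<exists>!X. X \<in> q \<and> v \<in> X" if v: "v \<in> V" for v
  proof -
    obtain X where "X \<in> q" "v \<in> X" using q v unfolding partition_on_def by blast
    moreover have "Y = X" if "Y \<in> q" "v \<in> Y" "X \<in> q" "v \<in> X" for Y X
      using q that unfolding partition_on_def disjoint_def by blast
    ultimately show ?thesis by blast
  qed
  have bl: "bl v \<in> q" "v \<in> bl v" if "v \<in> V" for v
    using theI'[OF ex[OF that]] unfolding bl_def by blast+
  have bl_eq: "bl v = X" if "X \<in> q" "v \<in> X" for v X
    unfolding bl_def using ex[of v] ne(2)[OF that(1)] that by (intro the1_equality) auto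
  have "bij_betw (\<lambda>c. restrict (\<lambda>X. c (pt X)) q) (cons N V (block_rel q)) (q \<rightarrow>\<^sub>E {..<N})"
  proof (rule bij_betw_byWitness[where f' = "\<lambda>f. restrict (\<lambda>v. f (bl v)) V"])
    show "\<forall>c\<in>cons N V (block_rel q). restrict (\<lambda>v. restrict (\<lambda>X. c (pt X)) q (bl v)) V = c"
    proof
      fix c assume c: "c \<in> cons N V (block_rel q)"
      show "restrict (\<lambda>v. restrict (\<lambda>X. c (pt X)) q (bl v)) V = c"
      proof
        fix v
        show "restrict (\<lambda>v. restrict (\<lambda>X. c (pt X)) q (bl v)) V v = c v"
        proof (cases "v \<in> V")
          case True
          then have "(pt (bl v), v) \<in> block_rel q" using bl pt unfolding block_rel_def by blast
          then have "c (pt (bl v)) = c v" using c unfolding cons_def by blast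
          then show ?thesis using True bl by simp
        next
          case False
          then show ?thesis using c unfolding cons_def by (auto simp: PiE_iff extensional_def)
        qed
      qed
    qed
    show "\<forall>f\<in>q \<rightarrow>\<^sub>E {..<N}. restrict (\<lambda>X. restrict (\<lambda>v. f (bl v)) V (pt X)) q = f"
    proof
      fix f assume f: "f \<in> q \<rightarrow>\<^sub>E {..<N}"
      show "restrict (\<lambda>X. restrict (\<lambda>v. f (bl v)) V (pt X)) q = f"
      proof
        fix X
        show "restrict (\<lambda>X. restrict (\<lambda>v. f (bl v)) V (pt X)) q X = f X"
        proof (cases "X \<in> q")
          case True
          have "pt X \<in> V" using pt[OF True] ne[OF True] by blast
          then show ?thesis using True bl_eq[OF True pt[OF True]] by simp
        next
          case False
          then show ?thesis using f by (auto simp: PiE_iff extensional_def)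
        qed
      qed
    qed
    show "(\<lambda>c. restrict (\<lambda>X. c (pt X)) q) ` cons N V (block_rel q) \<subseteq> q \<rightarrow>\<^sub>E {..<N}"
      using pt ne(2) unfolding cons_def by fastforce
    show "(\<lambda>f. restrict (\<lambda>v. f (bl v)) V) ` (q \<rightarrow>\<^sub>E {..<N}) \<subseteq> cons N V (block_rel q)"
    proof (rule image_subsetI)
      fix f assume f: "f \<in> q \<rightarrow>\<^sub>E {..<N}"
      have "restrict (\<lambda>v. f (bl v)) V \<in> V \<rightarrow>\<^sub>E {..<N}" using f bl by (auto simp: PiE_iff)
      moreover have "restrict (\<lambda>v. f (bl v)) V a = restrict (\<lambda>v. f (bl v)) V b" if ab: "(a, b) \<in> block_rel q" for a b
      proof -
        obtain X where X: "X \<in> q" "a \<in> X" "b \<in> X" using ab unfolding block_rel_def by blast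
        then have "a \<in> V" "b \<in> V" using ne by blast+
        then show ?thesis using bl_eq X by simp
      qed
      ultimately show "restrict (\<lambda>v. f (bl v)) V \<in> cons N V (block_rel q)" unfolding cons_def by blast
    qed
  qed
  then show ?thesis by (simp add: bij_betw_same_card card_PiE[OF finq])
qed

lemma cons_rtrancl:
  assumes R: "R \<subseteq> V \<times> V"
  shows "cons N V R = cons N V ((R \<union> R\<inverse>)\<^sup>* \<inter> V \<times> V)"
proof (rule subset_antisym)
  show "cons N V R \<subseteq> cons N V ((R \<union> R\<inverse>)\<^sup>* \<inter> V \<times> V)"
  proof
    fix c assume c: "c \<in> cons N V R"
    have "c a = c b" if "(a, b) \<in> (R \<union> R\<inverse>)\<^sup>*" for a b
      using that
    proof induction
      case (step y z)
      then have "(y, z) \<in> R \<or> (z, y) \<in> R" by blast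
      then have "c y = c z" using c unfolding cons_def by fastforce
      then show ?case using step by simp
    qed simp
    then show "c \<in> cons N V ((R \<union> R\<inverse>)\<^sup>* \<inter> V \<times> V)" using c unfolding cons_def by blast
  qed
  show "cons N V ((R \<union> R\<inverse>)\<^sup>* \<inter> V \<times> V) \<subseteq> cons N V R" using R unfolding cons_def by blast
qed

lemma equiv_rtrancl: "equiv V ((R \<union> R\<inverse>)\<^sup>* \<inter> V \<times> V)"
proof (rule equivI)
  have "sym ((R \<union> R\<inverse>)\<^sup>*)" by (rule sym_rtrancl) (auto simp: sym_def)
  then show "sym ((R \<union> R\<inverse>)\<^sup>* \<inter> V \<times> V)" by (auto simp: sym_def)
  show "trans ((R \<union> R\<inverse>)\<^sup>* \<inter> V \<times> V)" using trans_rtrancl[of "R \<union> R\<inverse>"] unfolding trans_def by blast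
qed (auto simp: refl_on_def)

lemma equiv_contains_rtrancl:
  assumes e: "equiv V E" and R: "R \<subseteq> E"
  shows "(R \<union> R\<inverse>)\<^sup>* \<inter> V \<times> V \<subseteq> E"
proof -
  have sym: "sym E" and tr: "trans E" and rf: "refl_on V E" using e unfolding equiv_def by auto
  have "a \<in> V \<longrightarrow> (a, b) \<in> E" if "(a, b) \<in> (R \<union> R\<inverse>)\<^sup>*" for a b
    using that
  proof induction
    case base
    then show ?case using rf unfolding refl_on_def by blast
  next
    case (step y z)
    have "(y, z) \<in> E" using step(2) R sym unfolding sym_def by blast
    then show ?case using step.IH tr unfolding trans_def by blast
  qed
  then show ?thesis by blast
qed

text \<open>The classes of the equivalence generated by both partitions refine every common
  coarsening; antisymmetry of refinement makes them the unique object described by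
  \<open>THE\<close>.\<close>

lemma sup_diagram_rtrancl:
  assumes p: "p \<in> diagrams k" and p': "p' \<in> diagrams k"
  shows "sup_diagram k p p' = vertices k // (((block_rel p \<union> block_rel p') \<union> (block_rel p \<union> block_rel p')\<inverse>)\<^sup>* \<inter> vertices k \<times> vertices k)"
    (is "_ = ?q")
proof -
  let ?V = "vertices k" and ?R = "block_rel p \<union> block_rel p'"
  let ?T = "(?R \<union> ?R\<inverse>)\<^sup>* \<inter> ?V \<times> ?V"
  have part: "partition_on ?V p" "partition_on ?V p'" using p p' unfolding diagrams_def by auto
  have eq: "equiv ?V ?T" by (rule equiv_rtrancl)
  have q: "partition_on ?V ?q" by (rule partition_on_quotient[OF eq])
  have "?R \<subseteq> ?T" using block_rel_subset[OF part(1)] block_rel_subset[OF part(2)] by blast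
  then have up: "refines ?V p ?q" "refines ?V p' ?q"
    unfolding refines_iff_block_rel[OF part(1) q] refines_iff_block_rel[OF part(2) q] block_rel_quotient[OF eq]
    by blast+
  have least: "refines ?V ?q r" if r: "refines ?V p r" "refines ?V p' r" for r
  proof -
    have pr: "partition_on ?V r" using r(1) unfolding refines_def by blast
    have "?R \<subseteq> block_rel r"
      using r unfolding refines_iff_block_rel[OF part(1) pr] refines_iff_block_rel[OF part(2) pr] by blast
    then have "?T \<subseteq> block_rel r" by (rule equiv_contains_rtrancl[OF equiv_block_rel[OF pr]])
    then show ?thesis unfolding refines_iff_block_rel[OF q pr] block_rel_quotient[OF eq] .
  qed
  show ?thesis
    unfolding sup_diagram_def
  proof (rule the_equality)
    fix q' assume H: "refines ?V p q' \<and> refines ?V p' q' \<and> (\<forall>r. refines ?V p r \<and> refines ?V p' r \<longrightarrow> refines ?V q' r)"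
    then have "refines ?V ?q q'" "refines ?V q' ?q" using least up by blast+
    then show "q' = ?q" by (rule refines_asym[symmetric])
  qed (use up least in blast)
qed

lemma id_diagram_diagrams: "id_diagram k \<in> diagrams k"
  unfolding diagrams_def id_diagram_def
proof (intro CollectI partition_onI)
  show "\<Union>{{Inl i, Inr i} |i. i \<in> {1..k}} = vertices k" unfolding vertices_def by (auto, blast+)
qed (auto simp: disjnt_def)

lemma card_sup_diagram:
  assumes p: "p \<in> diagrams k"
  shows "card (cons N (vertices k) (block_rel p \<union> block_rel (id_diagram k))) = N ^ card (sup_diagram k p (id_diagram k))"
proof -
  have part: "partition_on (vertices k) p" "partition_on (vertices k) (id_diagram k)"
    using p id_diagram_diagrams unfolding diagrams_def by auto
  have sub: "block_rel p \<union> block_rel (id_diagram k) \<subseteq> vertices k \<times> vertices k"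
    using part block_rel_subset by blast
  show ?thesis
    unfolding sup_diagram_rtrancl[OF p id_diagram_diagrams] cons_rtrancl[OF sub]
      card_block_functions[OF finite_vertices partition_on_quotient[OF equiv_rtrancl], symmetric]
      block_rel_quotient[OF equiv_rtrancl] ..
qed

section \<open>Moments of permutation matrices as normalised solution counts\<close>

definition csol :: "nat \<Rightarrow> (nat \<Rightarrow> nat) \<Rightarrow> nat \<Rightarrow> diagram \<Rightarrow> (nat + nat \<Rightarrow> nat) set" where
  "csol N S k p = {I \<in> vertices k \<rightarrow>\<^sub>E {..<N}. (\<forall>(a, b)\<in>block_rel p. I a = I b) \<and> (\<forall>l\<in>{1..k}. I (Inr l) = S (I (Inl l)))}"

lemma card_csol_id:
  assumes p: "p \<in> diagrams k"
  shows "card (csol N id k p) = N ^ card (sup_diagram k p (id_diagram k))"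
proof -
  have "(\<forall>(a, b)\<in>block_rel (id_diagram k). I a = I b) \<longleftrightarrow> (\<forall>l\<in>{1..k}. I (Inr l) = I (Inl l))" for I :: "nat + nat \<Rightarrow> nat"
  proof
    assume H: "\<forall>(a, b)\<in>block_rel (id_diagram k). I a = I b"
    show "\<forall>l\<in>{1..k}. I (Inr l) = I (Inl l)"
    proof
      fix l assume "l \<in> {1..k}"
      then have "(Inr l, Inl l) \<in> block_rel (id_diagram k)" unfolding block_rel_def id_diagram_def by blast
      then show "I (Inr l) = I (Inl l)" using H by blast
    qed
  next
    assume H: "\<forall>l\<in>{1..k}. I (Inr l) = I (Inl l)"
    have "I a = I b" if ab: "(a, b) \<in> block_rel (id_diagram k)" for a b
    proof -
      obtain i where i: "i \<in> {1..k}" and "a = Inl i \<or> a = Inr i" "b = Inl i \<or> b = Inr i"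
        using ab unfolding block_rel_def id_diagram_def by blast
      moreover have "I (Inr i) = I (Inl i)" using H i by blast
      ultimately show ?thesis by metis
    qed
    then show "\<forall>(a, b)\<in>block_rel (id_diagram k). I a = I b" by blast
  qed
  then have "csol N id k p = cons N (vertices k) (block_rel p \<union> block_rel (id_diagram k))"
    unfolding csol_def cons_def ball_Un id_apply by (intro Collect_cong) blast
  then show ?thesis using card_sup_diagram[OF p] by simp
qed

lemma Ker_partition: "partition_on (vertices k) (Ker k I)" "block_rel (Ker k I) = rel (vertices k) I"
proof -
  have e: "equiv (vertices k) (rel (vertices k) I)"
    by (rule equivI) (auto simp: rel_def refl_on_def sym_def trans_def)
  have K: "Ker k I = vertices k // rel (vertices k) I"
    unfolding Ker_def quotient_def rel_def by (auto intro!: exI)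
  show "partition_on (vertices k) (Ker k I)" unfolding K by (rule partition_on_quotient[OF e])
  show "block_rel (Ker k I) = rel (vertices k) I" unfolding K by (rule block_rel_quotient[OF e])
qed

text \<open>A product of entries of a permutation matrix is 1 or 0 according to whether
  \<open>I (Inr l) = S (I (Inl l))\<close> holds for all l. The power of N in the denominator is the
  same count for S = id, where both ends of each pair are identified.\<close>

lemma moment_csol:
  assumes p: "p \<in> diagrams k" and S: "S permutes {..<N}"
  shows "moment k p (permutation_matrix N S) = of_nat (card (csol N S k p)) / of_nat (card (csol N id k p))"
proof -
  let ?V = "vertices k"
  have part: "partition_on ?V p" using p unfolding diagrams_def by blast
  define X where "X = {I. I \<in> ?V \<rightarrow>\<^sub>E {..<N} \<and> refines ?V p (Ker k I)}"
  have X: "X = {I \<in> ?V \<rightarrow>\<^sub>E {..<N}. \<forall>(a, b)\<in>block_rel p. I a = I b}"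
    unfolding X_def refines_iff_block_rel[OF part Ker_partition(1)] Ker_partition(2)
    using block_rel_subset[OF part] unfolding rel_def by blast
  have fin: "finite X" unfolding X by (simp add: finite_PiE finite_vertices)
  have "(\<Sum>I\<in>X. \<Prod>l\<in>{1..k}. permutation_matrix N S $$ (I (Inr l), I (Inl l))) =
      (\<Sum>I\<in>X. of_bool (\<forall>l\<in>{1..k}. I (Inr l) = S (I (Inl l))))"
  proof (rule sum.cong[OF refl])
    fix I assume "I \<in> X"
    then have I: "I \<in> ?V \<rightarrow>\<^sub>E {..<N}" unfolding X by blast
    have "(\<Prod>l\<in>{1..k}. permutation_matrix N S $$ (I (Inr l), I (Inl l))) =
        (\<Prod>l\<in>{1..k}. of_bool (I (Inr l) = S (I (Inl l))))"
    proof (rule prod.cong[OF refl])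
      fix l assume "l \<in> {1..k}"
      then have "I (Inr l) < N" "I (Inl l) < N" using I by (auto simp: PiE_iff)
      then show "permutation_matrix N S $$ (I (Inr l), I (Inl l)) = of_bool (I (Inr l) = S (I (Inl l)))"
        unfolding permutation_matrix_def by simp
    qed
    also have "\<dots> = of_bool (\<forall>l\<in>{1..k}. I (Inr l) = S (I (Inl l)))"
    proof (cases "\<forall>l\<in>{1..k}. I (Inr l) = S (I (Inl l))")
      case False
      then show ?thesis by (auto simp: prod_zero_iff)
    qed simp
    finally show "(\<Prod>l\<in>{1..k}. permutation_matrix N S $$ (I (Inr l), I (Inl l))) =
        of_bool (\<forall>l\<in>{1..k}. I (Inr l) = S (I (Inl l)))" .
  qed
  also have "\<dots> = of_nat (card (csol N S k p))"
  proof -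
    have "csol N S k p = X \<inter> {I. \<forall>l\<in>{1..k}. I (Inr l) = S (I (Inl l))}" unfolding csol_def X by blast
    then show ?thesis using fin by (subst sum_of_bool_eq) (simp_all)
  qed
  finally have "(\<Sum>I\<in>X. \<Prod>l\<in>{1..k}. permutation_matrix N S $$ (I (Inr l), I (Inl l))) = of_nat (card (csol N S k p))" .
  moreover have "dim_row (permutation_matrix N S) = N" unfolding permutation_matrix_def by simp
  ultimately show ?thesis
    unfolding moment_def card_csol_id[OF p] X_def by simp
qed

text \<open>The index conditions form a system of the kind counted by \<open>card_sols\<close>, with
  exponent 1 at \<open>Inl l\<close>. At the identity every factor becomes N, so the denominator is
  N to the number of factors, and each factor turns into a fixed fraction.\<close>

lemma moment_prod:
  assumes p: "p \<in> diagrams k"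
  obtains ms where "\<And>N S. N \<ge> 1 \<Longrightarrow> S permutes {..<N} \<Longrightarrow>
    moment k p (permutation_matrix N S) = of_real (\<Prod>m\<in>#ms. fixed_fraction N S m)"
proof -
  let ?V = "vertices k"
  have part: "partition_on ?V p" using p unfolding diagrams_def by blast
  define E where "E = (\<lambda>(a, b). (a, 0 :: nat, b, 0 :: nat)) ` block_rel p \<union> (\<lambda>l. (Inr l, 0, Inl l, 1)) ` {1..k}"
  have sub: "block_rel p \<subseteq> ?V \<times> ?V" by (rule block_rel_subset[OF part])
  have "finite (block_rel p)" using finite_subset[OF sub] finite_vertices by blast
  then have finE: "finite E" unfolding E_def by simp
  have wf: "\<forall>(a, i, b, j)\<in>E. a \<in> ?V \<and> b \<in> ?V" using sub unfolding E_def by auto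
  obtain ms where ms: "\<forall>N S. S permutes {..<N} \<longrightarrow> card (sols N S ?V E) = (\<Prod>m\<in>#ms. fixed_count N S m)"
    using card_sols[OF finite_vertices finE wf] by blast
  have csol: "csol N S k p = sols N S ?V E" for N S
  proof -
    have "(\<forall>(a, i, b, j)\<in>E. (S ^^ i) (z a) = (S ^^ j) (z b)) \<longleftrightarrow>
        (\<forall>(a, b)\<in>block_rel p. z a = z b) \<and> (\<forall>l\<in>{1..k}. z (Inr l) = S (z (Inl l)))" for z
    proof -
      have "(\<forall>(a, i, b, j)\<in>E. (S ^^ i) (z a) = (S ^^ j) (z b)) \<longleftrightarrow>
        (\<forall>(a, b)\<in>block_rel p. (S ^^ 0) (z a) = (S ^^ 0) (z b)) \<and> (\<forall>l\<in>{1..k}. (S ^^ 0) (z (Inr l)) = (S ^^ 1) (z (Inl l)))"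
        unfolding E_def ball_Un Set.ball_simps(9) by (simp only: split_def fst_conv snd_conv)
      moreover have "(S ^^ 1) x = S x" for x by simp
      ultimately show ?thesis by (simp only: funpow_0)
    qed
    then show ?thesis unfolding csol_def sols_def by (simp only:)
  qed
  have "moment k p (permutation_matrix N S) = of_real (\<Prod>m\<in>#ms. fixed_fraction N S m)"
    if N: "N \<ge> 1" and S: "S permutes {..<N}" for N S
  proof -
    have "card (csol N id k p) = N ^ size ms"
      unfolding csol using ms permutes_id[of "{..<N}"] by (simp add: fixed_count_id)
    moreover have "card (csol N S k p) = (\<Prod>m\<in>#ms. fixed_count N S m)" unfolding csol using ms S by blast
    moreover have "real (\<Prod>m\<in>#M. fixed_count N S m) / real N ^ size M = (\<Prod>m\<in>#M. fixed_fraction N S m)" for M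
      by (induction M) (use N in \<open>simp_all add: fixed_fraction_def field_simps\<close>)
    ultimately show ?thesis
      unfolding moment_csol[OF p S] by (metis of_nat_power of_real_divide of_real_of_nat_eq)
  qed
  then show ?thesis by (rule that)
qed

text \<open>The smallest example is the normalised trace; two copies of it will refute
  factorization.\<close>

lemma moment_id_diagram_1:
  assumes N: "N \<ge> 1" and S: "S permutes {..<N}"
  shows "moment 1 (id_diagram 1) (permutation_matrix N S) = of_real (fixed_fraction N S 1)"
proof -
  have "card (csol N S 1 (id_diagram 1)) = fixed_count N S 1" for S
  proof -
    have V: "vertices 1 = {Inl 1, Inr 1}" unfolding vertices_def by auto
    have b: "block_rel (id_diagram 1) = {Inl 1, Inr 1} \<times> {Inl 1, Inr 1}"
      unfolding block_rel_def id_diagram_def by auto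
    have s1: "S ^^ 1 = S" by (simp add: fun_eq_iff)
    have b1: "(\<forall>(a, b)\<in>{Inl 1, Inr 1} \<times> {Inl 1, Inr 1}. I a = I b) \<longleftrightarrow> I (Inr 1) = I (Inl 1)"
      for I :: "nat + nat \<Rightarrow> nat" by auto
    have l1: "(\<forall>l\<in>{1..1}. P l) \<longleftrightarrow> P 1" for P :: "nat \<Rightarrow> bool" by simp
    have cs: "I \<in> csol N S 1 (id_diagram 1) \<longleftrightarrow>
        I \<in> vertices 1 \<rightarrow>\<^sub>E {..<N} \<and> I (Inr 1) = I (Inl 1) \<and> S (I (Inl 1)) = I (Inl 1)" for I
      unfolding csol_def b b1 l1 mem_Collect_eq by metis
    have "bij_betw (\<lambda>I. I (Inl 1)) (csol N S 1 (id_diagram 1)) {x\<in>{..<N}. (S ^^ 1) x = x}"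
    proof (rule bij_betw_byWitness[where f' = "\<lambda>x. restrict (\<lambda>_. x) (vertices 1)"])
      show "\<forall>a\<in>csol N S 1 (id_diagram 1). restrict (\<lambda>_. a (Inl 1)) (vertices 1) = a"
      proof
        fix a assume a: "a \<in> csol N S 1 (id_diagram 1)"
        have "a (Inr 1) = a (Inl 1)" "a \<in> extensional (vertices 1)"
          using a[unfolded cs] unfolding PiE_iff by blast+
        then show "restrict (\<lambda>_. a (Inl 1)) (vertices 1) = a"
          unfolding V by (auto simp: fun_eq_iff extensional_def restrict_def)
      qed
    next
      show "(\<lambda>I. I (Inl 1)) ` csol N S 1 (id_diagram 1) \<subseteq> {x\<in>{..<N}. (S ^^ 1) x = x}"
      proof (rule image_subsetI)
        fix I assume "I \<in> csol N S 1 (id_diagram 1)"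
        note I = this[unfolded cs]
        have "I (Inl 1) < N" using I unfolding V PiE_iff by blast
        then show "I (Inl 1) \<in> {x\<in>{..<N}. (S ^^ 1) x = x}" unfolding s1 using I by blast
      qed
      show "(\<lambda>x. restrict (\<lambda>_. x) (vertices 1)) ` {x\<in>{..<N}. (S ^^ 1) x = x} \<subseteq> csol N S 1 (id_diagram 1)"
      proof (rule image_subsetI)
        fix x assume "x \<in> {x\<in>{..<N}. (S ^^ 1) x = x}"
        then have x: "x < N" "S x = x" unfolding s1 by blast+
        have "restrict (\<lambda>_. x) (vertices 1) (Inl 1) = x" "restrict (\<lambda>_. x) (vertices 1) (Inr 1) = x"
          unfolding V by simp_all
        then show "restrict (\<lambda>_. x) (vertices 1) \<in> csol N S 1 (id_diagram 1)"
          unfolding cs using x by (simp del: One_nat_def add: V)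
      qed
    qed (simp add: V)
    then show ?thesis unfolding fixed_count_def by (rule bij_betw_same_card)
  qed
  then show ?thesis
    unfolding moment_csol[OF id_diagram_diagrams S] by (simp add: fixed_fraction_def fixed_count_id del: One_nat_def)
qed

section \<open>Juxtaposition of diagrams\<close>

abbreviation shift :: "nat \<Rightarrow> nat + nat \<Rightarrow> nat + nat" where
  "shift k \<equiv> map_sum (\<lambda>i. k + i) (\<lambda>i. k + i)"

abbreviation unshift :: "nat \<Rightarrow> nat + nat \<Rightarrow> nat + nat" where
  "unshift k \<equiv> map_sum (\<lambda>i. i - k) (\<lambda>i. i - k)"

lemma unshift_shift: "unshift k (shift k v) = v"
  by (cases v) auto

lemma atLeastAtMost_1_add: "{1..k + l} = {1..k} \<union> (\<lambda>i. k + i) ` {1..l :: nat}"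
proof (rule subset_antisym; rule subsetI)
  fix j assume j: "j \<in> {1..k + l}"
  show "j \<in> {1..k} \<union> (\<lambda>i. k + i) ` {1..l}"
  proof (cases "j \<le> k")
    case False
    then have "j = k + (j - k)" "j - k \<in> {1..l}" using j by auto
    then show ?thesis by blast
  qed (use j in auto)
qed auto

lemma vertices_add: "vertices (k + l) = vertices k \<union> shift k ` vertices l"
  unfolding vertices_def atLeastAtMost_1_add by (simp only: Plus_def image_Un image_image map_sum.simps) blast

lemma vertices_shift_disjoint: "vertices k \<inter> shift k ` vertices l = {}"
  unfolding vertices_def by auto

lemma partition_on_Un:
  assumes AB: "A \<inter> B = {}" and P: "partition_on A P" and Q: "partition_on B Q"
  shows "partition_on (A \<union> B) (P \<union> Q)"
proof (rule partition_onI)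
  have sub: "X \<subseteq> A" if "X \<in> P" for X using P that unfolding partition_on_def by blast
  have sub': "X \<subseteq> B" if "X \<in> Q" for X using Q that unfolding partition_on_def by blast
  fix X Y assume XY: "X \<in> P \<union> Q" "Y \<in> P \<union> Q" "X \<noteq> Y"
  have "X \<inter> Y = {}" if "X \<in> P" "Y \<in> P" using P that XY unfolding partition_on_def disjoint_def by blast
  moreover have "X \<inter> Y = {}" if "X \<in> Q" "Y \<in> Q" using Q that XY unfolding partition_on_def disjoint_def by blast
  moreover have "X \<inter> Y = {}" if "X \<in> P" "Y \<in> Q" using sub[OF that(1)] sub'[OF that(2)] AB by blast
  moreover have "X \<inter> Y = {}" if "X \<in> Q" "Y \<in> P" using sub[OF that(2)] sub'[OF that(1)] AB by blast
  ultimately show "disjnt X Y" unfolding disjnt_def using XY by blast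
next
  show "\<Union>(P \<union> Q) = A \<union> B" using P Q unfolding partition_on_def by blast
  show "{} \<notin> P \<union> Q" using P Q unfolding partition_on_def by blast
qed

lemma juxtapose_diagrams:
  assumes p1: "p1 \<in> diagrams k" and p2: "p2 \<in> diagrams l"
  shows "juxtapose k p1 p2 \<in> diagrams (k + l)"
proof -
  have part: "partition_on (vertices k) p1" "partition_on (vertices l) p2" using p1 p2 unfolding diagrams_def by auto
  have "inj (shift k)" by (rule inj_on_inverseI[where g = "unshift k"]) (rule unshift_shift)
  then have "inj_on (shift k) (vertices l)" by (rule inj_on_subset) simp
  then have "partition_on (shift k ` vertices l) ((`) (shift k) ` p2 - {{}})"
    by (rule partition_on_inj_image[OF part(2)])
  moreover have "(`) (shift k) ` p2 - {{}} = (`) (shift k) ` p2" using part(2) unfolding partition_on_def by auto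
  ultimately have "partition_on (shift k ` vertices l) ((`) (shift k) ` p2)" by simp
  then show ?thesis
    unfolding diagrams_def juxtapose_def vertices_add mem_Collect_eq
    by (rule partition_on_Un[OF vertices_shift_disjoint part(1)])
qed

lemma block_rel_juxtapose:
  "block_rel (juxtapose k p1 p2) = block_rel p1 \<union> (\<lambda>(a, b). (shift k a, shift k b)) ` block_rel p2"
proof (rule subset_antisym; rule subsetI)
  fix e assume e: "e \<in> block_rel (juxtapose k p1 p2)"
  obtain a b where ab: "e = (a, b)" by fastforce
  obtain X where X: "X \<in> juxtapose k p1 p2" "a \<in> X" "b \<in> X" using e unfolding ab block_rel_def by blast
  show "e \<in> block_rel p1 \<union> (\<lambda>(a, b). (shift k a, shift k b)) ` block_rel p2"
  proof (cases "X \<in> p1")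
    case True
    then show ?thesis using X unfolding ab block_rel_def by blast
  next
    case False
    then obtain Y where Y: "Y \<in> p2" "X = shift k ` Y" using X(1) unfolding juxtapose_def by blast
    obtain a' b' where a': "a' \<in> Y" "b' \<in> Y" "a = shift k a'" "b = shift k b'" using X(2,3) unfolding Y(2) by blast
    then have "(a', b') \<in> block_rel p2" using Y(1) unfolding block_rel_def by blast
    then have "(\<lambda>(a, b). (shift k a, shift k b)) (a', b') \<in> (\<lambda>(a, b). (shift k a, shift k b)) ` block_rel p2"
      by (rule imageI)
    then show ?thesis unfolding ab a'(3,4) by simp
  qed
next
  fix e assume "e \<in> block_rel p1 \<union> (\<lambda>(a, b). (shift k a, shift k b)) ` block_rel p2"
  then consider "e \<in> block_rel p1" | a b where "(a, b) \<in> block_rel p2" "e = (shift k a, shift k b)" by auto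
  then show "e \<in> block_rel (juxtapose k p1 p2)"
  proof cases
    case 1
    then show ?thesis unfolding block_rel_def juxtapose_def by blast
  next
    case 2
    then obtain Y where "Y \<in> p2" "a \<in> Y" "b \<in> Y" unfolding block_rel_def by blast
    then have "shift k ` Y \<in> juxtapose k p1 p2" "shift k a \<in> shift k ` Y" "shift k b \<in> shift k ` Y"
      unfolding juxtapose_def by blast+
    then show ?thesis unfolding 2(2) by (rule block_relI)
  qed
qed

text \<open>The two halves share neither vertices nor equations, so a solution is a pair of
  solutions. Applied also to S = id, this makes the moments factor for each single permutation; what
  may fail to factor is the expectation.\<close>

lemma card_csol_juxtapose:
  assumes p1: "p1 \<in> diagrams k" and p2: "p2 \<in> diagrams l"
  shows "card (csol N S (k + l) (juxtapose k p1 p2)) = card (csol N S k p1) * card (csol N S l p2)"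
proof -
  have part: "partition_on (vertices k) p1" "partition_on (vertices l) p2" using p1 p2 unfolding diagrams_def by auto
  have sub: "block_rel p1 \<subseteq> vertices k \<times> vertices k" "block_rel p2 \<subseteq> vertices l \<times> vertices l"
    using block_rel_subset part by blast+
  have V: "v \<in> vertices (k + l)" if "v \<in> vertices k" for v using that unfolding vertices_add by blast
  have V': "shift k v \<in> vertices (k + l)" "shift k v \<notin> vertices k" if "v \<in> vertices l" for v
    using that vertices_shift_disjoint unfolding vertices_add by blast+
  define f where "f I = (restrict I (vertices k), restrict (\<lambda>v. I (shift k v)) (vertices l))" for I :: "nat + nat \<Rightarrow> nat"
  define h :: "(nat + nat \<Rightarrow> nat) \<times> (nat + nat \<Rightarrow> nat) \<Rightarrow> nat + nat \<Rightarrow> nat" where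
    "h = (\<lambda>(I1, I2). restrict (\<lambda>v. if v \<in> vertices k then I1 v else I2 (unshift k v)) (vertices (k + l)))"
  have h1: "h (I1, I2) v = I1 v" if "v \<in> vertices k" for I1 I2 v using that V[OF that] by (simp add: h_def)
  have h2: "h (I1, I2) (shift k v) = I2 v" if "v \<in> vertices l" for I1 I2 v
    using V'[OF that] by (simp add: h_def unshift_shift)
  have sh: "shift k (Inl j) = Inl (k + j)" "shift k (Inr j) = Inr (k + j)" for j by simp_all
  have split: "(\<forall>j\<in>{1..k + l}. P j) \<longleftrightarrow> (\<forall>j\<in>{1..k}. P j) \<and> (\<forall>j\<in>{1..l}. P (k + j))" for P
    unfolding atLeastAtMost_1_add ball_Un Set.ball_simps(9) ..
  have cs: "I \<in> csol N S (k + l) (juxtapose k p1 p2) \<longleftrightarrow>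
     I \<in> vertices (k + l) \<rightarrow>\<^sub>E {..<N} \<and> (\<forall>(a, b)\<in>block_rel p1. I a = I b) \<and>
     (\<forall>(a, b)\<in>block_rel p2. I (shift k a) = I (shift k b)) \<and>
     (\<forall>j\<in>{1..k}. I (Inr j) = S (I (Inl j))) \<and> (\<forall>j\<in>{1..l}. I (shift k (Inr j)) = S (I (shift k (Inl j))))" for I
    unfolding csol_def block_rel_juxtapose ball_Un Set.ball_simps(9) split sh mem_Collect_eq
    by (simp only: split_def fst_conv snd_conv conj_assoc)
  have "bij_betw f (csol N S (k + l) (juxtapose k p1 p2)) (csol N S k p1 \<times> csol N S l p2)"
  proof (rule bij_betw_byWitness[where f' = h])
    show "\<forall>I\<in>csol N S (k + l) (juxtapose k p1 p2). h (f I) = I"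
    proof
      fix I assume "I \<in> csol N S (k + l) (juxtapose k p1 p2)"
      then have ext: "I \<in> extensional (vertices (k + l))" unfolding csol_def PiE_def by blast
      show "h (f I) = I"
      proof
        fix v
        consider "v \<in> vertices k" | w where "w \<in> vertices l" "v = shift k w" | "v \<notin> vertices (k + l)"
          unfolding vertices_add by blast
        then show "h (f I) v = I v"
        proof cases
          case 1
          then show ?thesis unfolding f_def h1[OF 1] by simp
        next
          case 2
          then show ?thesis unfolding f_def 2(2) h2[OF 2(1)] by simp
        next
          case 3
          then show ?thesis using ext by (simp add: f_def h_def extensional_def)
        qed
      qed
    qed
    show "\<forall>J\<in>csol N S k p1 \<times> csol N S l p2. f (h J) = J"
    proof
      fix J assume "J \<in> csol N S k p1 \<times> csol N S l p2"
      then obtain I1 I2 where J: "J = (I1, I2)" "I1 \<in> extensional (vertices k)" "I2 \<in> extensional (vertices l)"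
        unfolding csol_def PiE_def by blast
      have "restrict (h (I1, I2)) (vertices k) = I1"
        using J(2) h1 by (auto simp: fun_eq_iff restrict_def extensional_def)
      moreover have "restrict (\<lambda>v. h (I1, I2) (shift k v)) (vertices l) = I2"
        using J(3) h2 by (auto simp: fun_eq_iff restrict_def extensional_def)
      ultimately show "f (h J) = J" unfolding J(1) f_def by simp
    qed
    show "f ` csol N S (k + l) (juxtapose k p1 p2) \<subseteq> csol N S k p1 \<times> csol N S l p2"
    proof (rule image_subsetI)
      fix I assume "I \<in> csol N S (k + l) (juxtapose k p1 p2)"
      note I = this[unfolded cs]
      note I1 = conjunct1[OF I] and I2 = conjunct1[OF conjunct2[OF I]]
        and I3 = conjunct1[OF conjunct2[OF conjunct2[OF I]]]
        and I4 = conjunct1[OF conjunct2[OF conjunct2[OF conjunct2[OF I]]]]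
        and I5 = conjunct2[OF conjunct2[OF conjunct2[OF conjunct2[OF I]]]]
      have "restrict I (vertices k) \<in> vertices k \<rightarrow>\<^sub>E {..<N}" using I1 V by (auto simp: PiE_iff)
      moreover have "\<forall>(a, b)\<in>block_rel p1. restrict I (vertices k) a = restrict I (vertices k) b"
        using I2 sub(1) by auto
      moreover have "\<forall>j\<in>{1..k}. restrict I (vertices k) (Inr j) = S (restrict I (vertices k) (Inl j))"
        using I4 by simp
      ultimately have 1: "restrict I (vertices k) \<in> csol N S k p1"
        unfolding csol_def by (intro CollectI conjI)
      let ?I2 = "restrict (\<lambda>v. I (shift k v)) (vertices l)"
      have "?I2 \<in> vertices l \<rightarrow>\<^sub>E {..<N}" using I1 V'(1) by (auto simp: PiE_iff simp del: map_sum.simps)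
      moreover have "\<forall>(a, b)\<in>block_rel p2. ?I2 a = ?I2 b" using I3 sub(2) by auto
      moreover have "\<forall>j\<in>{1..l}. ?I2 (Inr j) = S (?I2 (Inl j))" using I5 by simp
      ultimately have "?I2 \<in> csol N S l p2" unfolding csol_def by (intro CollectI conjI)
      then show "f I \<in> csol N S k p1 \<times> csol N S l p2" using 1 unfolding f_def by blast
    qed
    show "h ` (csol N S k p1 \<times> csol N S l p2) \<subseteq> csol N S (k + l) (juxtapose k p1 p2)"
    proof (rule image_subsetI)
      fix J assume "J \<in> csol N S k p1 \<times> csol N S l p2"
      then obtain I1 I2 where J: "J = (I1, I2)" and I1: "I1 \<in> csol N S k p1" and I2: "I2 \<in> csol N S l p2" by blast
      have I1P: "I1 \<in> vertices k \<rightarrow>\<^sub>E {..<N}" and I2P: "I2 \<in> vertices l \<rightarrow>\<^sub>E {..<N}"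
        using I1 I2 unfolding csol_def by blast+
      have I1b: "I1 a = I1 b" if "(a, b) \<in> block_rel p1" for a b using I1 that unfolding csol_def by blast
      have I2b: "I2 a = I2 b" if "(a, b) \<in> block_rel p2" for a b using I2 that unfolding csol_def by blast
      have I1S: "I1 (Inr j) = S (I1 (Inl j))" if "j \<in> {1..k}" for j using I1 that unfolding csol_def by blast
      have I2S: "I2 (Inr j) = S (I2 (Inl j))" if "j \<in> {1..l}" for j using I2 that unfolding csol_def by blast
      have "h (I1, I2) v < N" if v: "v \<in> vertices (k + l)" for v
      proof -
        consider "v \<in> vertices k" | w where "w \<in> vertices l" "v = shift k w"
          using v unfolding vertices_add by blast
        then show ?thesis
        proof cases
          case 1
          then show ?thesis using I1P unfolding h1[OF 1] PiE_iff by blast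
        next
          case 2
          then show ?thesis using I2P unfolding 2(2) h2[OF 2(1)] PiE_iff by blast
        qed
      qed
      then have "h (I1, I2) \<in> vertices (k + l) \<rightarrow>\<^sub>E {..<N}" by (auto simp: PiE_iff h_def)
      moreover have "\<forall>(a, b)\<in>block_rel p1. h (I1, I2) a = h (I1, I2) b"
      proof clarify
        fix a b assume ab: "(a, b) \<in> block_rel p1"
        then have "a \<in> vertices k" "b \<in> vertices k" using sub(1) by auto
        then show "h (I1, I2) a = h (I1, I2) b" using I1b[OF ab] by (simp only: h1)
      qed
      moreover have "\<forall>(a, b)\<in>block_rel p2. h (I1, I2) (shift k a) = h (I1, I2) (shift k b)"
      proof clarify
        fix a b assume ab: "(a, b) \<in> block_rel p2"
        then have "a \<in> vertices l" "b \<in> vertices l" using sub(2) by auto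
        then show "h (I1, I2) (shift k a) = h (I1, I2) (shift k b)" using I2b[OF ab] by (simp only: h2)
      qed
      moreover have "\<forall>j\<in>{1..k}. h (I1, I2) (Inr j) = S (h (I1, I2) (Inl j))"
      proof
        fix j assume j: "j \<in> {1..k}"
        then have "Inr j \<in> vertices k" "Inl j \<in> vertices k" by auto
        then show "h (I1, I2) (Inr j) = S (h (I1, I2) (Inl j))" using I1S[OF j] by (simp only: h1)
      qed
      moreover have "\<forall>j\<in>{1..l}. h (I1, I2) (shift k (Inr j)) = S (h (I1, I2) (shift k (Inl j)))"
      proof
        fix j assume "j \<in> {1..l}"
        then have "Inr j \<in> vertices l" "Inl j \<in> vertices l" "I2 (Inr j) = S (I2 (Inl j))"
          using I2S by auto
        then show "h (I1, I2) (shift k (Inr j)) = S (h (I1, I2) (shift k (Inl j)))" by (simp only: h2)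
      qed
      ultimately show "h J \<in> csol N S (k + l) (juxtapose k p1 p2)" unfolding J cs by (intro conjI)
    qed
  qed
  then show ?thesis by (simp add: bij_betw_same_card card_cartesian_product)
qed

lemma moment_juxtapose:
  assumes p: "p1 \<in> diagrams k" "p2 \<in> diagrams l" and S: "S permutes {..<N}"
  shows "moment (k + l) (juxtapose k p1 p2) (permutation_matrix N S) =
    moment k p1 (permutation_matrix N S) * moment l p2 (permutation_matrix N S)"
  unfolding moment_csol[OF juxtapose_diagrams[OF p] S] moment_csol[OF p(1) S] moment_csol[OF p(2) S]
    card_csol_juxtapose[OF p] by simp

subsection \<open>Sequences of conjugacy classes\<close>

lemma
  assumes C: "conjugacy_class N C"
  shows conjugacy_class_nonempty: "C \<noteq> {}"
    and conjugacy_class_permutes: "s \<in> C \<Longrightarrow> s permutes {..<N}"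
    and conjugacy_class_conj: "s \<in> C \<Longrightarrow> t permutes {..<N} \<Longrightarrow> t \<circ> s \<circ> inv_into UNIV t \<in> C"
    and conjugacy_class_conjugate: "s \<in> C \<Longrightarrow> s' \<in> C \<Longrightarrow> \<exists>t. t permutes {..<N} \<and> s' = t \<circ> s \<circ> inv_into UNIV t"
proof -
  obtain r where r: "r permutes {..<N}"
    and C: "C = {t \<circ> r \<circ> inv_into UNIV t |t. t permutes {..<N}}"
    using C unfolding conjugacy_class_def Sym_def by auto
  show "C \<noteq> {}" unfolding C using permutes_id by blast
  show "s permutes {..<N}" if s: "s \<in> C"
  proof -
    obtain t where t: "t permutes {..<N}" "s = t \<circ> r \<circ> inv_into UNIV t" using s unfolding C by blast
    show ?thesis unfolding t(2) by (intro permutes_compose permutes_inv t(1) r)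
  qed
  show "t \<circ> s \<circ> inv_into UNIV t \<in> C" if s: "s \<in> C" and t: "t permutes {..<N}"
  proof -
    obtain u where u: "u permutes {..<N}" "s = u \<circ> r \<circ> inv_into UNIV u" using s unfolding C by blast
    have "t \<circ> s \<circ> inv_into UNIV t = (t \<circ> u) \<circ> r \<circ> inv_into UNIV (t \<circ> u)"
      unfolding u(2) o_inv_distrib[OF permutes_bij[OF t] permutes_bij[OF u(1)]] by (simp only: o_assoc)
    then show ?thesis unfolding C using permutes_compose[OF u(1) t] by blast
  qed
  show "\<exists>t. t permutes {..<N} \<and> s' = t \<circ> s \<circ> inv_into UNIV t" if s: "s \<in> C" and s': "s' \<in> C"
  proof -
    obtain u where u: "u permutes {..<N}" "s = u \<circ> r \<circ> inv_into UNIV u" using s unfolding C by blast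
    obtain v where v: "v permutes {..<N}" "s' = v \<circ> r \<circ> inv_into UNIV v" using s' unfolding C by blast
    note uu = inv_permutes_apply[OF u(1)]
    let ?t = "v \<circ> inv_into UNIV u"
    have t: "?t permutes {..<N}" by (intro permutes_compose permutes_inv u(1) v(1))
    have "inv_into UNIV ?t = u \<circ> inv_into UNIV v"
      using o_inv_distrib[OF permutes_bij[OF v(1)] permutes_bij[OF permutes_inv[OF u(1)]]]
      unfolding permutes_inv_inv[OF u(1)] .
    then have "?t \<circ> s \<circ> inv_into UNIV ?t = s'"
      unfolding u(2) v(2) by (simp add: fun_eq_iff uu)
    then show ?thesis using t by metis
  qed
qed

lemma fixed_count_periods:
  assumes s: "s permutes {..<N}" and m: "m \<ge> 1"
  shows "fixed_count N s m = (\<Sum>i\<in>{i. i dvd m}. card {j\<in>{..<N}. least_power s j = i})"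
proof -
  have "permutation s" using s finite_lessThan permutation_permutes by blast
  then have "{x\<in>{..<N}. (s ^^ m) x = x} = (\<Union>i\<in>{i. i dvd m}. {j\<in>{..<N}. least_power s j = i})"
    by (simp only: least_power_dvd[symmetric]) blast
  moreover have "finite {i. i dvd m}" using m by simp
  ultimately show ?thesis
    unfolding fixed_count_def by (simp only:, subst card_UN_disjoint) auto
qed

lemma fixed_count_le: "fixed_count N S k \<le> N"
proof -
  have "{x\<in>{..<N}. (S ^^ k) x = x} \<subseteq> {..<N}" by blast
  from card_mono[OF finite_lessThan this] show ?thesis unfolding fixed_count_def by simp
qed

text \<open>For the rates, the fixed points of \<open>s ^^ m\<close> with m \<ge> 1 are sorted by
  period. Period 1 accounts for N minus the moved points, so the expression in
  \<open>fixed_rate\<close> is the sum of the ratios \<open>period_count / nonfixed_count\<close>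
  over the divisors i \<ge> 2 of m, minus 1.\<close>

lemma class_sequence_of_classes:
  assumes C: "\<And>N. N \<ge> 2 \<Longrightarrow> conjugacy_class N (C N)" and nontriv: "\<And>N. N \<ge> 2 \<Longrightarrow> C N \<noteq> {id}"
    and conv: "classes_converge_to C l \<alpha>"
  shows "class_sequence C (\<lambda>N. nonfixed_count N (C N)) \<alpha>"
proof -
  define s where "s N = (SOME \<sigma>. \<sigma> \<in> C N)" for N
  have s: "s N \<in> C N" if "N \<ge> 2" for N
    unfolding s_def using conjugacy_class_nonempty[OF C[OF that]] by (simp add: some_in_eq)
  have sp: "s N permutes {..<N}" if "N \<ge> 2" for N by (rule conjugacy_class_permutes[OF C[OF that] s[OF that]])
  have pc: "period_count N (C N) i = card {j\<in>{..<N}. least_power (s N) j = i}" for N i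
    unfolding period_count_def s_def ..
  have fc: "fixed_count N u m = fixed_count N (s N) m" if N: "N \<ge> 2" and u: "u \<in> C N" for N u m
  proof -
    obtain t where "t permutes {..<N}" "u = t \<circ> s N \<circ> inv_into UNIV t"
      using conjugacy_class_conjugate[OF C[OF N] s[OF N] u] by blast
    then show ?thesis using fixed_count_conj by simp
  qed
  have pc1: "period_count N (C N) 1 = fixed_count N (s N) 1" if N: "N \<ge> 2" for N
    unfolding pc fixed_count_periods[OF sp[OF N] order_refl] by simp
  note le = fixed_count_le
  have support: "card {x\<in>{..<N}. u x \<noteq> x} = N - fixed_count N u 1" for N u
  proof -
    have "{x\<in>{..<N}. u x \<noteq> x} = {..<N} - {x\<in>{..<N}. (u ^^ 1) x = x}" by auto
    moreover have sub: "{x\<in>{..<N}. (u ^^ 1) x = x} \<subseteq> {..<N}" by blast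
    ultimately show ?thesis
      unfolding fixed_count_def using card_Diff_subset[OF finite_subset[OF sub finite_lessThan] sub]
      by (simp only: card_lessThan)
  qed
  have dN: "nonfixed_count N (C N) = N - fixed_count N (s N) 1" if "N \<ge> 2" for N
    unfolding nonfixed_count_def pc1[OF that] ..
  \<comment> \<open>A representative that moves nothing is id, and then so are all its conjugates,
    against non-triviality.\<close>
  have dpos: "nonfixed_count N (C N) > 0" if N: "N \<ge> 2" for N
  proof (rule ccontr)
    assume "\<not> nonfixed_count N (C N) > 0"
    then have "card {x\<in>{..<N}. s N x \<noteq> x} = 0" unfolding support dN[OF N] by simp
    then have "{x\<in>{..<N}. s N x \<noteq> x} = {}" by simp
    then have "s N x = x" for x using permutes_not_in[OF sp[OF N], of x] by blast
    then have sid: "s N = id" by (simp add: fun_eq_iff)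
    have "id \<in> C N" using s[OF N] unfolding sid .
    then have "{id} \<subseteq> C N" by (simp only: insert_subset empty_subsetI simp_thms)
    moreover have uid: "u = id" if u: "u \<in> C N" for u
    proof -
      obtain t where t: "t permutes {..<N}" "u = t \<circ> s N \<circ> inv_into UNIV t"
        using conjugacy_class_conjugate[OF C[OF N] s[OF N] u] by blast
      show ?thesis unfolding t(2) sid using inv_permutes_apply(2)[OF t(1)] by (simp add: fun_eq_iff)
    qed
    have "C N \<subseteq> {id}" by (rule subsetI) (simp only: uid singleton_iff)
    ultimately have "C N = {id}" by (simp only: set_eq_subset simp_thms)
    then show False using nontriv[OF N] by contradiction
  qed
  have p1: "(\<lambda>N. real (period_count N (C N) 1) / real N) \<longlonglongrightarrow> 1 - \<alpha>"
    and pi: "\<And>i. i \<ge> 2 \<Longrightarrow> (\<lambda>N. real (period_count N (C N) i) / real (nonfixed_count N (C N))) \<longlonglongrightarrow> l i"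
    using conv unfolding classes_converge_to_def by blast+
  show ?thesis
  proof
    fix N :: nat assume N: "2 \<le> N"
    show "C N \<noteq> {}" by (rule conjugacy_class_nonempty[OF C[OF N]])
    show "0 < nonfixed_count N (C N)" by (rule dpos[OF N])
    show "u permutes {..<N}" if "u \<in> C N" for u by (rule conjugacy_class_permutes[OF C[OF N] that])
    show "t \<circ> u \<circ> inv_into UNIV t \<in> C N" if "u \<in> C N" "t permutes {..<N}" for u t
      by (rule conjugacy_class_conj[OF C[OF N] that])
    show "\<exists>t. t permutes {..<N} \<and> u' = t \<circ> u \<circ> inv_into UNIV t" if "u \<in> C N" "u' \<in> C N" for u u'
      by (rule conjugacy_class_conjugate[OF C[OF N] that])
    show "card {x\<in>{..<N}. u x \<noteq> x} = nonfixed_count N (C N)" if "u \<in> C N" for u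
      unfolding support fc[OF N that] dN[OF N] ..
  next
    have "(\<lambda>N. 1 - real (period_count N (C N) 1) / real N) \<longlonglongrightarrow> 1 - (1 - \<alpha>)"
      by (intro tendsto_diff tendsto_const p1)
    moreover have "\<forall>\<^sub>F N in sequentially. 1 - real (period_count N (C N) 1) / real N = real (nonfixed_count N (C N)) / real N"
    proof (rule eventually_sequentiallyI[of 2])
      fix N :: nat assume N: "2 \<le> N"
      show "1 - real (period_count N (C N) 1) / real N = real (nonfixed_count N (C N)) / real N"
        unfolding dN[OF N] pc1[OF N] of_nat_diff[OF le] using N by (simp add: field_simps)
    qed
    ultimately show "(\<lambda>N. real (nonfixed_count N (C N)) / real N) \<longlonglongrightarrow> \<alpha>"
      by (simp add: filterlim_cong[OF refl refl] tendsto_cong)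
  next
    fix m
    have avg: "avg (C N) (\<lambda>u. fixed_fraction N u m) = fixed_fraction N (s N) m" if N: "N \<ge> 2" for N
    proof (rule avg_eqI)
      show "finite (C N)"
        by (rule finite_subset[of _ "{u. u permutes {..<N}}"])
          (use conjugacy_class_permutes[OF C[OF N]] in \<open>auto simp: finite_permutations\<close>)
    qed (use conjugacy_class_nonempty[OF C[OF N]] fc[OF N] in \<open>auto simp: fixed_fraction_def\<close>)
    show "convergent (\<lambda>N. real N / real (nonfixed_count N (C N)) * (avg (C N) (\<lambda>u. fixed_fraction N u m) - 1))"
    proof (cases "m = 0")
      case True
      show ?thesis
      proof (rule convergent_eventually_eq[OF convergent_const[of 0]])
        show "\<forall>\<^sub>F N in sequentially. 0 = real N / real (nonfixed_count N (C N)) * (avg (C N) (\<lambda>u. fixed_fraction N u m) - 1)"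
          by (rule eventually_sequentiallyI[of 2]) (simp only: avg, simp add: True fixed_fraction_def fixed_count_def)
      qed
    next
      case False
      let ?D = "{i. i dvd m} - {1}"
      have fin: "finite {i. i dvd m}" using False by simp
      have "(\<lambda>N. (\<Sum>i\<in>?D. real (period_count N (C N) i) / real (nonfixed_count N (C N))) - 1) \<longlonglongrightarrow> (\<Sum>i\<in>?D. l i) - 1"
      proof (intro tendsto_diff tendsto_const tendsto_sum pi)
        fix i assume "i \<in> ?D"
        then have "i \<noteq> 0" "i \<noteq> 1" using False by auto
        then show "2 \<le> i" by linarith
      qed
      moreover have "\<forall>\<^sub>F N in sequentially. (\<Sum>i\<in>?D. real (period_count N (C N) i) / real (nonfixed_count N (C N))) - 1 =
          real N / real (nonfixed_count N (C N)) * (avg (C N) (\<lambda>u. fixed_fraction N u m) - 1)"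
      proof (rule eventually_sequentiallyI[of 2])
        fix N :: nat assume N: "2 \<le> N"
        let ?d = "real (nonfixed_count N (C N))"
        have "fixed_count N (s N) m = (\<Sum>i\<in>{i. i dvd m}. period_count N (C N) i)"
          unfolding pc using fixed_count_periods[OF sp[OF N], of m] False by simp
        also have "\<dots> = period_count N (C N) 1 + (\<Sum>i\<in>?D. period_count N (C N) i)"
          by (rule sum.remove[OF fin]) simp
        finally have "real (fixed_count N (s N) m) = real (period_count N (C N) 1) + (\<Sum>i\<in>?D. real (period_count N (C N) i))"
          by simp
        moreover have "?d = real N - real (period_count N (C N) 1)"
          unfolding dN[OF N] pc1[OF N] of_nat_diff[OF le] ..
        ultimately have X: "(\<Sum>i\<in>?D. real (period_count N (C N) i)) = real (fixed_count N (s N) m) - real N + ?d" by simp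
        show "(\<Sum>i\<in>?D. real (period_count N (C N) i) / ?d) - 1 =
            real N / ?d * (avg (C N) (\<lambda>u. fixed_fraction N u m) - 1)"
          unfolding avg[OF N] unfolding fixed_fraction_def sum_divide_distrib[symmetric] X
          using dpos[OF N] N by (simp add: field_simps)
      qed
      ultimately show ?thesis by (rule convergent_eventually_eq[OF convergentI])
    qed
  qed
qed

subsection \<open>Concentrated laws on the symmetric group\<close>

lemma fixed_fraction_bounds: "0 \<le> fixed_fraction N S k" "fixed_fraction N S k \<le> 1"
  unfolding fixed_fraction_def using fixed_count_le[of N S k] by (auto simp: divide_le_eq_1)

abbreviation eigd :: "nat \<Rightarrow> (nat \<Rightarrow> nat) \<Rightarrow> complex measure" where
  "eigd N S \<equiv> circle_eigenvalue_distribution (permutation_matrix N S)"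

lemma finite_Sym: "finite (Sym N)"
  unfolding Sym_def by (simp add: finite_permutations)

locale permutation_laws =
  fixes q :: "nat \<Rightarrow> (nat \<Rightarrow> nat) pmf" and m :: "nat \<Rightarrow> real"
  assumes supp: "N \<ge> 2 \<Longrightarrow> set_pmf (q N) \<subseteq> Sym N"
    and mean: "(\<lambda>N. measure_pmf.expectation (q N) (\<lambda>S. fixed_fraction N S k)) \<longlonglongrightarrow> m k"
begin

lemma integrable: "N \<ge> 2 \<Longrightarrow> integrable (measure_pmf (q N)) (f :: _ \<Rightarrow> 'b::{banach, second_countable_topology})"
  by (rule integrable_measure_pmf_finite[OF finite_subset[OF supp finite_Sym]])

lemma m_bounds: "0 \<le> m k" "m k \<le> 1"
proof -
  have e: "\<forall>\<^sub>F N in sequentially. 0 \<le> measure_pmf.expectation (q N) (\<lambda>S. fixed_fraction N S k) \<and>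
      measure_pmf.expectation (q N) (\<lambda>S. fixed_fraction N S k) \<le> 1"
  proof (rule eventually_sequentiallyI[of 2])
    fix N :: nat assume N: "2 \<le> N"
    have "measure_pmf.expectation (q N) (\<lambda>S. fixed_fraction N S k) \<le> measure_pmf.expectation (q N) (\<lambda>S. 1)"
      by (rule integral_mono[OF integrable[OF N] integrable[OF N]]) (rule fixed_fraction_bounds)
    moreover have "0 \<le> measure_pmf.expectation (q N) (\<lambda>S. fixed_fraction N S k)"
      by (rule Bochner_Integration.integral_nonneg) (rule fixed_fraction_bounds)
    ultimately show "0 \<le> measure_pmf.expectation (q N) (\<lambda>S. fixed_fraction N S k) \<and>
      measure_pmf.expectation (q N) (\<lambda>S. fixed_fraction N S k) \<le> 1" by simp
  qed
  show "0 \<le> m k" by (rule tendsto_lowerbound[OF mean]) (use e in \<open>auto elim: eventually_mono\<close>)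
  show "m k \<le> 1" by (rule tendsto_upperbound[OF mean]) (use e in \<open>auto elim: eventually_mono\<close>)
qed

text \<open>An eigenvalue chosen uniformly from a random S has the means of the fixed fractions as
  its moments, so \<open>limit_measure\<close> applies to these averaged laws. The shift by 2 makes
  the support condition available for every index.\<close>

lemma ex_limit_measure: "\<exists>\<mu>. has_moments \<mu> m"
proof (rule limit_measure[where a = "\<lambda>N k. measure_pmf.expectation (q (N + 2)) (\<lambda>S. fixed_fraction (N + 2) S k)"
    and p = "\<lambda>N. bind_pmf (q (N + 2)) (eig_pmf (N + 2))"])
  have perm: "S permutes {..<N + 2}" if "S \<in> Sym (N + 2)" for S N using that unfolding Sym_def by blast
  have S2: "set_pmf (q (N + 2)) \<subseteq> Sym (N + 2)" for N by (rule supp) simp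
  fix N k
  show "set_pmf (bind_pmf (q (N + 2)) (eig_pmf (N + 2))) \<subseteq> unit_circle"
    unfolding set_bind_pmf using set_eig_pmf[of "N + 2"] S2 perm by fastforce
  have "measure_pmf.expectation (bind_pmf (q (N + 2)) (eig_pmf (N + 2))) (\<lambda>z. z ^ k) =
      (\<Sum>S\<in>Sym (N + 2). pmf (q (N + 2)) S *\<^sub>R measure_pmf.expectation (eig_pmf (N + 2) S) (\<lambda>z. z ^ k))"
    by (rule pmf_expectation_bind[OF finite_Sym _ S2]) (rule finite_eig_pmf, simp, rule perm)
  also have "\<dots> = (\<Sum>S\<in>Sym (N + 2). of_real (pmf (q (N + 2)) S * fixed_fraction (N + 2) S k))"
  proof (rule sum.cong[OF refl])
    fix S assume "S \<in> Sym (N + 2)"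
    then have "measure_pmf.expectation (eig_pmf (N + 2) S) (\<lambda>z. z ^ k) = of_real (fixed_fraction (N + 2) S k)"
      by (intro eig_pmf_power perm) simp
    then show "pmf (q (N + 2)) S *\<^sub>R measure_pmf.expectation (eig_pmf (N + 2) S) (\<lambda>z. z ^ k) =
        of_real (pmf (q (N + 2)) S * fixed_fraction (N + 2) S k)"
      by (simp add: scaleR_conv_of_real)
  qed
  also have "\<dots> = of_real (measure_pmf.expectation (q (N + 2)) (\<lambda>S. fixed_fraction (N + 2) S k))"
    using S2[of N]
    by (subst integral_measure_pmf_real[OF finite_Sym, of _ _ "N + 2"]) (auto simp: mult.commute)
  finally show "measure_pmf.expectation (bind_pmf (q (N + 2)) (eig_pmf (N + 2))) (\<lambda>z. z ^ k) =
      of_real (measure_pmf.expectation (q (N + 2)) (\<lambda>S. fixed_fraction (N + 2) S k))" .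
qed (rule LIMSEQ_ignore_initial_segment[OF mean])

end

section \<open>Laws whose fixed fractions have vanishing variance\<close>

locale concentrated_laws = permutation_laws +
  assumes variance: "(\<lambda>N. measure_pmf.expectation (q N) (\<lambda>S. (fixed_fraction N S k)\<^sup>2)
      - (measure_pmf.expectation (q N) (\<lambda>S. fixed_fraction N S k))\<^sup>2) \<longlonglongrightarrow> 0"
begin

abbreviation ffprod :: "nat multiset \<Rightarrow> nat \<Rightarrow> (nat \<Rightarrow> nat) \<Rightarrow> real" where
  "ffprod ms N S \<equiv> (\<Prod>k\<in>#ms. fixed_fraction N S k)"

abbreviation mprod :: "nat multiset \<Rightarrow> real" where
  "mprod ms \<equiv> (\<Prod>k\<in>#ms. m k)"

lemma mean_square:
  "(\<lambda>N. measure_pmf.expectation (q N) (\<lambda>S. (fixed_fraction N S k - m k)\<^sup>2)) \<longlonglongrightarrow> 0"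
proof -
  let ?E = "\<lambda>N. measure_pmf.expectation (q N) (\<lambda>S. fixed_fraction N S k)"
  let ?V = "\<lambda>N. measure_pmf.expectation (q N) (\<lambda>S. (fixed_fraction N S k)\<^sup>2) - (?E N)\<^sup>2"
  have "(\<lambda>N. ?V N + (?E N - m k)\<^sup>2) \<longlonglongrightarrow> 0 + (m k - m k)\<^sup>2"
    by (intro tendsto_intros variance mean)
  moreover have "\<forall>\<^sub>F N in sequentially. ?V N + (?E N - m k)\<^sup>2 =
      measure_pmf.expectation (q N) (\<lambda>S. (fixed_fraction N S k - m k)\<^sup>2)"
  proof (rule eventually_sequentiallyI[of 2])
    fix N :: nat assume N: "2 \<le> N"
    have "measure_pmf.expectation (q N) (\<lambda>S. (fixed_fraction N S k - m k)\<^sup>2) =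
        measure_pmf.expectation (q N) (\<lambda>S. (fixed_fraction N S k)\<^sup>2 - (2 * m k) * fixed_fraction N S k + (m k)\<^sup>2)"
      by (simp add: power2_diff algebra_simps)
    also have "\<dots> = measure_pmf.expectation (q N) (\<lambda>S. (fixed_fraction N S k)\<^sup>2) - (2 * m k) * ?E N + (m k)\<^sup>2"
      by (subst Bochner_Integration.integral_add[OF integrable[OF N] integrable[OF N]],
          subst Bochner_Integration.integral_diff[OF integrable[OF N] integrable[OF N]]) simp
    finally show "?V N + (?E N - m k)\<^sup>2 =
      measure_pmf.expectation (q N) (\<lambda>S. (fixed_fraction N S k - m k)\<^sup>2)"
      by (simp add: power2_diff)
  qed
  ultimately show ?thesis using Lim_transform_eventually by fastforce
qed

lemma ffprod_bounds: "0 \<le> ffprod ms N S" "ffprod ms N S \<le> 1"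
  by (induction ms) (simp_all add: fixed_fraction_bounds mult_le_one)

text \<open>All factors and their limits lie in [0, 1], so the squared error of a product is at most
  twice the sum of the squared errors of its two factors; mean square convergence passes from single
  fixed fractions to products.\<close>

lemma prod_mean_square:
  "(\<lambda>N. measure_pmf.expectation (q N) (\<lambda>S. (ffprod ms N S - mprod ms)\<^sup>2)) \<longlonglongrightarrow> 0"
proof (induction ms)
  case (add k ms)
  have bound: "(a * b - a' * b')\<^sup>2 \<le> 2 * (a - a')\<^sup>2 + 2 * (b - b')\<^sup>2"
    if "0 \<le> b" "b \<le> 1" "0 \<le> a'" "a' \<le> 1" for a b a' b' :: real
  proof -
    have "a * b - a' * b' = (a - a') * b + a' * (b - b')" by (simp add: algebra_simps)
    then have "(a * b - a' * b')\<^sup>2 \<le> 2 * ((a - a') * b)\<^sup>2 + 2 * (a' * (b - b'))\<^sup>2"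
      using sum_squares_bound[of "(a - a') * b" "a' * (b - b')"] by (simp add: power2_sum)
    also have "((a - a') * b)\<^sup>2 \<le> (a - a')\<^sup>2 * 1"
      unfolding power_mult_distrib using that by (intro mult_left_mono power_le_one) auto
    also have "(a' * (b - b'))\<^sup>2 \<le> 1 * (b - b')\<^sup>2"
      unfolding power_mult_distrib using that by (intro mult_right_mono power_le_one) auto
    finally show ?thesis by simp
  qed
  let ?A = "\<lambda>N. measure_pmf.expectation (q N) (\<lambda>S. (fixed_fraction N S k - m k)\<^sup>2)"
  let ?B = "\<lambda>N. measure_pmf.expectation (q N) (\<lambda>S. (ffprod ms N S - mprod ms)\<^sup>2)"
  have lim: "(\<lambda>N. 2 * ?A N + 2 * ?B N) \<longlonglongrightarrow> 0"
    using tendsto_add[OF tendsto_mult[OF tendsto_const[of 2] mean_square[of k]] tendsto_mult[OF tendsto_const[of 2] add]]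
    by simp
  show ?case
  proof (rule tendsto_sandwich[OF _ _ tendsto_const lim])
    show "\<forall>\<^sub>F N in sequentially. 0 \<le> measure_pmf.expectation (q N) (\<lambda>S. (ffprod (add_mset k ms) N S - mprod (add_mset k ms))\<^sup>2)"
      by (rule always_eventually) (simp add: Bochner_Integration.integral_nonneg)
    show "\<forall>\<^sub>F N in sequentially. measure_pmf.expectation (q N) (\<lambda>S. (ffprod (add_mset k ms) N S - mprod (add_mset k ms))\<^sup>2)
        \<le> 2 * ?A N + 2 * ?B N"
    proof (rule eventually_sequentiallyI[of 2])
      fix N :: nat assume N: "2 \<le> N"
      have "measure_pmf.expectation (q N) (\<lambda>S. (ffprod (add_mset k ms) N S - mprod (add_mset k ms))\<^sup>2) \<le>
          measure_pmf.expectation (q N) (\<lambda>S. 2 * (fixed_fraction N S k - m k)\<^sup>2 + 2 * (ffprod ms N S - mprod ms)\<^sup>2)"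
        by (rule integral_mono[OF integrable[OF N] integrable[OF N]])
          (use bound ffprod_bounds m_bounds in simp)
      also have "\<dots> = 2 * ?A N + 2 * ?B N"
        by (subst Bochner_Integration.integral_add[OF integrable[OF N] integrable[OF N]]) simp
      finally show "measure_pmf.expectation (q N) (\<lambda>S. (ffprod (add_mset k ms) N S - mprod (add_mset k ms))\<^sup>2)
        \<le> 2 * ?A N + 2 * ?B N" .
    qed
  qed
qed simp

lemma deviation_bound:
  fixes f :: "(nat \<Rightarrow> nat) \<Rightarrow> real"
  assumes N: "N \<ge> 2" and e: "e > 0"
  shows "measure_pmf.prob (q N) {S. \<bar>f S - c\<bar> \<ge> e} \<le> measure_pmf.expectation (q N) (\<lambda>S. (f S - c)\<^sup>2) / e\<^sup>2"
proof -
  have "measure_pmf.prob (q N) {S. \<bar>f S - c\<bar> \<ge> e} = measure_pmf.expectation (q N) (indicator {S. \<bar>f S - c\<bar> \<ge> e})"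
    by simp
  also have "\<dots> \<le> measure_pmf.expectation (q N) (\<lambda>S. (f S - c)\<^sup>2 / e\<^sup>2)"
  proof (rule integral_mono[OF integrable[OF N] integrable[OF N]])
    fix S
    show "indicator {S. \<bar>f S - c\<bar> \<ge> e} S \<le> (f S - c)\<^sup>2 / e\<^sup>2"
    proof (cases "\<bar>f S - c\<bar> \<ge> e")
      case True
      then have "e\<^sup>2 \<le> \<bar>f S - c\<bar>\<^sup>2" using e by (intro power_mono) auto
      then show ?thesis using True e by (simp add: le_divide_eq)
    qed simp
  qed
  finally show ?thesis by simp
qed

lemma prod_deviation:
  assumes "e > 0"
  shows "(\<lambda>N. measure_pmf.prob (q N) {S. \<bar>ffprod ms N S - mprod ms\<bar> \<ge> e}) \<longlonglongrightarrow> 0"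
proof (rule tendsto_sandwich[OF _ _ tendsto_const])
  show "(\<lambda>N. measure_pmf.expectation (q N) (\<lambda>S. (ffprod ms N S - mprod ms)\<^sup>2) / e\<^sup>2) \<longlonglongrightarrow> 0"
    using tendsto_divide[OF prod_mean_square[of ms] tendsto_const[of "e\<^sup>2"]] assms by simp
  show "\<forall>\<^sub>F N in sequentially. measure_pmf.prob (q N) {S. \<bar>ffprod ms N S - mprod ms\<bar> \<ge> e}
      \<le> measure_pmf.expectation (q N) (\<lambda>S. (ffprod ms N S - mprod ms)\<^sup>2) / e\<^sup>2"
    by (rule eventually_sequentiallyI[of 2]) (rule deviation_bound[OF _ assms])
qed (auto intro: always_eventually)

lemma prod_mean:
  "(\<lambda>N. measure_pmf.expectation (q N) (ffprod ms N)) \<longlonglongrightarrow> mprod ms"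
proof -
  have "(\<lambda>N. sqrt (measure_pmf.expectation (q N) (\<lambda>S. (ffprod ms N S - mprod ms)\<^sup>2))) \<longlonglongrightarrow> sqrt 0"
    by (intro tendsto_real_sqrt prod_mean_square)
  then have lim: "(\<lambda>N. sqrt (measure_pmf.expectation (q N) (\<lambda>S. (ffprod ms N S - mprod ms)\<^sup>2))) \<longlonglongrightarrow> 0" by simp
  have "(\<lambda>N. measure_pmf.expectation (q N) (ffprod ms N) - mprod ms) \<longlonglongrightarrow> 0"
  proof (rule Lim_null_comparison[OF _ lim], rule eventually_sequentiallyI[of 2])
    fix N :: nat assume N: "2 \<le> N"
    let ?f = "\<lambda>S. ffprod ms N S - mprod ms"
    have eq: "measure_pmf.expectation (q N) (ffprod ms N) - mprod ms = measure_pmf.expectation (q N) ?f"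
      by (subst Bochner_Integration.integral_diff[OF integrable[OF N] integrable[OF N]]) simp
    let ?e = "measure_pmf.expectation (q N) ?f"
    \<comment> \<open>Jensen's inequality for the square, from the nonnegativity of the variance of
      \<open>?f\<close>.\<close>
    have "0 \<le> measure_pmf.expectation (q N) (\<lambda>S. (?f S - ?e)\<^sup>2)"
      by (rule Bochner_Integration.integral_nonneg) simp
    also have "\<dots> = measure_pmf.expectation (q N) (\<lambda>S. (?f S)\<^sup>2 - (2 * ?e) * ?f S + ?e\<^sup>2)"
      by (rule Bochner_Integration.integral_cong[OF refl]) (simp add: power2_diff)
    also have "\<dots> = measure_pmf.expectation (q N) (\<lambda>S. (?f S)\<^sup>2) - (2 * ?e) * ?e + ?e\<^sup>2"
      by (subst Bochner_Integration.integral_add[OF integrable[OF N] integrable[OF N]],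
          subst Bochner_Integration.integral_diff[OF integrable[OF N] integrable[OF N]],
          subst Bochner_Integration.integral_mult_right_zero) simp
    finally have "?e\<^sup>2 \<le> measure_pmf.expectation (q N) (\<lambda>S. (?f S)\<^sup>2)" by (simp add: power2_eq_square)
    then have "sqrt (?e\<^sup>2) \<le> sqrt (measure_pmf.expectation (q N) (\<lambda>S. (?f S)\<^sup>2))" by (rule real_sqrt_le_mono)
    then show "norm (measure_pmf.expectation (q N) (ffprod ms N) - mprod ms)
        \<le> sqrt (measure_pmf.expectation (q N) (\<lambda>S. (?f S)\<^sup>2))" unfolding eq by simp
  qed
  then show ?thesis by (rule LIM_zero_cancel)
qed

text \<open>A neighbourhood of \<mu> contains all measures with finitely many moments close to those
  of \<mu>, so leaving it forces one of finitely many fixed fractions to deviate, and each such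
  event becomes improbable.\<close>

lemma escape_probability:
  assumes \<mu>: "has_moments \<mu> m" and V: "openin (weak_topology unit_circle) V" "\<mu> \<in> V"
  shows "(\<lambda>N. measure_pmf.prob (q N) {S. eigd N S \<notin> V}) \<longlonglongrightarrow> 0"
proof -
  obtain K e where e: "e > 0"
    and near: "\<forall>\<nu> m'. has_moments \<nu> m' \<and> (\<forall>i\<le>K. \<bar>m' i - m i\<bar> < e) \<longrightarrow> \<nu> \<in> V"
    using weak_neighbourhood[OF V \<mu>] by blast
  let ?A = "\<lambda>N i. {S. \<bar>ffprod {#i#} N S - mprod {#i#}\<bar> \<ge> e}"
  have "(\<lambda>N. \<Sum>i\<le>K. measure_pmf.prob (q N) (?A N i)) \<longlonglongrightarrow> (\<Sum>i\<le>K. 0)"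
    by (rule tendsto_sum) (rule prod_deviation[OF e])
  then have lim: "(\<lambda>N. \<Sum>i\<le>K. measure_pmf.prob (q N) (?A N i)) \<longlonglongrightarrow> 0" by simp
  show ?thesis
  proof (rule tendsto_sandwich[OF _ _ tendsto_const lim])
    show "\<forall>\<^sub>F N in sequentially. measure_pmf.prob (q N) {S. eigd N S \<notin> V} \<le> (\<Sum>i\<le>K. measure_pmf.prob (q N) (?A N i))"
    proof (rule eventually_sequentiallyI[of 2])
      fix N :: nat assume N: "2 \<le> N"
      have "measure_pmf.prob (q N) {S. eigd N S \<notin> V} \<le> measure_pmf.prob (q N) (\<Union>i\<le>K. ?A N i)"
      proof (rule measure_pmf.finite_measure_mono_AE)
        show "AE S in q N. S \<in> {S. eigd N S \<notin> V} \<longrightarrow> S \<in> (\<Union>i\<le>K. ?A N i)"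
          unfolding AE_measure_pmf_iff
        proof (intro ballI impI)
          fix S assume S: "S \<in> set_pmf (q N)" "S \<in> {S. eigd N S \<notin> V}"
          then have "S permutes {..<N}" using supp[OF N] unfolding Sym_def by blast
          then have mom: "has_moments (eigd N S) (fixed_fraction N S)"
            using N by (intro circle_eigenvalue_distribution_has_moments) auto
          show "S \<in> (\<Union>i\<le>K. ?A N i)"
          proof (rule ccontr)
            assume "S \<notin> (\<Union>i\<le>K. ?A N i)"
            then have "\<forall>i\<le>K. \<bar>fixed_fraction N S i - m i\<bar> < e" by (auto simp: not_le)
            then show False using near mom S(2) by blast
          qed
        qed
      qed simp
      also have "\<dots> \<le> (\<Sum>i\<le>K. measure_pmf.prob (q N) (?A N i))"
        by (rule measure_pmf.finite_measure_subadditive_finite) auto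
      finally show "measure_pmf.prob (q N) {S. eigd N S \<notin> V} \<le> (\<Sum>i\<le>K. measure_pmf.prob (q N) (?A N i))" .
    qed
  qed (auto intro: always_eventually)
qed

text \<open>While the eigenvalue distribution stays in V, F is within r / 3 of its value at \<mu>;
  otherwise it is within 2 B, on an event of small probability. The argument works with
  neighbourhoods and uses no metric on the space of measures.\<close>

lemma functional_limit:
  assumes \<mu>: "has_moments \<mu> m" and F: "continuous_map (weak_topology unit_circle) euclideanreal F"
    and B: "\<And>\<nu>. \<nu> \<in> prob_measures_on unit_circle \<Longrightarrow> \<bar>F \<nu>\<bar> \<le> B"
  shows "(\<lambda>N. measure_pmf.expectation (q N) (\<lambda>S. F (eigd N S))) \<longlonglongrightarrow> F \<mu>"
proof (rule LIMSEQ_I)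
  fix r :: real assume r: "r > 0"
  have \<mu>p: "\<mu> \<in> prob_measures_on unit_circle" using \<mu> unfolding has_moments_def by blast
  have B0: "B \<ge> 0" using B[OF \<mu>p] by linarith
  define V where "V = {\<nu> \<in> topspace (weak_topology unit_circle). F \<nu> \<in> ball (F \<mu>) (r / 3)}"
  have V: "openin (weak_topology unit_circle) V"
    unfolding V_def using F by (rule openin_continuous_map_preimage) simp
  have \<mu>V: "\<mu> \<in> V" unfolding V_def topspace_weak_topology using \<mu>p r by simp
  have "(\<lambda>N. 2 * B * measure_pmf.prob (q N) {S. eigd N S \<notin> V}) \<longlonglongrightarrow> 2 * B * 0"
    by (intro tendsto_mult tendsto_const escape_probability[OF \<mu> V \<mu>V])
  then have "\<forall>\<^sub>F N in sequentially. 2 * B * measure_pmf.prob (q N) {S. eigd N S \<notin> V} < r / 3"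
    using r by (intro order_tendstoD) auto
  then obtain N0 where N0: "\<And>N. N \<ge> N0 \<Longrightarrow> 2 * B * measure_pmf.prob (q N) {S. eigd N S \<notin> V} < r / 3"
    unfolding eventually_sequentially by blast
  show "\<exists>no. \<forall>N\<ge>no. norm (measure_pmf.expectation (q N) (\<lambda>S. F (eigd N S)) - F \<mu>) < r"
  proof (intro exI[of _ "max 2 N0"] allI impI)
    fix N assume "max 2 N0 \<le> N"
    then have N: "2 \<le> N" "N0 \<le> N" by simp_all
    have eq: "measure_pmf.expectation (q N) (\<lambda>S. F (eigd N S)) - F \<mu> = measure_pmf.expectation (q N) (\<lambda>S. F (eigd N S) - F \<mu>)"
      by (subst Bochner_Integration.integral_diff[OF integrable[OF N(1)] integrable[OF N(1)]]) simp
    have "\<bar>measure_pmf.expectation (q N) (\<lambda>S. F (eigd N S) - F \<mu>)\<bar> \<le> measure_pmf.expectation (q N) (\<lambda>S. \<bar>F (eigd N S) - F \<mu>\<bar>)"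
      by (rule integral_abs_bound)
    also have "\<dots> \<le> measure_pmf.expectation (q N) (\<lambda>S. r / 3 + 2 * B * indicator {S. eigd N S \<notin> V} S)"
    proof (rule integral_mono_AE[OF integrable[OF N(1)] integrable[OF N(1)]])
      show "AE S in q N. \<bar>F (eigd N S) - F \<mu>\<bar> \<le> r / 3 + 2 * B * indicator {S. eigd N S \<notin> V} S"
        unfolding AE_measure_pmf_iff
      proof
        fix S assume "S \<in> set_pmf (q N)"
        then have "S permutes {..<N}" using supp[OF N(1)] unfolding Sym_def by blast
        then have "has_moments (eigd N S) (fixed_fraction N S)"
          using N by (intro circle_eigenvalue_distribution_has_moments) auto
        then have pr: "eigd N S \<in> prob_measures_on unit_circle" unfolding has_moments_def by blast
        show "\<bar>F (eigd N S) - F \<mu>\<bar> \<le> r / 3 + 2 * B * indicator {S. eigd N S \<notin> V} S"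
        proof (cases "eigd N S \<in> V")
          case True
          then have "dist (F \<mu>) (F (eigd N S)) < r / 3" unfolding V_def by simp
          then show ?thesis using True by (simp add: dist_real_def abs_minus_commute)
        next
          case False
          then show ?thesis using B[OF pr] B[OF \<mu>p] r by simp
        qed
      qed
    qed
    also have "\<dots> = r / 3 + 2 * B * measure_pmf.prob (q N) {S. eigd N S \<notin> V}"
      by (subst Bochner_Integration.integral_add[OF integrable[OF N(1)] integrable[OF N(1)]]) simp
    also have "\<dots> < r" using N0[OF N(2)] r by linarith
    finally show "norm (measure_pmf.expectation (q N) (\<lambda>S. F (eigd N S)) - F \<mu>) < r" unfolding eq by simp
  qed
qed

end

subsection \<open>Poisson mixtures\<close>

lemma tannery_sums:
  fixes a :: "nat \<Rightarrow> nat \<Rightarrow> real"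
  assumes lim: "\<And>n. (\<lambda>N. a N n) \<longlonglongrightarrow> b n" and bound: "\<And>N n. N \<ge> 2 \<Longrightarrow> \<bar>a N n\<bar> \<le> M n"
    and M: "summable M" and sums: "\<And>N. N \<ge> 2 \<Longrightarrow> a N sums s N"
  shows "s \<longlonglongrightarrow> suminf b"
proof -
  have "\<forall>\<^sub>F (n, N) in at_top \<times>\<^sub>F sequentially. norm (a N n) \<le> M n"
    unfolding eventually_prod_filter
    by (intro exI[of _ "\<lambda>_. True"] exI[of _ "\<lambda>N. 2 \<le> N"]) (auto simp: bound eventually_ge_at_top)
  from tannerys_theorem[OF lim this M sequentially_bot]
  have "(\<lambda>N. \<Sum>n. a N n) \<longlonglongrightarrow> suminf b" by blast
  moreover have "\<forall>\<^sub>F N in sequentially. (\<Sum>n. a N n) = s N"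
    by (rule eventually_sequentiallyI[of 2]) (rule sums_unique[OF sums, symmetric])
  ultimately show ?thesis by (rule Lim_transform_eventually)
qed

section \<open>Poisson weights and their first two moments\<close>

definition poisson_weight :: "real \<Rightarrow> nat \<Rightarrow> real" where
  "poisson_weight x n = exp (- x) * x ^ n / fact n"

lemma poisson_weight_nonneg: "x \<ge> 0 \<Longrightarrow> 0 \<le> poisson_weight x n"
  unfolding poisson_weight_def by simp

lemma poisson_sums: "poisson_weight x sums 1"
proof -
  have "(\<lambda>n. exp (- x) * (x ^ n /\<^sub>R fact n)) sums (exp (- x) * exp x)"
    by (intro sums_mult exp_converges)
  then show ?thesis unfolding poisson_weight_def by (simp add: exp_minus divide_inverse ac_simps)
qed

lemma poisson_sums_Suc: "poisson_weight x (Suc n) * real (Suc n) = x * poisson_weight x n"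
  unfolding poisson_weight_def fact_Suc by (simp del: of_nat_Suc)

lemma poisson_sums_first: "(\<lambda>n. poisson_weight x n * real n) sums x"
proof -
  have "(\<lambda>n. poisson_weight x (Suc n) * real (Suc n)) sums x"
    unfolding poisson_sums_Suc using sums_mult[OF poisson_sums, of x x] by simp
  from sums_Suc[OF this] show ?thesis by simp
qed

lemma poisson_sums_second: "(\<lambda>n. poisson_weight x n * (real n)\<^sup>2) sums (x\<^sup>2 + x)"
proof -
  have "(\<lambda>n. x * (poisson_weight x n * real n) + x * poisson_weight x n) sums (x * x + x * 1)"
    by (intro sums_add sums_mult poisson_sums poisson_sums_first)
  moreover have "x * (poisson_weight x n * real n) + x * poisson_weight x n = poisson_weight x (Suc n) * (real (Suc n))\<^sup>2" for n
  proof -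
    have "poisson_weight x (Suc n) * (real (Suc n))\<^sup>2 = (x * poisson_weight x n) * real (Suc n)"
      unfolding poisson_sums_Suc[symmetric] by (simp add: power2_eq_square)
    then show ?thesis by (simp add: algebra_simps)
  qed
  ultimately have "(\<lambda>n. poisson_weight x (Suc n) * (real (Suc n))\<^sup>2) sums (x\<^sup>2 + x)" by (simp add: power2_eq_square)
  from sums_Suc[OF this] show ?thesis by simp
qed

lemma poisson_expectation_sums:
  fixes g :: "nat \<Rightarrow> real"
  assumes r: "r > 0" and B: "\<And>n. \<bar>g n\<bar> \<le> B"
  shows "(\<lambda>n. poisson_weight r n * g n) sums measure_pmf.expectation (poisson_pmf r) g"
proof -
  have int: "integrable (measure_pmf (poisson_pmf r)) g"
    by (rule measure_pmf.integrable_const_bound[of _ B]) (use B in auto)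
  have "integrable (count_space UNIV) (\<lambda>n. pmf (poisson_pmf r) n *\<^sub>R g n)"
    using int unfolding measure_pmf_eq_density by (subst (asm) integrable_density) auto
  from sums_integral_count_space_nat[OF this]
  have "(\<lambda>n. pmf (poisson_pmf r) n *\<^sub>R g n) sums (\<integral>n. pmf (poisson_pmf r) n *\<^sub>R g n \<partial>count_space UNIV)" .
  moreover have "(\<integral>n. pmf (poisson_pmf r) n *\<^sub>R g n \<partial>count_space UNIV) = measure_pmf.expectation (poisson_pmf r) g"
    unfolding measure_pmf_eq_density by (subst integral_density) auto
  ultimately show ?thesis by (simp add: pmf_poisson[OF r] poisson_weight_def ac_simps)
qed

section \<open>The walk after a fixed number of steps, and the two series for its law\<close>

context class_sequence
begin

primrec walk_pmf :: "nat \<Rightarrow> nat \<Rightarrow> (nat \<Rightarrow> nat) pmf" where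
  "walk_pmf 0 N = return_pmf id"
| "walk_pmf (Suc n) N = bind_pmf (walk_pmf n N) (\<lambda>S. map_pmf (\<lambda>s. s \<circ> S) (pmf_of_set (C N)))"

lemma set_walk_pmf:
  assumes N: "N \<ge> 2"
  shows "set_pmf (walk_pmf n N) \<subseteq> Sym N"
proof (induction n)
  case 0
  then show ?case by (simp add: Sym_def permutes_id[unfolded id_def] id_def)
next
  case (Suc n)
  have "s \<circ> S \<in> Sym N" if "S \<in> Sym N" "s \<in> C N" for s S
    using that C_permutes[OF N] permutes_compose unfolding Sym_def by blast
  then show ?case using Suc by (auto simp: set_pmf_of_set[OF C_nonempty[OF N] C_finite[OF N]])
qed

lemma walk_pmf_expectation:
  assumes N: "N \<ge> 2"
  shows "measure_pmf.expectation (walk_pmf n N) f = (Qop N ^^ n) f id"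
proof (induction n arbitrary: f)
  case (Suc n)
  have step: "measure_pmf.expectation (map_pmf (\<lambda>s. s \<circ> S) (pmf_of_set (C N))) f = Qop N f S" for S
    unfolding integral_map_pmf integral_pmf_of_set[OF C_nonempty[OF N] C_finite[OF N]] Qop_def avg_def ..
  have "measure_pmf.expectation (walk_pmf (Suc n) N) f =
      (\<Sum>S\<in>Sym N. pmf (walk_pmf n N) S *\<^sub>R measure_pmf.expectation (map_pmf (\<lambda>s. s \<circ> S) (pmf_of_set (C N))) f)"
    unfolding walk_pmf.simps
    by (rule pmf_expectation_bind[OF finite_Sym _ set_walk_pmf[OF N]])
      (simp add: set_pmf_of_set[OF C_nonempty[OF N] C_finite[OF N]] C_finite[OF N])
  also have "\<dots> = (\<Sum>S\<in>Sym N. Qop N f S * pmf (walk_pmf n N) S)" unfolding step by (simp add: mult.commute)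
  also have "\<dots> = measure_pmf.expectation (walk_pmf n N) (Qop N f)"
    by (rule integral_measure_pmf_real[OF finite_Sym, symmetric]) (use set_walk_pmf[OF N] in blast)
  also have "\<dots> = (Qop N ^^ n) (Qop N f) id" by (rule Suc.IH)
  finally show ?case by (simp only: funpow_Suc_right comp_apply)
qed simp

lemma tau_one: "N \<ge> 2 \<Longrightarrow> tau N 1 = 1 - real (d N) / real N"
proof -
  assume N: "N \<ge> 2"
  obtain s where s: "s \<in> C N" using C_nonempty[OF N] by blast
  have sub: "{x\<in>{..<N}. (s ^^ 1) x = x} \<subseteq> {..<N}" by blast
  have "{x\<in>{..<N}. s x \<noteq> x} = {..<N} - {x\<in>{..<N}. (s ^^ 1) x = x}" by auto
  then have "d N = N - fixed_count N s 1"
    unfolding d_support[OF N s, symmetric] fixed_count_def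
    using card_Diff_subset[OF finite_subset[OF sub finite_lessThan] sub] by (simp only: card_lessThan)
  then have "real (d N) = real N - real (fixed_count N s 1)" using fixed_count_le[of N s 1] by simp
  then show ?thesis
    unfolding fixed_fraction_tau[OF N s, symmetric] fixed_fraction_def using N by (simp add: field_simps)
qed

lemma Qop_iter_bound:
  assumes N: "N \<ge> 2" and B: "\<And>y. y \<in> Sym N \<Longrightarrow> \<bar>f y\<bar> \<le> B"
  shows "y \<in> Sym N \<Longrightarrow> \<bar>(Qop N ^^ n) f y\<bar> \<le> B"
proof (induction n arbitrary: y)
  case (Suc n)
  have "s \<circ> y \<in> Sym N" if "s \<in> C N" for s
    using Suc.prems C_permutes[OF N that] permutes_compose unfolding Sym_def by blast
  then show ?case
    unfolding funpow.simps comp_apply Qop_def[of N "(Qop N ^^ n) f"]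
    by (intro avg_abs_le[OF C_finite[OF N] C_nonempty[OF N]] Suc.IH)
qed (use B in simp)

text \<open>For fixed N this makes the exponential series converge for every f; a bound uniform in N
  is the matter of \<open>gen_iter_bound\<close>.\<close>

lemma gen_iter_crude_bound:
  assumes N: "N \<ge> 2" and B: "\<And>y. y \<in> Sym N \<Longrightarrow> \<bar>f y\<bar> \<le> B"
  shows "y \<in> Sym N \<Longrightarrow> \<bar>(gen N ^^ n) f y\<bar> \<le> B * (2 * rate N) ^ n"
proof (induction n arbitrary: y)
  case (Suc n)
  let ?g = "(gen N ^^ n) f" and ?b = "B * (2 * rate N) ^ n"
  have "\<bar>(Qop N ^^ 1) ?g y\<bar> \<le> ?b" by (rule Qop_iter_bound[OF N Suc.IH Suc.prems])
  then have "\<bar>Qop N ?g y\<bar> \<le> ?b" by simp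
  then have "\<bar>Qop N ?g y - ?g y\<bar> \<le> 2 * ?b" using Suc.IH[OF Suc.prems] by linarith
  then have "rate N * \<bar>Qop N ?g y - ?g y\<bar> \<le> rate N * (2 * ?b)"
    using rate_pos[OF N] by (intro mult_left_mono) auto
  then show ?case
    unfolding funpow.simps comp_apply gen_def[of N ?g] abs_mult using rate_pos[OF N] by (simp add: ac_simps)
qed (use B in simp)

text \<open>One law with two expansions: the Poisson mixture over numbers of steps, used for
  variances and for the limiting mixture, and the exponential series of the generator, used for
  means when the rate may diverge.\<close>

lemma random_walk_series:
  assumes N: "N \<ge> 2" and walk: "random_walk N (C N) M S" and d: "d N = nonfixed_count N (C N)" and t: "t > 0"
  shows "\<exists>l. prob_space M \<and> S t \<in> M \<rightarrow>\<^sub>M count_space (Sym N) \<and> set_pmf l \<subseteq> Sym N \<and>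
    (\<forall>f :: (nat \<Rightarrow> nat) \<Rightarrow> real. (\<integral>\<omega>. f (S t \<omega>) \<partial>M) = measure_pmf.expectation l f) \<and>
    (\<forall>f. (\<lambda>n. poisson_weight (rate N * t) n * (Qop N ^^ n) f id) sums measure_pmf.expectation l f) \<and>
    (\<forall>f. (\<lambda>n. (gen N ^^ n) f id * t ^ n / fact n) sums measure_pmf.expectation l f)"
proof -
  obtain P where P: "prob_space M" "transition_semigroup (Sym N) P" "has_generator (Sym N) P (walk_generator N (C N))"
    "\<And>t. t \<ge> 0 \<Longrightarrow> S t \<in> M \<rightarrow>\<^sub>M count_space (Sym N)"
    "\<And>t f :: (nat \<Rightarrow> nat) \<Rightarrow> real. t \<ge> 0 \<Longrightarrow> (\<integral>\<omega>. f (S t \<omega>) \<partial>M) = measure_pmf.expectation (P t id) f"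
    by (rule random_walk_law[OF walk]) blast
  have "walk_generator N (C N) f y = gen N f y" for f y
  proof -
    have "real (card (C N)) \<noteq> 0" using C_finite[OF N] C_nonempty[OF N] by simp
    then have "1 / real (card (C N)) * (\<Sum>\<sigma>\<in>C N. f (\<sigma> \<circ> y) - f y) = (\<Sum>\<sigma>\<in>C N. f (\<sigma> \<circ> y)) / real (card (C N)) - f y"
      by (simp add: sum_subtractf field_simps)
    then show ?thesis
      unfolding walk_generator_def gen_def rate_def Qop_def avg_def d mult.assoc by (simp only:)
  qed
  then have gen: "walk_generator N (C N) = gen N" by (intro ext)
  interpret fs: finite_semigroup "Sym N" P "gen N"
    by unfold_locales (use P(2,3) finite_Sym in \<open>simp_all only: gen\<close>)
  have id: "id \<in> Sym N" unfolding Sym_def using permutes_id by blast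
  have bound: "\<bar>f y\<bar> \<le> (\<Sum>x\<in>Sym N. \<bar>f x\<bar>)" if "y \<in> Sym N" for f :: "(nat \<Rightarrow> nat) \<Rightarrow> real" and y
    using member_le_sum[of y "Sym N" "\<lambda>x. \<bar>f x\<bar>"] that finite_Sym by simp
  have "(\<lambda>n. poisson_weight (rate N * t) n * (Qop N ^^ n) f id) sums fs.ev t f id" for f
    unfolding poisson_weight_def
  proof (rule fs.ev_poisson[OF t id])
    show "rate N \<ge> 0" using rate_pos[OF N] by simp
    show "gen N g y = rate N * (Qop N g y - g y)" for g y by (rule gen_def)
    show "Qop N (\<lambda>y. c * g y) = (\<lambda>y. c * Qop N g y)" for c g unfolding Qop_def avg_cmult ..
    show "\<bar>(Qop N ^^ n) f y\<bar> \<le> (\<Sum>x\<in>Sym N. \<bar>f x\<bar>)" if "y \<in> Sym N" for n y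
      by (rule Qop_iter_bound[OF N bound that])
  qed
  moreover have "(\<lambda>n. (gen N ^^ n) f id * t ^ n / fact n) sums fs.ev t f id" for f
    by (rule fs.ev_series[OF t id gen_iter_crude_bound[OF N bound]])
  ultimately show ?thesis
    unfolding fs.ev_def using P(1) P(4)[OF less_imp_le[OF t]] P(5)[OF less_imp_le[OF t]] fs.supp[OF less_imp_le[OF t] id]
    by (intro exI[of _ "P t id"] conjI allI)
qed

end

section \<open>The law at time t: concentration for \<alpha> = 0, Poisson mixture for \<alpha> >
  0\<close>

locale walk_law = class_sequence +
  fixes t :: real and law :: "nat \<Rightarrow> (nat \<Rightarrow> nat) pmf"
  assumes t_pos: "t > 0"
    and law_supp: "N \<ge> 2 \<Longrightarrow> set_pmf (law N) \<subseteq> Sym N"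
    and law_poisson: "N \<ge> 2 \<Longrightarrow>
      (\<lambda>n. poisson_weight (rate N * t) n * (Qop N ^^ n) f id) sums measure_pmf.expectation (law N) f"
    and law_gen: "N \<ge> 2 \<Longrightarrow> (\<lambda>n. (gen N ^^ n) f id * t ^ n / fact n) sums measure_pmf.expectation (law N) f"
begin

lemma fixed_fraction_0: "N \<ge> 1 \<Longrightarrow> fixed_fraction N S 0 = 1"
  unfolding fixed_fraction_def fixed_count_def by simp

definition mean_limit :: "nat \<Rightarrow> real" where
  "mean_limit k = lim (\<lambda>N. measure_pmf.expectation (law N) (\<lambda>S. fixed_fraction N S k))"

text \<open>Dominated exchange of limit and series: each term converges, and
  \<open>gen_iter_bound\<close> provides the majorant. The case k = 0 is separate because the cycle
  needs at least one edge.\<close>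

lemma law_mean: "(\<lambda>N. measure_pmf.expectation (law N) (\<lambda>S. fixed_fraction N S k)) \<longlonglongrightarrow> mean_limit k"
proof -
  have "convergent (\<lambda>N. measure_pmf.expectation (law N) (\<lambda>S. fixed_fraction N S k))"
  proof (cases "k = 0")
    case True
    show ?thesis
      by (rule convergent_eventually_eq[OF convergent_const[of 1]], rule eventually_sequentiallyI[of 2])
        (simp add: True fixed_fraction_0)
  next
    case False
    then have k: "k \<ge> 1" by simp
    obtain B K where BK: "\<And>N n. N \<ge> 2 \<Longrightarrow> \<bar>(gen N ^^ n) (\<lambda>S. fixed_fraction N S k) id\<bar> \<le> B * K ^ n"
      by (rule gen_iter_bound[OF k]) blast
    have "(\<lambda>N. measure_pmf.expectation (law N) (\<lambda>S. fixed_fraction N S k)) \<longlonglongrightarrow>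
      (\<Sum>n. lim (\<lambda>N. (gen N ^^ n) (\<lambda>S. fixed_fraction N S k) id) * t ^ n / fact n)"
    proof (rule tannery_sums)
      show "(\<lambda>N. (gen N ^^ n) (\<lambda>S. fixed_fraction N S k) id * t ^ n / fact n) \<longlonglongrightarrow>
          lim (\<lambda>N. (gen N ^^ n) (\<lambda>S. fixed_fraction N S k) id) * t ^ n / fact n" for n
        using convergent_LIMSEQ_iff[THEN iffD1, OF gen_iter_convergent[OF k]] by (intro tendsto_intros) auto
      show "\<bar>(gen N ^^ n) (\<lambda>S. fixed_fraction N S k) id * t ^ n / fact n\<bar> \<le> B * (inverse (fact n) * (K * t) ^ n)"
        if N: "N \<ge> 2" for N n
      proof -
        have "\<bar>(gen N ^^ n) (\<lambda>S. fixed_fraction N S k) id\<bar> * (t ^ n / fact n) \<le> (B * K ^ n) * (t ^ n / fact n)"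
          using t_pos by (intro mult_right_mono BK N) auto
        then show ?thesis using t_pos by (simp add: abs_mult power_mult_distrib divide_inverse ac_simps)
      qed
      show "summable (\<lambda>n. B * (inverse (fact n) * (K * t) ^ n))" by (rule summable_mult[OF summable_exp])
      show "(\<lambda>n. (gen N ^^ n) (\<lambda>S. fixed_fraction N S k) id * t ^ n / fact n) sums
          measure_pmf.expectation (law N) (\<lambda>S. fixed_fraction N S k)" if "N \<ge> 2" for N
        by (rule law_gen[OF that])
    qed
    then show ?thesis by (rule convergentI)
  qed
  then show ?thesis unfolding mean_limit_def convergent_LIMSEQ_iff .
qed

sublocale permutation_laws law mean_limit
  by unfold_locales (rule law_supp, assumption, rule law_mean)

text \<open>Deviations are measured from c, the mean after n0 steps, with n0 the integer part of the
  expected number x of steps. Given n steps, the variance is at most n times \<delta> squared, and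
  the mean is off c by at most |n - n0| times \<delta>. For n with Poisson law, n + (n - n0)^2 has
  mean 2 x + (x - n0)^2, which is at most 2 x + 1.\<close>

lemma law_variance:
  fixes k :: nat
  assumes N: "N \<ge> 2"
  defines "\<delta> \<equiv> real k * real (d N) / real N"
  shows "measure_pmf.expectation (law N) (\<lambda>S. (fixed_fraction N S k)\<^sup>2)
      - (measure_pmf.expectation (law N) (\<lambda>S. fixed_fraction N S k))\<^sup>2 \<le> \<delta>\<^sup>2 * (2 * (rate N * t) + 1)"
proof -
  let ?x = "rate N * t"
  define f where "f n = (Qop N ^^ n) (\<lambda>S. fixed_fraction N S k) id" for n
  define s where "s n = (Qop N ^^ n) (\<lambda>S. (fixed_fraction N S k)\<^sup>2) id" for n
  define E where "E = measure_pmf.expectation (law N) (\<lambda>S. fixed_fraction N S k)"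
  define E2 where "E2 = measure_pmf.expectation (law N) (\<lambda>S. (fixed_fraction N S k)\<^sup>2)"
  define n0 where "n0 = nat \<lfloor>?x\<rfloor>"
  define c where "c = f n0"
  have x: "?x \<ge> 0" using rate_pos[OF N] t_pos by simp
  have n0: "(?x - real n0)\<^sup>2 \<le> 1"
  proof -
    have "real n0 = of_int \<lfloor>?x\<rfloor>" unfolding n0_def using x by simp
    then have "0 \<le> ?x - real n0" "?x - real n0 \<le> 1" by linarith+
    then show ?thesis by (intro power_le_one)
  qed
  have step: "\<bar>f (n + j) - f n\<bar> \<le> real j * \<delta>" for n j
  proof (induction j)
    case (Suc j)
    have "\<bar>f (Suc (n + j)) - f (n + j)\<bar> \<le> \<delta>"
      unfolding f_def \<delta>_def by (rule Qop_iter_step[OF N permutes_id])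
    then show ?case using Suc by (simp add: algebra_simps)
  qed simp
  have dev: "(f n - c)\<^sup>2 \<le> (real n - real n0)\<^sup>2 * \<delta>\<^sup>2" for n
  proof -
    have "\<bar>f n - c\<bar> \<le> \<bar>real n - real n0\<bar> * \<delta>"
    proof (cases "n0 \<le> n")
      case True
      then show ?thesis using step[of n0 "n - n0"] unfolding c_def by simp
    next
      case False
      then show ?thesis using step[of n "n0 - n"] unfolding c_def by (simp add: abs_minus_commute)
    qed
    then have "\<bar>f n - c\<bar>\<^sup>2 \<le> (\<bar>real n - real n0\<bar> * \<delta>)\<^sup>2" by (intro power_mono) auto
    then show ?thesis by (simp add: power_mult_distrib)
  qed
  have var: "s n - (f n)\<^sup>2 \<le> real n * \<delta>\<^sup>2" for n
    unfolding s_def f_def \<delta>_def by (rule Qop_iter_variance_small_class[OF N permutes_id])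
  have le: "s n - 2 * c * f n + c\<^sup>2 \<le> \<delta>\<^sup>2 * (real n + ((real n)\<^sup>2 - 2 * real n0 * real n + (real n0)\<^sup>2))" for n
    using var[of n] dev[of n] by (simp add: power2_diff algebra_simps)
  have sumf: "(\<lambda>n. poisson_weight ?x n * f n) sums E" and sums: "(\<lambda>n. poisson_weight ?x n * s n) sums E2"
    unfolding f_def s_def E_def E2_def by (rule law_poisson[OF N])+
  have L: "(\<lambda>n. poisson_weight ?x n * s n - 2 * c * (poisson_weight ?x n * f n) + c\<^sup>2 * poisson_weight ?x n)
      sums (E2 - 2 * c * E + c\<^sup>2 * 1)"
    by (intro sums_add sums_diff sums_mult sumf sums poisson_sums)
  have R: "(\<lambda>n. \<delta>\<^sup>2 * (poisson_weight ?x n * real n + (poisson_weight ?x n * (real n)\<^sup>2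
        - 2 * real n0 * (poisson_weight ?x n * real n) + (real n0)\<^sup>2 * poisson_weight ?x n)))
      sums (\<delta>\<^sup>2 * (?x + (?x\<^sup>2 + ?x - 2 * real n0 * ?x + (real n0)\<^sup>2 * 1)))"
    by (intro sums_add sums_diff sums_mult poisson_sums poisson_sums_first poisson_sums_second)
  have "E2 - 2 * c * E + c\<^sup>2 * 1 \<le> \<delta>\<^sup>2 * (?x + (?x\<^sup>2 + ?x - 2 * real n0 * ?x + (real n0)\<^sup>2 * 1))"
  proof (rule sums_le[OF _ L R])
    fix n
    have "poisson_weight ?x n * (s n - 2 * c * f n + c\<^sup>2) \<le>
        poisson_weight ?x n * (\<delta>\<^sup>2 * (real n + ((real n)\<^sup>2 - 2 * real n0 * real n + (real n0)\<^sup>2)))"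
      by (rule mult_left_mono[OF le poisson_weight_nonneg[OF x]])
    then show "poisson_weight ?x n * s n - 2 * c * (poisson_weight ?x n * f n) + c\<^sup>2 * poisson_weight ?x n \<le>
        \<delta>\<^sup>2 * (poisson_weight ?x n * real n + (poisson_weight ?x n * (real n)\<^sup>2
        - 2 * real n0 * (poisson_weight ?x n * real n) + (real n0)\<^sup>2 * poisson_weight ?x n))"
      by (simp add: algebra_simps)
  qed
  also have "\<dots> = \<delta>\<^sup>2 * (2 * ?x + (?x - real n0)\<^sup>2)" by (simp add: power2_diff algebra_simps)
  also have "\<dots> \<le> \<delta>\<^sup>2 * (2 * ?x + 1)" using n0 by (intro mult_left_mono) auto
  finally have "E2 - 2 * c * E + c\<^sup>2 \<le> \<delta>\<^sup>2 * (2 * ?x + 1)" by simp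
  moreover have "0 \<le> E\<^sup>2 - 2 * c * E + c\<^sup>2"
    using zero_le_power2[of "E - c"] by (simp add: power2_diff ac_simps)
  ultimately have "E2 - E\<^sup>2 \<le> \<delta>\<^sup>2 * (2 * ?x + 1)" by linarith
  then show ?thesis unfolding E_def E2_def .
qed

lemma variance_nonneg:
  assumes N: "N \<ge> 2" and p: "set_pmf p \<subseteq> Sym N"
  shows "0 \<le> measure_pmf.expectation p (\<lambda>S. (fixed_fraction N S k)\<^sup>2) - (measure_pmf.expectation p (\<lambda>S. fixed_fraction N S k))\<^sup>2"
proof -
  have int: "integrable (measure_pmf p) f" for f :: "_ \<Rightarrow> real"
    by (rule integrable_measure_pmf_finite[OF finite_subset[OF p finite_Sym]])
  have "measure_pmf.expectation p (\<lambda>S. (fixed_fraction N S k)\<^sup>2) - (measure_pmf.expectation p (\<lambda>S. fixed_fraction N S k))\<^sup>2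
      = measure_pmf.variance p (\<lambda>S. fixed_fraction N S k)"
    by (rule measure_pmf.variance_eq[OF int int, symmetric])
  then show ?thesis by simp
qed

text \<open>The factor 2 x + 1 grows like N / d at most and the squared step is of order (d / N)^2,
  so the variance is of order d / N.\<close>

lemma concentrated_law:
  assumes "\<alpha> = 0"
  shows "concentrated_laws law mean_limit"
proof (unfold_locales)
  fix k
  have "(\<lambda>N. 2 * t * (real k)\<^sup>2 * (real (d N) / real N) + (real k)\<^sup>2 * (real (d N) / real N)\<^sup>2) \<longlonglongrightarrow>
      2 * t * (real k)\<^sup>2 * \<alpha> + (real k)\<^sup>2 * \<alpha>\<^sup>2"
    by (intro tendsto_intros d_asymp)
  then have lim: "(\<lambda>N. 2 * t * (real k)\<^sup>2 * (real (d N) / real N) + (real k)\<^sup>2 * (real (d N) / real N)\<^sup>2) \<longlonglongrightarrow> 0"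
    unfolding assms by simp
  show "(\<lambda>N. measure_pmf.expectation (law N) (\<lambda>S. (fixed_fraction N S k)\<^sup>2)
      - (measure_pmf.expectation (law N) (\<lambda>S. fixed_fraction N S k))\<^sup>2) \<longlonglongrightarrow> 0"
  proof (rule tendsto_sandwich[OF _ _ tendsto_const lim]; rule eventually_sequentiallyI[of 2])
    fix N :: nat assume N: "2 \<le> N"
    show "0 \<le> measure_pmf.expectation (law N) (\<lambda>S. (fixed_fraction N S k)\<^sup>2)
      - (measure_pmf.expectation (law N) (\<lambda>S. fixed_fraction N S k))\<^sup>2"
      by (rule variance_nonneg[OF N law_supp[OF N]])
    have "(real k * real (d N) / real N)\<^sup>2 * (2 * (rate N * t) + 1) =
        2 * t * (real k)\<^sup>2 * (real (d N) / real N) + (real k)\<^sup>2 * (real (d N) / real N)\<^sup>2"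
      using d_pos[OF N] N unfolding rate_def by (simp add: power2_eq_square field_simps)
    then show "measure_pmf.expectation (law N) (\<lambda>S. (fixed_fraction N S k)\<^sup>2)
      - (measure_pmf.expectation (law N) (\<lambda>S. fixed_fraction N S k))\<^sup>2 \<le>
      2 * t * (real k)\<^sup>2 * (real (d N) / real N) + (real k)\<^sup>2 * (real (d N) / real N)\<^sup>2"
      using law_variance[OF N, of k] by simp
  qed
qed

definition walk_mean_limit :: "nat \<Rightarrow> nat \<Rightarrow> real" where
  "walk_mean_limit n k = lim (\<lambda>N. measure_pmf.expectation (walk_pmf n N) (\<lambda>S. fixed_fraction N S k))"

text \<open>With n fixed the uniform bound is of order 1 / N for every \<alpha>, whereas the bound
  by the number of moved points does not vanish when \<alpha> > 0.\<close>

lemma concentrated_walk_pmf: "concentrated_laws (walk_pmf n) (walk_mean_limit n)"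
proof (unfold_locales)
  show "set_pmf (walk_pmf n N) \<subseteq> Sym N" if "N \<ge> 2" for N by (rule set_walk_pmf[OF that])
  fix k
  have "convergent (\<lambda>N. measure_pmf.expectation (walk_pmf n N) (\<lambda>S. fixed_fraction N S k))"
  proof (cases "k = 0")
    case True
    show ?thesis
      by (rule convergent_eventually_eq[OF convergent_const[of 1]], rule eventually_sequentiallyI[of 2])
        (simp add: True fixed_fraction_0)
  next
    case False
    then have k: "k \<ge> 1" by simp
    show ?thesis
      by (rule convergent_eventually_eq[OF Qop_iter_convergent[OF k]], rule eventually_sequentiallyI[of 2])
        (rule walk_pmf_expectation[symmetric])
  qed
  then show "(\<lambda>N. measure_pmf.expectation (walk_pmf n N) (\<lambda>S. fixed_fraction N S k)) \<longlonglongrightarrow> walk_mean_limit n k"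
    unfolding walk_mean_limit_def convergent_LIMSEQ_iff .
  have lim: "(\<lambda>N. real n * (16 * (real k)\<^sup>2 / real N)) \<longlonglongrightarrow> 0" by real_asymp
  show "(\<lambda>N. measure_pmf.expectation (walk_pmf n N) (\<lambda>S. (fixed_fraction N S k)\<^sup>2)
      - (measure_pmf.expectation (walk_pmf n N) (\<lambda>S. fixed_fraction N S k))\<^sup>2) \<longlonglongrightarrow> 0"
  proof (rule tendsto_sandwich[OF _ _ tendsto_const lim]; rule eventually_sequentiallyI[of 2])
    fix N :: nat assume N: "2 \<le> N"
    show "0 \<le> measure_pmf.expectation (walk_pmf n N) (\<lambda>S. (fixed_fraction N S k)\<^sup>2)
      - (measure_pmf.expectation (walk_pmf n N) (\<lambda>S. fixed_fraction N S k))\<^sup>2"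
      by (rule variance_nonneg[OF N set_walk_pmf[OF N]])
    show "measure_pmf.expectation (walk_pmf n N) (\<lambda>S. (fixed_fraction N S k)\<^sup>2)
      - (measure_pmf.expectation (walk_pmf n N) (\<lambda>S. fixed_fraction N S k))\<^sup>2 \<le> real n * (16 * (real k)\<^sup>2 / real N)"
      unfolding walk_pmf_expectation[OF N] by (rule Qop_iter_variance_uniform[OF N permutes_id])
  qed
qed

lemma walk_mean_limit_0: "walk_mean_limit 0 k = 1"
proof -
  have "\<forall>\<^sub>F N in sequentially. 1 = measure_pmf.expectation (walk_pmf 0 N) (\<lambda>S. fixed_fraction N S k)"
    by (rule eventually_sequentiallyI[of 2])
      (simp add: fixed_fraction_def fixed_count_id[unfolded id_def] id_def)
  then have "(\<lambda>N. measure_pmf.expectation (walk_pmf 0 N) (\<lambda>S. fixed_fraction N S k)) \<longlonglongrightarrow> 1"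
    by (rule Lim_transform_eventually[OF tendsto_const])
  then show ?thesis unfolding walk_mean_limit_def by (rule limI)
qed

lemma tau_one_limit: "(\<lambda>N. tau N 1) \<longlonglongrightarrow> 1 - \<alpha>"
proof (rule Lim_transform_eventually[OF tendsto_diff[OF tendsto_const[of 1] d_asymp]])
  show "\<forall>\<^sub>F N in sequentially. 1 - real (d N) / real N = tau N 1"
    by (rule eventually_sequentiallyI[of 2]) (rule tau_one[symmetric])
qed

lemma walk_mean_limit_1: "walk_mean_limit 1 1 = 1 - \<alpha>"
proof -
  have "\<forall>\<^sub>F N in sequentially. tau N 1 = measure_pmf.expectation (walk_pmf 1 N) (\<lambda>S. fixed_fraction N S 1)"
  proof (rule eventually_sequentiallyI[of 2])
    fix N :: nat assume N: "2 \<le> N"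
    show "tau N 1 = measure_pmf.expectation (walk_pmf 1 N) (\<lambda>S. fixed_fraction N S 1)"
      unfolding walk_pmf_expectation[OF N] tau_def by (simp add: Qop_def)
  qed
  then have "(\<lambda>N. measure_pmf.expectation (walk_pmf 1 N) (\<lambda>S. fixed_fraction N S 1)) \<longlonglongrightarrow> 1 - \<alpha>"
    by (rule Lim_transform_eventually[OF tau_one_limit])
  then show ?thesis unfolding walk_mean_limit_def by (rule limI)
qed

lemma rate_limit:
  assumes "\<alpha> > 0"
  shows "(\<lambda>N. rate N * t) \<longlonglongrightarrow> t / \<alpha>"
proof -
  have "(\<lambda>N. inverse (1 / rate N) * t) \<longlonglongrightarrow> inverse \<alpha> * t"
    by (intro tendsto_mult tendsto_const tendsto_inverse inverse_rate) (use assms in simp)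
  then show ?thesis by (simp add: divide_inverse mult.commute)
qed

text \<open>If the second moment converged to the square, the mean square distance to the limit m of
  the mean would vanish. But it is at least the contribution of zero steps, where the fixed fraction
  is 1, and of one step, where it is 1 - d / N. Both numbers of steps have positive limiting
  probability, so m would equal 1 as well as 1 - \<alpha>.\<close>

lemma macroscopic_not_concentrated:
  assumes \<alpha>: "\<alpha> > 0"
  shows "\<not> (\<lambda>N. measure_pmf.expectation (law N) (\<lambda>S. (fixed_fraction N S 1)\<^sup>2)) \<longlonglongrightarrow> (mean_limit 1)\<^sup>2"
proof
  let ?m = "mean_limit 1"
  assume sq: "(\<lambda>N. measure_pmf.expectation (law N) (\<lambda>S. (fixed_fraction N S 1)\<^sup>2)) \<longlonglongrightarrow> ?m\<^sup>2"
  let ?E = "\<lambda>N. measure_pmf.expectation (law N) (\<lambda>S. (fixed_fraction N S 1)\<^sup>2)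
      - 2 * ?m * measure_pmf.expectation (law N) (\<lambda>S. fixed_fraction N S 1) + ?m\<^sup>2"
  let ?w = "\<lambda>N. poisson_weight (rate N * t)"
  have "?E \<longlonglongrightarrow> ?m\<^sup>2 - 2 * ?m * ?m + ?m\<^sup>2" by (intro tendsto_intros sq law_mean)
  then have E: "?E \<longlonglongrightarrow> 0" by (simp add: power2_eq_square)
  have w: "(\<lambda>N. ?w N n) \<longlonglongrightarrow> poisson_weight (t / \<alpha>) n" for n
    unfolding poisson_weight_def by (intro tendsto_intros rate_limit \<alpha>) simp
  have L: "(\<lambda>N. ?w N 0 * (1 - ?m)\<^sup>2 + ?w N 1 * (tau N 1 - ?m)\<^sup>2) \<longlonglongrightarrow>
      poisson_weight (t / \<alpha>) 0 * (1 - ?m)\<^sup>2 + poisson_weight (t / \<alpha>) 1 * ((1 - \<alpha>) - ?m)\<^sup>2"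
    by (intro tendsto_intros w tau_one_limit)
  have "poisson_weight (t / \<alpha>) 0 * (1 - ?m)\<^sup>2 + poisson_weight (t / \<alpha>) 1 * ((1 - \<alpha>) - ?m)\<^sup>2 \<le> 0"
  proof (rule tendsto_le[OF sequentially_bot E L], rule eventually_sequentiallyI[of 2])
    fix N :: nat assume N: "2 \<le> N"
    let ?g = "\<lambda>S. (fixed_fraction N S 1 - ?m)\<^sup>2"
    have "measure_pmf.expectation (law N) ?g = measure_pmf.expectation (law N)
        (\<lambda>S. (fixed_fraction N S 1)\<^sup>2 - (2 * ?m) * fixed_fraction N S 1 + ?m\<^sup>2)"
      by (rule Bochner_Integration.integral_cong[OF refl]) (simp add: power2_diff)
    also have "\<dots> = ?E N"
      by (subst Bochner_Integration.integral_add[OF integrable[OF N] integrable[OF N]],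
          subst Bochner_Integration.integral_diff[OF integrable[OF N] integrable[OF N]],
          subst Bochner_Integration.integral_mult_right_zero) simp
    finally have s: "(\<lambda>n. ?w N n * (Qop N ^^ n) ?g id) sums ?E N" using law_poisson[OF N, of ?g] by simp
    have x: "rate N * t \<ge> 0" using rate_pos[OF N] t_pos by simp
    have nn: "0 \<le> (Qop N ^^ n) ?g id" for n
    proof -
      have "0 \<le> measure_pmf.expectation (walk_pmf n N) ?g" by (rule Bochner_Integration.integral_nonneg) simp
      then show ?thesis unfolding walk_pmf_expectation[OF N] .
    qed
    have "0 \<le> ?w N n * (Qop N ^^ n) ?g id" for n
      by (rule mult_nonneg_nonneg[OF poisson_weight_nonneg[OF x] nn])
    then have "(\<Sum>n<2. ?w N n * (Qop N ^^ n) ?g id) \<le> ?E N"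
      unfolding sums_unique[OF s] by (intro sum_le_suminf sums_summable[OF s]) simp_all
    moreover have "(Qop N ^^ 0) ?g id = (1 - ?m)\<^sup>2"
      using N by (simp add: fixed_fraction_def fixed_count_id[unfolded id_def] id_def)
    moreover have "(Qop N ^^ 1) ?g id = (tau N 1 - ?m)\<^sup>2"
    proof -
      have "Qop N ?g id = (tau N 1 - ?m)\<^sup>2"
        unfolding Qop_def comp_id
        by (rule avg_eqI[OF C_finite[OF N] C_nonempty[OF N]]) (simp only: fixed_fraction_tau[OF N])
      then show ?thesis by simp
    qed
    ultimately show "?w N 0 * (1 - ?m)\<^sup>2 + ?w N 1 * (tau N 1 - ?m)\<^sup>2 \<le> ?E N"
      by (simp only: lessThan_Suc lessThan_0 numeral_2_eq_2 sum.insert sum.empty finite.intros) (simp add: numeral_2_eq_2)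
  qed
  moreover have "poisson_weight (t / \<alpha>) n > 0" for n unfolding poisson_weight_def using t_pos \<alpha> by simp
  ultimately have "(1 - ?m)\<^sup>2 = 0" "((1 - \<alpha>) - ?m)\<^sup>2 = 0"
    by (smt (verit) mult_pos_pos zero_le_power2 mult_nonneg_nonneg less_imp_le)+
  then show False using \<alpha> by simp
qed

text \<open>For each number n of steps the walk concentrates at \<open>\<mu> n\<close>, and the
  Poisson parameter converges to t / \<alpha>. A common bound X of the parameters gives a summable
  majorant, so limit and sum commute.\<close>

lemma mixture_limit:
  assumes \<alpha>: "\<alpha> > 0" and \<mu>: "\<And>n. has_moments (\<mu> n) (walk_mean_limit n)"
    and F: "continuous_map (weak_topology unit_circle) euclideanreal F"
    and B: "\<And>\<nu>. \<nu> \<in> prob_measures_on unit_circle \<Longrightarrow> \<bar>F \<nu>\<bar> \<le> B"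
  shows "(\<lambda>N. measure_pmf.expectation (law N) (\<lambda>S. F (eigd N S))) \<longlonglongrightarrow>
    measure_pmf.expectation (poisson_pmf (t / \<alpha>)) (\<lambda>n. F (\<mu> n))"
proof -
  have r: "t / \<alpha> > 0" using t_pos \<alpha> by simp
  have Bn: "\<bar>F (\<mu> n)\<bar> \<le> B" for n using B \<mu> unfolding has_moments_def by blast
  have B0: "B \<ge> 0" using Bn[of 0] by linarith
  obtain X where X: "\<And>N. \<bar>rate N * t\<bar> \<le> X"
    using convergent_imp_Bseq[OF convergentI[OF rate_limit[OF \<alpha>]]] unfolding Bseq_def real_norm_def by blast
  have "(\<lambda>N. measure_pmf.expectation (law N) (\<lambda>S. F (eigd N S))) \<longlonglongrightarrow> (\<Sum>n. poisson_weight (t / \<alpha>) n * F (\<mu> n))"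
  proof (rule tannery_sums)
    show "(\<lambda>N. poisson_weight (rate N * t) n * measure_pmf.expectation (walk_pmf n N) (\<lambda>S. F (eigd N S)))
        \<longlonglongrightarrow> poisson_weight (t / \<alpha>) n * F (\<mu> n)" for n
    proof (rule tendsto_mult)
      show "(\<lambda>N. poisson_weight (rate N * t) n) \<longlonglongrightarrow> poisson_weight (t / \<alpha>) n"
        unfolding poisson_weight_def by (intro tendsto_intros rate_limit \<alpha>) simp
      show "(\<lambda>N. measure_pmf.expectation (walk_pmf n N) (\<lambda>S. F (eigd N S))) \<longlonglongrightarrow> F (\<mu> n)"
        by (rule concentrated_laws.functional_limit[OF concentrated_walk_pmf \<mu> F B])
    qed
    show "\<bar>poisson_weight (rate N * t) n * measure_pmf.expectation (walk_pmf n N) (\<lambda>S. F (eigd N S))\<bar>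
        \<le> B * (inverse (fact n) * X ^ n)" if N: "N \<ge> 2" for N n
    proof -
      have x: "rate N * t \<ge> 0" using rate_pos[OF N] t_pos by simp
      have "\<bar>measure_pmf.expectation (walk_pmf n N) (\<lambda>S. F (eigd N S))\<bar> \<le> B"
        unfolding walk_pmf_expectation[OF N]
      proof (rule Qop_iter_bound[OF N])
        show "id \<in> Sym N" unfolding Sym_def using permutes_id by blast
        fix S assume "S \<in> Sym N"
        then have "has_moments (eigd N S) (fixed_fraction N S)"
          using N unfolding Sym_def by (intro circle_eigenvalue_distribution_has_moments) auto
        then show "\<bar>F (eigd N S)\<bar> \<le> B" unfolding has_moments_def using B by blast
      qed
      moreover have "\<bar>poisson_weight (rate N * t) n\<bar> \<le> inverse (fact n) * X ^ n"
      proof -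
        have "exp (- (rate N * t)) * (rate N * t) ^ n \<le> 1 * X ^ n"
          using x X[of N] by (intro mult_mono power_mono) auto
        then show ?thesis
          unfolding poisson_weight_def using x by (simp add: divide_inverse mult.commute mult_right_mono)
      qed
      ultimately have "\<bar>poisson_weight (rate N * t) n\<bar> * \<bar>measure_pmf.expectation (walk_pmf n N) (\<lambda>S. F (eigd N S))\<bar>
          \<le> (inverse (fact n) * X ^ n) * B"
        by (intro mult_mono) auto
      then show ?thesis unfolding abs_mult by (simp only: mult.commute)
    qed
    show "summable (\<lambda>n. B * (inverse (fact n) * X ^ n))" by (rule summable_mult[OF summable_exp])
    show "(\<lambda>n. poisson_weight (rate N * t) n * measure_pmf.expectation (walk_pmf n N) (\<lambda>S. F (eigd N S))) sums
        measure_pmf.expectation (law N) (\<lambda>S. F (eigd N S))" if N: "N \<ge> 2" for N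
      unfolding walk_pmf_expectation[OF N] by (rule law_poisson[OF N])
  qed
  also have "(\<Sum>n. poisson_weight (t / \<alpha>) n * F (\<mu> n)) = measure_pmf.expectation (poisson_pmf (t / \<alpha>)) (\<lambda>n. F (\<mu> n))"
    by (rule sums_unique[OF poisson_expectation_sums[OF r Bn], symmetric])
  finally show ?thesis .
qed

end

subsection \<open>Convergence of the eigenvalue distributions\<close>

text \<open>The sample space is the space of measures itself, with the discrete law of
  \<open>\<mu> n\<close>, and the variable is the identity on probability measures. Replacing all
  other points by \<open>\<mu> 0\<close> puts the whole image into the target space, since
  measurability asks this at every point, not just almost everywhere.\<close>

lemma random_measure_pmf:
  assumes "\<And>n :: nat. \<mu> n \<in> prob_measures_on K"
  shows "random_measure K (measure_pmf (map_pmf \<mu> L)) (\<lambda>\<nu>. if \<nu> \<in> prob_measures_on K then \<nu> else \<mu> 0)"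
proof -
  have "space (borel_of (weak_topology K)) = prob_measures_on K"
    unfolding borel_of_def space_measure_of_conv topspace_weak_topology ..
  then show ?thesis
    unfolding random_measure_def measurable_pmf_measure1
    using assms by (auto simp: measure_pmf.prob_space_axioms)
qed

lemma expectation_map_pmf_in:
  assumes "\<And>n :: nat. \<mu> n \<in> K"
  shows "measure_pmf.expectation (map_pmf \<mu> L) (\<lambda>\<nu>. F (if \<nu> \<in> K then \<nu> else \<mu> 0)) =
    measure_pmf.expectation L (\<lambda>n. F (\<mu> n) :: real)"
  unfolding integral_map_pmf using assms by simp

lemma limitin_of_moments:
  assumes \<mu>: "has_moments \<mu> m" and \<nu>: "\<And>N. N \<ge> 2 \<Longrightarrow> has_moments (\<nu> N) (a N)"
    and lim: "\<And>k. (\<lambda>N. a N k) \<longlonglongrightarrow> m k"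
  shows "limitin (weak_topology unit_circle) \<nu> \<mu> sequentially"
  unfolding limitin_def
proof (intro conjI allI impI)
  show "\<mu> \<in> topspace (weak_topology unit_circle)"
    unfolding topspace_weak_topology using \<mu> unfolding has_moments_def by blast
  fix U assume U: "openin (weak_topology unit_circle) U \<and> \<mu> \<in> U"
  obtain K e where e: "e > 0"
    and near: "\<forall>\<nu> m'. has_moments \<nu> m' \<and> (\<forall>i\<le>K. \<bar>m' i - m i\<bar> < e) \<longrightarrow> \<nu> \<in> U"
    using weak_neighbourhood[OF _ _ \<mu>, of U] U by blast
  have "\<forall>\<^sub>F N in sequentially. \<forall>i\<in>{..K}. \<bar>a N i - m i\<bar> < e"
  proof (rule eventually_ball_finite; intro ballI finite_atMost)
    fix i
    show "\<forall>\<^sub>F N in sequentially. \<bar>a N i - m i\<bar> < e"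
      using tendstoD[OF lim[of i] e] by (simp add: dist_real_def)
  qed
  then show "\<forall>\<^sub>F N in sequentially. \<nu> N \<in> U"
    using eventually_ge_at_top[of 2]
  proof eventually_elim
    case (elim N)
    have "\<forall>i\<le>K. \<bar>a N i - m i\<bar> < e" using elim(1) by blast
    then show ?case using near \<nu>[OF elim(2)] by blast
  qed
qed

text \<open>Integration against a mixture is iterated integration, so the moments of the mean
  measure are the means of the random moments. The kernel is measurable since it factors through a
  discrete space.\<close>

lemma bind_has_moments:
  assumes M: "prob_space M" and X: "X \<in> M \<rightarrow>\<^sub>M count_space (Sym N)" and N: "N \<ge> 1"
  shows "has_moments (Giry_Monad.bind M (\<lambda>\<omega>. eigd N (X \<omega>))) (\<lambda>k. \<integral>\<omega>. fixed_fraction N (X \<omega>) k \<partial>M)"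
proof -
  interpret prob_space M by (rule M)
  let ?K = "\<lambda>\<omega>. eigd N (X \<omega>)"
  have mom: "has_moments (eigd N S) (fixed_fraction N S)" if "S \<in> Sym N" for S
    using that N unfolding Sym_def by (intro circle_eigenvalue_distribution_has_moments) auto
  have "eigd N \<in> count_space (Sym N) \<rightarrow>\<^sub>M prob_algebra circle_space"
    unfolding measurable_count_space_eq1 using mom unfolding has_moments_def prob_measures_on_def by blast
  then have K: "?K \<in> M \<rightarrow>\<^sub>M prob_algebra circle_space"
    using X by (rule measurable_compose[rotated])
  note K' = measurable_prob_algebraD[OF K]
  have XS: "X \<omega> \<in> Sym N" if "\<omega> \<in> space M" for \<omega> using measurable_space[OF X that] by simp
  have pr: "eigd N (X \<omega>) \<in> prob_measures_on unit_circle" if "\<omega> \<in> space M" for \<omega>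
    using mom[OF XS[OF that]] unfolding has_moments_def by blast
  have sets: "sets (Giry_Monad.bind M ?K) = sets circle_space"
    using pr not_empty unfolding prob_measures_on_circle by (intro sets_bind) auto
  have "prob_space (Giry_Monad.bind M ?K)"
    by (rule prob_space_bind[OF _ K'], rule AE_I2) (use pr prob_measures_on_circle in blast)
  then have bp: "Giry_Monad.bind M ?K \<in> prob_measures_on unit_circle"
    using sets prob_measures_on_circle by blast
  have int: "integrable M (\<lambda>\<omega>. fixed_fraction N (X \<omega>) k)" for k
    by (rule integrable_const_bound[of _ 1])
      (use measurable_compose[OF X, of "\<lambda>S. fixed_fraction N S k" borel] fixed_fraction_bounds in auto)
  have "(\<integral>z. Re (poly p z) \<partial>Giry_Monad.bind M ?K) =
      (\<Sum>i\<le>degree p. Re (coeff p i) * (\<integral>\<omega>. fixed_fraction N (X \<omega>) i \<partial>M))" for p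
  proof -
    have cont: "continuous_on unit_circle (\<lambda>z. Re (poly p z))" by (intro continuous_intros)
    have "compact ((\<lambda>z. Re (poly p z)) ` unit_circle)" by (rule compact_continuous_image[OF cont compact_sphere])
    from compact_imp_bounded[OF this] obtain B where "\<forall>x\<in>(\<lambda>z. Re (poly p z)) ` unit_circle. norm x \<le> B"
      unfolding bounded_iff ..
    then have B: "\<bar>Re (poly p z)\<bar> \<le> B" if "z \<in> unit_circle" for z using that by simp
    have "(\<integral>z. Re (poly p z) \<partial>Giry_Monad.bind M ?K) = (\<integral>\<omega>. \<integral>z. Re (poly p z) \<partial>?K \<omega> \<partial>M)"
    proof (rule integral_bind[OF _ _ K'])
      show "(\<lambda>z. Re (poly p z)) \<in> borel_measurable circle_space"
        by (rule borel_measurable_continuous_on_restrict[OF cont])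
      show "\<bar>Re (poly p z)\<bar> \<le> B" if "z \<in> space circle_space" for z
        using that by (intro B) (simp add: space_restrict_space)
      show "finite_measure M" by unfold_locales
      show "AE \<omega> in M. emeasure (?K \<omega>) (space (?K \<omega>)) \<le> ennreal 1"
        by (rule AE_I2) (use pr prob_measures_on_circle prob_space.emeasure_space_1 in fastforce)
    qed
    also have "\<dots> = (\<integral>\<omega>. (\<Sum>i\<le>degree p. Re (coeff p i) * fixed_fraction N (X \<omega>) i) \<partial>M)"
      by (rule Bochner_Integration.integral_cong[OF refl]) (use mom[OF XS] in \<open>simp add: has_moments_def\<close>)
    also have "\<dots> = (\<Sum>i\<le>degree p. Re (coeff p i) * (\<integral>\<omega>. fixed_fraction N (X \<omega>) i \<partial>M))"
      by (subst Bochner_Integration.integral_sum) (simp_all add: int)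
    finally show ?thesis .
  qed
  then show ?thesis unfolding has_moments_def using bp by blast
qed

section \<open>Transfer from the laws to the given probability spaces\<close>

locale random_walks = walk_law +
  fixes M :: "nat \<Rightarrow> 'p measure" and X :: "nat \<Rightarrow> 'p \<Rightarrow> nat \<Rightarrow> nat"
  assumes prob_space_M: "N \<ge> 2 \<Longrightarrow> prob_space (M N)"
    and measurable_X: "N \<ge> 2 \<Longrightarrow> X N \<in> M N \<rightarrow>\<^sub>M count_space (Sym N)"
    and expectation_X: "N \<ge> 2 \<Longrightarrow> (\<integral>\<omega>. f (X N \<omega>) \<partial>M N) = measure_pmf.expectation (law N) (f :: _ \<Rightarrow> real)"
begin

abbreviation walk_matrix :: "nat \<Rightarrow> 'p \<Rightarrow> complex mat" where
  "walk_matrix \<equiv> \<lambda>N \<omega>. permutation_matrix N (X N \<omega>)"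

lemma X_permutes: "N \<ge> 2 \<Longrightarrow> \<omega> \<in> space (M N) \<Longrightarrow> X N \<omega> permutes {..<N}"
  using measurable_space[OF measurable_X] unfolding Sym_def by auto

lemma measure_X:
  assumes "N \<ge> 2"
  shows "measure (M N) {\<omega> \<in> space (M N). R (X N \<omega>)} = measure_pmf.prob (law N) {S. R S}"
proof -
  have "(\<integral>\<omega>. indicator {S. R S} (X N \<omega>) \<partial>M N) = measure_pmf.expectation (law N) (indicator {S. R S} :: _ \<Rightarrow> real)"
    by (rule expectation_X[OF assms])
  moreover have "(\<integral>\<omega>. indicator {S. R S} (X N \<omega>) \<partial>M N) = (\<integral>\<omega>. indicator {\<omega> \<in> space (M N). R (X N \<omega>)} \<omega> \<partial>M N :: real)"
    by (rule Bochner_Integration.integral_cong[OF refl]) (simp add: indicator_def)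
  ultimately show ?thesis by (simp add: Int_def conj_commute cong: conj_cong)
qed

lemma moments_prod:
  assumes p: "p \<in> diagrams k"
  obtains ms where
    "\<And>N S. N \<ge> 1 \<Longrightarrow> S permutes {..<N} \<Longrightarrow> moment k p (permutation_matrix N S) = of_real (\<Prod>m\<in>#ms. fixed_fraction N S m)"
    "\<And>N. N \<ge> 2 \<Longrightarrow> mean_moment M walk_matrix k p N = of_real (measure_pmf.expectation (law N) (\<lambda>S. \<Prod>m\<in>#ms. fixed_fraction N S m))"
proof -
  obtain ms where ms: "\<And>N S. N \<ge> 1 \<Longrightarrow> S permutes {..<N} \<Longrightarrow>
      moment k p (permutation_matrix N S) = of_real (\<Prod>m\<in>#ms. fixed_fraction N S m)"
    by (rule moment_prod[OF p]) blast
  have "mean_moment M walk_matrix k p N = of_real (measure_pmf.expectation (law N) (\<lambda>S. \<Prod>m\<in>#ms. fixed_fraction N S m))"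
    if N: "N \<ge> 2" for N
  proof -
    have "mean_moment M walk_matrix k p N = (\<integral>\<omega>. of_real (\<Prod>m\<in>#ms. fixed_fraction N (X N \<omega>) m) \<partial>M N)"
      unfolding mean_moment_def
      by (rule Bochner_Integration.integral_cong[OF refl], rule ms[OF _ X_permutes[OF N]]) (use N in simp_all)
    also have "\<dots> = of_real (\<integral>\<omega>. (\<Prod>m\<in>#ms. fixed_fraction N (X N \<omega>) m) \<partial>M N)"
      by (rule integral_complex_of_real)
    finally show ?thesis
      unfolding expectation_X[OF N, of "\<lambda>S. \<Prod>m\<in>#ms. fixed_fraction N S m"] .
  qed
  then show ?thesis using that ms by blast
qed

text \<open>Every moment is a product of fixed fractions, and juxtaposing diagrams adds the
  multisets. Under concentration the mean of a product tends to the product of the limits, which is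
  multiplicative in the multiset; the mean square estimate also gives convergence in
  probability.\<close>

lemma evanescent_P_distribution:
  assumes "\<alpha> = 0"
  shows "asymptotic_P_factorization M walk_matrix" "converges_in_prob_in_P_distribution M walk_matrix"
proof -
  interpret conc: concentrated_laws law mean_limit by (rule concentrated_law[OF assms])
  have lim: "mean_moment M walk_matrix k p \<longlonglongrightarrow> of_real (conc.mprod ms)"
    if ms: "\<And>N. N \<ge> 2 \<Longrightarrow> mean_moment M walk_matrix k p N = of_real (measure_pmf.expectation (law N) (conc.ffprod ms N))" for k p ms
  proof (rule Lim_transform_eventually[OF tendsto_of_real[OF conc.prod_mean[of ms]]])
    show "\<forall>\<^sub>F N in sequentially. of_real (measure_pmf.expectation (law N) (conc.ffprod ms N)) = mean_moment M walk_matrix k p N"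
      by (rule eventually_sequentiallyI[of 2]) (rule ms[symmetric])
  qed
  have conv: "converges_in_P_distribution M walk_matrix"
    unfolding converges_in_P_distribution_def
  proof (intro allI ballI)
    fix k p assume p: "p \<in> diagrams k"
    show "convergent (mean_moment M walk_matrix k p)"
      by (rule moments_prod[OF p]) (rule convergentI[OF lim])
  qed
  have "limit_moment M walk_matrix (k + l) (juxtapose k p1 p2) = limit_moment M walk_matrix k p1 * limit_moment M walk_matrix l p2"
    if p1: "p1 \<in> diagrams k" and p2: "p2 \<in> diagrams l" for k l p1 p2
  proof -
    obtain m1 where m1: "\<And>N S. N \<ge> 1 \<Longrightarrow> S permutes {..<N} \<Longrightarrow> moment k p1 (permutation_matrix N S) = of_real (conc.ffprod m1 N S)"
      "\<And>N. N \<ge> 2 \<Longrightarrow> mean_moment M walk_matrix k p1 N = of_real (measure_pmf.expectation (law N) (conc.ffprod m1 N))"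
      by (rule moments_prod[OF p1]) blast
    obtain m2 where m2: "\<And>N S. N \<ge> 1 \<Longrightarrow> S permutes {..<N} \<Longrightarrow> moment l p2 (permutation_matrix N S) = of_real (conc.ffprod m2 N S)"
      "\<And>N. N \<ge> 2 \<Longrightarrow> mean_moment M walk_matrix l p2 N = of_real (measure_pmf.expectation (law N) (conc.ffprod m2 N))"
      by (rule moments_prod[OF p2]) blast
    have m12: "mean_moment M walk_matrix (k + l) (juxtapose k p1 p2) N =
        of_real (measure_pmf.expectation (law N) (conc.ffprod (m1 + m2) N))" if N: "N \<ge> 2" for N
    proof -
      have "mean_moment M walk_matrix (k + l) (juxtapose k p1 p2) N = (\<integral>\<omega>. of_real (conc.ffprod (m1 + m2) N (X N \<omega>)) \<partial>M N)"
        unfolding mean_moment_def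
      proof (rule Bochner_Integration.integral_cong[OF refl])
        fix \<omega> assume "\<omega> \<in> space (M N)"
        then have perm: "X N \<omega> permutes {..<N}" by (rule X_permutes[OF N])
        show "moment (k + l) (juxtapose k p1 p2) (permutation_matrix N (X N \<omega>)) = of_real (conc.ffprod (m1 + m2) N (X N \<omega>))"
          unfolding moment_juxtapose[OF p1 p2 perm] using m1(1)[OF _ perm] m2(1)[OF _ perm] N by simp
      qed
      also have "\<dots> = of_real (\<integral>\<omega>. conc.ffprod (m1 + m2) N (X N \<omega>) \<partial>M N)"
        by (rule integral_complex_of_real)
      finally show ?thesis unfolding expectation_X[OF N, of "conc.ffprod (m1 + m2) N"] .
    qed
    have "limit_moment M walk_matrix k p1 = of_real (conc.mprod m1)"
      unfolding limit_moment_def by (rule limI, rule lim, rule m1(2))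
    moreover have "limit_moment M walk_matrix l p2 = of_real (conc.mprod m2)"
      unfolding limit_moment_def by (rule limI, rule lim, rule m2(2))
    moreover have "limit_moment M walk_matrix (k + l) (juxtapose k p1 p2) = of_real (conc.mprod (m1 + m2))"
      unfolding limit_moment_def by (rule limI, rule lim, rule m12)
    ultimately show ?thesis by simp
  qed
  then show "asymptotic_P_factorization M walk_matrix"
    unfolding asymptotic_P_factorization_def using conv by blast
  show "converges_in_prob_in_P_distribution M walk_matrix"
    unfolding converges_in_prob_in_P_distribution_def
  proof (intro conjI conv allI ballI)
    fix k p assume p: "p \<in> diagrams k"
    obtain ms where ms: "\<And>N S. N \<ge> 1 \<Longrightarrow> S permutes {..<N} \<Longrightarrow> moment k p (permutation_matrix N S) = of_real (conc.ffprod ms N S)"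
      "\<And>N. N \<ge> 2 \<Longrightarrow> mean_moment M walk_matrix k p N = of_real (measure_pmf.expectation (law N) (conc.ffprod ms N))"
      by (rule moments_prod[OF p]) blast
    have c: "limit_moment M walk_matrix k p = of_real (conc.mprod ms)"
      unfolding limit_moment_def by (rule limI, rule lim, rule ms(2))
    show "converges_in_prob euclidean M (\<lambda>N \<omega>. moment k p (walk_matrix N \<omega>)) (limit_moment M walk_matrix k p)"
      unfolding converges_in_prob_def c
    proof (intro conjI allI impI)
      fix V :: "complex set" assume V: "openin euclidean V \<and> complex_of_real (conc.mprod ms) \<in> V"
      then have V': "open V" "complex_of_real (conc.mprod ms) \<in> V" by simp_all
      obtain e where e: "e > 0" "ball (complex_of_real (conc.mprod ms)) e \<subseteq> V"
        using openE[OF V'] .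
      show "(\<lambda>N. measure (M N) {\<omega> \<in> space (M N). moment k p (walk_matrix N \<omega>) \<notin> V}) \<longlonglongrightarrow> 0"
      proof (rule tendsto_sandwich[OF _ _ tendsto_const conc.prod_deviation[OF e(1), of ms]])
        show "\<forall>\<^sub>F N in sequentially. measure (M N) {\<omega> \<in> space (M N). moment k p (walk_matrix N \<omega>) \<notin> V}
            \<le> measure_pmf.prob (law N) {S. e \<le> \<bar>conc.ffprod ms N S - conc.mprod ms\<bar>}"
        proof (rule eventually_sequentiallyI[of 2])
          fix N :: nat assume N: "2 \<le> N"
          have "measure (M N) {\<omega> \<in> space (M N). moment k p (walk_matrix N \<omega>) \<notin> V} =
              measure_pmf.prob (law N) {S. moment k p (permutation_matrix N S) \<notin> V}"
            by (rule measure_X[OF N])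
          also have "\<dots> \<le> measure_pmf.prob (law N) {S. e \<le> \<bar>conc.ffprod ms N S - conc.mprod ms\<bar>}"
          proof (rule measure_pmf.finite_measure_mono_AE)
            show "AE S in law N. S \<in> {S. moment k p (permutation_matrix N S) \<notin> V} \<longrightarrow>
                S \<in> {S. e \<le> \<bar>conc.ffprod ms N S - conc.mprod ms\<bar>}"
              unfolding AE_measure_pmf_iff
            proof (intro ballI impI)
              fix S assume S: "S \<in> set_pmf (law N)" "S \<in> {S. moment k p (permutation_matrix N S) \<notin> V}"
              then have "S permutes {..<N}" using law_supp[OF N] unfolding Sym_def by blast
              then have mom: "moment k p (permutation_matrix N S) = of_real (conc.ffprod ms N S)"
                using N by (intro ms(1)) auto
              show "S \<in> {S. e \<le> \<bar>conc.ffprod ms N S - conc.mprod ms\<bar>}"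
              proof (rule ccontr)
                assume "S \<notin> {S. e \<le> \<bar>conc.ffprod ms N S - conc.mprod ms\<bar>}"
                then have "\<bar>conc.mprod ms - conc.ffprod ms N S\<bar> < e" by (simp add: abs_minus_commute)
                then have "complex_of_real (conc.ffprod ms N S) \<in> ball (complex_of_real (conc.mprod ms)) e"
                  by (simp add: dist_norm flip: of_real_diff)
                then have "complex_of_real (conc.ffprod ms N S) \<in> V" by (rule subsetD[OF e(2)])
                then show False using S(2) mom by simp
              qed
            qed
          qed simp
          finally show "measure (M N) {\<omega> \<in> space (M N). moment k p (walk_matrix N \<omega>) \<notin> V}
            \<le> measure_pmf.prob (law N) {S. e \<le> \<bar>conc.ffprod ms N S - conc.mprod ms\<bar>}" .
        qed
      qed (auto intro: always_eventually)
    qed simp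
  qed
qed

text \<open>Tested on two copies of \<open>id_diagram 1\<close>: factorization would make the second
  moment of the normalised trace converge to the square of the limit of its mean, which
  \<open>macroscopic_not_concentrated\<close> excludes.\<close>

lemma macroscopic_P_distribution:
  assumes \<alpha>: "\<alpha> > 0"
  shows "\<not> asymptotic_P_factorization M walk_matrix"
proof
  assume fac: "asymptotic_P_factorization M walk_matrix"
  let ?i = "id_diagram 1"
  let ?j = "juxtapose 1 ?i ?i"
  have j: "?j \<in> diagrams (1 + 1)" by (rule juxtapose_diagrams[OF id_diagram_diagrams id_diagram_diagrams])
  have m1: "mean_moment M walk_matrix 1 ?i N = of_real (measure_pmf.expectation (law N) (\<lambda>S. fixed_fraction N S 1))"
    if N: "N \<ge> 2" for N
  proof -
    have "mean_moment M walk_matrix 1 ?i N = (\<integral>\<omega>. of_real (fixed_fraction N (X N \<omega>) 1) \<partial>M N)"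
      unfolding mean_moment_def
      by (rule Bochner_Integration.integral_cong[OF refl], rule moment_id_diagram_1[OF _ X_permutes[OF N]]) (use N in simp_all)
    also have "\<dots> = of_real (\<integral>\<omega>. fixed_fraction N (X N \<omega>) 1 \<partial>M N)" by (rule integral_complex_of_real)
    finally show ?thesis unfolding expectation_X[OF N, of "\<lambda>S. fixed_fraction N S 1"] .
  qed
  have m2: "mean_moment M walk_matrix (1 + 1) ?j N = of_real (measure_pmf.expectation (law N) (\<lambda>S. (fixed_fraction N S 1)\<^sup>2))"
    if N: "N \<ge> 2" for N
  proof -
    have "mean_moment M walk_matrix (1 + 1) ?j N = (\<integral>\<omega>. of_real ((fixed_fraction N (X N \<omega>) 1)\<^sup>2) \<partial>M N)"
      unfolding mean_moment_def
    proof (rule Bochner_Integration.integral_cong[OF refl])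
      fix \<omega> assume "\<omega> \<in> space (M N)"
      then have perm: "X N \<omega> permutes {..<N}" by (rule X_permutes[OF N])
      have "moment 1 ?i (permutation_matrix N (X N \<omega>)) = of_real (fixed_fraction N (X N \<omega>) 1)"
        by (rule moment_id_diagram_1[OF _ perm]) (use N in simp)
      then show "moment (1 + 1) ?j (permutation_matrix N (X N \<omega>)) = of_real ((fixed_fraction N (X N \<omega>) 1)\<^sup>2)"
        unfolding moment_juxtapose[OF id_diagram_diagrams id_diagram_diagrams perm]
        by (simp only: power2_eq_square of_real_mult)
    qed
    also have "\<dots> = of_real (\<integral>\<omega>. (fixed_fraction N (X N \<omega>) 1)\<^sup>2 \<partial>M N)" by (rule integral_complex_of_real)
    finally show ?thesis unfolding expectation_X[OF N, of "\<lambda>S. (fixed_fraction N S 1)\<^sup>2"] .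
  qed
  have "mean_moment M walk_matrix 1 ?i \<longlonglongrightarrow> of_real (mean_limit 1)"
  proof (rule Lim_transform_eventually[OF tendsto_of_real[OF law_mean]])
    show "\<forall>\<^sub>F N in sequentially. of_real (measure_pmf.expectation (law N) (\<lambda>S. fixed_fraction N S 1)) = mean_moment M walk_matrix 1 ?i N"
      by (rule eventually_sequentiallyI[of 2]) (rule m1[symmetric])
  qed
  then have l1: "limit_moment M walk_matrix 1 ?i = of_real (mean_limit 1)" unfolding limit_moment_def by (rule limI)
  have "limit_moment M walk_matrix (1 + 1) ?j = limit_moment M walk_matrix 1 ?i * limit_moment M walk_matrix 1 ?i"
    using fac id_diagram_diagrams unfolding asymptotic_P_factorization_def by blast
  moreover have "mean_moment M walk_matrix (1 + 1) ?j \<longlonglongrightarrow> limit_moment M walk_matrix (1 + 1) ?j"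
    using fac j unfolding asymptotic_P_factorization_def converges_in_P_distribution_def limit_moment_def convergent_LIMSEQ_iff
    by blast
  ultimately have "mean_moment M walk_matrix (1 + 1) ?j \<longlonglongrightarrow> of_real ((mean_limit 1)\<^sup>2)"
    unfolding l1 by (simp only: power2_eq_square of_real_mult)
  moreover have "\<forall>\<^sub>F N in sequentially. mean_moment M walk_matrix (1 + 1) ?j N =
      of_real (measure_pmf.expectation (law N) (\<lambda>S. (fixed_fraction N S 1)\<^sup>2))"
    by (rule eventually_sequentiallyI[of 2]) (rule m2)
  ultimately have "(\<lambda>N. complex_of_real (measure_pmf.expectation (law N) (\<lambda>S. (fixed_fraction N S 1)\<^sup>2))) \<longlonglongrightarrow> of_real ((mean_limit 1)\<^sup>2)"
    by (rule Lim_transform_eventually)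
  then have "(\<lambda>N. measure_pmf.expectation (law N) (\<lambda>S. (fixed_fraction N S 1)\<^sup>2)) \<longlonglongrightarrow> (mean_limit 1)\<^sup>2"
    unfolding tendsto_of_real_iff .
  then show False using macroscopic_not_concentrated[OF \<alpha>] by contradiction
qed

lemma mean_measure_limit:
  assumes "has_moments \<mu> mean_limit"
  shows "limitin (weak_topology unit_circle) (\<lambda>N. Giry_Monad.bind (M N) (\<lambda>\<omega>. eigd N (X N \<omega>))) \<mu> sequentially"
proof (rule limitin_of_moments[OF assms _ law_mean])
  fix N :: nat assume N: "2 \<le> N"
  have "has_moments (Giry_Monad.bind (M N) (\<lambda>\<omega>. eigd N (X N \<omega>))) (\<lambda>k. \<integral>\<omega>. fixed_fraction N (X N \<omega>) k \<partial>M N)"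
    by (rule bind_has_moments[OF prob_space_M[OF N] measurable_X[OF N]]) (use N in simp)
  then show "has_moments (Giry_Monad.bind (M N) (\<lambda>\<omega>. eigd N (X N \<omega>)))
      (\<lambda>k. measure_pmf.expectation (law N) (\<lambda>S. fixed_fraction N S k))"
    unfolding expectation_X[OF N, of "\<lambda>S. fixed_fraction N S _"] .
qed

lemma converges_in_lawI:
  assumes "\<And>F B. continuous_map (weak_topology unit_circle) euclideanreal F \<Longrightarrow>
      (\<And>\<nu>. \<nu> \<in> prob_measures_on unit_circle \<Longrightarrow> \<bar>F \<nu>\<bar> \<le> B) \<Longrightarrow>
      (\<lambda>N. measure_pmf.expectation (law N) (\<lambda>S. F (eigd N S))) \<longlonglongrightarrow> (\<integral>\<omega>. F (Y \<omega>) \<partial>\<Omega>)"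
  shows "converges_in_law (weak_topology unit_circle) M (\<lambda>N \<omega>. eigd N (X N \<omega>)) \<Omega> Y"
  unfolding converges_in_law_def
proof (intro allI impI)
  fix F :: "complex measure \<Rightarrow> real"
  assume F: "continuous_map (weak_topology unit_circle) euclideanreal F \<and> bounded (F ` topspace (weak_topology unit_circle))"
  then obtain B where B: "\<And>\<nu>. \<nu> \<in> prob_measures_on unit_circle \<Longrightarrow> \<bar>F \<nu>\<bar> \<le> B"
    unfolding topspace_weak_topology bounded_iff real_norm_def by blast
  show "(\<lambda>N. \<integral>\<omega>. F (eigd N (X N \<omega>)) \<partial>M N) \<longlonglongrightarrow> (\<integral>\<omega>. F (Y \<omega>) \<partial>\<Omega>)"
  proof (rule Lim_transform_eventually[OF assms[OF conjunct1[OF F] B]])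
    show "\<forall>\<^sub>F N in sequentially. measure_pmf.expectation (law N) (\<lambda>S. F (eigd N S)) = (\<integral>\<omega>. F (eigd N (X N \<omega>)) \<partial>M N)"
      by (rule eventually_sequentiallyI[of 2]) (rule expectation_X[symmetric])
  qed
qed

lemma evanescent_limit:
  assumes \<alpha>: "\<alpha> = 0" and \<mu>: "has_moments \<mu> mean_limit"
  shows "converges_in_prob (weak_topology unit_circle) M (\<lambda>N \<omega>. eigd N (X N \<omega>)) \<mu>"
  unfolding converges_in_prob_def
proof (intro conjI allI impI)
  interpret conc: concentrated_laws law mean_limit by (rule concentrated_law[OF \<alpha>])
  show "\<mu> \<in> topspace (weak_topology unit_circle)"
    unfolding topspace_weak_topology using \<mu> unfolding has_moments_def by blast
  fix V assume V: "openin (weak_topology unit_circle) V \<and> \<mu> \<in> V"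
  show "(\<lambda>N. measure (M N) {\<omega> \<in> space (M N). eigd N (X N \<omega>) \<notin> V}) \<longlonglongrightarrow> 0"
  proof (rule Lim_transform_eventually[OF conc.escape_probability[OF \<mu> conjunct1[OF V] conjunct2[OF V]]])
    show "\<forall>\<^sub>F N in sequentially. measure_pmf.prob (law N) {S. eigd N S \<notin> V} =
        measure (M N) {\<omega> \<in> space (M N). eigd N (X N \<omega>) \<notin> V}"
      by (rule eventually_sequentiallyI[of 2]) (rule measure_X[symmetric])
  qed
qed

text \<open>The polynomial z reads off the moment of order 1, which is 1 after no step and 1 -
  \<alpha> after one step.\<close>

lemma walk_moments_distinct:
  assumes \<alpha>: "\<alpha> > 0" and \<mu>: "has_moments \<mu> (walk_mean_limit 0)"
  shows "\<not> has_moments \<mu> (walk_mean_limit 1)"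
proof
  assume \<mu>': "has_moments \<mu> (walk_mean_limit 1)"
  have "(\<Sum>i\<le>degree [:0, 1 :: complex:]. Re (coeff [:0, 1 :: complex:] i) * walk_mean_limit 0 i) =
      (\<Sum>i\<le>degree [:0, 1 :: complex:]. Re (coeff [:0, 1 :: complex:] i) * walk_mean_limit 1 i)"
    using \<mu> \<mu>' unfolding has_moments_def by metis
  then have "walk_mean_limit 0 1 = walk_mean_limit 1 1" by simp
  then show False using \<alpha> walk_mean_limit_0 walk_mean_limit_1 by simp
qed

end

text \<open>A law is chosen for each N separately; for N < 2, where nothing is assumed about the
  walk, the choice is arbitrary.\<close>

lemma ex_random_walks:
  assumes "\<And>N. N \<ge> 2 \<Longrightarrow> conjugacy_class N (C N)" and "\<And>N. N \<ge> 2 \<Longrightarrow> C N \<noteq> {id}"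
    and conv: "classes_converge_to C l \<alpha>" and walk: "\<And>N. N \<ge> 2 \<Longrightarrow> random_walk N (C N) (M N) (S N)" and t: "t > 0"
  shows "\<exists>law. random_walks C (\<lambda>N. nonfixed_count N (C N)) \<alpha> t law M (\<lambda>N. S N t)"
proof -
  interpret cs: class_sequence C "\<lambda>N. nonfixed_count N (C N)" \<alpha>
    by (rule class_sequence_of_classes[OF assms(1-3)])
  have "\<exists>l. N \<ge> 2 \<longrightarrow> prob_space (M N) \<and> S N t \<in> M N \<rightarrow>\<^sub>M count_space (Sym N) \<and> set_pmf l \<subseteq> Sym N \<and>
    (\<forall>f :: (nat \<Rightarrow> nat) \<Rightarrow> real. (\<integral>\<omega>. f (S N t \<omega>) \<partial>M N) = measure_pmf.expectation l f) \<and>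
    (\<forall>f. (\<lambda>n. poisson_weight (cs.rate N * t) n * (cs.Qop N ^^ n) f id) sums measure_pmf.expectation l f) \<and>
    (\<forall>f. (\<lambda>n. (cs.gen N ^^ n) f id * t ^ n / fact n) sums measure_pmf.expectation l f)" for N
  proof (cases "N \<ge> 2")
    case True
    from cs.random_walk_series[OF True walk[OF True] refl t] show ?thesis using True by simp
  qed simp
  then have "\<forall>N. \<exists>l. N \<ge> 2 \<longrightarrow> prob_space (M N) \<and> S N t \<in> M N \<rightarrow>\<^sub>M count_space (Sym N) \<and> set_pmf l \<subseteq> Sym N \<and>
    (\<forall>f :: (nat \<Rightarrow> nat) \<Rightarrow> real. (\<integral>\<omega>. f (S N t \<omega>) \<partial>M N) = measure_pmf.expectation l f) \<and>
    (\<forall>f. (\<lambda>n. poisson_weight (cs.rate N * t) n * (cs.Qop N ^^ n) f id) sums measure_pmf.expectation l f) \<and>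
    (\<forall>f. (\<lambda>n. (cs.gen N ^^ n) f id * t ^ n / fact n) sums measure_pmf.expectation l f)" ..
  from choice[OF this] obtain law where law: "\<forall>N. N \<ge> 2 \<longrightarrow> prob_space (M N) \<and> S N t \<in> M N \<rightarrow>\<^sub>M count_space (Sym N) \<and> set_pmf (law N) \<subseteq> Sym N \<and>
    (\<forall>f :: (nat \<Rightarrow> nat) \<Rightarrow> real. (\<integral>\<omega>. f (S N t \<omega>) \<partial>M N) = measure_pmf.expectation (law N) f) \<and>
    (\<forall>f. (\<lambda>n. poisson_weight (cs.rate N * t) n * (cs.Qop N ^^ n) f id) sums measure_pmf.expectation (law N) f) \<and>
    (\<forall>f. (\<lambda>n. (cs.gen N ^^ n) f id * t ^ n / fact n) sums measure_pmf.expectation (law N) f)" ..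
  have "random_walks C (\<lambda>N. nonfixed_count N (C N)) \<alpha> t law M (\<lambda>N. S N t)"
  proof (intro random_walks.intro walk_law.intro walk_law_axioms.intro random_walks_axioms.intro cs.class_sequence_axioms t)
    fix N :: nat assume "2 \<le> N"
    note * = mp[OF spec[OF law, of N] this]
    show "prob_space (M N)" by (rule conjunct1[OF *])
    note * = conjunct2[OF *]
    show "S N t \<in> M N \<rightarrow>\<^sub>M count_space (Sym N)" by (rule conjunct1[OF *])
    note * = conjunct2[OF *]
    show "set_pmf (law N) \<subseteq> Sym N" by (rule conjunct1[OF *])
    note * = conjunct2[OF *]
    fix f :: "(nat \<Rightarrow> nat) \<Rightarrow> real"
    show "(\<integral>\<omega>. f (S N t \<omega>) \<partial>M N) = measure_pmf.expectation (law N) f" by (rule spec[OF conjunct1[OF *]])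
    note * = conjunct2[OF *]
    show "(\<lambda>n. poisson_weight (cs.rate N * t) n * (cs.Qop N ^^ n) f id) sums measure_pmf.expectation (law N) f"
      by (rule spec[OF conjunct1[OF *]])
    show "(\<lambda>n. (cs.gen N ^^ n) f id * t ^ n / fact n) sums measure_pmf.expectation (law N) f"
      by (rule spec[OF conjunct2[OF *]])
  qed
  then show ?thesis by (rule exI[of _ law])
qed

theorem theorem2p6:
  fixes C :: "nat \<Rightarrow> (nat \<Rightarrow> nat) set"
    and M :: "nat \<Rightarrow> 'a measure"
    and S :: "nat \<Rightarrow> real \<Rightarrow> 'a \<Rightarrow> (nat \<Rightarrow> nat)"
    and t :: real
  assumes "\<And>N. N \<ge> 2 \<Longrightarrow> conjugacy_class N (C N)"
    and "\<And>N. N \<ge> 2 \<Longrightarrow> C N \<noteq> {id}"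
    and "classes_converge C"
    and "\<And>N. N \<ge> 2 \<Longrightarrow> random_walk N (C N) (M N) (S N)"
    and "t > 0"
  defines "A \<equiv> \<lambda>N \<omega>. permutation_matrix N (S N t \<omega>)"
  defines "\<mu>N \<equiv> \<lambda>N \<omega>. circle_eigenvalue_distribution (A N \<omega>)"
  shows "\<exists>(\<Omega> :: complex measure measure) \<mu> \<mu>bar.
           random_measure unit_circle \<Omega> \<mu> \<and>
           converges_in_law (weak_topology unit_circle) M \<mu>N \<Omega> \<mu> \<and>
           limitin (weak_topology unit_circle) (\<lambda>N. Giry_Monad.bind (M N) (\<mu>N N)) \<mu>bar sequentially \<and>
           (evanescent C \<longrightarrow>
              (AE \<omega> in \<Omega>. \<mu> \<omega> = \<mu>bar) \<and>
              converges_in_prob (weak_topology unit_circle) M \<mu>N \<mu>bar \<and>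
              asymptotic_P_factorization M A \<and>
              converges_in_prob_in_P_distribution M A) \<and>
           (macroscopic C \<longrightarrow>
              \<not> nonrandom \<Omega> \<mu> \<and>
              \<not> asymptotic_P_factorization M A)"
proof -
  obtain l \<alpha> where conv: "classes_converge_to C l \<alpha>" using assms(3) unfolding classes_converge_def by blast
  \<comment> \<open>\<alpha> is determined as the limit of a sequence, so it does not depend on the
    witness; hence evanescent means \<alpha> = 0, macroscopic means \<alpha> > 0, and the two
    exclude each other.\<close>
  have unique: "\<beta> = \<alpha>" if "classes_converge_to C l' \<beta>" for l' \<beta>
  proof -
    have "(\<lambda>N. real (period_count N (C N) 1) / real N) \<longlonglongrightarrow> 1 - \<alpha>"
      "(\<lambda>N. real (period_count N (C N) 1) / real N) \<longlonglongrightarrow> 1 - \<beta>"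
      using conv that unfolding classes_converge_to_def by blast+
    then have "1 - \<alpha> = 1 - \<beta>" by (rule LIMSEQ_unique)
    then show ?thesis by simp
  qed
  have evan: "\<alpha> = 0" if "evanescent C" using that unique unfolding evanescent_def by metis
  have macro: "\<alpha> > 0" if "macroscopic C" using that unique unfolding macroscopic_def by metis
  have \<alpha>: "\<alpha> \<ge> 0" using conv unfolding classes_converge_to_def by simp
  obtain law where "random_walks C (\<lambda>N. nonfixed_count N (C N)) \<alpha> t law M (\<lambda>N. S N t)"
    using ex_random_walks[OF assms(1,2) conv assms(4,5)] by blast
  then interpret random_walks C "\<lambda>N. nonfixed_count N (C N)" \<alpha> t law M "\<lambda>N. S N t" .
  obtain \<mu>bar where bar: "has_moments \<mu>bar mean_limit" using ex_limit_measure by blast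
  have barp: "\<mu>bar \<in> prob_measures_on unit_circle" using bar unfolding has_moments_def by blast
  note mean = mean_measure_limit[OF bar]
  show ?thesis
  proof (cases "\<alpha> = 0")
    case True
    interpret conc: concentrated_laws law mean_limit by (rule concentrated_law[OF True])
    let ?\<Omega> = "measure_pmf (map_pmf (\<lambda>_ :: nat. \<mu>bar) (return_pmf 0))"
    let ?\<mu> = "\<lambda>\<nu>. if \<nu> \<in> prob_measures_on unit_circle then \<nu> else \<mu>bar"
    have rm: "random_measure unit_circle ?\<Omega> ?\<mu>" by (rule random_measure_pmf[OF barp])
    have law: "converges_in_law (weak_topology unit_circle) M \<mu>N ?\<Omega> ?\<mu>"
      unfolding \<mu>N_def A_def
    proof (rule converges_in_lawI)
      fix F B assume F: "continuous_map (weak_topology unit_circle) euclideanreal F"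
        and B: "\<And>\<nu>. \<nu> \<in> prob_measures_on unit_circle \<Longrightarrow> \<bar>F \<nu>\<bar> \<le> B"
      have "(\<integral>\<omega>. F (?\<mu> \<omega>) \<partial>?\<Omega>) = F \<mu>bar"
        by (rule trans[OF expectation_map_pmf_in[OF barp]]) simp
      then show "(\<lambda>N. measure_pmf.expectation (law N) (\<lambda>S. F (eigd N S))) \<longlonglongrightarrow> (\<integral>\<omega>. F (?\<mu> \<omega>) \<partial>?\<Omega>)"
        using conc.functional_limit[OF bar F B] by simp
    qed
    have "AE \<omega> in ?\<Omega>. ?\<mu> \<omega> = \<mu>bar" by (simp add: AE_measure_pmf_iff)
    moreover have "converges_in_prob (weak_topology unit_circle) M \<mu>N \<mu>bar"
      unfolding \<mu>N_def A_def by (rule evanescent_limit[OF True bar])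
    moreover have "asymptotic_P_factorization M A" "converges_in_prob_in_P_distribution M A"
      unfolding A_def by (rule evanescent_P_distribution[OF True])+
    moreover have "\<not> macroscopic C" using macro True by auto
    moreover have "limitin (weak_topology unit_circle) (\<lambda>N. Giry_Monad.bind (M N) (\<mu>N N)) \<mu>bar sequentially"
      unfolding \<mu>N_def A_def by (rule mean)
    ultimately show ?thesis using rm law by (intro exI[of _ ?\<Omega>] exI[of _ ?\<mu>] exI[of _ \<mu>bar]) blast
  next
    case False
    then have \<alpha>0: "\<alpha> > 0" using \<alpha> by simp
    then have r: "t / \<alpha> > 0" using assms(5) by simp
    have "\<exists>\<mu>. has_moments \<mu> (walk_mean_limit n)" for n
    proof -
      interpret conc: concentrated_laws "walk_pmf n" "walk_mean_limit n" by (rule concentrated_walk_pmf)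
      show ?thesis by (rule conc.ex_limit_measure)
    qed
    then obtain \<mu> where \<mu>: "\<And>n. has_moments (\<mu> n) (walk_mean_limit n)" by metis
    have \<mu>p: "\<mu> n \<in> prob_measures_on unit_circle" for n using \<mu>[of n] unfolding has_moments_def by blast
    \<comment> \<open>The limit is a random choice among the measures \<open>\<mu> n\<close>, where
      n is the limiting Poisson number of steps.\<close>
    let ?\<Omega> = "measure_pmf (map_pmf \<mu> (poisson_pmf (t / \<alpha>)))"
    let ?\<mu> = "\<lambda>\<nu>. if \<nu> \<in> prob_measures_on unit_circle then \<nu> else \<mu> 0"
    have rm: "random_measure unit_circle ?\<Omega> ?\<mu>" by (rule random_measure_pmf[OF \<mu>p])
    have law: "converges_in_law (weak_topology unit_circle) M \<mu>N ?\<Omega> ?\<mu>"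
      unfolding \<mu>N_def A_def
    proof (rule converges_in_lawI)
      fix F B assume F: "continuous_map (weak_topology unit_circle) euclideanreal F"
        and B: "\<And>\<nu>. \<nu> \<in> prob_measures_on unit_circle \<Longrightarrow> \<bar>F \<nu>\<bar> \<le> B"
      have mix: "(\<integral>\<omega>. F (?\<mu> \<omega>) \<partial>?\<Omega>) = measure_pmf.expectation (poisson_pmf (t / \<alpha>)) (\<lambda>n. F (\<mu> n))"
        by (rule expectation_map_pmf_in[OF \<mu>p])
      show "(\<lambda>N. measure_pmf.expectation (law N) (\<lambda>S. F (eigd N S))) \<longlonglongrightarrow> (\<integral>\<omega>. F (?\<mu> \<omega>) \<partial>?\<Omega>)"
        unfolding mix by (rule mixture_limit[OF \<alpha>0 \<mu> F B])
    qed
    have "\<not> nonrandom ?\<Omega> ?\<mu>"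
    proof
      assume "nonrandom ?\<Omega> ?\<mu>"
      then obtain c where "AE \<omega> in ?\<Omega>. ?\<mu> \<omega> = c" unfolding nonrandom_def by blast
      \<comment> \<open>Every natural number has positive Poisson probability, so a constant limit
        would identify all the \<open>\<mu> n\<close>.\<close>
      then have "\<mu> n = c" for n
        using \<mu>p[of n] by (auto simp: AE_measure_pmf_iff set_pmf_poisson[OF r])
      then have "\<mu> 0 = \<mu> 1" by metis
      then show False using walk_moments_distinct[OF \<alpha>0 \<mu>[of 0]] \<mu>[of 1] by simp
    qed
    moreover have "\<not> asymptotic_P_factorization M A"
      unfolding A_def by (rule macroscopic_P_distribution[OF \<alpha>0])
    moreover have "\<not> evanescent C" using evan False by auto
    moreover have "limitin (weak_topology unit_circle) (\<lambda>N. Giry_Monad.bind (M N) (\<mu>N N)) \<mu>bar sequentially"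
      unfolding \<mu>N_def A_def by (rule mean)
    ultimately show ?thesis using rm law by (intro exI[of _ ?\<Omega>] exI[of _ ?\<mu>] exI[of _ \<mu>bar]) blast
  qed
qed

end
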